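(* Let $\mathbb{D}$ be a division ring with finite dimension $d$ over a central subfield $\mathbb{F}$, and let $n\geq 1$. Assume that $\mathbb{D}$ has quadratic type over $\mathbb{F}$, with $|\mathbb{F}|\geq nd$, and let $(\sigma,e)$ be an associated pair. (1) Let $\mathcal{M}$ be an optimal unital $\mathbb{F}$-affine subspace of $\mathrm{M}_n(\mathbb{D})$. Then there exist an ordered partition $n=n_1+\cdots+n_p$ into positive integers and a list $(P_1,\dots,P_p)$ of $e$-nonisotropic matrices, with $P_i\in\mathrm{GL}_{n_i}(\mathbb{D})$, such that $\mathcal{M}$ is equivalent to $$(P_1+\mathcal{SH}_{n_1}(\mathbb{D}))\vee\cdots\vee(P_p+\mathcal{SH}_{n_p}(\mathbb{D})).$$ (2) Conversely, let $n=n_1+\cdots+n_p$ be an ordered partition into positive integers, and $(P_1,\dots,P_p)$ be a list of $e$-nonisotropic matrices, with $P_i\in\mathrm{GL}_{n_i}(\mathbb{D})$. Then $(P_1+\mathcal{SH}_{n_1}(\mathbb{D}))\vee\cdots\vee(P_p+\mathcal{SH}_{n_p}(\mathbb{D}))$ is an optimal unital $\mathbb{F}$-affine subspace of $\mathrm{M}_n(\mathbb{D})$. (3) Let $n=n_1+\cdots+n_p$ and $(P_1,\dots,P_p)$ be as in (2), and let $n=m_1+\cdots+m_q$ be another ordered partition into positive integers and $(P'_1,\dots,P'_q)$ be a list of $e$-nonisotropic matrices, with $P'_i\in\mathrm{GL}_{m_i}(\mathbb{D})$. Then $(P_1+\mathcal{SH}_{n_1}(\mathbb{D}))\vee\cdots\vee(P_p+\mathcal{SH}_{n_p}(\mathbb{D}))$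 is equivalent to $(P'_1+\mathcal{SH}_{m_1}(\mathbb{D}))\vee\cdots\vee(P'_q+\mathcal{SH}_{m_q}(\mathbb{D}))$ if and only if $(n_1,\dots,n_p)=(m_1,\dots,m_q)$ and, for all $k\in\{1,\dots,p\}$, there exist an invertible matrix $Q_k\in\mathrm{GL}_{n_k}(\mathbb{D})$ and a scalar $\alpha\in\mathbb{F}^\times$ such that $$\forall X\in\mathbb{D}^{n_k},\quad e(X^\star P'_kX)=\alpha\,e\bigl((Q_kX)^\star P_k(Q_kX)\bigr).$$
   Context: A central subfield of $\mathbb{D}$ is a subfield contained in the center of $\mathbb{D}$. A subset of $\mathrm{M}_n(\mathbb{D})$ is called unital if it is contained in $\mathrm{GL}_n(\mathbb{D})$. A unital $\mathbb{F}$-affine subspace of $\mathrm{M}_n(\mathbb{D})$ is optimal if it has the greatest possible dimension over $\mathbb{F}$ among all unital $\mathbb{F}$-affine subspaces of $\mathrm{M}_n(\mathbb{D})$. Two subsets $\mathcal{S},\mathcal{T}$ of $\mathrm{M}_n(\mathbb{D})$ are equivalent if $\mathcal{T}=P\mathcal{S}Q$ for some $P,Q\in\mathrm{GL}_n(\mathbb{D})$. For nonempty $\mathcal{M}_i\subseteq\mathrm{M}_{n_i}(\mathbb{D})$, the joint $\mathcal{M}_1\vee\cdots\vee\mathcal{M}_p$ is the set of all block upper-triangular matrices with diagonal blocks $M_1\in\mathcal{M}_1,\dots,M_p\in\mathcal{M}_p$ and arbitrary blocks above the diagonal. $\mathbb{D}$ is of quadratic type over $\mathbb{F}$ if one of the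 following holds: (i) $d=1$; (ii) $d=2$ and $\mathbb{D}$ is a separable field extension of $\mathbb{F}$; (iii) $d=4$ and $\mathbb{D}$ is a quaternion algebra over $\mathbb{F}$; (iv) $d=2^m$ for some $m\geq 1$, $\operatorname{char}(\mathbb{F})=2$, $\mathbb{D}$ is a field and $x^2\in\mathbb{F}$ for all $x\in\mathbb{D}$. The standard involution $\sigma$ of $\mathbb{D}$ is the identity of $\mathbb{D}$ in cases (i) and (iv), the non-identity $\mathbb{F}$-automorphism in case (ii), and the quaternionic conjugation in case (iii). An associated pair $(\sigma,e)$ for $\mathbb{D}$ over $\mathbb{F}$ consists of the standard involution $\sigma$ and of an $\mathbb{F}$-linear form $e:\mathbb{D}\to\mathbb{F}$ which is the Galois trace of $\mathbb{D}$ over $\mathbb{F}$ in cases (i) and (ii) (so $e=\operatorname{id}$ if $d=1$), the reduced trace $x\mapsto x+\sigma(x)$ in case (iii), and an arbitrary nonzero $\mathbb{F}$-linear form on $\mathbb{D}$ in case (iv). For a matrix $A$ over $\mathbb{D}$, $A^\star$ is the transpose of the matrix obtained by applying $\sigma$ to all entries of $A$. $\mathcal{SH}_k(\mathbb{D})$ is the set of all $M=(m_{i,j})\in\mathrm{M}_k(\mathbb{D})$ such that $M^\star=-M$ and $e(m_{i,i})=0$ for all $i$. A matrix $P\in\mathrm{M}_k(\mathbb{D})$ is $e$-nonisotropic if $e(X^\star PX)\neq 0$ for all $X\in\mathbb{D}^k\setminus\{0\}$. *)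

theory Defs
  imports
    "HOL-Algebra.Finite_Extensions"
    "Jordan_Normal_Form.VS_Connect"
begin

text \<open>
  The division ring is the type \<open>'a\<close>; a subfield of it is a set \<open>F\<close> of elements. Linear algebra
  over \<open>F\<close> is that of the locale \<open>vectorspace\<close>, for the field record \<open>scalars F\<close> and the modules
  \<open>ring_module\<close> (the division ring itself) and \<open>module_mat TYPE('a) n n\<close> (the square matrices).
\<close>

definition central_subfield :: "'a::division_ring set \<Rightarrow> bool" where
  "central_subfield F \<longleftrightarrow> subfield F class_ring \<and> (\<forall>a\<in>F. \<forall>x. a * x = x * a)"

definition scalars :: "'a::division_ring set \<Rightarrow> 'a ring" where
  "scalars F = class_ring\<lparr>carrier := F\<rparr>"

definition ring_module :: "('a::division_ring, 'a) module" where
  "ring_module =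
     \<lparr>carrier = UNIV, mult = (*), one = 1, zero = 0, add = (+), smult = (*)\<rparr>"

definition finite_degree :: "'a::division_ring set \<Rightarrow> bool" where
  "finite_degree F \<longleftrightarrow> vectorspace.fin_dim (scalars F) (ring_module :: ('a, 'a) module)"

definition degree_over :: "'a::division_ring set \<Rightarrow> nat" where
  "degree_over F = vectorspace.dim (scalars F) (ring_module :: ('a, 'a) module)"


section \<open>Affine spaces of invertible matrices\<close>

definition GL :: "nat \<Rightarrow> 'a::division_ring mat set" where
  "GL n = {A \<in> carrier_mat n n. invertible_mat A}"

text \<open>Affine subspaces are nonempty.\<close>

definition affine_subspace :: "'a::division_ring set \<Rightarrow> nat \<Rightarrow> 'a mat set \<Rightarrow> bool" where
  "affine_subspace F n S \<longleftrightarrow>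
     (\<exists>A\<in>carrier_mat n n. \<exists>W. VectorSpace.subspace (scalars F) W (module_mat TYPE('a) n n)
        \<and> S = (\<lambda>B. A + B) ` W)"

definition affine_direction :: "'a::division_ring mat set \<Rightarrow> 'a mat set" where
  "affine_direction S = {A - B | A B. A \<in> S \<and> B \<in> S}"

definition affine_dimension :: "'a::division_ring set \<Rightarrow> nat \<Rightarrow> 'a mat set \<Rightarrow> nat" where
  "affine_dimension F n S =
     vectorspace.dim (scalars F) ((module_mat TYPE('a) n n)\<lparr>carrier := affine_direction S\<rparr>)"

definition unital_affine_subspace :: "'a::division_ring set \<Rightarrow> nat \<Rightarrow> 'a mat set \<Rightarrow> bool" where
  "unital_affine_subspace F n S \<longleftrightarrow> affine_subspace F n S \<and> S \<subseteq> GL n"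

definition optimal :: "'a::division_ring set \<Rightarrow> nat \<Rightarrow> 'a mat set \<Rightarrow> bool" where
  "optimal F n S \<longleftrightarrow> unital_affine_subspace F n S \<and>
     (\<forall>T. unital_affine_subspace F n T \<longrightarrow> affine_dimension F n T \<le> affine_dimension F n S)"

definition mat_equivalent :: "nat \<Rightarrow> 'a::division_ring mat set \<Rightarrow> 'a mat set \<Rightarrow> bool" where
  "mat_equivalent n S T \<longleftrightarrow> (\<exists>P\<in>GL n. \<exists>Q\<in>GL n. T = (\<lambda>M. P * M * Q) ` S)"

text \<open>The block sizes are read off the matrices; the empty joint is the \<open>0 \<times> 0\<close> matrix.\<close>

fun joint :: "'a::division_ring mat set list \<Rightarrow> 'a mat set" where
  "joint [] = carrier_mat 0 0"
| "joint (S # Ss) =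
     {four_block_mat A B (0\<^sub>m (dim_row C) (dim_col A)) C | A B C.
        A \<in> S \<and> C \<in> joint Ss \<and> B \<in> carrier_mat (dim_row A) (dim_col C)}"


section \<open>Division rings of quadratic type\<close>

definition commutative_ring :: "'a::division_ring itself \<Rightarrow> bool" where
  "commutative_ring ty \<longleftrightarrow> (\<forall>x y :: 'a. x * y = y * x)"

text \<open>Polynomials are coefficient lists as in \<^theory>\<open>HOL-Algebra.Polynomials\<close>, leading coefficient first.\<close>

definition poly_derivative :: "'a::division_ring list \<Rightarrow> 'a list" where
  "poly_derivative p = ring.normalize class_ring
     (map (\<lambda>i. of_nat (length p - 1 - i) * p ! i) [0..<length p - 1])"

text \<open>A polynomial is separable if it is coprime to its derivative, in the Bezout sense.\<close>

definition separable_poly :: "'a::division_ring set \<Rightarrow> 'a list \<Rightarrow> bool" where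
  "separable_poly F p \<longleftrightarrow>
     (\<exists>u\<in>carrier (univ_poly class_ring F). \<exists>v\<in>carrier (univ_poly class_ring F).
        (u \<otimes>\<^bsub>univ_poly class_ring F\<^esub> p) \<oplus>\<^bsub>univ_poly class_ring F\<^esub>
        (v \<otimes>\<^bsub>univ_poly class_ring F\<^esub> poly_derivative p) = \<one>\<^bsub>univ_poly class_ring F\<^esub>)"

text \<open>Meant for finite degree only: \<open>Irr\<close> is the minimal polynomial of an algebraic element.\<close>

definition separable_field_extension :: "'a::division_ring set \<Rightarrow> bool" where
  "separable_field_extension F \<longleftrightarrow> commutative_ring TYPE('a) \<and>
     (\<forall>x::'a. separable_poly F (ring.Irr class_ring F x))"

text \<open>
  A quaternion algebra over \<open>F\<close> is a central simple \<open>F\<close>-algebra of dimension \<open>4\<close>;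
  a division ring is always simple.
\<close>

definition quaternion_algebra :: "'a::division_ring set \<Rightarrow> bool" where
  "quaternion_algebra F \<longleftrightarrow> finite_degree F \<and> degree_over F = 4 \<and> F = {a. \<forall>x. a * x = x * a}"

definition quad_type_i :: "'a::division_ring set \<Rightarrow> bool" where
  "quad_type_i F \<longleftrightarrow> degree_over F = 1"

definition quad_type_ii :: "'a::division_ring set \<Rightarrow> bool" where
  "quad_type_ii F \<longleftrightarrow> degree_over F = 2 \<and> separable_field_extension F"

definition quad_type_iii :: "'a::division_ring set \<Rightarrow> bool" where
  "quad_type_iii F \<longleftrightarrow> degree_over F = 4 \<and> quaternion_algebra F"

definition quad_type_iv :: "'a::division_ring set \<Rightarrow> bool" where
  "quad_type_iv F \<longleftrightarrow> (\<exists>m\<ge>1. degree_over F = 2 ^ m) \<and> CHAR('a) = 2 \<and>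
     commutative_ring TYPE('a) \<and> (\<forall>x::'a. x ^ 2 \<in> F)"

definition quadratic_type :: "'a::division_ring set \<Rightarrow> bool" where
  "quadratic_type F \<longleftrightarrow> quad_type_i F \<or> quad_type_ii F \<or> quad_type_iii F \<or> quad_type_iv F"

definition linear_over :: "'a::division_ring set \<Rightarrow> ('a \<Rightarrow> 'a) \<Rightarrow> bool" where
  "linear_over F f \<longleftrightarrow> (\<forall>x y. f (x + y) = f x + f y) \<and> (\<forall>a\<in>F. \<forall>x. f (a * x) = a * f x)"

definition linear_form :: "'a::division_ring set \<Rightarrow> ('a \<Rightarrow> 'a) \<Rightarrow> bool" where
  "linear_form F e \<longleftrightarrow> linear_over F e \<and> range e \<subseteq> F"

definition field_automorphisms :: "'a::division_ring set \<Rightarrow> ('a \<Rightarrow> 'a) set" where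
  "field_automorphisms F = {\<tau>. bij \<tau> \<and> (\<forall>x y. \<tau> (x + y) = \<tau> x + \<tau> y) \<and>
     (\<forall>x y. \<tau> (x * y) = \<tau> x * \<tau> y) \<and> (\<forall>a\<in>F. \<tau> a = a)}"

text \<open>
  Used only in the Galois cases \<open>(i)\<close> and \<open>(ii)\<close>, where the group of automorphisms is finite.
\<close>

definition galois_trace :: "'a::division_ring set \<Rightarrow> 'a \<Rightarrow> 'a" where
  "galois_trace F x = (\<Sum>\<tau>\<in>field_automorphisms F. \<tau> x)"

text \<open>
  The conjugation of a quaternion algebra is its unique \<open>F\<close>-linear anti-automorphic involution
  for which all \<open>x + \<sigma> x\<close> and all \<open>x * \<sigma> x\<close> are scalars. (Uniqueness: an \<open>x\<close> outside \<open>F\<close> is a root of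
  \<open>t\<^sup>2 - (x + \<sigma> x) t + x * \<sigma> x\<close>, which must then be its minimal polynomial.)
\<close>

definition quaternionic_conjugation :: "'a::division_ring set \<Rightarrow> ('a \<Rightarrow> 'a) \<Rightarrow> bool" where
  "quaternionic_conjugation F \<sigma> \<longleftrightarrow> linear_over F \<sigma> \<and> (\<forall>x y. \<sigma> (x * y) = \<sigma> y * \<sigma> x) \<and>
     (\<forall>x. \<sigma> (\<sigma> x) = x) \<and> (\<forall>x. x + \<sigma> x \<in> F) \<and> (\<forall>x. x * \<sigma> x \<in> F)"

definition standard_involution :: "'a::division_ring set \<Rightarrow> ('a \<Rightarrow> 'a) \<Rightarrow> bool" where
  "standard_involution F \<sigma> \<longleftrightarrow>
     (quad_type_i F \<and> \<sigma> = id) \<or>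
     (quad_type_ii F \<and> \<sigma> \<in> field_automorphisms F \<and> \<sigma> \<noteq> id) \<or>
     (quad_type_iii F \<and> quaternionic_conjugation F \<sigma>) \<or>
     (quad_type_iv F \<and> \<sigma> = id)"

definition associated_pair :: "'a::division_ring set \<Rightarrow> ('a \<Rightarrow> 'a) \<Rightarrow> ('a \<Rightarrow> 'a) \<Rightarrow> bool" where
  "associated_pair F \<sigma> e \<longleftrightarrow> standard_involution F \<sigma> \<and> linear_form F e \<and>
     (quad_type_i F \<longrightarrow> e = galois_trace F) \<and>
     (quad_type_ii F \<longrightarrow> e = galois_trace F) \<and>
     (quad_type_iii F \<longrightarrow> e = (\<lambda>x. x + \<sigma> x)) \<and>
     (quad_type_iv F \<longrightarrow> e \<noteq> (\<lambda>x. 0))"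


section \<open>Skew-Hermitian matrices and nonisotropic matrices\<close>

definition star_mat :: "('a \<Rightarrow> 'a) \<Rightarrow> 'a::division_ring mat \<Rightarrow> 'a mat" where
  "star_mat \<sigma> A = transpose_mat (map_mat \<sigma> A)"

definition SH :: "('a \<Rightarrow> 'a) \<Rightarrow> ('a \<Rightarrow> 'a) \<Rightarrow> nat \<Rightarrow> 'a::division_ring mat set" where
  "SH \<sigma> e k = {M \<in> carrier_mat k k. star_mat \<sigma> M = - M \<and> (\<forall>i<k. e (M $$ (i, i)) = 0)}"

text \<open>\<open>star_form \<sigma> P x\<close> is the entry of the \<open>1 \<times> 1\<close> matrix \<open>x\<^sup>\<star> P x\<close>, for a column \<open>x\<close>.\<close>

definition star_form :: "('a \<Rightarrow> 'a) \<Rightarrow> 'a::division_ring mat \<Rightarrow> 'a vec \<Rightarrow> 'a" where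
  "star_form \<sigma> P x = map_vec \<sigma> x \<bullet> (P *\<^sub>v x)"

definition nonisotropic ::
    "('a \<Rightarrow> 'a) \<Rightarrow> ('a \<Rightarrow> 'a) \<Rightarrow> nat \<Rightarrow> 'a::division_ring mat \<Rightarrow> bool" where
  "nonisotropic \<sigma> e k P \<longleftrightarrow> P \<in> carrier_mat k k \<and>
     (\<forall>x\<in>carrier_vec k. x \<noteq> 0\<^sub>v k \<longrightarrow> e (star_form \<sigma> P x) \<noteq> 0)"

definition ordered_partition :: "nat \<Rightarrow> nat list \<Rightarrow> bool" where
  "ordered_partition n ns \<longleftrightarrow> sum_list ns = n \<and> (\<forall>m\<in>set ns. m > 0)"

definition nonisotropic_list ::
    "('a \<Rightarrow> 'a) \<Rightarrow> ('a \<Rightarrow> 'a) \<Rightarrow> nat list \<Rightarrow> 'a::division_ring mat list \<Rightarrow> bool" where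
  "nonisotropic_list \<sigma> e ns Ps \<longleftrightarrow> length Ps = length ns \<and>
     (\<forall>k<length ns. Ps ! k \<in> GL (ns ! k) \<and> nonisotropic \<sigma> e (ns ! k) (Ps ! k))"

definition SH_joint ::
    "('a \<Rightarrow> 'a) \<Rightarrow> ('a \<Rightarrow> 'a) \<Rightarrow> nat list \<Rightarrow> 'a::division_ring mat list \<Rightarrow> 'a mat set" where
  "SH_joint \<sigma> e ns Ps = joint (map2 (\<lambda>m P. (\<lambda>N. P + N) ` SH \<sigma> e m) ns Ps)"

end

theory Submission
  imports Defs "HOL-Library.Function_Algebras"
begin

text \<open>
  Normalising by an element \<open>A\<close> of a unital affine space \<open>A + W\<close> turns it into the linear space
  \<open>V = A\<^sup>-\<^sup>1 W\<close> of endomorphisms of the right space \<open>D\<^sup>n\<close> having no nonzero fixed vector. For a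
  vector \<open>x\<close> of maximal rank, i.e. with \<open>dim V x\<close> maximal, a pencil argument over the large field
  \<open>F\<close> shows that the \<open>N \<in> V\<close> with \<open>N x = 0\<close> act on a hyperplane again without fixed vectors,
  which bounds \<open>dim V\<close> by induction.

  If the bound is attained, then either \<open>V\<close> leaves a proper nonzero subspace invariant, and the space
  splits into two smaller optimal blocks, or \<open>V x\<close> is an \<open>F\<close>-hyperplane for every \<open>x \<noteq> 0\<close>. In the
  latter case \<open>V x\<close> is the kernel of \<open>e \<circ> \<eta>\<close> for a linear form \<open>\<eta>\<close> depending on \<open>x\<close>, unique up
  to a scalar in \<open>F\<close>. The scalars can be chosen so that \<open>\<eta>\<close> depends \<open>\<sigma>\<close>-semilinearly on \<open>x\<close>; this
  yields a matrix \<open>G\<close> with \<open>e (x\<^sup>\<star> G N x) = 0\<close> for all \<open>x\<close> and all \<open>N \<in> V\<close>, that is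
  \<open>G V \<subseteq> SH\<close>, with equality by dimension.

  For uniqueness, the rows \<open>y\<close> for which some \<open>v \<noteq> 0\<close> satisfies \<open>y A v = 0\<close> for all \<open>A\<close> in a joint
  are those vanishing on the first block, so that equivalences of joints are block triangular.
\<close>

section \<open>Linear algebra over a central subfield\<close>

text \<open>All dimensions are taken over \<open>F\<close>: a noncentral multiple of an operator is
  no longer linear over the division ring, so the spaces \<open>V\<close> carry no structure over
  it, although the vectors do. Forms over \<open>F\<close> are therefore rewritten as
  \<open>e\<close> composed with forms over the division ring, which is possible because
  \<open>e (x * y)\<close> is a nondegenerate pairing; only then do coordinates and matrices become
  available. The bound is the dimension of \<open>SH\<close>. It grows by \<open>n * d - 1\<close>
  from \<open>n - 1\<close> to \<open>n\<close>: this is the largest possible dimension of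
  \<open>V x\<close>, because \<open>x\<close> itself is not in \<open>V x\<close>, and the rest
  belongs to the stabiliser of \<open>x\<close>. The pencil argument plays a rank of at most
  \<open>n * d - 1\<close> against one more scalar, which explains the hypothesis on the size of
  \<open>F\<close>. In the case of equality, counting yields only one vector with \<open>V x\<close>
  a hyperplane. That an irreducible space has this property at every nonzero vector is the hard
  point: reducibility of a stabiliser must be lifted to \<open>V\<close>, and the remaining bad
  vectors are excluded by counting operators of rank one, with a separate count for
  \<open>n = 2\<close>.\<close>

locale central_sub =
  fixes F :: "'a::division_ring set"
  assumes cs: "central_subfield F"
begin

lemma subfield_F: "subfield F class_ring"
  using cs unfolding central_subfield_def by simp

lemma F_0 [simp]: "0 \<in> F" and F_1 [simp]: "1 \<in> F"
  and F_add: "a \<in> F \<Longrightarrow> b \<in> F \<Longrightarrow> a + b \<in> F"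
  and F_mult: "a \<in> F \<Longrightarrow> b \<in> F \<Longrightarrow> a * b \<in> F"
  and F_uminus: "a \<in> F \<Longrightarrow> - a \<in> F"
  using subringE[OF subfieldE(1)[OF subfield_F]] by (auto simp: class_ring_simps)

lemma F_comm: "a \<in> F \<Longrightarrow> a * x = x * a"
  using cs unfolding central_subfield_def by blast

lemma F_diff: "a \<in> F \<Longrightarrow> b \<in> F \<Longrightarrow> a - b \<in> F"
  using F_add[of a "- b"] F_uminus by simp

lemma F_inverse: assumes "a \<in> F" shows "inverse a \<in> F"
proof (cases "a = 0")
  case False
  have "F - {0} = Units (class_ring\<lparr>carrier := F\<rparr>)"
    using subfield.subfield_Units[OF subfield_F] by (simp add: class_ring_simps)
  then obtain b where "b \<in> F" "b * a = 1" using assms False by (auto simp: Units_def)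
  then show ?thesis using False by (metis inverse_unique left_inverse right_inverse mult.assoc mult.right_neutral mult_1)
qed auto

lemma field_scalars: "field (scalars F)"
  using ring.subfield_iff(2)[OF class_ring.ring_axioms subfield_F] unfolding scalars_def .

end

section \<open>Vector spaces over \<open>F\<close>, their subspaces and dimensions\<close>

locale fmod = central_sub F for F :: "'a::division_ring set" +
  fixes sm :: "'a \<Rightarrow> 'b::ab_group_add \<Rightarrow> 'b"
  assumes sm_add: "a \<in> F \<Longrightarrow> sm a (v + w) = sm a v + sm a w"
    and sm_add_left: "a \<in> F \<Longrightarrow> b \<in> F \<Longrightarrow> sm (a + b) v = sm a v + sm b v"
    and sm_mult: "a \<in> F \<Longrightarrow> b \<in> F \<Longrightarrow> sm (a * b) v = sm a (sm b v)"
    and sm_one: "sm 1 v = v"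
begin

lemma sm_zero [simp]: "a \<in> F \<Longrightarrow> sm a 0 = 0"
  using sm_add[of a 0 0] by simp

lemma sm_zero_left [simp]: "sm 0 v = 0"
  using sm_add_left[of 0 0 v] by simp

lemma sm_uminus_left: "a \<in> F \<Longrightarrow> sm (- a) v = - sm a v"
  using sm_add_left[of "-a" a v] F_uminus by (simp add: eq_neg_iff_add_eq_0)

lemma sm_uminus: "a \<in> F \<Longrightarrow> sm a (- v) = - sm a v"
  using sm_add[of a "-v" v] by (simp add: eq_neg_iff_add_eq_0)

lemma sm_diff: "a \<in> F \<Longrightarrow> sm a (v - w) = sm a v - sm a w"
  using sm_add[of a v "- w"] sm_uminus by simp

lemma sm_inverse: "a \<in> F \<Longrightarrow> a \<noteq> 0 \<Longrightarrow> sm (inverse a) (sm a v) = v"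
  using sm_mult[of "inverse a" a v] F_inverse sm_one by simp

lemma sm_inverse': "a \<in> F \<Longrightarrow> a \<noteq> 0 \<Longrightarrow> sm a (sm (inverse a) v) = v"
  using sm_mult[of a "inverse a" v] F_inverse sm_one by simp

lemma sm_eq_0: "a \<in> F \<Longrightarrow> sm a v = 0 \<longleftrightarrow> a = 0 \<or> v = 0"
  by (metis sm_inverse sm_zero sm_zero_left F_inverse)

definition fsub :: "'b set \<Rightarrow> bool" where
  "fsub S \<longleftrightarrow> 0 \<in> S \<and> (\<forall>v\<in>S. \<forall>w\<in>S. v + w \<in> S) \<and> (\<forall>a\<in>F. \<forall>v\<in>S. sm a v \<in> S)"

lemma fsubI:
  "0 \<in> S \<Longrightarrow> (\<And>v w. v \<in> S \<Longrightarrow> w \<in> S \<Longrightarrow> v + w \<in> S) \<Longrightarrow> (\<And>a v. a \<in> F \<Longrightarrow> v \<in> S \<Longrightarrow> sm a v \<in> S)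
    \<Longrightarrow> fsub S"
  unfolding fsub_def by blast

lemma fsub_0: "fsub S \<Longrightarrow> 0 \<in> S"
  and fsub_add: "fsub S \<Longrightarrow> v \<in> S \<Longrightarrow> w \<in> S \<Longrightarrow> v + w \<in> S"
  and fsub_sm: "fsub S \<Longrightarrow> a \<in> F \<Longrightarrow> v \<in> S \<Longrightarrow> sm a v \<in> S"
  unfolding fsub_def by blast+

lemma fsub_uminus: "fsub S \<Longrightarrow> v \<in> S \<Longrightarrow> - v \<in> S"
  using fsub_sm[of S "-1" v] sm_uminus_left[of 1 v] F_uminus[of 1] by (simp add: sm_one)

lemma fsub_diff: "fsub S \<Longrightarrow> v \<in> S \<Longrightarrow> w \<in> S \<Longrightarrow> v - w \<in> S"
  using fsub_add[of S v "- w"] fsub_uminus by simp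

lemma fsub_sum: "fsub S \<Longrightarrow> (\<And>i. i \<in> I \<Longrightarrow> g i \<in> S) \<Longrightarrow> sum g I \<in> S"
  by (induction I rule: infinite_finite_induct) (auto intro: fsub_0 fsub_add)

lemma fsub_UNIV: "fsub UNIV"
  by (simp add: fsub_def)

lemma fsub_zero: "fsub {0}"
  by (simp add: fsub_def)

definition frec :: "'b set \<Rightarrow> ('a, 'b) module" where
  "frec S = \<lparr>carrier = S, mult = (\<lambda>x y. x), one = 0, zero = 0, add = (+), smult = sm\<rparr>"

definition fd :: "'b set \<Rightarrow> bool" where
  "fd S \<longleftrightarrow> fsub S \<and> vectorspace.fin_dim (scalars F) (frec S)"

definition dm :: "'b set \<Rightarrow> nat" where
  "dm S = vectorspace.dim (scalars F) (frec S)"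

lemma frec_simps [simp]:
  "carrier (frec S) = S" "\<zero>\<^bsub>frec S\<^esub> = 0" "v \<oplus>\<^bsub>frec S\<^esub> w = v + w" "a \<odot>\<^bsub>frec S\<^esub> v = sm a v"
  by (simp_all add: frec_def)

lemma scalars_simps [simp]:
  "carrier (scalars F) = F" "\<zero>\<^bsub>scalars F\<^esub> = 0" "\<one>\<^bsub>scalars F\<^esub> = 1"
  "a \<oplus>\<^bsub>scalars F\<^esub> b = a + b" "a \<otimes>\<^bsub>scalars F\<^esub> b = a * b"
  by (simp_all add: scalars_def)

lemma vectorspace_frec: "fsub S \<Longrightarrow> vectorspace (scalars F) (frec S)"
  by (rule vs_criteria)
    (auto simp: field_scalars fsub_0 fsub_add fsub_sm sm_add sm_add_left sm_mult sm_one add.assoc add.commute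
       intro!: bexI[where x = "- _"] fsub_uminus)

lemma fd_fsub: "fd S \<Longrightarrow> fsub S"
  by (simp add: fd_def)

lemma frec_carrier: "(frec S)\<lparr>carrier := T\<rparr> = frec T"
  by (simp add: frec_def)

lemma subspace_frec: "fsub S \<Longrightarrow> fsub T \<Longrightarrow> S \<subseteq> T \<Longrightarrow> VectorSpace.subspace (scalars F) S (frec T)"
  using vectorspace_frec[of T]
  by (auto simp: VectorSpace.subspace_def submodule_def vectorspace_def fsub_0 fsub_add fsub_sm)

text \<open>Independent subsets of \<open>S\<close> are independent in \<open>T\<close>, so their
  sizes are bounded and a maximal one exists; being maximal, it is a basis of \<open>S\<close>. If
  it has \<open>dm T\<close> elements, it is a basis of \<open>T\<close> as well.\<close>

lemma fd_mono:
  assumes T: "fd T" and S: "fsub S" and sub: "S \<subseteq> T"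
  shows "fd S" "dm S \<le> dm T" "dm S = dm T \<Longrightarrow> S = T"
proof -
  interpret T: vectorspace "scalars F" "frec T" using vectorspace_frec T fd_fsub by blast
  interpret S: vectorspace "scalars F" "frec S" using vectorspace_frec S by blast
  have sm: "submodule (scalars F) S (frec T)"
    using subspace_frec[OF S fd_fsub[OF T] sub] by (simp add: VectorSpace.subspace_def)
  have fdT: "T.fin_dim" using T by (simp add: fd_def)
  have span_eq: "S.span A = T.span A" and li_eq: "S.lin_dep A = T.lin_dep A" if "A \<subseteq> S" for A
    using T.span_li_not_depend[OF that sm] by (simp_all add: frec_carrier)
  have bnd: "finite A \<and> card A \<le> T.dim" if "A \<subseteq> S \<and> T.lin_indpt A" for A
    using T.li_le_dim[OF fdT, of A] that sub by auto
  have "{} \<subseteq> S \<and> T.lin_indpt {}" by (simp add: T.lin_dep_def)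
  from maximal_exists[of "\<lambda>A. A \<subseteq> S \<and> T.lin_indpt A", OF bnd this]
  obtain A where A: "finite A" "maximal A (\<lambda>A. A \<subseteq> S \<and> T.lin_indpt A)" by blast
  then have "maximal A (\<lambda>A. A \<subseteq> carrier (frec S) \<and> S.lin_indpt A)"
    unfolding maximal_def using li_eq by auto
  then have b: "S.basis A" by (rule S.max_li_is_basis)
  then have AS: "A \<subseteq> S" and gen: "S.span A = S" and li: "T.lin_indpt A"
    using li_eq by (auto simp: S.basis_def)
  show "fd S" using S A(1) AS gen unfolding fd_def S.fin_dim_def by auto
  have dS: "dm S = card A" unfolding dm_def using S.dim_basis[OF A(1) b] .
  show "dm S \<le> dm T" using dS T.li_le_dim(2)[OF fdT _ li] AS sub by (auto simp: dm_def)
  assume "dm S = dm T"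
  then have "T.basis A" using T.dim_li_is_basis[OF fdT A(1) _ li] AS sub dS by (auto simp: dm_def)
  then have "T.span A = T" by (simp add: T.basis_def)
  then show "S = T" using gen span_eq AS by auto
qed

lemma dm_strict: "fd T \<Longrightarrow> fsub S \<Longrightarrow> S \<subset> T \<Longrightarrow> dm S < dm T"
  using fd_mono(2,3)[of T S] by fastforce

lemma fd_zero: "fd {0}" and dm_zero: "dm {0} = 0"
proof -
  interpret Z: vectorspace "scalars F" "frec {0}" using vectorspace_frec fsub_zero by blast
  have "Z.span {} = {0}" using Z.span_empty by simp
  then have b: "Z.basis {}" "Z.fin_dim" unfolding Z.basis_def Z.fin_dim_def
    by (auto simp: Z.lin_dep_def intro!: exI[of _ "{}"])
  show "fd {0}" using b by (simp add: fd_def fsub_zero)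
  show "dm {0} = 0" using Z.dim_basis[OF _ b(1)] by (simp add: dm_def)
qed

lemma dm_0_iff: "fd S \<Longrightarrow> dm S = 0 \<longleftrightarrow> S = {0}"
  using fd_mono(3)[of S "{0}"] dm_zero fsub_zero fsub_0[OF fd_fsub] by auto

definition fline :: "'b \<Rightarrow> 'b set" where "fline v = (\<lambda>a. sm a v) ` F"

lemma fsub_fline: "fsub (fline v)"
  unfolding fline_def
proof (rule fsubI)
  show "0 \<in> (\<lambda>a. sm a v) ` F" by (rule image_eqI[of _ _ 0]) auto
  fix x y assume "x \<in> (\<lambda>a. sm a v) ` F" "y \<in> (\<lambda>a. sm a v) ` F"
  then show "x + y \<in> (\<lambda>a. sm a v) ` F" by (auto simp: sm_add_left[symmetric] F_add)
next
  fix a x assume "a \<in> F" "x \<in> (\<lambda>a. sm a v) ` F"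
  then show "sm a x \<in> (\<lambda>a. sm a v) ` F" by (auto simp: sm_mult[symmetric] F_mult)
qed

lemma in_fline: "v \<in> fline v"
  unfolding fline_def by (rule image_eqI[of _ _ 1]) (auto simp: sm_one)

lemma fline_fd: "fd (fline v)" and dm_fline: "v \<noteq> 0 \<Longrightarrow> dm (fline v) = 1"
proof -
  interpret L: vectorspace "scalars F" "frec (fline v)" using vectorspace_frec fsub_fline by blast
  have sub: "fline v \<subseteq> L.span {v}"
  proof
    fix x assume "x \<in> fline v"
    then obtain a where a: "a \<in> F" "x = sm a v" by (auto simp: fline_def)
    have "L.lincomb (\<lambda>_. a) {v} = sm a v"
      unfolding L.lincomb_def using in_fline fsub_sm[OF fsub_fline] a by (auto simp: Pi_def)
    then show "x \<in> L.span {v}" unfolding L.span_def using a by (intro CollectI exI[of _ "\<lambda>_. a"] exI[of _ "{v}"]) auto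
  qed
  moreover have "L.span {v} \<subseteq> fline v"
    using L.span_is_subset2[of "{v}"] in_fline by auto
  ultimately have g: "L.span {v} = carrier (frec (fline v))" by auto
  show "fd (fline v)" unfolding fd_def L.fin_dim_def using g in_fline fsub_fline by (auto intro!: exI[of _ "{v}"])
  show "v \<noteq> 0 \<Longrightarrow> dm (fline v) = 1" unfolding dm_def by (rule L.dim1I[OF g]) (auto simp: in_fline)
qed

definition fplus :: "'b set \<Rightarrow> 'b set \<Rightarrow> 'b set" where
  "fplus S T = {v + w | v w. v \<in> S \<and> w \<in> T}"

lemma fsub_fplus: "fsub S \<Longrightarrow> fsub T \<Longrightarrow> fsub (fplus S T)"
  unfolding fplus_def
  apply (rule fsubI)
    apply (use fsub_0 in force)
   apply (clarsimp, metis (no_types, lifting) fsub_add add.assoc add.commute)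
  apply (clarsimp, metis sm_add fsub_sm)
  done

lemma fplus_supL: "fsub T \<Longrightarrow> S \<subseteq> fplus S T"
  unfolding fplus_def using fsub_0 by force

lemma fplus_supR: "fsub S \<Longrightarrow> T \<subseteq> fplus S T"
  unfolding fplus_def using fsub_0 by force

end

section \<open>Linear maps on subspaces\<close>

locale fmod2 = A: fmod F sm + B: fmod F sm'
  for F :: "'a::division_ring set" and sm :: "'a \<Rightarrow> 'b::ab_group_add \<Rightarrow> 'b"
    and sm' :: "'a \<Rightarrow> 'c::ab_group_add \<Rightarrow> 'c"
begin

text \<open>The conditions range over \<open>S\<close> only: later maps are given by formulas that
  are linear on a subspace but not on the whole type.\<close>

definition flin :: "'b set \<Rightarrow> ('b \<Rightarrow> 'c) \<Rightarrow> bool" where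
  "flin S f \<longleftrightarrow> (\<forall>v\<in>S. \<forall>w\<in>S. f (v + w) = f v + f w) \<and> (\<forall>a\<in>F. \<forall>v\<in>S. f (sm a v) = sm' a (f v))"

lemma flinI: "(\<And>v w. v \<in> S \<Longrightarrow> w \<in> S \<Longrightarrow> f (v + w) = f v + f w) \<Longrightarrow>
   (\<And>a v. a \<in> F \<Longrightarrow> v \<in> S \<Longrightarrow> f (sm a v) = sm' a (f v)) \<Longrightarrow> flin S f"
  unfolding flin_def by blast

lemma flin_add: "flin S f \<Longrightarrow> v \<in> S \<Longrightarrow> w \<in> S \<Longrightarrow> f (v + w) = f v + f w"
  and flin_sm: "flin S f \<Longrightarrow> a \<in> F \<Longrightarrow> v \<in> S \<Longrightarrow> f (sm a v) = sm' a (f v)"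
  unfolding flin_def by blast+

lemma flin_mono: "flin T f \<Longrightarrow> S \<subseteq> T \<Longrightarrow> flin S f"
  unfolding flin_def by blast

lemma flin_0: "A.fsub S \<Longrightarrow> flin S f \<Longrightarrow> f 0 = 0"
  using flin_sm[of S f 0 0] A.fsub_0 by simp

lemma flin_uminus: "A.fsub S \<Longrightarrow> flin S f \<Longrightarrow> v \<in> S \<Longrightarrow> f (- v) = - f v"
  using flin_add[of S f v "- v"] flin_0[of S f] A.fsub_uminus[of S v] by (simp add: eq_neg_iff_add_eq_0 add.commute)

lemma flin_diff: "A.fsub S \<Longrightarrow> flin S f \<Longrightarrow> v \<in> S \<Longrightarrow> w \<in> S \<Longrightarrow> f (v - w) = f v - f w"
  using flin_add[of S f v "- w"] flin_uminus[of S f w] A.fsub_uminus[of S w] by simp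

lemma fsub_image: "A.fsub S \<Longrightarrow> flin S f \<Longrightarrow> B.fsub (f ` S)"
  apply (rule B.fsubI)
    apply (metis flin_0 A.fsub_0 imageI)
   apply (clarsimp, metis flin_add A.fsub_add imageI)
  apply (clarsimp, metis flin_sm A.fsub_sm imageI)
  done

lemma fsub_ker: "A.fsub S \<Longrightarrow> flin S f \<Longrightarrow> A.fsub {v\<in>S. f v = 0}"
  by (rule A.fsubI) (auto simp: flin_0 flin_add flin_sm A.fsub_0 A.fsub_add A.fsub_sm)

lemma inj_on_flin: "A.fsub S \<Longrightarrow> flin S f \<Longrightarrow> (\<And>v. v \<in> S \<Longrightarrow> f v = 0 \<Longrightarrow> v = 0) \<Longrightarrow> inj_on f S"
  by (rule inj_onI) (metis flin_diff A.fsub_diff right_minus_eq)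

lemma linear_map_frec:
  assumes S: "A.fsub S" and f: "flin S f" and T: "B.fsub T" and fST: "f ` S \<subseteq> T"
  shows "linear_map (scalars F) (A.frec S) (B.frec T) f"
proof -
  have "vectorspace (scalars F) (A.frec S)" "vectorspace (scalars F) (B.frec T)"
    using A.vectorspace_frec B.vectorspace_frec S T by auto
  moreover have "f \<in> module_hom (scalars F) (A.frec S) (B.frec T)"
    unfolding module_hom_def using f fST by (auto simp: flin_add flin_sm)
  ultimately show ?thesis
    unfolding linear_map_def mod_hom_def mod_hom_axioms_def vectorspace_def by auto
qed

lemma rank_nullity:
  assumes S: "A.fd S" and f: "flin S f"
  shows "B.fd (f ` S)" "A.fd {v\<in>S. f v = 0}" "A.dm S = B.dm (f ` S) + A.dm {v\<in>S. f v = 0}"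
proof -
  note sub = A.fd_fsub[OF S]
  have T: "B.fsub (f ` S)" using fsub_image[OF sub f] .
  interpret L: linear_map "scalars F" "A.frec S" "B.frec (f ` S)" f
    using linear_map_frec[OF sub f T] by auto
  have fin: "L.V.fin_dim" using S by (simp add: A.fd_def)
  have "L.W.fin_dim" using L.rank_nullity_main(2)[OF fin] by simp
  then show "B.fd (f ` S)" using T by (simp add: B.fd_def)
  show "A.fd {v\<in>S. f v = 0}" using A.fd_mono(1)[OF S fsub_ker[OF sub f]] by auto
  have "L.imT = f ` S" "L.kerT = {v\<in>S. f v = 0}" by (auto simp: L.im_def L.ker_def)
  then show "A.dm S = B.dm (f ` S) + A.dm {v\<in>S. f v = 0}"
    using L.rank_nullity_main(1)[OF fin] by (simp add: A.dm_def B.dm_def A.frec_carrier B.frec_carrier)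
qed

lemma dm_inj:
  assumes "A.fd S" "flin S f" "\<And>v. v \<in> S \<Longrightarrow> f v = 0 \<Longrightarrow> v = 0"
  shows "B.dm (f ` S) = A.dm S"
proof -
  have "{v\<in>S. f v = 0} = {0}" using assms flin_0 A.fsub_0 A.fd_fsub by blast
  then show ?thesis using rank_nullity(3)[OF assms(1,2)] A.dm_zero by simp
qed

text \<open>Generators of the kernel together with preimages of generators of the image span
  \<open>S\<close>. In contrast to \<open>rank_nullity\<close>, the finite dimension of
  \<open>S\<close> is the conclusion here; direct sums and function spaces obtain theirs in this
  way.\<close>

lemma fd_extension:
  assumes S: "A.fsub S" and f: "flin S f" and im: "B.fd (f ` S)" and ker: "A.fd {v\<in>S. f v = 0}"
  shows "A.fd S"
proof -
  let ?K = "{v\<in>S. f v = 0}"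
  have K: "A.fsub ?K" and I: "B.fsub (f ` S)" using fsub_ker fsub_image S f by auto
  interpret S: vectorspace "scalars F" "A.frec S" using A.vectorspace_frec S .
  interpret K: vectorspace "scalars F" "A.frec ?K" using A.vectorspace_frec K .
  interpret W: vectorspace "scalars F" "B.frec (f ` S)" using B.vectorspace_frec I .
  obtain A where A: "finite A" "A \<subseteq> ?K" "K.span A = ?K"
    using ker unfolding A.fd_def K.fin_dim_def by auto
  obtain B where B: "finite B" "B \<subseteq> f ` S" "W.span B = f ` S"
    using im unfolding B.fd_def W.fin_dim_def by auto
  obtain C where C: "C \<subseteq> S" "finite C" "B = f ` C"
    using finite_subset_image[OF B(1,2)] by blast
  have AC: "A \<union> C \<subseteq> carrier (A.frec S)" using A(2) C(1) by auto
  define U where "U = S.span (A \<union> C)"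
  have subU: "VectorSpace.subspace (scalars F) U (A.frec S)" unfolding U_def by (rule S.span_is_subspace[OF AC])
  then have U: "A.fsub U" "U \<subseteq> S"
    by (auto simp: VectorSpace.subspace_def submodule_def A.fsub_def)
  have ACU: "A \<union> C \<subseteq> U" unfolding U_def by (rule S.in_own_span[OF AC])
  have smK: "submodule (scalars F) ?K (A.frec S)"
    using A.subspace_frec[OF K S] by (auto simp: VectorSpace.subspace_def)
  have KU: "?K \<subseteq> U"
  proof -
    have "K.span A = S.span A" using S.span_li_not_depend(1)[OF A(2) smK] by (simp add: A.frec_carrier)
    also have "\<dots> \<subseteq> S.span (A \<union> C)" by (rule S.span_is_monotone) auto
    finally show ?thesis using A(3) U_def by simp
  qed
  have IU: "B.fsub (f ` U)" using fsub_image[OF U(1) flin_mono[OF f U(2)]] .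
  have "submodule (scalars F) (f ` U) (B.frec (f ` S))"
    using B.subspace_frec[OF IU I] U(2) by (auto simp: VectorSpace.subspace_def)
  then have "W.span B \<subseteq> f ` U"
    using W.span_is_subset[of B "f ` U"] C(3) ACU by auto
  then have fU: "f ` S \<subseteq> f ` U" using B(3) by simp
  have "S \<subseteq> U"
  proof
    fix v assume v: "v \<in> S"
    then obtain u where u: "u \<in> U" "f v = f u" using fU by blast
    then have "v - u \<in> ?K" using v U(2) flin_diff[OF S f] A.fsub_diff[OF S] by auto
    then have "(v - u) + u \<in> U" using KU u A.fsub_add[OF U(1)] by blast
    then show "v \<in> U" by simp
  qed
  then have "S.span (A \<union> C) = S" using U U_def by auto
  then show ?thesis unfolding A.fd_def S.fin_dim_def using S A(1) C(2) AC by (auto intro!: exI[of _ "A \<union> C"])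
qed

end

section \<open>Pencils of linear maps\<close>

context fmod
begin

lemma fmod2_self: "fmod2 F sm sm" ..

lemma greatest_fsub:
  assumes "fd T" "fsub S" "S \<subseteq> T" "P S"
  obtains H where "fsub H" "H \<subseteq> T" "P H" "\<And>H'. fsub H' \<Longrightarrow> H' \<subseteq> T \<Longrightarrow> P H' \<Longrightarrow> dm H' \<le> dm H"
proof -
  \<comment> \<open>The bound \<open>dm T + 1\<close> is needed because
    \<open>ex_has_greatest_nat\<close> asks for a strict one.\<close>
  have "\<exists>H. (fsub H \<and> H \<subseteq> T \<and> P H) \<and> (\<forall>H'. fsub H' \<and> H' \<subseteq> T \<and> P H' \<longrightarrow> dm H' \<le> dm H)"
    by (rule ex_has_greatest_nat[of _ S _ "dm T + 1"]) (use assms fd_mono(2)[OF assms(1)] in \<open>auto simp: less_Suc_eq_le\<close>)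
  then show ?thesis using that by blast
qed

lemma fplus_sub: "fsub T \<Longrightarrow> A \<subseteq> T \<Longrightarrow> B \<subseteq> T \<Longrightarrow> fplus A B \<subseteq> T"
  unfolding fplus_def using fsub_add by blast

lemma fline_sub: "fsub T \<Longrightarrow> v \<in> T \<Longrightarrow> fline v \<subseteq> T"
  unfolding fline_def using fsub_sm by blast

text \<open>A subspace \<open>C\<close> of greatest dimension among those meeting \<open>S\<close>
  trivially is a complement: if \<open>p\<close> were outside \<open>S + C\<close>, then
  \<open>C\<close> enlarged by the line of \<open>p\<close> would still meet \<open>S\<close>
  trivially, since a relation with nonzero coefficient at \<open>p\<close> puts \<open>p\<close>
  into \<open>S + C\<close>.\<close>

lemma complement_exists:
  assumes T: "fd T" and S: "fsub S" "S \<subseteq> T"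
  obtains C where "fsub C" "C \<subseteq> T" "S \<inter> C = {0}" "fplus S C = T"
proof -
  note subT = fd_fsub[OF T]
  obtain C where C: "fsub C" "C \<subseteq> T" "S \<inter> C = {0}"
    and max: "\<And>H. fsub H \<Longrightarrow> H \<subseteq> T \<Longrightarrow> S \<inter> H = {0} \<Longrightarrow> dm H \<le> dm C"
    using greatest_fsub[of T "{0}" "\<lambda>H. S \<inter> H = {0}"] T fsub_zero fsub_0[OF S(1)] fsub_0[OF subT] by auto
  have "T \<subseteq> fplus S C"
  proof (rule ccontr)
    assume "\<not> T \<subseteq> fplus S C"
    then obtain p where p: "p \<in> T" "p \<notin> fplus S C" by blast
    define C' where "C' = fplus C (fline p)"
    have C': "fsub C'" "C' \<subseteq> T" "C \<subseteq> C'" "p \<in> C'"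
      unfolding C'_def using fsub_fplus fsub_fline C(1) fplus_sub[OF subT C(2) fline_sub[OF subT p(1)]]
        fplus_supL[OF fsub_fline] subsetD[OF fplus_supR[OF C(1), of "fline p"] in_fline] by auto
    have "x = 0" if x: "x \<in> S" "x \<in> C'" for x
    proof -
      obtain c a where ca: "c \<in> C" "a \<in> F" "x = c + sm a p"
        using x(2) unfolding C'_def fplus_def fline_def by auto
      show ?thesis
      proof (cases "a = 0")
        case True
        then have "x \<in> S \<inter> C" using ca x by simp
        then show ?thesis using C(3) by auto
      next
        case False
        have "p = sm (inverse a) (x - c)" using ca False by (simp add: sm_inverse)
        also have "\<dots> = sm (inverse a) x + sm (inverse a) (- c)"
          using ca F_inverse by (simp add: sm_add[symmetric])
        also have "\<dots> \<in> fplus S C" unfolding fplus_def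
          using fsub_sm[OF S(1) F_inverse[OF ca(2)] x(1)] fsub_sm[OF C(1) F_inverse[OF ca(2)] fsub_uminus[OF C(1) ca(1)]] by blast
        finally show ?thesis using p by blast
      qed
    qed
    then have "S \<inter> C' = {0}" using fsub_0[OF S(1)] fsub_0[OF C'(1)] by auto
    then have "dm C' \<le> dm C" using max C' by blast
    moreover have "dm C < dm C'"
      using dm_strict[of C' C] fd_mono(1)[OF T C'(1,2)] C(1) C'(3,4) p(2) fplus_supR[OF S(1), of C] by auto
    ultimately show False by simp
  qed
  then show ?thesis using that[OF C(1,2,3)] fplus_sub[OF subT S(2) C(2)] by blast
qed

text \<open>The projection of the sum onto \<open>S\<close> along \<open>T\<close> has image
  \<open>S\<close> and kernel \<open>T\<close>.\<close>

lemma dm_fplus: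
  assumes S: "fd S" and T: "fd T" and d: "S \<inter> T = {0}"
  shows "fd (fplus S T)" "dm (fplus S T) = dm S + dm T"
proof -
  interpret E: fmod2 F sm sm by (rule fmod2_self)
  note s = fd_fsub[OF S] and t = fd_fsub[OF T]
  have P: "fsub (fplus S T)" using fsub_fplus s t .
  define g where "g x = (THE v. v \<in> S \<and> x - v \<in> T)" for x
  have geq: "g x = v" if "v \<in> S" "x - v \<in> T" for x v
    unfolding g_def
  proof (rule the_equality)
    fix u assume u: "u \<in> S \<and> x - u \<in> T"
    then have "v - u \<in> S \<inter> T" using that fsub_diff[OF s, of v u] fsub_diff[OF t, of "x - u" "x - v"] by simp
    then show "u = v" using d by auto
  qed (use that in auto)
  have dec: "\<exists>v\<in>S. x - v \<in> T \<and> g x = v" if "x \<in> fplus S T" for x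
    using that geq unfolding fplus_def by force
  have lin: "E.flin (fplus S T) g"
  proof (rule E.flinI)
    fix x y assume "x \<in> fplus S T" "y \<in> fplus S T"
    then obtain v w where "v \<in> S" "x - v \<in> T" "g x = v" "w \<in> S" "y - w \<in> T" "g y = w" using dec by metis
    then show "g (x + y) = g x + g y"
      using geq[of "v + w" "x + y"] fsub_add[OF s] fsub_add[OF t, of "x - v" "y - w"] by (simp add: algebra_simps)
  next
    fix a x assume a: "a \<in> F" and "x \<in> fplus S T"
    then obtain v where "v \<in> S" "x - v \<in> T" "g x = v" using dec by metis
    then show "g (sm a x) = sm a (g x)"
      using geq[of "sm a v" "sm a x"] fsub_sm[OF s a] fsub_sm[OF t a, of "x - v"] a by (simp add: sm_diff)
  qed
  have im: "g ` fplus S T = S"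
  proof
    show "g ` fplus S T \<subseteq> S" using dec by force
    show "S \<subseteq> g ` fplus S T"
    proof
      fix v assume v: "v \<in> S"
      then have "g v = v" using geq[of v v] fsub_0[OF t] by simp
      then show "v \<in> g ` fplus S T" using v fplus_supL[OF t, of S] by force
    qed
  qed
  have ker: "{x \<in> fplus S T. g x = 0} = T"
  proof
    show "{x \<in> fplus S T. g x = 0} \<subseteq> T" using dec by force
    show "T \<subseteq> {x \<in> fplus S T. g x = 0}" using geq[of 0] fsub_0[OF s] fplus_supR[OF s, of T] by auto
  qed
  show fdP: "fd (fplus S T)" using E.fd_extension[OF P lin] im ker S T by simp
  show "dm (fplus S T) = dm S + dm T" using E.rank_nullity(3)[OF fdP lin] im ker by simp
qed

text \<open>Let \<open>C\<close> be a complement of the sum of \<open>S\<close> and the line of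
  \<open>p\<close>. The hyperplane \<open>H\<close>, the sum of \<open>S\<close> and
  \<open>C\<close>, misses \<open>p\<close>, and \<open>\<phi> v\<close> is the coefficient of
  \<open>p\<close> in \<open>v\<close> modulo \<open>H\<close>.\<close>

lemma separating_form:
  assumes T: "fd T" and S: "fsub S" "S \<subseteq> T" and p: "p \<in> T" "p \<notin> S"
  obtains \<phi> where "\<And>v. v \<in> T \<Longrightarrow> \<phi> v \<in> F" "\<And>v w. v \<in> T \<Longrightarrow> w \<in> T \<Longrightarrow> \<phi> (v + w) = \<phi> v + \<phi> w"
    "\<And>a v. a \<in> F \<Longrightarrow> v \<in> T \<Longrightarrow> \<phi> (sm a v) = a * \<phi> v" "\<And>v. v \<in> S \<Longrightarrow> \<phi> v = 0" "\<phi> p = 1"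
proof -
  note subT = fd_fsub[OF T]
  have Sp: "fsub (fplus S (fline p))" "fplus S (fline p) \<subseteq> T"
    using fsub_fplus S fsub_fline fplus_sub[OF subT S(2) fline_sub[OF subT p(1)]] by auto
  obtain C where C: "fsub C" "C \<subseteq> T" "fplus S (fline p) \<inter> C = {0}" "fplus (fplus S (fline p)) C = T"
    using complement_exists[OF T Sp] .
  define H where "H = fplus S C"
  have H: "fsub H" unfolding H_def using fsub_fplus S C by blast
  have SH: "S \<subseteq> H" unfolding H_def by (rule fplus_supL[OF C(1)])
  have pH: "p \<notin> H"
  proof
    assume "p \<in> H"
    then obtain s c where sc: "s \<in> S" "c \<in> C" "p = s + c" unfolding H_def fplus_def by blast
    have "c = sm (-1) s + p" using sc F_uminus by (simp add: sm_uminus_left sm_one)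
    moreover have "sm (-1) s \<in> S" using fsub_sm[OF S(1) F_uminus[OF F_1] sc(1)] .
    ultimately have "c \<in> fplus S (fline p)" unfolding fplus_def using in_fline[of p] by blast
    then have "c = 0" using C(3) sc(2) by blast
    then show False using sc p by simp
  qed
  define \<phi> where "\<phi> v = (THE a. a \<in> F \<and> v - sm a p \<in> H)" for v
  have eq: "\<phi> v = a" if "a \<in> F" "v - sm a p \<in> H" for v a
    unfolding \<phi>_def
  proof (rule the_equality)
    fix b assume b: "b \<in> F \<and> v - sm b p \<in> H"
    have "sm (a - b) p = (v - sm b p) - (v - sm a p)"
      using that b F_uminus by (simp add: sm_add_left[of a "- b", simplified] sm_uminus_left)
    moreover have "(v - sm b p) - (v - sm a p) \<in> H" using fsub_diff[OF H] b that by blast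
    ultimately have "sm (a - b) p \<in> H" by metis
    then have "a - b \<noteq> 0 \<Longrightarrow> p \<in> H"
      using fsub_sm[OF H, of "inverse (a - b)" "sm (a - b) p"] F_inverse F_diff that b sm_inverse[of "a - b" p] by auto
    then show "b = a" using pH by auto
  qed (use that in auto)
  have dec: "\<exists>a\<in>F. v - sm a p \<in> H \<and> \<phi> v = a" if "v \<in> T" for v
  proof -
    have "v \<in> fplus (fplus S (fline p)) C" using that C(4) by simp
    then obtain s a c where "s \<in> S" "a \<in> F" "c \<in> C" "v = (s + sm a p) + c"
      unfolding fplus_def fline_def by blast
    then have "a \<in> F" "v - sm a p = s + c" "s + c \<in> H" unfolding H_def fplus_def by auto
    then show ?thesis using eq by (metis)
  qed
  show ?thesis
  proof (rule that[of \<phi>])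
    fix v w assume "v \<in> T" "w \<in> T"
    then obtain a b where "a \<in> F" "v - sm a p \<in> H" "\<phi> v = a" "b \<in> F" "w - sm b p \<in> H" "\<phi> w = b" using dec by metis
    then show "\<phi> (v + w) = \<phi> v + \<phi> w"
      using eq[of "a + b" "v + w"] fsub_add[OF H, of "v - sm a p" "w - sm b p"] F_add
      by (simp add: sm_add_left algebra_simps)
  next
    fix c v assume c: "c \<in> F" and "v \<in> T"
    then obtain a where "a \<in> F" "v - sm a p \<in> H" "\<phi> v = a" using dec by metis
    then show "\<phi> (sm c v) = c * \<phi> v"
      using eq[of "c * a" "sm c v"] fsub_sm[OF H c, of "v - sm a p"] c F_mult by (simp add: sm_diff sm_mult)
  next
    fix v assume "v \<in> S" then show "\<phi> v = 0" using eq[of 0 v] SH by auto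
  next
    show "\<phi> p = 1" using eq[of 1 p] fsub_0[OF H] by (simp add: sm_one)
  qed (use dec in force)
qed

lemma fmod_fun: "fmod F (\<lambda>a g (i::'i). sm a (g i))"
  by unfold_locales (auto simp: sm_add sm_add_left sm_mult sm_one fun_eq_iff)

text \<open>Induction on the support: evaluation at the new index maps onto \<open>K\<close>, with
  the functions supported on the old indices as kernel. Coordinate spaces and spaces of matrices
  with prescribed support are of this kind.\<close>

lemma fd_fun:
  assumes "finite (I :: 'i set)" and K: "fd K"
  shows "fmod.fd F (\<lambda>a g i. sm a (g i)) {g. (\<forall>i. i \<notin> I \<longrightarrow> g i = 0) \<and> (\<forall>i\<in>I. g i \<in> K)} \<and>
    fmod.dm F (\<lambda>a g i. sm a (g i)) {g. (\<forall>i. i \<notin> I \<longrightarrow> g i = 0) \<and> (\<forall>i\<in>I. g i \<in> K)} = card I * dm K"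
  using assms(1)
proof (induction I rule: finite_induct)
  interpret G: fmod F "\<lambda>a g (i::'i). sm a (g i)" by (rule fmod_fun)
  case empty
  have "{g. (\<forall>i. i \<notin> {} \<longrightarrow> g i = 0) \<and> (\<forall>i\<in>{}. g i \<in> K)} = {0 :: 'i \<Rightarrow> 'b}" by (auto simp: fun_eq_iff)
  then show ?case using G.fd_zero G.dm_zero by simp
next
  interpret G: fmod F "\<lambda>a g (i::'i). sm a (g i)" by (rule fmod_fun)
  interpret E: fmod2 F "\<lambda>a g (i::'i). sm a (g i)" sm ..
  case (insert j I)
  note k = fd_fsub[OF K]
  let ?S = "{g. (\<forall>i. i \<notin> insert j I \<longrightarrow> g i = 0) \<and> (\<forall>i\<in>insert j I. g i \<in> K)}"
  let ?T = "{g. (\<forall>i. i \<notin> I \<longrightarrow> g i = 0) \<and> (\<forall>i\<in>I. g i \<in> K)}"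
  have S: "G.fsub ?S" by (rule G.fsubI) (auto simp: fsub_0[OF k] fsub_add[OF k] fsub_sm[OF k])
  have lin: "E.flin ?S (\<lambda>g. g j)" by (rule E.flinI) auto
  have ker: "{g \<in> ?S. g j = 0} = ?T" using insert(2) fsub_0[OF k] by auto
  have im: "(\<lambda>g. g j) ` ?S = K"
  proof
    show "K \<subseteq> (\<lambda>g. g j) ` ?S"
    proof
      fix v assume "v \<in> K"
      then show "v \<in> (\<lambda>g. g j) ` ?S"
        by (intro image_eqI[of _ _ "(\<lambda>_. 0)(j := v)"]) (auto simp: fsub_0[OF k])
    qed
  qed auto
  have fd: "G.fd ?S" using E.fd_extension[OF S lin] im ker K insert.IH by simp
  show ?case using fd E.rank_nullity(3)[OF fd lin] im ker insert.IH insert(1,2) by simp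
qed

end

section \<open>Eigenvalues of a pencil \<open>\<beta> - t \<alpha>\<close> with
  \<open>\<alpha>\<close> injective\<close>

context fmod2
begin

text \<open>Applying \<open>\<beta> - s \<alpha>\<close> to the relation removes \<open>c s\<close>
  and leaves \<open>\<alpha>\<close> of the sum of the \<open>(t - s) c t\<close>. As
  \<open>\<alpha>\<close> is injective, this is a shorter relation between eigenvectors with the
  same eigenvalues, and the factors \<open>t - s\<close> are invertible.\<close>

lemma eigenvectors_sum_zero:
  assumes S: "A.fsub S" and al: "flin S \<alpha>" and be: "flin S \<beta>"
    and inj: "\<And>v. v \<in> S \<Longrightarrow> \<alpha> v = 0 \<Longrightarrow> v = 0"
    and T: "finite T" "T \<subseteq> F"
  shows "\<lbrakk>\<And>t. t \<in> T \<Longrightarrow> c t \<in> S \<and> \<beta> (c t) = sm' t (\<alpha> (c t)); (\<Sum>t\<in>T. c t) = 0; t \<in> T\<rbrakk> \<Longrightarrow> c t = 0"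
  using T
proof (induction T arbitrary: c t rule: finite_induct)
  case (insert s T)
  have sum_flin: "f (sum g J) = (\<Sum>i\<in>J. f (g i))" if "flin S f" "finite J" "\<And>i. i \<in> J \<Longrightarrow> g i \<in> S" for f and g :: "'a \<Rightarrow> 'b" and J
    using that(2,3)
  proof (induction J rule: finite_induct)
    case empty
    then show ?case using flin_0[OF S that(1)] by simp
  next
    case (insert j J)
    have "sum g J \<in> S" by (rule A.fsub_sum[OF S]) (use insert.prems in blast)
    then show ?case using insert flin_add[OF that(1), of "g j" "sum g J"] by simp
  qed
  have cS: "c t \<in> S" if "t \<in> insert s T" for t using insert.prems(1) that by blast
  have cb: "\<beta> (c t) = sm' t (\<alpha> (c t))" if "t \<in> insert s T" for t using insert.prems(1) that by blast
  have TF: "t \<in> F" if "t \<in> insert s T" for t using insert.prems that by blast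
  have dF: "t - s \<in> F" if "t \<in> insert s T" for t using TF that A.F_diff by blast
  have sF: "s \<in> F" and cs: "c s \<in> S" using TF cS by blast+
  have cT: "sum c T \<in> S" by (rule A.fsub_sum[OF S]) (use cS in blast)
  have z: "c s + sum c T = 0" using insert.prems(2) insert.hyps by simp
  have b1: "\<beta> (c s + sum c T) = sm' s (\<alpha> (c s)) + (\<Sum>t\<in>T. sm' t (\<alpha> (c t)))"
  proof -
    have "\<beta> (sum c T) = (\<Sum>t\<in>T. \<beta> (c t))" by (rule sum_flin[OF be insert.hyps(1)]) (use cS in blast)
    also have "\<dots> = (\<Sum>t\<in>T. sm' t (\<alpha> (c t)))" by (rule sum.cong) (use cb in auto)
    finally show ?thesis using flin_add[OF be cs cT] cb[of s] by simp
  qed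
  have sms: "sm' s (sum g R) = (\<Sum>t\<in>R. sm' s (g t))" for g :: "'a \<Rightarrow> 'c" and R
    by (induction R rule: infinite_finite_induct) (auto simp: B.sm_add sF)
  have b2: "sm' s (\<alpha> (c s + sum c T)) = sm' s (\<alpha> (c s)) + (\<Sum>t\<in>T. sm' s (\<alpha> (c t)))"
  proof -
    have "\<alpha> (sum c T) = (\<Sum>t\<in>T. \<alpha> (c t))" by (rule sum_flin[OF al insert.hyps(1)]) (use cS in blast)
    then show ?thesis using flin_add[OF al cs cT] B.sm_add[OF sF] sms by simp
  qed
  have "\<beta> (c s + sum c T) - sm' s (\<alpha> (c s + sum c T)) = 0"
    unfolding z flin_0[OF S al] flin_0[OF S be] using sF by simp
  then have b3: "(\<Sum>t\<in>T. sm' t (\<alpha> (c t))) - (\<Sum>t\<in>T. sm' s (\<alpha> (c t))) = 0" unfolding b1 b2 by simp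
  have b4: "sm' t (\<alpha> (c t)) - sm' s (\<alpha> (c t)) = \<alpha> (sm (t - s) (c t))" if "t \<in> T" for t
  proof -
    have "\<alpha> (sm (t - s) (c t)) = sm' (t + - s) (\<alpha> (c t))" using flin_sm[OF al dF cS] that by simp
    also have "\<dots> = sm' t (\<alpha> (c t)) - sm' s (\<alpha> (c t))"
      using that TF[of t] B.sm_add_left[OF TF A.F_uminus[OF sF]] B.sm_uminus_left[OF sF] by simp
    finally show ?thesis by simp
  qed
  have a0: "(\<Sum>t\<in>T. \<alpha> (sm (t - s) (c t))) = 0"
  proof -
    have "(\<Sum>t\<in>T. \<alpha> (sm (t - s) (c t))) = (\<Sum>t\<in>T. sm' t (\<alpha> (c t)) - sm' s (\<alpha> (c t)))"
      by (rule sum.cong) (use b4 in auto)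
    then show ?thesis using b3 by (simp add: sum_subtractf)
  qed
  have dS: "sm (t - s) (c t) \<in> S" if "t \<in> T" for t
    by (rule A.fsub_sm[OF S dF cS]) (use that in auto)
  have "\<alpha> (\<Sum>t\<in>T. sm (t - s) (c t)) = 0" using a0 sum_flin[OF al insert.hyps(1) dS] by simp
  moreover have "(\<Sum>t\<in>T. sm (t - s) (c t)) \<in> S" by (rule A.fsub_sum[OF S dS])
  ultimately have s0: "(\<Sum>t\<in>T. sm (t - s) (c t)) = 0" by (rule inj[rotated])
  have e0: "sm (t - s) (c t) = 0" if t: "t \<in> T" for t
  proof (rule insert.IH[of "\<lambda>t. sm (t - s) (c t)", OF _ s0 t])
    show "T \<subseteq> F" using TF by blast
    fix u assume u: "u \<in> T"
    then have uF: "u \<in> F" "u - s \<in> F" "c u \<in> S" and bu: "\<beta> (c u) = sm' u (\<alpha> (c u))" using TF dF cS cb by blast+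
    have "\<beta> (sm (u - s) (c u)) = sm' (u - s) (sm' u (\<alpha> (c u)))"
      using flin_sm[OF be uF(2,3)] bu by simp
    also have "\<dots> = sm' u (sm' (u - s) (\<alpha> (c u)))"
      by (simp only: B.sm_mult[OF uF(1,2), symmetric] B.sm_mult[OF uF(2,1), symmetric] A.F_comm[OF uF(1), of "u - s"])
    also have "\<dots> = sm' u (\<alpha> (sm (u - s) (c u)))" using flin_sm[OF al uF(2,3)] by simp
    finally show "sm (u - s) (c u) \<in> S \<and> \<beta> (sm (u - s) (c u)) = sm' u (\<alpha> (sm (u - s) (c u)))"
      using dS[OF u] by blast
  qed
  have c0: "c t = 0" if t: "t \<in> T" for t
  proof -
    have "t - s \<noteq> 0" using t insert.hyps(2) by auto
    then show ?thesis using A.sm_eq_0[OF dF, of t "c t"] e0[OF t] t by simp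
  qed
  then have "sum c T = 0" by simp
  then have "c s = 0" using z by simp
  then show ?case using c0 insert.prems(3) by blast
qed simp

text \<open>The span \<open>U R\<close> of the \<open>c t\<close> with \<open>t \<in> R\<close>
  gains a dimension with every new index, since \<open>c s \<in> U R\<close> would be a relation
  between eigenvectors of different eigenvalues.\<close>

lemma card_eigenvalues:
  assumes Sfd: "A.fd S" and al: "flin S \<alpha>" and be: "flin S \<beta>"
    and inj: "\<And>v. v \<in> S \<Longrightarrow> \<alpha> v = 0 \<Longrightarrow> v = 0"
    and T: "finite T" "T \<subseteq> F"
    and c: "\<And>t. t \<in> T \<Longrightarrow> c t \<in> S \<and> c t \<noteq> 0 \<and> \<beta> (c t) = sm' t (\<alpha> (c t))"
  shows "card T \<le> A.dm S"
proof -
  note S = A.fd_fsub[OF Sfd]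
  define U where "U R = {\<Sum>t\<in>R. sm (g t) (c t) | g. \<forall>t\<in>R. g t \<in> F}" for R
  have "A.fsub (U R) \<and> U R \<subseteq> S \<and> card R \<le> A.dm (U R)" if "R \<subseteq> T" for R
    using finite_subset[OF that T(1)] that
  proof (induction R rule: finite_induct)
    case empty
    then show ?case using A.fsub_zero A.fsub_0[OF S] by (simp add: U_def)
  next
    case (insert s R)
    then have IH: "A.fsub (U R)" "U R \<subseteq> S" "card R \<le> A.dm (U R)" by auto
    have s: "s \<in> F" "c s \<in> S" "c s \<noteq> 0" "\<beta> (c s) = sm' s (\<alpha> (c s))" using insert.prems T(2) c by auto
    have eq: "U (insert s R) = A.fplus (U R) (A.fline (c s))"
    proof
      show "U (insert s R) \<subseteq> A.fplus (U R) (A.fline (c s))"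
      proof
        fix x assume "x \<in> U (insert s R)"
        then obtain g where g: "\<forall>t\<in>insert s R. g t \<in> F" "x = (\<Sum>t\<in>insert s R. sm (g t) (c t))"
          unfolding U_def by blast
        then have "x = (\<Sum>t\<in>R. sm (g t) (c t)) + sm (g s) (c s)" using insert.hyps by (simp add: add.commute)
        then show "x \<in> A.fplus (U R) (A.fline (c s))"
          unfolding U_def A.fplus_def A.fline_def using g(1) by blast
      qed
      show "A.fplus (U R) (A.fline (c s)) \<subseteq> U (insert s R)"
      proof
        fix x assume "x \<in> A.fplus (U R) (A.fline (c s))"
        then obtain g a where ga: "\<forall>t\<in>R. g t \<in> F" "a \<in> F" "x = (\<Sum>t\<in>R. sm (g t) (c t)) + sm a (c s)"
          unfolding U_def A.fplus_def A.fline_def by blast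
        have "(\<Sum>t\<in>R. sm ((g(s := a)) t) (c t)) = (\<Sum>t\<in>R. sm (g t) (c t))"
          by (rule sum.cong) (use insert.hyps in auto)
        then have "x = (\<Sum>t\<in>insert s R. sm ((g(s := a)) t) (c t))"
          using ga insert.hyps by (simp add: add.commute)
        moreover have "\<forall>t\<in>insert s R. (g(s := a)) t \<in> F" using ga by simp
        ultimately show "x \<in> U (insert s R)" unfolding U_def by blast
      qed
    qed
    have "c s \<notin> U R"
    proof
      assume "c s \<in> U R"
      then obtain g where g: "\<forall>t\<in>R. g t \<in> F" "c s = (\<Sum>t\<in>R. sm (g t) (c t))" unfolding U_def by blast
      \<comment> \<open>The membership rewritten as a vanishing sum over \<open>insert s R\<close>,
        with coefficient \<open>- 1\<close> at the new index.\<close>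
      define h where "h = (\<lambda>t. sm (g t) (c t))(s := - c s)"
      have "(\<Sum>t\<in>R. h t) = (\<Sum>t\<in>R. sm (g t) (c t))"
        by (rule sum.cong) (use insert.hyps in \<open>auto simp: h_def\<close>)
      then have "sum h (insert s R) = 0" using insert.hyps g(2)[symmetric] by (simp add: h_def)
      moreover have "h t \<in> S \<and> \<beta> (h t) = sm' t (\<alpha> (h t))" if t: "t \<in> insert s R" for t
      proof (cases "t = s")
        case True
        then show ?thesis unfolding h_def using s A.fsub_uminus[OF S s(2)]
          by (simp add: flin_uminus[OF S be] flin_uminus[OF S al] B.sm_uminus)
      next
        case False
        then have t': "t \<in> R" "t \<in> F" "g t \<in> F" using t insert.prems T(2) g by auto
        then have ct: "c t \<in> S" "\<beta> (c t) = sm' t (\<alpha> (c t))" using c insert.prems by auto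
        have "sm' (g t) (sm' t (\<alpha> (c t))) = sm' t (sm' (g t) (\<alpha> (c t)))"
          using t' B.sm_mult[of "g t" t] B.sm_mult[of t "g t"] A.F_comm[of t "g t"] by simp
        then show ?thesis unfolding h_def using False ct t' A.fsub_sm[OF S]
          by (simp add: flin_sm[OF be] flin_sm[OF al])
      qed
      ultimately have "h s = 0"
        using eigenvectors_sum_zero[OF S al be inj, of "insert s R" h s] insert.hyps insert.prems T(2) by auto
      then show False using s(3) by (simp add: h_def)
    qed
    then have "U R \<subset> U (insert s R)"
      using eq A.fplus_supL[OF A.fsub_fline, of "U R" "c s"] A.fplus_supR[OF IH(1), of "A.fline (c s)"] A.in_fline[of "c s"] by blast
    moreover have sub: "A.fsub (U (insert s R))" "U (insert s R) \<subseteq> S"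
      using eq A.fsub_fplus[OF IH(1) A.fsub_fline] A.fplus_sub[OF S IH(2) A.fline_sub[OF S s(2)]] by auto
    ultimately have "A.dm (U R) < A.dm (U (insert s R))"
      using A.dm_strict[OF A.fd_mono(1)[OF Sfd sub] IH(1)] by blast
    then show ?case using sub IH(3) insert.hyps by simp
  qed
  from this[OF subset_refl] have "A.fsub (U T)" "U T \<subseteq> S" "card T \<le> A.dm (U T)" by auto
  then show ?thesis using A.fd_mono(2)[OF Sfd] by fastforce
qed

end

text \<open>\<open>card\<close> of an infinite set is \<open>0\<close>, hence the
  disjunction.\<close>

definition big :: "'a set \<Rightarrow> nat \<Rightarrow> bool" where
  "big F k \<longleftrightarrow> infinite F \<or> k \<le> card F"

lemma big_mono: "big F k \<Longrightarrow> l \<le> k \<Longrightarrow> big F l"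
  unfolding big_def by auto

lemma big_finite_subset:
  assumes "big F k"
  obtains T where "T \<subseteq> F" "finite T" "card T = k"
  using assms unfolding big_def by (metis infinite_arbitrarily_large obtain_subset_with_card_n)

context fmod2
begin

text \<open>With \<open>\<alpha>\<close> injective, each \<open>t\<close> for which \<open>\<alpha> + t \<beta>\<close> fails to be injective gives the eigenvalue
  \<open>-1/t\<close> of \<open>\<alpha>\<^sup>-\<^sup>1 \<beta>\<close>; the degenerate \<open>\<beta>\<close> supplies the additional eigenvalue \<open>0\<close>.\<close>

lemma pencil_rank:
  assumes V: "A.fd V" and al: "flin V \<alpha>" and be: "flin V \<beta>"
    and lt: "B.dm (\<beta> ` V) < B.dm (\<alpha> ` V)" and big: "big F (B.dm (\<alpha> ` V) + 1)"
  shows "\<exists>t\<in>F. t \<noteq> 0 \<and> B.dm (\<alpha> ` V) \<le> B.dm ((\<lambda>N. \<alpha> N + sm' t (\<beta> N)) ` V)"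
proof (rule ccontr)
  assume neg: "\<not> ?thesis"
  then have bad: "B.dm ((\<lambda>N. \<alpha> N + sm' t (\<beta> N)) ` V) < B.dm (\<alpha> ` V)" if "t \<in> F" "t \<noteq> 0" for t
    using that neg not_le by blast
  define r where "r = B.dm (\<alpha> ` V)"
  note subV = A.fd_fsub[OF V]
  \<comment> \<open>On a complement of its kernel \<open>\<alpha>\<close> is injective and has the
    same image, so \<open>S\<close> has dimension \<open>r\<close>.\<close>
  obtain S where S: "A.fsub S" "S \<subseteq> V" "{N\<in>V. \<alpha> N = 0} \<inter> S = {0}" "A.fplus {N\<in>V. \<alpha> N = 0} S = V"
    using A.complement_exists[OF V fsub_ker[OF subV al]] by blast
  have Sfd: "A.fd S" using A.fd_mono(1)[OF V S(1,2)] .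
  have inj: "v = 0" if "v \<in> S" "\<alpha> v = 0" for v
  proof -
    have "v \<in> {N\<in>V. \<alpha> N = 0} \<inter> S" using that S(2) by auto
    then show ?thesis unfolding S(3) by simp
  qed
  have alS: "flin S \<alpha>" and beS: "flin S \<beta>" using al be S(2) flin_mono by auto
  have "\<alpha> ` S = \<alpha> ` V"
  proof
    show "\<alpha> ` V \<subseteq> \<alpha> ` S"
    proof
      fix x assume "x \<in> \<alpha> ` V"
      then obtain N where N: "N \<in> V" "x = \<alpha> N" by blast
      then have "N \<in> A.fplus {N\<in>V. \<alpha> N = 0} S" using S(4) by simp
      then obtain k s where "k \<in> V" "\<alpha> k = 0" "s \<in> S" "x = \<alpha> (k + s)" unfolding A.fplus_def using N by auto
      then show "x \<in> \<alpha> ` S" using S(2) by (auto simp: flin_add[OF al])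
    qed
  qed (use S in auto)
  then have dS: "A.dm S = r" using dm_inj[OF Sfd alS inj] r_def by simp
  \<comment> \<open>A map of rank below \<open>r\<close>, the dimension of \<open>S\<close>, cannot
    be injective on \<open>S\<close>.\<close>
  have noninj: "\<exists>v\<in>S. v \<noteq> 0 \<and> \<gamma> v = 0" if g: "flin V \<gamma>" "B.dm (\<gamma> ` V) < r" for \<gamma>
  proof (rule ccontr)
    assume "\<not> ?thesis"
    then have "B.dm (\<gamma> ` S) = r" using dm_inj[OF Sfd flin_mono[OF g(1) S(2)]] dS by blast
    moreover have "B.dm (\<gamma> ` S) \<le> B.dm (\<gamma> ` V)"
      using B.fd_mono(2)[OF rank_nullity(1)[OF V g(1)] fsub_image[OF S(1) flin_mono[OF g(1) S(2)]]] S(2) by blast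
    ultimately show False using g(2) by simp
  qed
  have lin_t: "flin V (\<lambda>N. \<alpha> N + sm' t (\<beta> N))" if t: "t \<in> F" for t
  proof (rule flinI)
    fix a v assume a: "a \<in> F" "v \<in> V"
    have "sm' t (sm' a (\<beta> v)) = sm' a (sm' t (\<beta> v))"
      using a t B.sm_mult[of t a] B.sm_mult[of a t] A.F_comm[of t a] by simp
    then show "\<alpha> (sm a v) + sm' t (\<beta> (sm a v)) = sm' a (\<alpha> v + sm' t (\<beta> v))"
      using a t by (simp add: flin_sm[OF al] flin_sm[OF be] B.sm_add)
  qed (use t in \<open>simp add: flin_add[OF al] flin_add[OF be] B.sm_add\<close>)
  have ex: "\<exists>v. v \<in> S \<and> v \<noteq> 0 \<and> \<beta> v = sm' \<tau> (\<alpha> v)" if tau: "\<tau> \<in> F" for \<tau>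
  proof (cases "\<tau> = 0")
    case True
    then show ?thesis using noninj[OF be] lt r_def by auto
  next
    case False
    \<comment> \<open>With this \<open>t\<close>, a kernel vector of
      \<open>\<alpha> + t \<beta>\<close> satisfies
      \<open>\<beta> v = \<tau> \<alpha> v\<close>.\<close>
    define t where "t = - inverse \<tau>"
    have t: "t \<in> F" "t \<noteq> 0" using tau False A.F_inverse A.F_uminus by (auto simp: t_def)
    obtain v where v: "v \<in> S" "v \<noteq> 0" "\<alpha> v + sm' t (\<beta> v) = 0"
      using noninj[OF lin_t[OF t(1)]] bad[OF t] r_def by auto
    have "sm' t (\<beta> v) = - sm' (inverse \<tau>) (\<beta> v)" unfolding t_def using tau A.F_inverse by (simp add: B.sm_uminus_left)
    then have "\<alpha> v = sm' (inverse \<tau>) (\<beta> v)" using v(3) by simp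
    then have "\<beta> v = sm' \<tau> (\<alpha> v)" using B.sm_inverse'[OF tau False] by simp
    then show ?thesis using v by blast
  qed
  \<comment> \<open>By now every element of \<open>F\<close> is an eigenvalue, but \<open>S\<close>
    has room for only \<open>r\<close> of them.\<close>
  obtain T where T: "T \<subseteq> F" "finite T" "card T = r + 1" using big_finite_subset[OF big] r_def by blast
  have "\<forall>\<tau>\<in>T. \<exists>v. v \<in> S \<and> v \<noteq> 0 \<and> \<beta> v = sm' \<tau> (\<alpha> v)" using ex T(1) by blast
  then obtain c where "\<And>\<tau>. \<tau> \<in> T \<Longrightarrow> c \<tau> \<in> S \<and> c \<tau> \<noteq> 0 \<and> \<beta> (c \<tau>) = sm' \<tau> (\<alpha> (c \<tau>))" by metis
  then have "card T \<le> r" using card_eigenvalues[OF Sfd alS beS inj T(2,1)] dS by auto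
  then show False using T(3) by simp
qed

end

section \<open>Spaces of endomorphisms with trivial spectrum\<close>

text \<open>These are the properties that the four quadratic types share. In cases (ii) and (iii)
  one has \<open>e x = x + \<sigma> x\<close>, in (i) both maps are the identity, in (iv)
  \<open>\<sigma>\<close> is the identity and the characteristic is \<open>2\<close>; each of these
  makes \<open>s_skew\<close> true. Within the locale the cases are no longer distinguished.\<close>

locale quad = central_sub F for F :: "'a::division_ring set" +
  fixes \<sigma> e :: "'a \<Rightarrow> 'a" and d :: nat
  assumes e_F: "e x \<in> F" and e_add: "e (x + y) = e x + e y"
    and e_sm: "a \<in> F \<Longrightarrow> e (a * x) = a * e x" and e_comm: "e (x * y) = e (y * x)"
    and e_nz: "\<exists>x. e x \<noteq> 0"
    and s_add: "\<sigma> (x + y) = \<sigma> x + \<sigma> y" and s_mult: "\<sigma> (x * y) = \<sigma> y * \<sigma> x"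
    and s_s [simp]: "\<sigma> (\<sigma> x) = x" and s_F: "a \<in> F \<Longrightarrow> \<sigma> a = a"
    and s_norm: "x * \<sigma> x \<in> F" and e_s: "e (\<sigma> x) = e x" and s_skew: "e x = 0 \<Longrightarrow> \<sigma> x = - x"
    and fd_D: "fmod.fd F (*) (UNIV :: 'a set)" and dm_D: "fmod.dm F (*) (UNIV :: 'a set) = d"
begin

sublocale D: fmod F "(*)"
  by unfold_locales (auto simp: algebra_simps)

sublocale DD: fmod2 F "(*)" "(*)" ..

lemma e_0 [simp]: "e 0 = 0" using e_add[of 0 0] by simp
lemma e_uminus: "e (- x) = - e x" using e_add[of x "- x"] by (simp add: eq_neg_iff_add_eq_0 add.commute)
lemma e_diff: "e (x - y) = e x - e y" using e_add[of x "- y"] e_uminus by simp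
lemma e_sm_right: "a \<in> F \<Longrightarrow> e (x * a) = a * e x" using e_sm F_comm by metis
lemma e_sum: "e (sum g I) = (\<Sum>i\<in>I. e (g i))"
  by (induction I rule: infinite_finite_induct) (auto simp: e_add)
lemma s_0 [simp]: "\<sigma> 0 = 0" using s_add[of 0 0] by simp
lemma s_uminus: "\<sigma> (- x) = - \<sigma> x" using s_add[of x "- x"] by (simp add: eq_neg_iff_add_eq_0 add.commute)
lemma s_eq_0 [simp]: "\<sigma> x = 0 \<longleftrightarrow> x = 0" by (metis s_0 s_s)
lemma s_1 [simp]: "\<sigma> 1 = 1" by (simp add: s_F)
lemma s_sum: "\<sigma> (sum g I) = (\<Sum>i\<in>I. \<sigma> (g i))"
  by (induction I rule: infinite_finite_induct) (auto simp: s_add)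

lemma F_left_comm: "a \<in> F \<Longrightarrow> x * (a * y) = a * (x * y)"
  using F_comm[of a x] by (simp add: mult.assoc[symmetric])

text \<open>The inverse is \<open>\<sigma> x\<close> divided by the norm
  \<open>x * \<sigma> x\<close>, which lies in \<open>F\<close>. Rescaling a vector multiplies its
  annihilator by an inverse; this lemma turns the inverse into a value of \<open>\<sigma>\<close> up
  to \<open>F\<close>, and that is the source of semilinearity.\<close>

lemma s_inverse: assumes "x \<noteq> 0" shows "\<exists>c\<in>F - {0}. inverse x = c * \<sigma> x"
proof
  let ?c = "inverse (x * \<sigma> x)"
  have nz: "x * \<sigma> x \<noteq> 0" using assms by simp
  show c: "?c \<in> F - {0}" using F_inverse[OF s_norm, of x] nz by simp
  have "x * (?c * \<sigma> x) = ?c * (x * \<sigma> x)" using F_left_comm c by blast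
  also have "\<dots> = 1" using nz by simp
  finally show "inverse x = ?c * \<sigma> x" by (rule inverse_unique)
qed

lemma e_nondegenerate: assumes "\<And>y. e (x * y) = 0" shows "x = 0"
proof (rule ccontr)
  assume "x \<noteq> 0"
  obtain z where "e z \<noteq> 0" using e_nz by blast
  then show False using assms[of "inverse x * z"] \<open>x \<noteq> 0\<close> by (simp add: mult.assoc[symmetric])
qed

lemma dm_F: "D.dm F = 1" and fd_F: "D.fd F"
proof -
  have "D.fline 1 = F" by (auto simp: D.fline_def)
  then show "D.dm F = 1" "D.fd F" using D.dm_fline[of 1] D.fline_fd[of 1] by auto
qed

lemma fd_subD: "D.fsub S \<Longrightarrow> D.fd S" "D.fsub S \<Longrightarrow> D.dm S \<le> d"
  using D.fd_mono[OF fd_D] dm_D by auto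

lemma d_pos: "d \<ge> 1"
  using dm_D D.dm_0_iff[OF fd_D] by (metis One_nat_def UNIV_I less_one linorder_not_le singletonD zero_neq_one)

lemma e_lin: "DD.flin S e" "DD.flin S (\<lambda>c. e (c * y))"
  by (auto simp: DD.flin_def e_add e_sm distrib_right mult.assoc)

lemma form_image:
  assumes "fmod.fsub F sm S" "fmod F sm" "fmod2.flin F sm (*) S \<phi>" "\<phi> ` S \<subseteq> F" "v \<in> S" "\<phi> v \<noteq> 0"
  shows "\<phi> ` S = F"
proof -
  interpret A: fmod F sm by fact
  interpret B: fmod2 F sm "(*)" ..
  have "c \<in> \<phi> ` S" if "c \<in> F" for c
  proof (rule image_eqI)
    have *: "c * inverse (\<phi> v) \<in> F" using that assms F_mult F_inverse by auto
    show "c = \<phi> (sm (c * inverse (\<phi> v)) v)" using B.flin_sm[OF assms(3) * assms(5)] assms(6) by (simp add: mult.assoc)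
    show "sm (c * inverse (\<phi> v)) v \<in> S" using A.fsub_sm[OF assms(1) * assms(5)] .
  qed
  then show ?thesis using assms(4) by blast
qed

lemma dm_form_kernel:
  assumes "fmod.fd F sm S" "fmod F sm" "fmod2.flin F sm (*) S \<phi>" "\<phi> ` S \<subseteq> F"
  shows "fmod.dm F sm S \<le> fmod.dm F sm {v\<in>S. \<phi> v = 0} + 1"
    "v \<in> S \<Longrightarrow> \<phi> v \<noteq> 0 \<Longrightarrow> fmod.dm F sm S = fmod.dm F sm {v\<in>S. \<phi> v = 0} + 1"
proof -
  interpret A: fmod F sm by fact
  interpret B: fmod2 F sm "(*)" ..
  have "D.dm (\<phi> ` S) \<le> 1" using D.fd_mono(2)[OF fd_F B.fsub_image[OF A.fd_fsub assms(3)]] assms dm_F by auto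
  then show "A.dm S \<le> A.dm {v\<in>S. \<phi> v = 0} + 1" using B.rank_nullity(3)[OF assms(1,3)] by simp
  assume "v \<in> S" "\<phi> v \<noteq> 0"
  then have "\<phi> ` S = F" using form_image[OF A.fd_fsub[OF assms(1)] assms(2-4)] by blast
  then show "A.dm S = A.dm {v\<in>S. \<phi> v = 0} + 1" using B.rank_nullity(3)[OF assms(1,3)] dm_F by simp
qed

lemma dm_ker_e: "D.dm {a. e a = 0} = d - 1"
proof -
  obtain z where "e z \<noteq> 0" using e_nz by blast
  then have "D.dm UNIV = D.dm {v \<in> UNIV. e v = 0} + 1"
    using dm_form_kernel(2)[OF fd_D D.fmod_axioms e_lin(1), of z] e_F by auto
  then show ?thesis using dm_D by simp
qed

text \<open>Each dimension of \<open>T\<close> imposes one \<open>F\<close>-linear condition on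
  \<open>c\<close> and so costs at most one dimension; the induction splits a line off
  \<open>T\<close>.\<close>

lemma annihilator_ge:
  "D.fsub T \<Longrightarrow> d \<le> D.dm {c. \<forall>t\<in>T. e (c * t) = 0} + D.dm T"
proof (induction "D.dm T" arbitrary: T)
  case 0
  then have "T = {0}" using D.dm_0_iff[OF fd_subD(1)] by simp
  then show ?case using dm_D D.dm_zero by simp
next
  case (Suc k)
  let ?A = "\<lambda>T. {c. \<forall>t\<in>T. e (c * t) = 0}"
  have "T \<noteq> {0}" using Suc.hyps(2) D.dm_zero by auto
  then obtain p where p: "p \<in> T" "p \<noteq> 0" using D.fsub_0[OF Suc.prems] by blast
  obtain C where C: "D.fsub C" "C \<subseteq> T" "D.fline p \<inter> C = {0}" "D.fplus (D.fline p) C = T"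
    using D.complement_exists[OF fd_subD(1)[OF Suc.prems] D.fsub_fline D.fline_sub[OF Suc.prems p(1)]] by blast
  have dC: "D.dm T = 1 + D.dm C"
    using D.dm_fplus[OF D.fline_fd fd_subD(1)[OF C(1)] C(3)] C(4) D.dm_fline[OF p(2)] by simp
  have A: "D.fsub (?A C)" by (rule D.fsubI) (auto simp: e_add distrib_right mult.assoc e_sm)
  have eq: "{c \<in> ?A C. e (c * p) = 0} = ?A T"
  proof
    show "{c \<in> ?A C. e (c * p) = 0} \<subseteq> ?A T"
    proof clarify
      fix c t assume c: "\<forall>t\<in>C. e (c * t) = 0" "e (c * p) = 0" and "t \<in> T"
      then obtain a s where "a \<in> F" "s \<in> C" "t = a * p + s"
        using C(4) unfolding D.fplus_def D.fline_def by blast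
      then show "e (c * t) = 0" using c by (simp add: distrib_left e_add F_left_comm e_sm)
    qed
  qed (use C(2) p in auto)
  have "D.dm (?A C) \<le> D.dm {c \<in> ?A C. e (c * p) = 0} + 1"
    using dm_form_kernel(1)[OF fd_subD(1)[OF A] D.fmod_axioms e_lin(2)] e_F by auto
  then show ?case using Suc.hyps(1)[of C] C(1) dC Suc.hyps(2) eq by simp
qed

lemma e_separates:
  assumes "D.fsub T" "T \<noteq> UNIV"
  obtains c where "c \<noteq> 0" "\<And>t. t \<in> T \<Longrightarrow> e (c * t) = 0"
proof -
  have "D.dm T < d" using D.dm_strict[OF fd_D assms(1)] assms(2) dm_D by auto
  then have "D.dm {c. \<forall>t\<in>T. e (c * t) = 0} > 0" using annihilator_ge[OF assms(1)] by simp
  then have "{c. \<forall>t\<in>T. e (c * t) = 0} \<noteq> {0}" using D.dm_zero by auto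
  then show ?thesis using that by auto
qed

text \<open>A nonzero \<open>\<psi>\<close> has a proper kernel, and \<open>e_separates\<close>
  supplies a nonzero \<open>c\<close> such that \<open>e (c * x)\<close> vanishes there. Two
  \<open>F\<close>-forms so related are proportional, and the factor \<open>g\<close> is absorbed
  into \<open>c\<close>. Thus the pairing \<open>e (c * x)\<close> is a perfect duality.\<close>

lemma e_represents:
  assumes \<psi>: "\<And>x. \<psi> x \<in> F" "\<And>x y. \<psi> (x + y) = \<psi> x + \<psi> y" "\<And>a x. a \<in> F \<Longrightarrow> \<psi> (a * x) = a * \<psi> x"
  obtains c where "\<And>x. \<psi> x = e (c * x)"
proof (cases "\<forall>x. \<psi> x = 0")
  case True
  then show ?thesis using that[of 0] by simp
next
  case False
  then obtain p where p: "\<psi> p \<noteq> 0" by blast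
  have H: "D.fsub {x. \<psi> x = 0}"
    using \<psi>(3)[of 0 0] by (auto intro!: D.fsubI simp: \<psi>)
  obtain c where c: "c \<noteq> 0" "\<And>t. \<psi> t = 0 \<Longrightarrow> e (c * t) = 0"
    using e_separates[OF H] p by auto
  have dec: "e (c * x) = \<psi> x * inverse (\<psi> p) * e (c * p)" for x
  proof -
    define a where "a = \<psi> x * inverse (\<psi> p)"
    have a: "a \<in> F" unfolding a_def by (rule F_mult[OF \<psi>(1) F_inverse[OF \<psi>(1)]])
    have "\<psi> (x + (- a) * p) = \<psi> x - a * \<psi> p"
      using \<psi>(2)[of x "- a * p"] \<psi>(3)[OF F_uminus[OF a], of p] by simp
    also have "a * \<psi> p = \<psi> x" unfolding a_def using p by (simp add: mult.assoc)
    also have "\<psi> x - \<psi> x = 0" by simp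
    finally have "e (c * (x + (- a) * p)) = 0" using c(2) by blast
    moreover have "e (c * (a * p)) = a * e (c * p)" by (simp add: F_left_comm[OF a] e_sm[OF a])
    ultimately show ?thesis unfolding a_def[symmetric] by (simp add: e_diff right_diff_distrib)
  qed
  have cp: "e (c * p) \<noteq> 0"
  proof
    assume "e (c * p) = 0"
    then have "e (c * x) = 0" for x using dec[of x] by simp
    then show False using e_nondegenerate[of c] c(1) by simp
  qed
  define g where "g = \<psi> p * inverse (e (c * p))"
  have g: "g \<in> F" unfolding g_def by (rule F_mult[OF \<psi>(1) F_inverse[OF e_F]])
  have "\<psi> x = e (g * c * x)" for x
  proof -
    have "e (g * c * x) = g * (\<psi> x * (inverse (\<psi> p) * e (c * p)))" using e_sm[OF g] dec[of x] by (simp add: mult.assoc)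
    also have "\<dots> = \<psi> x * (g * (inverse (\<psi> p) * e (c * p)))" by (simp only: F_left_comm[OF g])
    also have "g * (inverse (\<psi> p) * e (c * p)) = 1"
    proof -
      have "inverse (\<psi> p) * e (c * p) = e (c * p) * inverse (\<psi> p)" by (rule F_comm[OF e_F, symmetric])
      then have "g * (inverse (\<psi> p) * e (c * p)) = \<psi> p * ((inverse (e (c * p)) * e (c * p)) * inverse (\<psi> p))"
        unfolding g_def by (simp only: mult.assoc)
      then show ?thesis using p cp by simp
    qed
    finally show ?thesis by simp
  qed
  then show ?thesis using that by blast
qed

end

section \<open>Right vector spaces over the division ring and their linear forms\<close>

locale rspace = quad F \<sigma> e d for F :: "'a::division_ring set" and \<sigma> e d +
  fixes sc :: "'v::ab_group_add \<Rightarrow> 'a \<Rightarrow> 'v"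
  assumes sc_add: "sc (v + w) a = sc v a + sc w a" and sc_add_right: "sc v (a + b) = sc v a + sc v b"
    and sc_mult: "sc v (a * b) = sc (sc v a) b" and sc_one [simp]: "sc v 1 = v"
begin

sublocale X: fmod F "\<lambda>a v. sc v a"
  by unfold_locales (auto simp: sc_add sc_add_right sc_mult[symmetric] F_comm)

sublocale E: fmod F "\<lambda>a (f :: 'v \<Rightarrow> 'v) v. sc (f v) a" by (rule X.fmod_fun)

sublocale XX: fmod2 F "\<lambda>a v. sc v a" "\<lambda>a v. sc v a" ..
sublocale XD: fmod2 F "\<lambda>a v. sc v a" "(*)" ..
sublocale DX: fmod2 F "(*)" "\<lambda>a v. sc v a" ..
sublocale EX: fmod2 F "\<lambda>a (f :: 'v \<Rightarrow> 'v) v. sc (f v) a" "\<lambda>a v. sc v a" ..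
sublocale EE: fmod2 F "\<lambda>a (f :: 'v \<Rightarrow> 'v) v. sc (f v) a" "\<lambda>a (f :: 'v \<Rightarrow> 'v) v. sc (f v) a" ..

lemma sc_0 [simp]: "sc 0 a = 0" using sc_add[of 0 0 a] by simp
lemma sc_0_right [simp]: "sc v 0 = 0" using sc_add_right[of v 0 0] by simp
lemma sc_uminus: "sc (- v) a = - sc v a" using sc_add[of v "- v" a] by (simp add: eq_neg_iff_add_eq_0 add.commute)
lemma sc_uminus_right: "sc v (- a) = - sc v a" using sc_add_right[of v a "- a"] by (simp add: eq_neg_iff_add_eq_0 add.commute)
lemma sc_diff: "sc (v - w) a = sc v a - sc w a" using sc_add[of v "- w" a] sc_uminus by simp
lemma sc_inverse [simp]: "a \<noteq> 0 \<Longrightarrow> sc (sc v a) (inverse a) = v" by (simp add: sc_mult[symmetric])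
lemma sc_inverse' [simp]: "a \<noteq> 0 \<Longrightarrow> sc (sc v (inverse a)) a = v" by (simp add: sc_mult[symmetric])
lemma sc_eq_0: "sc v a = 0 \<longleftrightarrow> v = 0 \<or> a = 0" by (metis sc_0 sc_0_right sc_inverse)

definition dsub :: "'v set \<Rightarrow> bool" where
  "dsub U \<longleftrightarrow> 0 \<in> U \<and> (\<forall>v\<in>U. \<forall>w\<in>U. v + w \<in> U) \<and> (\<forall>v\<in>U. \<forall>a. sc v a \<in> U)"

lemma dsub_0: "dsub U \<Longrightarrow> 0 \<in> U" and dsub_add: "dsub U \<Longrightarrow> v \<in> U \<Longrightarrow> w \<in> U \<Longrightarrow> v + w \<in> U"
  and dsub_sc: "dsub U \<Longrightarrow> v \<in> U \<Longrightarrow> sc v a \<in> U"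
  unfolding dsub_def by blast+

lemma dsub_fsub: "dsub U \<Longrightarrow> X.fsub U" unfolding dsub_def X.fsub_def by blast
lemma dsub_diff: "dsub U \<Longrightarrow> v \<in> U \<Longrightarrow> w \<in> U \<Longrightarrow> v - w \<in> U" using X.fsub_diff dsub_fsub by blast
lemma dsub_uminus: "dsub U \<Longrightarrow> v \<in> U \<Longrightarrow> - v \<in> U" using X.fsub_uminus dsub_fsub by blast

lemma dsub_sc_iff: "dsub U \<Longrightarrow> a \<noteq> 0 \<Longrightarrow> sc v a \<in> U \<longleftrightarrow> v \<in> U"
  using dsub_sc[of U "sc v a" "inverse a"] dsub_sc[of U v a] by auto

definition dline :: "'v \<Rightarrow> 'v set" where "dline v = range (sc v)"

lemma dsub_dline: "dsub (dline v)"
  unfolding dsub_def dline_def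
  by (auto simp: sc_add_right[symmetric] sc_mult[symmetric]) (rule range_eqI[of _ _ 0], simp)

lemma in_dline: "v \<in> dline v" unfolding dline_def by (rule range_eqI[of _ _ 1]) simp

lemma dline_sub: "dsub U \<Longrightarrow> v \<in> U \<Longrightarrow> dline v \<subseteq> U" unfolding dline_def using dsub_sc by blast

lemma dsub_fplus: "dsub U \<Longrightarrow> dsub U' \<Longrightarrow> dsub (X.fplus U U')"
  unfolding dsub_def X.fplus_def
  apply (intro conjI)
    apply force
   apply (clarsimp, metis (no_types, lifting) add.assoc add.commute)
  apply (clarsimp, metis sc_add)
  done

lemma fd_dline: "X.fd (dline v)" and dm_dline: "v \<noteq> 0 \<Longrightarrow> X.dm (dline v) = d"
proof -
  have lin: "DX.flin UNIV (sc v)"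
  proof (rule DX.flinI)
    fix a x assume "a \<in> F"
    then show "sc v (a * x) = sc (sc v x) a" by (simp add: sc_mult[symmetric] F_comm[of a x])
  qed (simp add: sc_add_right)
  show "X.fd (dline v)" unfolding dline_def using DX.rank_nullity(1)[OF fd_D lin] .
  show "v \<noteq> 0 \<Longrightarrow> X.dm (dline v) = d"
    unfolding dline_def using DX.dm_inj[OF fd_D lin] dm_D by (simp add: sc_eq_0)
qed

lemma dline_Int:
  assumes "dsub U" "v \<notin> U" shows "U \<inter> dline v = {0}"
proof -
  have "sc v a \<in> U \<Longrightarrow> a = 0" for a using assms dsub_sc_iff by blast
  then show ?thesis using dsub_0[OF assms(1)] dsub_0[OF dsub_dline, of v] unfolding dline_def by force
qed

lemma dm_add_dline:
  assumes "dsub U" "X.fd U" "v \<notin> U"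
  shows "X.fd (X.fplus U (dline v))" "X.dm (X.fplus U (dline v)) = X.dm U + d"
proof -
  have "v \<noteq> 0" using assms dsub_0 by blast
  then show "X.fd (X.fplus U (dline v))" "X.dm (X.fplus U (dline v)) = X.dm U + d"
    using X.dm_fplus[OF assms(2) fd_dline dline_Int[OF assms(1,3)]] dm_dline by auto
qed

definition dlin :: "'v set \<Rightarrow> ('v \<Rightarrow> 'v) \<Rightarrow> bool" where
  "dlin S f \<longleftrightarrow> (\<forall>v\<in>S. \<forall>w\<in>S. f (v + w) = f v + f w) \<and> (\<forall>v\<in>S. \<forall>a. f (sc v a) = sc (f v) a)"

definition dfun :: "'v set \<Rightarrow> ('v \<Rightarrow> 'a) \<Rightarrow> bool" where
  "dfun S w \<longleftrightarrow> (\<forall>v\<in>S. \<forall>u\<in>S. w (v + u) = w v + w u) \<and> (\<forall>v\<in>S. \<forall>a. w (sc v a) = w v * a)"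

lemma dlin_add: "dlin S f \<Longrightarrow> v \<in> S \<Longrightarrow> u \<in> S \<Longrightarrow> f (v + u) = f v + f u"
  and dlin_sc: "dlin S f \<Longrightarrow> v \<in> S \<Longrightarrow> f (sc v a) = sc (f v) a"
  unfolding dlin_def by blast+

lemma dfun_add: "dfun S w \<Longrightarrow> v \<in> S \<Longrightarrow> u \<in> S \<Longrightarrow> w (v + u) = w v + w u"
  and dfun_sc: "dfun S w \<Longrightarrow> v \<in> S \<Longrightarrow> w (sc v a) = w v * a"
  unfolding dfun_def by blast+

lemma dlin_flin: "dlin S f \<Longrightarrow> XX.flin S f" unfolding dlin_def XX.flin_def by blast
lemma dfun_flin: "dfun S w \<Longrightarrow> XD.flin S w" unfolding dfun_def XD.flin_def using F_comm by metis
lemma dfun_e_flin: "dfun S w \<Longrightarrow> XD.flin S (\<lambda>v. e (w v))"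
  unfolding dfun_def XD.flin_def using e_sm_right e_add by simp

lemma dlin_mono: "dlin S f \<Longrightarrow> U \<subseteq> S \<Longrightarrow> dlin U f" unfolding dlin_def by blast
lemma dfun_mono: "dfun S w \<Longrightarrow> U \<subseteq> S \<Longrightarrow> dfun U w" unfolding dfun_def by blast

lemma dlin_0: "dsub S \<Longrightarrow> dlin S f \<Longrightarrow> f 0 = 0" using XX.flin_0 dlin_flin dsub_fsub by blast
lemma dlin_diff: "dsub S \<Longrightarrow> dlin S f \<Longrightarrow> v \<in> S \<Longrightarrow> u \<in> S \<Longrightarrow> f (v - u) = f v - f u"
  using XX.flin_diff dlin_flin dsub_fsub by blast
lemma dfun_0: "dsub S \<Longrightarrow> dfun S w \<Longrightarrow> w 0 = 0" using XD.flin_0 dfun_flin dsub_fsub by blast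
lemma dfun_diff: "dsub S \<Longrightarrow> dfun S w \<Longrightarrow> v \<in> S \<Longrightarrow> u \<in> S \<Longrightarrow> w (v - u) = w v - w u"
  using XD.flin_diff dfun_flin dsub_fsub by blast

lemma dfun_scale: "dfun S w \<Longrightarrow> dfun S (\<lambda>v. c * w v)"
  unfolding dfun_def by (simp add: distrib_left mult.assoc)
lemma dfun_plus: "dfun S w \<Longrightarrow> dfun S w' \<Longrightarrow> dfun S (\<lambda>v. w v + w' v)"
  unfolding dfun_def by (simp add: distrib_right algebra_simps)
lemma dfun_minus: "dfun S w \<Longrightarrow> dfun S w' \<Longrightarrow> dfun S (\<lambda>v. w v - w' v)"
  unfolding dfun_def by (simp add: left_diff_distrib)

lemma dsub_ker: "dsub S \<Longrightarrow> dfun S w \<Longrightarrow> dsub {v\<in>S. w v = 0}"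
  unfolding dsub_def dfun_def using dfun_0[of S w] unfolding dfun_def dsub_def by auto

lemma dfun_surj:
  assumes "dsub S" "dfun S w" "v \<in> S" "w v \<noteq> 0"
  shows "w ` S = UNIV"
proof -
  have "c = w (sc v (inverse (w v) * c))" for c
    using dfun_sc[OF assms(2,3)] assms(4) by (simp add: mult.assoc[symmetric])
  then show ?thesis using dsub_sc[OF assms(1,3)] by blast
qed

lemma dm_dfun_ker:
  assumes "dsub S" "X.fd S" "dfun S w" "v \<in> S" "w v \<noteq> 0"
  shows "X.dm S = X.dm {v\<in>S. w v = 0} + d"
  using XD.rank_nullity(3)[OF assms(2) dfun_flin[OF assms(3)]] dfun_surj[OF assms(1,3-5)] dm_D by simp

text \<open>Replacing \<open>v\<close> by \<open>sc v y\<close> gives \<open>e (w v * y) = 0\<close>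
  for all \<open>y\<close>, and the pairing is nondegenerate.\<close>

lemma e_dfun_zero:
  assumes "dsub S" "dfun S w" "\<And>v. v \<in> S \<Longrightarrow> e (w v) = 0" "v \<in> S"
  shows "w v = 0"
  by (rule e_nondegenerate) (metis assms dfun_sc dsub_sc)

text \<open>Any \<open>F\<close>-linear form \<open>\<phi>\<close> on \<open>S\<close> is
  \<open>e\<close> composed with a form over the division ring: \<open>w v\<close> is the element
  representing \<open>x \<mapsto> \<phi> (sc v x)\<close>, and uniqueness of this element makes
  \<open>w\<close> linear. The form to be rewritten is the one that separates \<open>p\<close> from
  \<open>T\<close>.\<close>

lemma dfun_separates:
  assumes S: "dsub S" "X.fd S" and T: "X.fsub T" "T \<subseteq> S" and p: "p \<in> S" "p \<notin> T"
  obtains w where "dfun S w" "\<And>v. v \<in> T \<Longrightarrow> e (w v) = 0" "e (w p) \<noteq> 0"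
proof -
  obtain \<phi> where \<phi>: "\<And>v. v \<in> S \<Longrightarrow> \<phi> v \<in> F" "\<And>v w. v \<in> S \<Longrightarrow> w \<in> S \<Longrightarrow> \<phi> (v + w) = \<phi> v + \<phi> w"
    "\<And>a v. a \<in> F \<Longrightarrow> v \<in> S \<Longrightarrow> \<phi> (sc v a) = a * \<phi> v" "\<And>v. v \<in> T \<Longrightarrow> \<phi> v = 0" "\<phi> p = 1"
    using X.separating_form[OF S(2) T p] by blast
  have "\<exists>c. \<forall>x. \<phi> (sc v x) = e (c * x)" if v: "v \<in> S" for v
  proof -
    have s: "sc v x \<in> S" for x using dsub_sc[OF S(1) v] .
    obtain c where "\<And>x. \<phi> (sc v x) = e (c * x)"
    proof (rule e_represents[of "\<lambda>x. \<phi> (sc v x)"])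
      show "\<phi> (sc v (a * x)) = a * \<phi> (sc v x)" if "a \<in> F" for a x
        unfolding F_comm[OF that, of x] sc_mult by (rule \<phi>(3)[OF that s])
    qed (auto simp: \<phi> s sc_add_right)
    then show ?thesis by blast
  qed
  then obtain w where w: "\<And>v x. v \<in> S \<Longrightarrow> \<phi> (sc v x) = e (w v * x)" by metis
  have uniq: "w v = c" if "v \<in> S" "\<And>x. \<phi> (sc v x) = e (c * x)" for v c
  proof -
    have "w v - c = 0" by (rule e_nondegenerate) (use w that in \<open>simp add: left_diff_distrib e_diff\<close>)
    then show ?thesis by simp
  qed
  have "dfun S w" unfolding dfun_def
  proof (intro conjI ballI allI)
    fix v u assume "v \<in> S" "u \<in> S"
    then show "w (v + u) = w v + w u"
      using dsub_sc[OF S(1)] by (intro uniq) (auto simp: dsub_add[OF S(1)] sc_add \<phi> w distrib_right e_add)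
  next
    fix v a assume "v \<in> S"
    then show "w (sc v a) = w v * a"
      by (intro uniq) (auto simp: dsub_sc[OF S(1)] sc_mult[symmetric] w mult.assoc)
  qed
  moreover have "e (w v) = \<phi> v" if "v \<in> S" for v using w[OF that, of 1] by simp
  moreover have "e (w v) = 0" if "v \<in> T" for v using \<phi>(4)[OF that] calculation(2) that T(2) by auto
  moreover have "e (w p) \<noteq> 0" using calculation(2)[OF p(1)] \<phi>(5) by simp
  ultimately show ?thesis using that[of w] by blast
qed

lemma dfun_separates_dsub:
  assumes S: "dsub S" "X.fd S" and U: "dsub U" "U \<subseteq> S" and p: "p \<in> S" "p \<notin> U"
  obtains w where "dfun S w" "\<And>v. v \<in> U \<Longrightarrow> w v = 0" "w p = 1"
proof -
  obtain w where w: "dfun S w" "\<And>v. v \<in> U \<Longrightarrow> e (w v) = 0" "e (w p) \<noteq> 0"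
    using dfun_separates[OF S dsub_fsub[OF U(1)] U(2) p] by blast
  have "w v = 0" if "v \<in> U" for v using e_dfun_zero[OF U(1) dfun_mono[OF w(1) U(2)] w(2) that] .
  moreover have "w p \<noteq> 0" using w(3) by auto
  ultimately show ?thesis using that[of "\<lambda>v. inverse (w p) * w v"] dfun_scale[OF w(1)] by simp
qed

text \<open>For a vector \<open>q\<close> with \<open>w q = 1\<close>, the difference
  \<open>v - sc q (w v)\<close> is in the kernel of \<open>w\<close>; so the factor is
  \<open>w' q\<close>, an arbitrary element of the division ring.\<close>

lemma dfun_proportional:
  assumes S: "dsub S" and w: "dfun S w" "dfun S w'" and ker: "\<And>v. v \<in> S \<Longrightarrow> w v = 0 \<Longrightarrow> w' v = 0"
  obtains c where "\<And>v. v \<in> S \<Longrightarrow> w' v = c * w v"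
proof (cases "\<forall>v\<in>S. w v = 0")
  case True
  then show ?thesis using that[of 0] ker by simp
next
  case False
  then obtain p where p: "p \<in> S" "w p \<noteq> 0" by blast
  define q where "q = sc p (inverse (w p))"
  have q: "q \<in> S" "w q = 1" using p dsub_sc[OF S] dfun_sc[OF w(1)] by (auto simp: q_def)
  have "w' v = w' q * w v" if v: "v \<in> S" for v
  proof -
    have s: "sc q (w v) \<in> S" using dsub_sc[OF S q(1)] .
    then have "w (v - sc q (w v)) = 0" using v q dfun_diff[OF S w(1)] dfun_sc[OF w(1)] by simp
    then have "w' (v - sc q (w v)) = 0" using ker dsub_diff[OF S v s] by blast
    then show ?thesis using v s q dfun_diff[OF S w(2)] dfun_sc[OF w(2)] by simp
  qed
  then show ?thesis using that by blast
qed

text \<open>As \<open>V\<close> consists of total functions, an operator is required to be determined by its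
  restriction to \<open>S\<close>.\<close>

definition trivial_spectrum :: "'v set \<Rightarrow> ('v \<Rightarrow> 'v) set \<Rightarrow> nat \<Rightarrow> bool" where
  "trivial_spectrum S V n \<longleftrightarrow> dsub S \<and> X.fd S \<and> X.dm S = n * d \<and> E.fd V \<and>
     (\<forall>N\<in>V. dlin S N \<and> N ` S \<subseteq> S) \<and> (\<forall>N\<in>V. (\<forall>v\<in>S. N v = 0) \<longrightarrow> N = 0) \<and>
     (\<forall>N\<in>V. \<forall>v\<in>S. N v = v \<longrightarrow> v = 0)"

definition ev :: "('v \<Rightarrow> 'v) set \<Rightarrow> 'v \<Rightarrow> 'v set" where "ev V x = (\<lambda>N. N x) ` V"

text \<open>The dimension of \<open>SH\<close>: \<open>d\<close> for each position above the
  diagonal and \<open>d - 1\<close>, the dimension of the kernel of \<open>e\<close>, for each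
  diagonal entry.\<close>

definition bound :: "nat \<Rightarrow> nat" where "bound n = d * (n * (n - 1) div 2) + n * (d - 1)"

lemma bound_Suc: "bound (Suc n) = (Suc n * d - 1) + bound n"
proof -
  define T where "T = n * (n - 1) div 2"
  \<comment> \<open>Positivity of \<open>d\<close> keeps the natural subtractions from
    truncating.\<close>
  obtain k where k: "d = Suc k" using d_pos by (cases d) auto
  have "Suc n * (Suc n - 1) div 2 = n + T"
  proof (cases n)
    case (Suc m)
    have "Suc n * (Suc n - 1) = 2 * n + n * (n - 1)" using Suc by (simp add: algebra_simps)
    then show ?thesis by (simp add: T_def)
  qed (simp add: T_def)
  then show ?thesis unfolding bound_def unfolding T_def[symmetric] k by (simp add: algebra_simps)
qed

lemma bound_0: "bound 0 = 0" by (simp add: bound_def)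

section \<open>Ranks of vectors under a space with trivial spectrum\<close>

context
  fixes S V n assumes ts: "trivial_spectrum S V n"
begin

lemma tsD: "dsub S" "X.fd S" "X.dm S = n * d" "E.fd V" "N \<in> V \<Longrightarrow> dlin S N"
    "N \<in> V \<Longrightarrow> v \<in> S \<Longrightarrow> N v \<in> S" "N \<in> V \<Longrightarrow> (\<And>v. v \<in> S \<Longrightarrow> N v = 0) \<Longrightarrow> N = 0"
    "N \<in> V \<Longrightarrow> v \<in> S \<Longrightarrow> N v = v \<Longrightarrow> v = 0"
  using ts unfolding trivial_spectrum_def by blast+

lemma ts_Vsub: "E.fsub V" using tsD(4) E.fd_fsub by blast

lemma ts_fixed: "N \<in> V \<Longrightarrow> v \<in> S \<Longrightarrow> v + N v = 0 \<Longrightarrow> v = 0"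
  using tsD(8)[of "- N" v] E.fsub_uminus[OF ts_Vsub] by (simp add: fun_Compl_def eq_neg_iff_add_eq_0 neg_eq_iff_add_eq_0 add.commute)

lemma ev_lin: "EX.flin V (\<lambda>N. N x)" by (rule EX.flinI) auto

lemma ev_sub: "X.fsub (ev V x)" "X.fd (ev V x)"
  unfolding ev_def using EX.rank_nullity(1)[OF tsD(4) ev_lin] X.fd_fsub by blast+

lemma ev_X: "x \<in> S \<Longrightarrow> ev V x \<subseteq> S" unfolding ev_def using tsD(6) by blast

lemma ev_notin: "x \<in> S \<Longrightarrow> x \<noteq> 0 \<Longrightarrow> x \<notin> ev V x" unfolding ev_def using tsD(8) by auto

text \<open>\<open>x\<close> lies in \<open>S\<close> but not in \<open>V x\<close>; this is the
  origin of the \<open>- 1\<close> in \<open>bound_Suc\<close>.\<close>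

lemma dm_ev_less: "x \<in> S \<Longrightarrow> x \<noteq> 0 \<Longrightarrow> X.dm (ev V x) < n * d"
  using X.dm_strict[OF tsD(2) ev_sub(1), of x] ev_X ev_notin tsD(3) by auto

lemma dm_ev_stab: "E.dm V = X.dm (ev V x) + E.dm {N\<in>V. N x = 0}"
  unfolding ev_def using EX.rank_nullity(3)[OF tsD(4) ev_lin] .

text \<open>Suppose that \<open>p = N u\<close> is outside \<open>V x\<close>. Modulo
  \<open>p\<close> the rank at \<open>u\<close> drops below the maximum while the rank at
  \<open>x\<close> is kept, so by \<open>pencil_rank\<close> some \<open>y = x + u t\<close> with
  \<open>t \<noteq> 0\<close> has modulo \<open>p\<close> at least the rank of \<open>x\<close>. But
  \<open>N y = p t\<close> shows \<open>p \<in> V y\<close>, so the full rank at \<open>y\<close>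
  exceeds the maximum.\<close>

lemma max_rank:
  assumes big: "big F (n * d)" and x: "x \<in> S" "x \<noteq> 0"
    and max: "\<And>u. u \<in> S \<Longrightarrow> X.dm (ev V u) \<le> X.dm (ev V x)"
    and N: "N \<in> V" "N x = 0" and u: "u \<in> S"
  shows "N u \<in> ev V x"
proof (rule ccontr)
  define p where "p = N u"
  define r where "r = X.dm (ev V x)"
  assume "N u \<notin> ev V x"
  then have p: "p \<in> S" "p \<notin> ev V x" using tsD(6)[OF N(1) u] by (auto simp: p_def)
  obtain \<phi> where \<phi>: "\<And>v. v \<in> S \<Longrightarrow> \<phi> v \<in> F" "\<And>v w. v \<in> S \<Longrightarrow> w \<in> S \<Longrightarrow> \<phi> (v + w) = \<phi> v + \<phi> w"
    "\<And>a v. a \<in> F \<Longrightarrow> v \<in> S \<Longrightarrow> \<phi> (sc v a) = a * \<phi> v" "\<And>v. v \<in> ev V x \<Longrightarrow> \<phi> v = 0" "\<phi> p = 1"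
    using X.separating_form[OF tsD(2) ev_sub(1) ev_X[OF x(1)] p] by blast
  \<comment> \<open>The projection along \<open>p\<close> onto the kernel of \<open>\<phi>\<close>;
    it fixes \<open>V x\<close> pointwise.\<close>
  define \<pi> where "\<pi> v = v - sc p (\<phi> v)" for v
  have pi_lin: "XX.flin S \<pi>"
    by (rule XX.flinI) (auto simp: \<pi>_def \<phi> sc_add_right sc_diff sc_mult[symmetric] F_comm)
  have pi_p: "\<pi> p = 0" by (simp add: \<pi>_def \<phi>)
  have piv: "XX.flin (ev V v) \<pi>" if "v \<in> S" for v using XX.flin_mono[OF pi_lin ev_X[OF that]] .
  have drop: "X.dm (\<pi> ` ev V v) + 1 \<le> X.dm (ev V v)" if v: "v \<in> S" "p \<in> ev V v" for v
  proof -
    have "p \<in> {z \<in> ev V v. \<pi> z = 0}" using v pi_p by simp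
    moreover have "p \<noteq> 0" using p X.fsub_0[OF ev_sub(1)] by blast
    ultimately have "{z \<in> ev V v. \<pi> z = 0} \<noteq> {0}" by blast
    then have "X.dm {z \<in> ev V v. \<pi> z = 0} \<noteq> 0"
      using X.dm_0_iff[OF XX.rank_nullity(2)[OF ev_sub(2) piv[OF v(1)]]] by blast
    then show ?thesis using XX.rank_nullity(3)[OF ev_sub(2) piv[OF v(1)]] by simp
  qed
  define \<alpha> where "\<alpha> = (\<lambda>N. \<pi> (N x))"
  define \<beta> where "\<beta> = (\<lambda>N. \<pi> (N u))"
  have al: "EX.flin V \<alpha>" and be: "EX.flin V \<beta>"
    unfolding \<alpha>_def \<beta>_def using x u tsD(6)
    by (auto intro!: EX.flinI simp: XX.flin_add[OF pi_lin] XX.flin_sm[OF pi_lin])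
  have aV: "\<alpha> ` V = ev V x"
  proof -
    have "\<pi> z = z" if "z \<in> ev V x" for z using \<phi>(4)[OF that] by (simp add: \<pi>_def)
    then have "\<pi> (N x) = N x" if "N \<in> V" for N using that unfolding ev_def by blast
    then show ?thesis unfolding \<alpha>_def ev_def by (intro image_cong) auto
  qed
  have bV: "\<beta> ` V = \<pi> ` ev V u" unfolding \<beta>_def ev_def by auto
  have "p \<in> ev V u" unfolding ev_def p_def using N by blast
  then have lt: "X.dm (\<beta> ` V) < X.dm (\<alpha> ` V)" using drop[OF u] max[OF u] aV bV by simp
  \<comment> \<open>The rank at \<open>x\<close> is at most \<open>n * d - 1\<close>, so
    \<open>n * d\<close> scalars are enough for the pencil.\<close>
  have "big F (X.dm (\<alpha> ` V) + 1)"
    using big_mono[OF big] dm_ev_less[OF x] aV by simp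
  then obtain t where t: "t \<in> F" "t \<noteq> 0" "X.dm (\<alpha> ` V) \<le> X.dm ((\<lambda>N. \<alpha> N + sc (\<beta> N) t) ` V)"
    using EX.pencil_rank[OF tsD(4) al be lt] by blast
  define y where "y = x + sc u t"
  have y: "y \<in> S" unfolding y_def by (rule dsub_add[OF tsD(1) x(1) dsub_sc[OF tsD(1) u]])
  have evy: "N' y = N' x + sc (N' u) t" if "N' \<in> V" for N'
    using tsD(5)[OF that] x u dsub_sc[OF tsD(1)] by (simp add: y_def dlin_add dlin_sc)
  have "(\<lambda>N. \<alpha> N + sc (\<beta> N) t) ` V = \<pi> ` ev V y"
  proof -
    have "\<pi> (N' y) = \<alpha> N' + sc (\<beta> N') t" if "N' \<in> V" for N'
      using that evy[OF that] XX.flin_add[OF pi_lin] XX.flin_sm[OF pi_lin t(1)] tsD(6)[OF that] x u dsub_sc[OF tsD(1)]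
      by (simp add: \<alpha>_def \<beta>_def)
    then show ?thesis unfolding ev_def image_image by (intro image_cong) auto
  qed
  then have "r \<le> X.dm (\<pi> ` ev V y)" using t(3) aV r_def by simp
  moreover have "p \<in> ev V y"
  proof -
    have "N y = sc p t" using evy[OF N(1)] N(2) by (simp add: p_def)
    then have "sc p t \<in> ev V y" unfolding ev_def using N(1) by (intro image_eqI[of _ _ N]) simp_all
    then have "sc (sc p t) (inverse t) \<in> ev V y" using X.fsub_sm[OF ev_sub(1)] F_inverse[OF t(1)] by blast
    then show ?thesis using t(2) by simp
  qed
  ultimately have "r + 1 \<le> X.dm (ev V y)" using drop[OF y] by simp
  then show False using max[OF y] r_def by simp
qed

lemma max_rank_exists:
  assumes "n \<ge> 1"
  obtains x where "x \<in> S" "x \<noteq> 0" "\<And>u. u \<in> S \<Longrightarrow> X.dm (ev V u) \<le> X.dm (ev V x)"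
proof -
  have "S \<noteq> {0}" using tsD(3) X.dm_zero assms d_pos by auto
  then obtain y where y: "y \<in> S" "y \<noteq> 0" using dsub_0[OF tsD(1)] by blast
  have "\<exists>x. (x \<in> S \<and> x \<noteq> 0) \<and> (\<forall>u. u \<in> S \<and> u \<noteq> 0 \<longrightarrow> X.dm (ev V u) \<le> X.dm (ev V x))"
    by (rule ex_has_greatest_nat[of _ y _ "n * d"]) (use y dm_ev_less less_imp_le in auto)
  then obtain x where x: "x \<in> S" "x \<noteq> 0" "\<And>u. u \<in> S \<Longrightarrow> u \<noteq> 0 \<Longrightarrow> X.dm (ev V u) \<le> X.dm (ev V x)" by blast
  have "ev V 0 = {0}" if "V \<noteq> {}" unfolding ev_def using dlin_0[OF tsD(1) tsD(5)] that by force
  then have "X.dm (ev V 0) \<le> X.dm (ev V x)" using X.dm_zero E.fsub_0[OF ts_Vsub] by force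
  then show ?thesis using that[OF x(1,2)] x(3) by blast
qed

text \<open>The line of \<open>x\<close> is a complement of the kernel of \<open>\<eta>\<close>, so
  an operator killing \<open>x\<close> is determined by its restriction to that kernel.\<close>

lemma ts_stab:
  assumes x: "x \<in> S" and eta: "dfun S \<eta>" "\<eta> x \<noteq> 0"
    and kills: "\<And>N v. N \<in> V \<Longrightarrow> N x = 0 \<Longrightarrow> v \<in> S \<Longrightarrow> \<eta> (N v) = 0"
  shows "trivial_spectrum {v\<in>S. \<eta> v = 0} {N\<in>V. N x = 0} (n - 1)" "n \<ge> 1"
proof -
  let ?Y = "{v\<in>S. \<eta> v = 0}" and ?W = "{N\<in>V. N x = 0}"
  have dY: "n * d = X.dm ?Y + d" using dm_dfun_ker[OF tsD(1,2) eta(1) x eta(2)] tsD(3) by simp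
  then show "n \<ge> 1" using d_pos by (cases n) auto
  have "dsub ?Y" using dsub_ker[OF tsD(1) eta(1)] .
  moreover have "X.fd ?Y" using X.fd_mono(1)[OF tsD(2) dsub_fsub[OF calculation]] by auto
  moreover have "X.dm ?Y = (n - 1) * d" using dY by (cases n) auto
  moreover have "E.fd ?W" using EX.rank_nullity(2)[OF tsD(4) ev_lin] .
  moreover have "dlin ?Y N \<and> N ` ?Y \<subseteq> ?Y" if "N \<in> ?W" for N
    using that dlin_mono[OF tsD(5)] tsD(6) kills by auto
  moreover have "N = 0" if N: "N \<in> ?W" and z: "\<forall>v\<in>?Y. N v = 0" for N
  proof (rule tsD(7))
    show "N \<in> V" using N by simp
    fix v assume v: "v \<in> S"
    define c where "c = inverse (\<eta> x) * \<eta> v"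
    have s: "sc x c \<in> S" using dsub_sc[OF tsD(1) x] .
    have "\<eta> (v - sc x c) = 0" using v s dfun_diff[OF tsD(1) eta(1)] dfun_sc[OF eta(1) x] eta(2)
      by (simp add: c_def mult.assoc[symmetric])
    then have "N (v - sc x c) = 0" using z dsub_diff[OF tsD(1) v s] by blast
    moreover have "N (sc x c) = 0" using N tsD(5)[of N] x by (simp add: dlin_sc)
    moreover have "N (v - sc x c) = N v - N (sc x c)" using dlin_diff[OF tsD(1) tsD(5) v s] N by blast
    ultimately show "N v = 0" by simp
  qed
  moreover have "v = 0" if "N \<in> ?W" "v \<in> ?Y" "N v = v" for N v using that tsD(8) by blast
  ultimately show "trivial_spectrum ?Y ?W (n - 1)" unfolding trivial_spectrum_def by blast
qed

text \<open>By \<open>max_rank\<close> the whole image of \<open>N\<close> lies in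
  \<open>V x\<close>, where \<open>e \<circ> \<eta>\<close> vanishes. The image is closed under
  right multiplication by scalars, so \<open>\<eta>\<close> itself vanishes on it.\<close>

lemma max_rank_kills:
  assumes big: "big F (n * d)" and x: "x \<in> S" "x \<noteq> 0"
    and max: "\<And>u. u \<in> S \<Longrightarrow> X.dm (ev V u) \<le> X.dm (ev V x)"
    and eta: "dfun S \<eta>" "\<And>v. v \<in> ev V x \<Longrightarrow> e (\<eta> v) = 0"
    and N: "N \<in> V" "N x = 0" and v: "v \<in> S"
  shows "\<eta> (N v) = 0"
proof (rule e_nondegenerate)
  fix y
  have s: "sc v y \<in> S" using dsub_sc[OF tsD(1) v] .
  have "e (\<eta> (N (sc v y))) = 0" using eta(2) max_rank[OF big x max N s] by blast
  then show "e (\<eta> (N v) * y) = 0"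
    using dlin_sc[OF tsD(5)[OF N(1)] v] dfun_sc[OF eta(1) tsD(6)[OF N(1) v]] by simp
qed

end

theorem dm_trivial_spectrum:
  assumes "trivial_spectrum S V n" "big F (n * d)"
  shows "E.dm V \<le> bound n"
  using assms
proof (induction n arbitrary: S V)
  case 0
  note t = tsD[OF 0(1)]
  have "S = {0}" using t(2,3) X.dm_0_iff by simp
  then have "N = 0" if "N \<in> V" for N using t(7)[OF that] dlin_0[OF t(1) t(5)[OF that]] by blast
  have "V = {0}" using \<open>\<And>N. N \<in> V \<Longrightarrow> N = 0\<close> E.fsub_0[OF ts_Vsub[OF 0(1)]] by blast
  then show ?case using E.dm_zero bound_0 unfolding \<open>V = {0}\<close> by presburger
next
  case (Suc n)
  note ts = Suc.prems(1) and t = tsD[OF Suc.prems(1)]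
  obtain x where x: "x \<in> S" "x \<noteq> 0" "\<And>u. u \<in> S \<Longrightarrow> X.dm (ev V u) \<le> X.dm (ev V x)"
    using max_rank_exists[OF ts] by auto
  \<comment> \<open>\<open>\<eta>\<close> separates \<open>x\<close> from \<open>V x\<close>; since
    \<open>\<eta> x \<noteq> 0\<close>, its kernel is a hyperplane complementary to the line of
    \<open>x\<close>.\<close>
  obtain \<eta> where eta: "dfun S \<eta>" "\<And>v. v \<in> ev V x \<Longrightarrow> e (\<eta> v) = 0" "e (\<eta> x) \<noteq> 0"
    using dfun_separates[OF t(1,2) ev_sub(1)[OF ts] ev_X[OF ts x(1)] x(1) ev_notin[OF ts x(1,2)]] by blast
  have "\<eta> x \<noteq> 0" using eta(3) by auto
  then have "trivial_spectrum {v\<in>S. \<eta> v = 0} {N\<in>V. N x = 0} n"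
    using ts_stab(1)[OF ts x(1) eta(1)] max_rank_kills[OF ts Suc.prems(2) x eta(1,2)] by simp
  then have "E.dm {N\<in>V. N x = 0} \<le> bound n"
    by (rule Suc.IH) (rule big_mono[OF Suc.prems(2)], simp)
  then show ?case
    using dm_ev_stab[OF ts, of x] dm_ev_less[OF ts x(1,2)] bound_Suc[of n] by simp
qed

end

section \<open>Trivial spectrum spaces of the greatest dimension\<close>

context rspace
begin

lemma dsubI:
  "0 \<in> U \<Longrightarrow> (\<And>v w. v \<in> U \<Longrightarrow> w \<in> U \<Longrightarrow> v + w \<in> U) \<Longrightarrow> (\<And>v a. v \<in> U \<Longrightarrow> sc v a \<in> U) \<Longrightarrow> dsub U"
  unfolding dsub_def by blast

lemma dm_dsub_ge: "dsub U \<Longrightarrow> X.fd U \<Longrightarrow> U \<noteq> {0} \<Longrightarrow> d \<le> X.dm U"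
proof -
  assume U: "dsub U" "X.fd U" "U \<noteq> {0}"
  then obtain u where "u \<in> U" "u \<noteq> 0" using dsub_0 by blast
  then show ?thesis
    using X.fd_mono(2)[OF U(2) dsub_fsub[OF dsub_dline] dline_sub[OF U(1)]] dm_dline by metis
qed

lemma dm_dsub_lt:
  assumes U: "dsub U" "U \<subseteq> S" "U \<noteq> S" and S: "dsub S" "X.fd S"
  shows "X.dm U + d \<le> X.dm S"
proof -
  obtain s where s: "s \<in> S" "s \<notin> U" using U by blast
  have fU: "X.fd U" using X.fd_mono(1)[OF S(2) dsub_fsub[OF U(1)] U(2)] .
  have "X.fplus U (dline s) \<subseteq> S" by (rule X.fplus_sub[OF dsub_fsub[OF S(1)] U(2) dline_sub[OF S(1) s(1)]])
  then have "X.dm (X.fplus U (dline s)) \<le> X.dm S"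
    by (rule X.fd_mono(2)[OF S(2) dsub_fsub[OF dsub_fplus[OF U(1) dsub_dline]]])
  then show ?thesis using dm_add_dline(2)[OF U(1) fU s(2)] by simp
qed

lemma flin_sc: "XX.flin T (\<lambda>v. sc v c)"
proof (rule XX.flinI)
  fix a v assume "a \<in> F"
  then show "sc (sc v a) c = sc (sc v c) a" by (simp add: sc_mult[symmetric] F_comm[of a c])
qed (simp add: sc_add)

text \<open>The \<open>F\<close>-forms \<open>e \<circ> w\<close> and \<open>e \<circ> w'\<close>
  are proportional with a factor \<open>c \<in> F\<close>; then \<open>e\<close> kills
  \<open>w' - c * w\<close>, and \<open>e_dfun_zero\<close> removes \<open>e\<close>. The
  weaker-looking kernels of \<open>e \<circ> w\<close> thus force a central factor, unlike in
  \<open>dfun_proportional\<close>.\<close>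

lemma e_proportional:
  assumes S: "dsub S" and w: "dfun S w" "dfun S w'" and ker: "\<And>v. v \<in> S \<Longrightarrow> e (w v) = 0 \<Longrightarrow> e (w' v) = 0"
  obtains c where "c \<in> F" "\<And>v. v \<in> S \<Longrightarrow> w' v = c * w v"
proof (cases "\<forall>v\<in>S. e (w v) = 0")
  case True
  then have "w' v = 0" if "v \<in> S" for v using e_dfun_zero[OF S w(2) _ that] ker by simp
  then show ?thesis using that[of 0] by simp
next
  case False
  then obtain p where p: "p \<in> S" "e (w p) \<noteq> 0" by blast
  define c where "c = e (w' p) * inverse (e (w p))"
  have c: "c \<in> F" unfolding c_def by (rule F_mult[OF e_F F_inverse[OF e_F]])
  have d: "dfun S (\<lambda>v. w' v - c * w v)" by (rule dfun_minus[OF w(2) dfun_scale[OF w(1)]])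
  have "e (w' v - c * w v) = 0" if v: "v \<in> S" for v
  proof -
    define t where "t = e (w v) * inverse (e (w p))"
    have t: "t \<in> F" unfolding t_def by (rule F_mult[OF e_F F_inverse[OF e_F]])
    have s: "sc p t \<in> S" using dsub_sc[OF S p(1)] .
    have "e (w (v - sc p t)) = e (w v) - t * e (w p)"
      using dfun_diff[OF S w(1) v s] dfun_sc[OF w(1) p(1)] t by (simp add: e_diff e_sm_right)
    also have "\<dots> = 0" using p(2) by (simp add: t_def mult.assoc)
    finally have "e (w' (v - sc p t)) = 0" using ker dsub_diff[OF S v s] by blast
    then have "e (w' v) = t * e (w' p)"
      using dfun_diff[OF S w(2) v s] dfun_sc[OF w(2) p(1)] t by (simp add: e_diff e_sm_right)
    moreover have "t * e (w' p) = c * e (w v)"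
      unfolding t_def c_def using F_comm[OF e_F] by (metis mult.assoc)
    ultimately show ?thesis using c by (simp add: e_diff e_sm)
  qed
  then have "w' v - c * w v = 0" if "v \<in> S" for v using e_dfun_zero[OF S d _ that] by blast
  then show ?thesis using that[OF c] by simp
qed

section \<open>Annihilators of hyperplanes, and invariant subspaces\<close>

definition annihilator :: "'v set \<Rightarrow> ('v \<Rightarrow> 'v) set \<Rightarrow> 'v \<Rightarrow> ('v \<Rightarrow> 'a) \<Rightarrow> bool" where
  "annihilator S V x \<eta> \<longleftrightarrow> dfun S \<eta> \<and> (\<forall>v\<in>S. v \<in> ev V x \<longleftrightarrow> e (\<eta> v) = 0)"

definition reducible :: "'v set \<Rightarrow> ('v \<Rightarrow> 'v) set \<Rightarrow> bool" where
  "reducible S V \<longleftrightarrow> (\<exists>U. dsub U \<and> U \<subseteq> S \<and> U \<noteq> {0} \<and> U \<noteq> S \<and> (\<forall>N\<in>V. N ` U \<subseteq> U))"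

definition full_rank :: "'v set \<Rightarrow> ('v \<Rightarrow> 'v) set \<Rightarrow> nat \<Rightarrow> bool" where
  "full_rank S V n \<longleftrightarrow> (\<forall>x\<in>S. x \<noteq> 0 \<longrightarrow> X.dm (ev V x) = n * d - 1)"

context
  fixes S V n assumes ts: "trivial_spectrum S V n"
begin

lemmas t = tsD[OF ts]

text \<open>No operator of \<open>V\<close> has the eigenvalue \<open>-1\<close>, so the map is
  injective, and bijective by dimension.\<close>

lemma shift_bij:
  assumes "N \<in> V" "dsub U" "U \<subseteq> S" "N ` U \<subseteq> U"
  shows "(\<lambda>v. v + N v) ` U = U"
proof -
  have fU: "X.fd U" using X.fd_mono(1)[OF t(2) dsub_fsub[OF assms(2)] assms(3)] .
  have lin: "XX.flin U (\<lambda>v. v + N v)"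
    using dlin_flin[OF dlin_mono[OF t(5)[OF assms(1)] assms(3)]]
    by (auto simp: XX.flin_def sc_add algebra_simps)
  have "X.dm ((\<lambda>v. v + N v) ` U) = X.dm U"
    by (rule XX.dm_inj[OF fU lin]) (use ts_fixed[OF ts assms(1)] assms(3) in blast)
  moreover have "(\<lambda>v. v + N v) ` U \<subseteq> U" using assms(4) dsub_add[OF assms(2)] by blast
  ultimately show ?thesis using X.fd_mono(3)[OF fU XX.fsub_image[OF X.fd_fsub[OF fU] lin]] by blast
qed

lemma ev_sc: assumes "x \<in> S" "c \<noteq> 0" shows "X.dm (ev V (sc x c)) = X.dm (ev V x)"
proof -
  have "ev V (sc x c) = (\<lambda>v. sc v c) ` ev V x"
    unfolding ev_def image_image by (rule image_cong) (use dlin_sc[OF t(5) assms(1)] in auto)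
  moreover have "X.dm ((\<lambda>v. sc v c) ` ev V x) = X.dm (ev V x)"
    by (rule XX.dm_inj[OF ev_sub(2)[OF ts] flin_sc]) (use assms(2) in \<open>simp add: sc_eq_0\<close>)
  ultimately show ?thesis by simp
qed

lemma ev_add: "N \<in> V \<Longrightarrow> x \<in> S \<Longrightarrow> u \<in> S \<Longrightarrow> N (x + sc u a) = N x + sc (N u) a"
  using t(5)[of N] dsub_sc[OF t(1)] by (simp add: dlin_add dlin_sc)

text \<open>As \<open>\<eta> \<noteq> 0\<close>, the kernel of \<open>e \<circ> \<eta>\<close> has
  dimension \<open>n * d - 1\<close>; it contains \<open>V x\<close>, which has the same
  dimension.\<close>

lemma annihilator_exists:
  assumes x: "x \<in> S" "x \<noteq> 0" and r: "X.dm (ev V x) = n * d - 1"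
    and \<eta>: "dfun S \<eta>" "\<And>v. v \<in> ev V x \<Longrightarrow> e (\<eta> v) = 0" "p \<in> S" "\<eta> p \<noteq> 0"
  shows "annihilator S V x \<eta>"
proof -
  let ?K = "{v\<in>S. e (\<eta> v) = 0}"
  have nz: "\<exists>q\<in>S. e (\<eta> q) \<noteq> 0" using e_dfun_zero[OF t(1) \<eta>(1) _ \<eta>(3)] \<eta>(4) by blast
  then obtain q where q: "q \<in> S" "e (\<eta> q) \<noteq> 0" by blast
  have sK: "X.fsub ?K" using XD.fsub_ker[OF dsub_fsub[OF t(1)] dfun_e_flin[OF \<eta>(1)]] .
  have fK: "X.fd ?K" using X.fd_mono(1)[OF t(2) sK] by blast
  have "X.dm S = X.dm ?K + 1"
    by (rule dm_form_kernel(2)[OF t(2) X.fmod_axioms dfun_e_flin[OF \<eta>(1)] _ q]) (use e_F in auto)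
  then have "X.dm ?K = X.dm (ev V x)" using r t(3) by simp
  moreover have "ev V x \<subseteq> ?K" using \<eta>(2) ev_X[OF ts x(1)] by blast
  ultimately have "ev V x = ?K" using X.fd_mono(3)[OF fK ev_sub(1)[OF ts]] by simp
  then show ?thesis unfolding annihilator_def using \<eta>(1) by blast
qed

lemma annihilator_ex:
  assumes x: "x \<in> S" "x \<noteq> 0" and r: "X.dm (ev V x) = n * d - 1"
  obtains \<eta> where "annihilator S V x \<eta>"
proof -
  obtain \<eta> where eta: "dfun S \<eta>" "\<And>v. v \<in> ev V x \<Longrightarrow> e (\<eta> v) = 0" "e (\<eta> x) \<noteq> 0"
    using dfun_separates[OF t(1,2) ev_sub(1)[OF ts] ev_X[OF ts x(1)] x(1) ev_notin[OF ts x(1,2)]] by blast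
  have "\<eta> x \<noteq> 0" using eta(3) by auto
  then show ?thesis using that annihilator_exists[OF x r eta(1,2) x(1)] by blast
qed

lemma annD: "annihilator S V x \<eta> \<Longrightarrow> dfun S \<eta>"
  unfolding annihilator_def by blast

lemma ann_ev: "annihilator S V x \<eta> \<Longrightarrow> N \<in> V \<Longrightarrow> x \<in> S \<Longrightarrow> e (\<eta> (N x)) = 0"
  unfolding annihilator_def using t(6)[of N x] unfolding ev_def by blast

lemma ann_nz: "annihilator S V x \<eta> \<Longrightarrow> x \<in> S \<Longrightarrow> x \<noteq> 0 \<Longrightarrow> e (\<eta> x) \<noteq> 0"
  unfolding annihilator_def using ev_notin[OF ts] by blast

lemma ann_nz': "annihilator S V x \<eta> \<Longrightarrow> x \<in> S \<Longrightarrow> x \<noteq> 0 \<Longrightarrow> \<eta> x \<noteq> 0"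
  using ann_nz by fastforce

lemma ann_unique:
  assumes "annihilator S V x \<eta>" "x \<in> S" "dfun S \<zeta>" "\<And>N. N \<in> V \<Longrightarrow> e (\<zeta> (N x)) = 0"
  obtains c where "c \<in> F" "\<And>v. v \<in> S \<Longrightarrow> \<zeta> v = c * \<eta> v"
proof -
  have "e (\<zeta> v) = 0" if "v \<in> S" "e (\<eta> v) = 0" for v
  proof -
    have "v \<in> ev V x" using assms(1) that unfolding annihilator_def by blast
    then show ?thesis using assms(4) unfolding ev_def by auto
  qed
  then show ?thesis using e_proportional[OF t(1) annD[OF assms(1)] assms(3)] that by blast
qed

context
  assumes opt: "E.dm V = bound n" and big: "big F (n * d)"
begin

text \<open>At a vector of maximal rank the stabiliser has dimension at most
  \<open>bound (n - 1)\<close>; since \<open>V\<close> attains the bound, the other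
  \<open>n * d - 1\<close> dimensions must appear in \<open>V x\<close>.\<close>

lemma max_good:
  assumes "n \<ge> 1"
  obtains x where "x \<in> S" "x \<noteq> 0" "X.dm (ev V x) = n * d - 1"
proof -
  obtain x where x: "x \<in> S" "x \<noteq> 0" "\<And>u. u \<in> S \<Longrightarrow> X.dm (ev V u) \<le> X.dm (ev V x)"
    using max_rank_exists[OF ts assms] by auto
  obtain \<eta> where eta: "dfun S \<eta>" "\<And>v. v \<in> ev V x \<Longrightarrow> e (\<eta> v) = 0" "e (\<eta> x) \<noteq> 0"
    using dfun_separates[OF t(1,2) ev_sub(1)[OF ts] ev_X[OF ts x(1)] x(1) ev_notin[OF ts x(1,2)]] by blast
  have "\<eta> x \<noteq> 0" using eta(3) by auto
  then have "trivial_spectrum {v\<in>S. \<eta> v = 0} {N\<in>V. N x = 0} (n - 1)"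
    using ts_stab(1)[OF ts x(1) eta(1)] max_rank_kills[OF ts big x eta(1,2)] by simp
  then have "E.dm {N\<in>V. N x = 0} \<le> bound (n - 1)"
    by (rule dm_trivial_spectrum) (rule big_mono[OF big], simp)
  then have "X.dm (ev V x) \<ge> n * d - 1"
    using dm_ev_stab[OF ts, of x] opt bound_Suc[of "n - 1"] assms by simp
  then show ?thesis using that[OF x(1,2)] dm_ev_less[OF ts x(1,2)] by simp
qed

context
  fixes x \<eta> assumes x: "x \<in> S" "x \<noteq> 0" and r: "X.dm (ev V x) = n * d - 1"
    and an: "annihilator S V x \<eta>"
begin

text \<open>By \<open>dm_ev_less\<close> no rank exceeds \<open>n * d - 1\<close>, so
  \<open>x\<close> is a vector of maximal rank.\<close>

lemma good_kills:
  assumes N: "N \<in> V" "N x = 0" and v: "v \<in> S"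
  shows "\<eta> (N v) = 0"
proof -
  have "X.dm (ev V u) \<le> X.dm (ev V x)" if u: "u \<in> S" for u
  proof (cases "u = 0")
    case True
    have "ev V u \<subseteq> {0}" unfolding ev_def True using dlin_0[OF t(1) t(5)] by blast
    then have "X.dm (ev V u) \<le> X.dm {0}" by (rule X.fd_mono(2)[OF X.fd_zero ev_sub(1)[OF ts]])
    then show ?thesis by (simp add: X.dm_zero)
  next
    case False
    then show ?thesis using dm_ev_less[OF ts u False] r by simp
  qed
  moreover have "e (\<eta> v) = 0" if "v \<in> ev V x" for v
    using that ann_ev[OF an _ x(1)] unfolding ev_def by auto
  ultimately show ?thesis using max_rank_kills[OF ts big x _ annD[OF an] _ N v] by blast
qed

text \<open>The stabiliser is again a space of greatest dimension, one size smaller. The inductions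
  below descend along it.\<close>

lemma good_stab:
  "trivial_spectrum {v\<in>S. \<eta> v = 0} {N\<in>V. N x = 0} (n - 1)" "n \<ge> 1"
  "E.dm {N\<in>V. N x = 0} = bound (n - 1)" "big F ((n - 1) * d)"
proof -
  show ts': "trivial_spectrum {v\<in>S. \<eta> v = 0} {N\<in>V. N x = 0} (n - 1)"
    by (rule ts_stab(1)[OF ts x(1) annD[OF an] ann_nz'[OF an x]]) (rule good_kills)
  show n: "n \<ge> 1"
    by (rule ts_stab(2)[OF ts x(1) annD[OF an] ann_nz'[OF an x]]) (rule good_kills)
  show "E.dm {N\<in>V. N x = 0} = bound (n - 1)"
    using dm_ev_stab[OF ts, of x] r opt bound_Suc[of "n - 1"] n by simp
  show "big F ((n - 1) * d)" by (rule big_mono[OF big]) simp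
qed

lemma good_decomp:
  assumes "v \<in> S"
  shows "v - sc x (inverse (\<eta> x) * \<eta> v) \<in> {v\<in>S. \<eta> v = 0}"
proof -
  let ?c = "inverse (\<eta> x) * \<eta> v"
  have s: "sc x ?c \<in> S" using dsub_sc[OF t(1) x(1)] .
  have "\<eta> (v - sc x ?c) = 0" using dfun_diff[OF t(1) annD[OF an] assms s] dfun_sc[OF annD[OF an] x(1)] ann_nz'[OF an x]
    by (simp add: mult.assoc[symmetric])
  then show ?thesis using dsub_diff[OF t(1) assms s] by simp
qed

end

text \<open>By maximality of \<open>V\<close>: adjoining the operator \<open>v \<mapsto> z w(v)\<close> creates no new eigenvalue.\<close>

lemma invariant_contains:
  assumes U: "dsub U" "U \<subseteq> S" and inv: "\<And>N. N \<in> V \<Longrightarrow> N ` U \<subseteq> U"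
    and z: "z \<in> U" and w: "dfun S w" "\<And>v. v \<in> U \<Longrightarrow> w v = 0"
  obtains N where "N \<in> V" "\<And>v. v \<in> S \<Longrightarrow> N v = sc z (w v)"
proof (rule ccontr)
  assume "\<not> thesis"
  then have no: "\<not> (\<exists>N\<in>V. \<forall>v\<in>S. N v = sc z (w v))" using that by blast
  define N0 where "N0 v = sc z (w v)" for v
  have N0: "dlin S N0" "N0 ` S \<subseteq> S" "N0 ` S \<subseteq> U" "\<And>v. v \<in> U \<Longrightarrow> N0 v = 0"
    using w z U dsub_sc[OF U(1) z] by (auto simp: N0_def dlin_def dfun_def sc_add_right sc_mult)
  \<comment> \<open>\<open>V'\<close> will have dimension \<open>bound n + 1\<close>, so it suffices
    to show that its spectrum is trivial.\<close>
  define V' where "V' = E.fplus V (E.fline N0)"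
  have N0V: "N0 \<notin> V"
  proof
    assume "N0 \<in> V"
    then show False using no N0_def by auto
  qed
  have "N = 0" if N: "N \<in> V" "N \<in> E.fline N0" for N
  proof (rule ccontr)
    assume "N \<noteq> 0"
    obtain a where a: "a \<in> F" "N = (\<lambda>v. sc (N0 v) a)" using N(2) unfolding E.fline_def by blast
    have "a \<noteq> 0" using a \<open>N \<noteq> 0\<close> by auto
    then have "N0 = (\<lambda>v. sc (N v) (inverse a))" by (intro ext) (simp add: a(2))
    then show False using N0V E.fsub_sm[OF ts_Vsub[OF ts] F_inverse[OF a(1)] N(1)] by metis
  qed
  then have int: "V \<inter> E.fline N0 = {0}" using E.fsub_0[OF ts_Vsub[OF ts]] E.fsub_0[OF E.fsub_fline] by blast
  have "N0 \<noteq> 0" using N0V E.fsub_0[OF ts_Vsub[OF ts]] by auto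
  then have dV': "E.fd V'" "E.dm V' = bound n + 1"
    unfolding V'_def using E.dm_fplus[OF t(4) E.fline_fd int] opt E.dm_fline[of N0] by auto
  have rep: "\<exists>N\<in>V. \<exists>a\<in>F. N' = (\<lambda>v. N v + sc (N0 v) a)" if "N' \<in> V'" for N'
    using that unfolding V'_def E.fplus_def E.fline_def by (auto simp: plus_fun_def)
  have "trivial_spectrum S V' n"
    unfolding trivial_spectrum_def
  proof (intro conjI ballI impI)
    show "dsub S" "X.fd S" "X.dm S = n * d" "E.fd V'" using t(1,2,3) dV' by auto
    fix N' assume "N' \<in> V'"
    then obtain N a where N: "N \<in> V" "a \<in> F" "N' = (\<lambda>v. N v + sc (N0 v) a)" using rep by blast
    show "dlin S N'" using t(5)[OF N(1)] N0(1) N(3) F_comm[OF N(2)]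
      by (simp add: dlin_def sc_add sc_mult[symmetric] algebra_simps)
    show "N' ` S \<subseteq> S" using N t(6)[OF N(1)] N0(2) dsub_add[OF t(1)] dsub_sc[OF t(1)] by blast
    show "N' = 0" if z0: "\<forall>v\<in>S. N' v = 0"
    proof (cases "a = 0")
      case True
      then have "N = 0" using t(7)[OF N(1)] z0 N(3) by simp
      then show ?thesis using True N(3) by auto
    next
      case False
      \<comment> \<open>Here \<open>N0\<close> need only agree on \<open>S\<close> with a member of
        \<open>V\<close>; this is what \<open>no\<close> excludes.\<close>
      have "N v + sc (N0 v) a = 0" if "v \<in> S" for v using z0 that N(3) by simp
      then have "N0 v = sc (N v) (- inverse a)" if "v \<in> S" for v
        using False that by (metis eq_neg_iff_add_eq_0 sc_inverse sc_uminus sc_uminus_right add.commute)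
      moreover have "(\<lambda>v. sc (N v) (- inverse a)) \<in> V"
        using E.fsub_sm[OF ts_Vsub[OF ts] F_uminus[OF F_inverse[OF N(2)]] N(1)] .
      ultimately have "(\<lambda>v. sc (N v) (- inverse a)) \<in> V \<and> (\<forall>v\<in>S. (\<lambda>v. sc (N v) (- inverse a)) v = sc z (w v))"
        by (simp add: N0_def)
      then have "\<exists>N\<in>V. \<forall>v\<in>S. N v = sc z (w v)"
        by (intro bexI[where x = "\<lambda>v. sc (N v) (- inverse a)"]) auto
      then have False using no by simp
      then show ?thesis ..
    qed
    fix v assume v: "v \<in> S" and fx: "N' v = v"
    \<comment> \<open>A fixed vector \<open>v\<close> of \<open>N + a N0\<close> satisfies
      \<open>v + M v \<in> U\<close>. Since \<open>1 + M\<close> maps \<open>U\<close> onto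
      \<open>U\<close> and is injective on \<open>S\<close>, it follows that
      \<open>v \<in> U\<close>, where \<open>N0\<close> vanishes; so \<open>v\<close> is fixed by
      \<open>N\<close>.\<close>
    define M where "M = - N"
    have M: "M \<in> V" "M ` U \<subseteq> U"
      using E.fsub_uminus[OF ts_Vsub[OF ts] N(1)] inv unfolding M_def by blast+
    have "v + M v = sc (N0 v) a" using fx N(3) unfolding M_def by (simp add: algebra_simps)
    then have "v + M v \<in> U" using N0(3) v dsub_sc[OF U(1)] by auto
    then obtain u where u: "u \<in> U" "u + M u = v + M v" using shift_bij[OF M(1) U M(2)] by (metis imageE)
    then have uS: "u \<in> S" using U(2) by blast
    have "(v - u) + M (v - u) = (v + M v) - (u + M u)"
      using dlin_diff[OF t(1) t(5)[OF M(1)] v uS] by (simp add: algebra_simps)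
    then have "(v - u) + M (v - u) = 0" using u(2) by simp
    then have "v - u = 0" by (rule ts_fixed[OF ts M(1) dsub_diff[OF t(1) v uS]])
    then have "v \<in> U" using u by simp
    then have "N v = v" using fx N(3) N0(4) by simp
    then show "v = 0" using t(8)[OF N(1) v] by blast
  qed
  then show False using dm_trivial_spectrum[OF _ big] dV'(2) by fastforce
qed

end

end

text \<open>A subspace \<open>U\<close> invariant under the stabiliser of \<open>x\<close> need not
  be invariant under \<open>V\<close>, but then \<open>X1\<close>, the sum of \<open>U\<close> and
  the line of \<open>x\<close>, is. The stabiliser supplies enough operators of rank one with image
  in \<open>U\<close> to confine the preimage of \<open>U\<close> under \<open>1 + N\<close> to
  \<open>X1\<close>; a comparison of dimensions shows that each single \<open>N\<close> preserves
  \<open>U\<close> or \<open>X1\<close>, and linearity of \<open>V\<close> makes the alternative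
  uniform.\<close>

lemma reducible_from_stabiliser:
  assumes ts: "trivial_spectrum S V n" and opt: "E.dm V = bound n" and big: "big F (n * d)"
    and x: "x \<in> S" "x \<noteq> 0" and r: "X.dm (ev V x) = n * d - 1" and an: "annihilator S V x \<eta>"
    and red: "reducible {v\<in>S. \<eta> v = 0} {N\<in>V. N x = 0}"
  shows "reducible S V"
proof -
  note t = tsD[OF ts]
  let ?Y = "{v\<in>S. \<eta> v = 0}" and ?W = "{N\<in>V. N x = 0}"
  note stab = good_stab[OF ts opt big x r an] and eta = annD[OF ts an]
  have etax: "\<eta> x \<noteq> 0" using ann_nz'[OF ts an x] .
  obtain U where U0: "dsub U \<and> U \<subseteq> ?Y \<and> U \<noteq> {0} \<and> U \<noteq> ?Y \<and> (\<forall>N\<in>?W. N ` U \<subseteq> U)"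
    using red unfolding reducible_def by (rule exE)
  then have U: "dsub U" "U \<subseteq> ?Y" "U \<noteq> {0}" "U \<noteq> ?Y" by simp_all
  have Uinv: "N ` U \<subseteq> U" if "N \<in> ?W" for N using U0 that by blast
  have US: "U \<subseteq> S" using U(2) by blast
  have fU: "X.fd U" using X.fd_mono(1)[OF t(2) dsub_fsub[OF U(1)] US] .
  have dU: "d \<le> X.dm U" "X.dm U + d \<le> (n - 1) * d"
    using dm_dsub_ge[OF U(1) fU U(3)] dm_dsub_lt[OF U(1,2,4) tsD(1,2)[OF stab(1)]] tsD(3)[OF stab(1)] by auto
  have n3: "n \<ge> 3"
  proof (rule ccontr)
    assume "\<not> ?thesis"
    then have "(n - 1) * d \<le> 1 * d" by (intro mult_le_mono1) simp
    then show False using dU d_pos by linarith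
  qed
  have xU: "x \<notin> U" using U(2) etax by auto
  define X1 where "X1 = X.fplus U (dline x)"
  have X1: "dsub X1" "X1 \<subseteq> S" "U \<subseteq> X1" "x \<in> X1"
    unfolding X1_def using dsub_fplus[OF U(1) dsub_dline]
      X.fplus_sub[OF dsub_fsub[OF t(1)] US dline_sub[OF t(1) x(1)]]
      X.fplus_supL[OF dsub_fsub[OF dsub_dline]] subsetD[OF X.fplus_supR[OF dsub_fsub[OF U(1)]] in_dline] by auto
  have dX1: "X.fd X1" "X.dm X1 = X.dm U + d" unfolding X1_def by (rule dm_add_dline[OF U(1) fU xU])+
  \<comment> \<open>The operator that \<open>invariant_contains\<close> finds in the stabiliser
    kills \<open>x\<close>, and so does \<open>v \<mapsto> sc z (w v)\<close>; hence their agreement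
    on the hyperplane extends to \<open>S\<close>.\<close>
  have contains: "\<exists>N\<in>V. \<forall>v\<in>S. N v = sc z (w v)"
    if z: "z \<in> U" and w: "dfun S w" "\<And>v. v \<in> X1 \<Longrightarrow> w v = 0" for z w
  proof -
    have wY: "dfun ?Y w" by (rule dfun_mono[OF w(1)]) blast
    obtain N where N: "N \<in> ?W" "\<And>v. v \<in> ?Y \<Longrightarrow> N v = sc z (w v)"
    proof (rule invariant_contains[OF stab(1,3,4) U(1,2) Uinv z wY])
      show "w v = 0" if "v \<in> U" for v using w(2) X1(3) that by blast
    qed blast+
    have "N v = sc z (w v)" if v: "v \<in> S" for v
    proof -
      define c where "c = inverse (\<eta> x) * \<eta> v"
      define y where "y = v - sc x c"
      have y: "y \<in> ?Y" unfolding y_def c_def by (rule good_decomp[OF ts opt big x r an v])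
      have s: "sc x c \<in> S" using dsub_sc[OF t(1) x(1)] .
      have vy: "v = y + sc x c" by (simp add: y_def)
      have "N v = N y + N (sc x c)" unfolding vy using dlin_add[OF t(5) _ s] N(1) y by blast
      also have "N (sc x c) = 0" using dlin_sc[OF t(5) x(1), of N c] N(1) by simp
      finally have 1: "N v = sc z (w y)" using N(2)[OF y] by simp
      have "w v = w y + w x * c" unfolding vy using dfun_add[OF w(1) _ s] dfun_sc[OF w(1) x(1)] y by simp
      then show ?thesis using 1 w(2)[OF X1(4)] by simp
    qed
    then show ?thesis using N(1) by blast
  qed
  \<comment> \<open>Otherwise some \<open>w\<close> vanishing on \<open>X1\<close> has
    \<open>w v = 1\<close>, and subtracting from \<open>N\<close> the rank one operator with value
    \<open>v + N v\<close> at \<open>v\<close> produces the eigenvalue \<open>-1\<close>.\<close>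
  have preimage: "v \<in> X1" if N: "N \<in> V" and v: "v \<in> S" "v + N v \<in> U" for N v
  proof (rule ccontr)
    assume "v \<notin> X1"
    then obtain w where w: "dfun S w" "\<And>v. v \<in> X1 \<Longrightarrow> w v = 0" "w v = 1"
      using dfun_separates_dsub[OF t(1,2) X1(1,2) v(1)] by blast
    obtain N' where N': "N' \<in> V" "\<And>u. u \<in> S \<Longrightarrow> N' u = sc (v + N v) (w u)"
      using contains[OF v(2) w(1,2)] by blast
    have "v + (N - N') v = 0" using N'(2)[OF v(1)] w(3) by simp
    then have "v = 0" by (rule ts_fixed[OF ts E.fsub_diff[OF ts_Vsub[OF ts] N N'(1)] v(1)])
    then show False using \<open>v \<notin> X1\<close> dsub_0[OF X1(1)] by simp
  qed
  \<comment> \<open>\<open>P\<close>, the preimage of \<open>U\<close> under \<open>1 + a N\<close>,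
    has the dimension of \<open>U\<close>, lies in \<open>X1\<close> and misses \<open>u\<close>. So
    \<open>P\<close> and the line of \<open>u\<close> fill \<open>X1\<close>, and decomposing
    \<open>x\<close> accordingly gives the claim.\<close>
  have rank_one: "x + sc (N x) a \<in> X.fplus U (dline (N u))"
    if N: "N \<in> V" and u: "u \<in> U" "N u \<notin> U" and a: "a \<in> F" "a \<noteq> 0" for N u a
  proof -
    define M where "M = (\<lambda>v. sc (N v) a)"
    have M: "M \<in> V" unfolding M_def by (rule E.fsub_sm[OF ts_Vsub[OF ts] a(1) N])
    define P where "P = {v\<in>S. v + M v \<in> U}"
    have Mlin: "dlin S M" using t(5)[OF M] .
    have P: "dsub P"
    proof (rule dsubI)
      show "0 \<in> P" unfolding P_def using dsub_0[OF t(1)] dsub_0[OF U(1)] dlin_0[OF t(1) Mlin] by simp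
    next
      fix v w assume vw: "v \<in> P" "w \<in> P"
      then have S: "v \<in> S" "w \<in> S" "v + M v \<in> U" "w + M w \<in> U" unfolding P_def by auto
      have eq: "(v + w) + M (v + w) = (v + M v) + (w + M w)" using dlin_add[OF Mlin S(1,2)] by (simp add: algebra_simps)
      have "(v + w) + M (v + w) \<in> U" unfolding eq by (rule dsub_add[OF U(1) S(3,4)])
      then show "v + w \<in> P" unfolding P_def using dsub_add[OF t(1) S(1,2)] by simp
    next
      fix v c assume "v \<in> P"
      then have S: "v \<in> S" "v + M v \<in> U" unfolding P_def by auto
      have eq: "sc v c + M (sc v c) = sc (v + M v) c" using dlin_sc[OF Mlin S(1)] by (simp add: sc_add)
      have "sc v c + M (sc v c) \<in> U" unfolding eq by (rule dsub_sc[OF U(1) S(2)])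
      then show "sc v c \<in> P" unfolding P_def using dsub_sc[OF t(1) S(1)] by simp
    qed
    have PX: "P \<subseteq> X1" using preimage[OF M] unfolding P_def by blast
    have fP: "X.fd P" using X.fd_mono(1)[OF dX1(1) dsub_fsub[OF P] PX] .
    have Plin: "XX.flin P (\<lambda>v. v + M v)"
      using dlin_flin[OF dlin_mono[OF Mlin, of P]] by (auto simp: P_def XX.flin_def sc_add algebra_simps)
    have MS: "M ` S \<subseteq> S" using t(6)[OF M] by blast
    have "(\<lambda>v. v + M v) ` P = U"
    proof
      show "U \<subseteq> (\<lambda>v. v + M v) ` P"
      proof
        fix z assume z: "z \<in> U"
        then have "z \<in> (\<lambda>v. v + M v) ` S" using shift_bij[OF ts M t(1) subset_refl MS] US by auto
        then show "z \<in> (\<lambda>v. v + M v) ` P" using z unfolding P_def by blast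
      qed
    qed (auto simp: P_def)
    moreover have "X.dm ((\<lambda>v. v + M v) ` P) = X.dm P"
      by (rule XX.dm_inj[OF fP Plin]) (use ts_fixed[OF ts M] in \<open>auto simp: P_def\<close>)
    ultimately have dP: "X.dm P = X.dm U" by simp
    have uS: "u \<in> S" using u US by blast
    have uP: "u \<notin> P"
    proof
      assume "u \<in> P"
      then have "u + M u \<in> U" unfolding P_def by simp
      then have "(u + M u) - u \<in> U" by (rule dsub_diff[OF U(1) _ u(1)])
      then show False using u(2) dsub_sc_iff[OF U(1) a(2)] by (simp add: M_def)
    qed
    have sub: "X.fplus P (dline u) \<subseteq> X1"
      by (rule X.fplus_sub[OF dsub_fsub[OF X1(1)] PX dline_sub[OF X1(1)]]) (use u X1(3) in blast)
    have "X.dm (X.fplus P (dline u)) = X.dm X1" using dm_add_dline(2)[OF P fP uP] dP dX1(2) by simp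
    then have "X.fplus P (dline u) = X1"
      using X.fd_mono(3)[OF dX1(1) dsub_fsub[OF dsub_fplus[OF P dsub_dline]] sub] by simp
    then obtain p c where p: "p \<in> P" "x = p + sc u c" using X1(4) unfolding X.fplus_def dline_def by blast
    have pS: "p \<in> S" "p + M p \<in> U" using p(1) unfolding P_def by auto
    have "M x = M p + sc (M u) c" unfolding p(2) by (rule ev_add[OF ts M pS(1) uS])
    then have "x + M x = ((p + M p) + sc u c) + sc (N u) (a * c)"
      using p(2) by (simp add: M_def sc_mult algebra_simps)
    moreover have "(p + M p) + sc u c \<in> U" by (rule dsub_add[OF U(1) pS(2) dsub_sc[OF U(1) u(1)]])
    ultimately show ?thesis unfolding X.fplus_def dline_def M_def by blast
  qed
  have step: "N ` X1 \<subseteq> X1" if N: "N \<in> V" and nU: "\<not> N ` U \<subseteq> U" for N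
  proof -
    \<comment> \<open>A scalar \<open>a\<close> other than \<open>0\<close> and \<open>1\<close> is
      wanted: \<open>rank_one\<close> for \<open>1\<close> and for \<open>a\<close> together
      isolates \<open>N x\<close> and \<open>x\<close>. Since \<open>n \<ge> 3\<close>, there is
      one.\<close>
    have "big F 3" by (rule big_mono[OF big]) (use n3 d_pos mult_le_mono[of 3 n 1 d] in simp)
    then obtain T where T: "T \<subseteq> F" "finite T" "card T = 3" using big_finite_subset by blast
    have "\<not> T \<subseteq> {0, 1}" using T(3) card_mono[of "{0, 1 :: 'a}" T] by auto
    then obtain a where a: "a \<in> F" "a \<noteq> 0" "a \<noteq> 1" using T(1) by blast
    have key: "N x \<in> X1 \<and> N u \<in> X1" if u: "u \<in> U" "N u \<notin> U" for u
    proof -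
      let ?Q = "X.fplus U (dline (N u))"
      have Q: "dsub ?Q" by (rule dsub_fplus[OF U(1) dsub_dline])
      have 1: "x + N x \<in> ?Q" "x + sc (N x) a \<in> ?Q" using rank_one[OF N u, of 1] rank_one[OF N u a(1,2)] by auto
      have "(x + sc (N x) a) - (x + N x) = sc (N x) (a - 1)"
        using sc_add_right[of "N x" a "-1"] sc_uminus_right[of "N x" 1] by simp
      then have "sc (N x) (a - 1) \<in> ?Q" using dsub_diff[OF Q 1(2,1)] by simp
      then have NxQ: "N x \<in> ?Q" using dsub_sc_iff[OF Q, of "a - 1" "N x"] a(3) by simp
      then have "x \<in> ?Q" using dsub_diff[OF Q 1(1)] by fastforce
      then obtain u0 c where u0: "u0 \<in> U" "x = u0 + sc (N u) c" unfolding X.fplus_def dline_def by blast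
      have "c \<noteq> 0" using u0 xU by auto
      have "sc (N u) c = x - u0" using u0(2) by simp
      also have "\<dots> \<in> X1" by (rule dsub_diff[OF X1(1,4)]) (use u0(1) X1(3) in blast)
      finally have Nu: "N u \<in> X1" using dsub_sc_iff[OF X1(1) \<open>c \<noteq> 0\<close>] by simp
      have "?Q \<subseteq> X1" by (rule X.fplus_sub[OF dsub_fsub[OF X1(1)] X1(3) dline_sub[OF X1(1) Nu]])
      then show ?thesis using NxQ Nu by blast
    qed
    obtain u where u: "u \<in> U" "N u \<notin> U" using nU by blast
    have NU: "N u' \<in> X1" if "u' \<in> U" for u' using key[OF that] X1(3) by blast
    show ?thesis
    proof clarify
      fix v assume "v \<in> X1"
      then obtain u' c where v: "u' \<in> U" "v = u' + sc x c" unfolding X1_def X.fplus_def dline_def by blast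
      have "N v = N u' + sc (N x) c" unfolding v(2) by (rule ev_add[OF ts N]) (use v(1) US x in auto)
      then show "N v \<in> X1" using NU[OF v(1)] dsub_sc[OF X1(1)] key[OF u] dsub_add[OF X1(1)] by simp
    qed
  qed
  \<comment> \<open>A vector space is not the union of two proper subspaces; here the subspaces are
    the operators preserving \<open>U\<close> and those preserving \<open>X1\<close>.\<close>
  have disj: "(\<forall>N\<in>V. N ` U \<subseteq> U) \<or> (\<forall>N\<in>V. N ` X1 \<subseteq> X1)"
  proof (rule ccontr)
    assume "\<not> ?thesis"
    then obtain N1 N2 where N1: "N1 \<in> V" "\<not> N1 ` U \<subseteq> U" and N2: "N2 \<in> V" "\<not> N2 ` X1 \<subseteq> X1" by blast
    have a: "N1 ` X1 \<subseteq> X1" "N2 ` U \<subseteq> U" using step N1 N2 by blast+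
    have "N1 + N2 \<in> V" using E.fsub_add[OF ts_Vsub[OF ts] N1(1) N2(1)] .
    then have "(N1 + N2) ` U \<subseteq> U \<or> (N1 + N2) ` X1 \<subseteq> X1" using step by blast
    then show False
    proof
      assume b: "(N1 + N2) ` U \<subseteq> U"
      have "N1 u \<in> U" if "u \<in> U" for u
      proof -
        have "(N1 + N2) u - N2 u \<in> U" by (rule dsub_diff[OF U(1)]) (use a b that in auto)
        then show ?thesis by simp
      qed
      then show False using N1(2) by blast
    next
      assume b: "(N1 + N2) ` X1 \<subseteq> X1"
      have "N2 u \<in> X1" if "u \<in> X1" for u
      proof -
        have "(N1 + N2) u - N1 u \<in> X1" by (rule dsub_diff[OF X1(1)]) (use a b that in auto)
        then show ?thesis by simp
      qed
      then show False using N2(2) by blast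
    qed
  qed
  have "U \<noteq> S" using xU x by blast
  have "X1 \<noteq> S"
  proof
    assume "X1 = S"
    then have "n * d \<le> (n - 1) * d" using dX1(2) dU(2) t(3) by simp
    then show False using n3 d_pos by simp
  qed
  have "X1 \<noteq> {0}" using X1(4) x by blast
  from disj show ?thesis
  proof
    assume "\<forall>N\<in>V. N ` U \<subseteq> U"
    then show ?thesis unfolding reducible_def
      by (intro exI[of _ U]) (simp add: U(1,3) US \<open>U \<noteq> S\<close>)
  next
    assume "\<forall>N\<in>V. N ` X1 \<subseteq> X1"
    then show ?thesis unfolding reducible_def
      by (intro exI[of _ X1]) (simp add: X1(1,2) \<open>X1 \<noteq> S\<close> \<open>X1 \<noteq> {0}\<close>)
  qed
qed

end

section \<open>Full rank of irreducible spaces of greatest dimension\<close>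

context rspace
begin

lemma evI: "N \<in> V \<Longrightarrow> N x \<in> ev V x"
  unfolding ev_def by blast

definition rank_one_range :: "'v set \<Rightarrow> ('v \<Rightarrow> 'v) set \<Rightarrow> 'v set \<Rightarrow> ('v \<Rightarrow> 'a) \<Rightarrow> 'v set" where
  "rank_one_range S V K w = {z\<in>K. \<exists>N\<in>V. \<forall>v\<in>S. N v = sc z (w v)}"

lemma rank_one_rangeI: "z \<in> K \<Longrightarrow> N \<in> V \<Longrightarrow> (\<And>v. v \<in> S \<Longrightarrow> N v = sc z (w v)) \<Longrightarrow> z \<in> rank_one_range S V K w"
  unfolding rank_one_range_def by blast

lemma fsub_rank_one_range:
  assumes "E.fsub V" "dsub K"
  shows "X.fsub (rank_one_range S V K w)"
proof (rule X.fsubI)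
  show "0 \<in> rank_one_range S V K w"
    by (rule rank_one_rangeI[OF dsub_0[OF assms(2)] E.fsub_0[OF assms(1)]]) simp
next
  fix y z assume "y \<in> rank_one_range S V K w" "z \<in> rank_one_range S V K w"
  note yz = this
  obtain N where N: "y \<in> K" "N \<in> V" "\<And>v. v \<in> S \<Longrightarrow> N v = sc y (w v)" using yz(1) unfolding rank_one_range_def by blast
  obtain M where M: "z \<in> K" "M \<in> V" "\<And>v. v \<in> S \<Longrightarrow> M v = sc z (w v)" using yz(2) unfolding rank_one_range_def by blast
  from N M show "y + z \<in> rank_one_range S V K w"
    by (intro rank_one_rangeI[of _ _ "N + M"]) (auto simp: dsub_add[OF assms(2)] E.fsub_add[OF assms(1)] sc_add)
next
  fix a z assume a: "a \<in> F" and "z \<in> rank_one_range S V K w"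
  then obtain N where N: "z \<in> K" "N \<in> V" "\<And>v. v \<in> S \<Longrightarrow> N v = sc z (w v)" unfolding rank_one_range_def by blast
  show "sc z a \<in> rank_one_range S V K w"
  proof (rule rank_one_rangeI)
    show "sc z a \<in> K" using dsub_sc[OF assms(2) N(1)] .
    show "(\<lambda>v. sc (N v) a) \<in> V" using E.fsub_sm[OF assms(1) a N(2)] .
    fix v assume "v \<in> S"
    then show "sc (N v) a = sc (sc z a) (w v)" using N(3) by (simp add: sc_mult[symmetric] F_comm[OF a])
  qed
qed

lemma rank_one_range_fixed:
  assumes "trivial_spectrum S V n" "z \<in> rank_one_range S V K w" "z \<in> S" "w z = 1"
  shows "z = 0"
proof -
  obtain N where N: "N \<in> V" "\<And>v. v \<in> S \<Longrightarrow> N v = sc z (w v)" using assms(2) unfolding rank_one_range_def by blast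
  have "N z = z" using N(2)[OF assms(3)] assms(4) by simp
  then show ?thesis by (rule tsD(8)[OF assms(1) N(1) assms(3)])
qed

text \<open>Let \<open>g = 1 + N1\<close>, let \<open>h\<close> be its inverse and
  \<open>w = \<eta> \<circ> g\<close>. If the image of \<open>N\<close> is in the kernel of
  \<open>\<eta>\<close>, then \<open>h N\<close> maps into the kernel \<open>Y\<close> of
  \<open>w\<close> and has no nonzero fixed vector there, because \<open>h (N v) = v\<close> means
  \<open>(N - N1) v = v\<close>. So the restrictions to \<open>Y\<close> account for at most
  \<open>bound (n - 1)\<close> dimensions, and an operator lost in the restriction has the form
  \<open>v \<mapsto> sc z (w v)\<close>.\<close>

lemma dm_rank_one_range_ge:
  assumes ts: "trivial_spectrum S V n" and big: "big F (n * d)" and n: "n \<ge> 1"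
    and eta: "dfun S \<eta>" and x: "x \<in> S" and N1: "N1 \<in> V" and nz: "\<eta> (x + N1 x) \<noteq> 0"
  shows "E.dm {N\<in>V. \<forall>v\<in>S. \<eta> (N v) = 0} \<le>
    bound (n - 1) + X.dm (rank_one_range S V {v\<in>S. \<eta> v = 0} (\<lambda>v. \<eta> (v + N1 v)))"
proof -
  note t = tsD[OF ts]
  let ?K = "{v\<in>S. \<eta> v = 0}" and ?Z = "{N\<in>V. \<forall>v\<in>S. \<eta> (N v) = 0}"
  define w where "w v = \<eta> (v + N1 v)" for v
  define g where "g v = v + N1 v" for v
  define h where "h = inv_into S g"
  have glin: "dlin S g" using t(5)[OF N1] by (simp add: g_def dlin_def sc_add algebra_simps)
  have gS: "g v \<in> S" if "v \<in> S" for v using dsub_add[OF t(1) that t(6)[OF N1 that]] by (simp add: g_def)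
  have wlin: "dfun S w"
    using gS by (auto simp: w_def g_def[symmetric] dfun_def dlin_add[OF glin] dlin_sc[OF glin] dfun_add[OF eta] dfun_sc[OF eta])
  have gim: "g ` S = S" using shift_bij[OF ts N1 t(1) subset_refl] t(6)[OF N1] unfolding g_def by blast
  have ginj: "inj_on g S"
    by (rule XX.inj_on_flin[OF dsub_fsub[OF t(1)] dlin_flin[OF glin]]) (use ts_fixed[OF ts N1] in \<open>simp add: g_def\<close>)
  have h: "h v \<in> S" "g (h v) = v" if "v \<in> S" for v
    using that gim unfolding h_def by (auto intro: inv_into_into f_inv_into_f)
  have hg: "h (g v) = v" if "v \<in> S" for v unfolding h_def using inv_into_f_f[OF ginj that] .
  have hadd: "h (u + v) = h u + h v" if "u \<in> S" "v \<in> S" for u v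
    using hg[OF dsub_add[OF t(1) h(1)[OF that(1)] h(1)[OF that(2)]]] dlin_add[OF glin h(1) h(1)] h(2) that by simp
  have hsc: "h (sc u a) = sc (h u) a" if "u \<in> S" for u a
    using hg[OF dsub_sc[OF t(1) h(1)[OF that]], of a] dlin_sc[OF glin h(1)[OF that]] h(2) that by simp
  define Y where "Y = {v\<in>S. w v = 0}"
  have Yd: "dsub Y" unfolding Y_def by (rule dsub_ker[OF t(1) wlin])
  have YS: "Y \<subseteq> S" unfolding Y_def by blast
  have wx: "w x \<noteq> 0" using nz by (simp add: w_def)
  have Y: "X.fd Y" "X.dm Y = (n - 1) * d"
    using X.fd_mono(1)[OF t(2) dsub_fsub[OF Yd] YS] dm_dfun_ker[OF t(1,2) wlin x wx] t(3) n
    by (auto simp: Y_def[symmetric] diff_mult_distrib)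
  have NS: "N v \<in> S" "\<eta> (N v) = 0" "N \<in> V" if "N \<in> ?Z" "v \<in> S" for N v using that t(6) by auto
  have Zsub: "E.fsub ?Z"
    using E.fsub_0[OF ts_Vsub[OF ts]] E.fsub_add[OF ts_Vsub[OF ts]] E.fsub_sm[OF ts_Vsub[OF ts]]
      dfun_0[OF t(1) eta] dfun_add[OF eta t(6) t(6)] dfun_sc[OF eta t(6)]
    by (intro E.fsubI) auto
  have Zfd: "E.fd ?Z" using E.fd_mono(1)[OF t(4) Zsub] by blast
  \<comment> \<open>The value zero off \<open>Y\<close> makes a member of the new space determined
    by its restriction to \<open>Y\<close>.\<close>
  define T where "T N = (\<lambda>v. if v \<in> Y then h (N v) else 0)" for N
  have Tlin: "EE.flin ?Z T"
  proof (rule EE.flinI)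
    fix N M assume "N \<in> ?Z" "M \<in> ?Z"
    then show "T (N + M) = T N + T M"
      unfolding T_def using hadd NS(1) YS by (auto simp: fun_eq_iff subset_iff)
  next
    fix a N assume "N \<in> ?Z"
    then show "T (\<lambda>v. sc (N v) a) = (\<lambda>v. sc (T N v) a)"
      unfolding T_def using hsc NS(1) YS by (auto simp: fun_eq_iff subset_iff)
  qed
  have hY: "h z \<in> Y" if "z \<in> S" "\<eta> z = 0" for z
    using h[OF that(1)] that(2) unfolding Y_def w_def g_def by simp
  have "trivial_spectrum Y (T ` ?Z) (n - 1)"
    unfolding trivial_spectrum_def
  proof (intro conjI ballI impI)
    show "dsub Y" "X.fd Y" "X.dm Y = (n - 1) * d" by fact+
    show "E.fd (T ` ?Z)" using EE.rank_nullity(1)[OF Zfd Tlin] .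
    fix M assume "M \<in> T ` ?Z"
    then obtain N where N: "N \<in> ?Z" "M = T N" by blast
    have NV: "N \<in> V" using N by blast
    show "dlin Y M"
      using N(2) YS NS(1)[OF N(1)] hadd hsc dlin_add[OF t(5)[OF NV]] dlin_sc[OF t(5)[OF NV]] dsub_add[OF Yd] dsub_sc[OF Yd]
      by (auto simp: T_def dlin_def subset_iff)
    show "M ` Y \<subseteq> Y" using N(2) hY[OF NS(1,2)[OF N(1)]] YS by (auto simp: T_def)
    show "M = 0" if "\<forall>v\<in>Y. M v = 0" using that N(2) by (auto simp: T_def fun_eq_iff)
    fix v assume v: "v \<in> Y" "M v = v"
    then have vS: "v \<in> S" using YS by blast
    have "h (N v) = v" using v N(2) by (simp add: T_def)
    then have "N v = g v" using h(2)[OF NS(1)[OF N(1) vS]] by simp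
    then have "(N - N1) v = v" by (simp add: g_def)
    then show "v = 0" by (rule t(8)[OF E.fsub_diff[OF ts_Vsub[OF ts] NV N1] vS])
  qed
  then have "E.dm (T ` ?Z) \<le> bound (n - 1)"
    by (rule dm_trivial_spectrum) (rule big_mono[OF big], simp)
  moreover have "E.dm {N\<in>?Z. T N = 0} \<le> X.dm (rank_one_range S V ?K w)"
  proof -
    \<comment> \<open>\<open>v1\<close> spans a complement of \<open>Y\<close> and has
      \<open>w v1 = 1\<close>; so an operator vanishing on \<open>Y\<close> sends \<open>v\<close>
      to \<open>sc (N v1) (w v)\<close>.\<close>
    define v1 where "v1 = sc x (inverse (w x))"
    have v1: "v1 \<in> S" "w v1 = 1" unfolding v1_def using dsub_sc[OF t(1) x] dfun_sc[OF wlin x] wx by auto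
    have van: "N v = sc (N v1) (w v)" if N: "N \<in> ?Z" "T N = 0" and v: "v \<in> S" for N v
    proof -
      have s: "sc v1 (w v) \<in> S" using dsub_sc[OF t(1) v1(1)] .
      have "v - sc v1 (w v) \<in> Y"
        unfolding Y_def using dsub_diff[OF t(1) v s] dfun_diff[OF t(1) wlin v s] dfun_sc[OF wlin v1(1)] v1(2) by simp
      then have y: "v - sc v1 (w v) \<in> Y" "v - sc v1 (w v) \<in> S" using YS by auto
      have "h (N (v - sc v1 (w v))) = 0" using fun_cong[OF N(2), of "v - sc v1 (w v)"] y(1) by (simp add: T_def)
      then have "N (v - sc v1 (w v)) = 0"
        using h(2)[OF NS(1)[OF N(1) y(2)]] dlin_0[OF t(1) glin] by simp
      then show ?thesis using dlin_diff[OF t(1) t(5)[OF NS(3)[OF N(1) v]] v s] dlin_sc[OF t(5)[OF NS(3)[OF N(1) v]] v1(1)]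
        by simp
    qed
    have lin: "EX.flin {N\<in>?Z. T N = 0} (\<lambda>N. N v1)" by (rule EX.flinI) auto
    have fk: "E.fd {N\<in>?Z. T N = 0}" using EE.rank_nullity(2)[OF Zfd Tlin] .
    have "X.dm ((\<lambda>N. N v1) ` {N\<in>?Z. T N = 0}) = E.dm {N\<in>?Z. T N = 0}"
    proof (rule EX.dm_inj[OF fk lin])
      fix N assume N: "N \<in> {N\<in>?Z. T N = 0}" "N v1 = 0"
      have "N v = 0" if "v \<in> S" for v using van[of N v] N that by simp
      then show "N = 0" using t(7)[of N] N(1) by blast
    qed
    moreover have sub: "(\<lambda>N. N v1) ` {N\<in>?Z. T N = 0} \<subseteq> rank_one_range S V ?K w"
    proof clarify
      fix N assume N: "N \<in> V" "\<forall>v\<in>S. \<eta> (N v) = 0" "T N = 0"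
      show "N v1 \<in> rank_one_range S V ?K w"
        by (rule rank_one_rangeI[of _ _ N]) (use N v1 van t(6)[OF N(1)] in auto)
    qed
    moreover have fR: "X.fd (rank_one_range S V ?K w)"
      by (rule X.fd_mono(1)[OF t(2) fsub_rank_one_range[OF ts_Vsub[OF ts] dsub_ker[OF t(1) eta]]])
        (auto simp: rank_one_range_def)
    ultimately show ?thesis using X.fd_mono(2)[OF fR EX.fsub_image[OF E.fd_fsub[OF fk] lin] sub] by simp
  qed
  ultimately show ?thesis using EE.rank_nullity(3)[OF Zfd Tlin] unfolding w_def by linarith
qed

text \<open>Operators killing \<open>x\<close> do not see the component of \<open>u\<close> along
  \<open>x\<close>. The other component is a nonzero vector of the hyperplane, where the stabiliser
  has full rank.\<close>

lemma dm_ev_stabiliser: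
  assumes ts: "trivial_spectrum S V n" and opt: "E.dm V = bound n" and big: "big F (n * d)"
    and x: "x \<in> S" "x \<noteq> 0" "X.dm (ev V x) = n * d - 1" and an: "annihilator S V x \<eta>"
    and fr: "full_rank {v\<in>S. \<eta> v = 0} {N\<in>V. N x = 0} (n - 1)"
    and u: "u \<in> S" "u \<notin> dline x"
  shows "X.dm (ev {N\<in>V. N x = 0} u) = (n - 1) * d - 1 \<and> n \<ge> 2"
proof -
  note t = tsD[OF ts]
  let ?K = "{v\<in>S. \<eta> v = 0}" and ?W = "{N\<in>V. N x = 0}"
  note st = good_stab[OF ts opt big x an] and dec = good_decomp[OF ts opt big x an]
  have K: "dsub ?K" "X.fd ?K" "X.dm ?K = (n - 1) * d" using tsD[OF st(1)] by blast+
  let ?c = "inverse (\<eta> x) * \<eta> u"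
  define u' where "u' = u - sc x ?c"
  have u': "u' \<in> ?K" unfolding u'_def by (rule dec[OF u(1)])
  have "u' \<noteq> 0" using u(2) unfolding u'_def dline_def by auto
  have "ev ?W u = ev ?W u'"
    unfolding ev_def
  proof (rule image_cong[OF refl])
    fix N assume N: "N \<in> ?W"
    have "N u' = N u - N (sc x ?c)" unfolding u'_def
      by (rule dlin_diff[OF t(1) t(5) u(1) dsub_sc[OF t(1) x(1)]]) (use N in blast)
    also have "N (sc x ?c) = 0" using dlin_sc[OF t(5) x(1), of N ?c] N by simp
    finally show "N u = N u'" by simp
  qed
  moreover have "X.dm (ev ?W u') = (n - 1) * d - 1" using fr u' \<open>u' \<noteq> 0\<close> unfolding full_rank_def by blast
  moreover have "n \<ge> 2"
  proof (rule ccontr)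
    assume "\<not> ?thesis"
    then have "X.dm ?K = 0" using K(3) by simp
    then have "?K = {0}" using X.dm_0_iff[OF K(2)] by simp
    then show False using u' \<open>u' \<noteq> 0\<close> by blast
  qed
  ultimately show ?thesis by simp
qed

text \<open>A bad vector can be moved to a bad \<open>u\<close> such that
  \<open>e \<circ> \<eta>\<close> vanishes on \<open>u\<close> and on \<open>V u\<close>. Then some
  good \<open>y = x + u a\<close> has the same annihilator \<open>\<eta>\<close> as
  \<open>x\<close>, which forces many operators to have their image in the kernel of
  \<open>\<eta>\<close>. This yields either an invariant hyperplane or, for
  \<open>n \<ge> 3\<close>, an operator of rank one incompatible with the full rank of the
  stabiliser; \<open>n = 2\<close> is settled by a count of its own.\<close>

lemma full_rank_step:
  assumes ts: "trivial_spectrum S V n" and opt: "E.dm V = bound n" and big: "big F (n * d)"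
    and stab: "\<And>x \<eta>. x \<in> S \<Longrightarrow> x \<noteq> 0 \<Longrightarrow> X.dm (ev V x) = n * d - 1 \<Longrightarrow> annihilator S V x \<eta> \<Longrightarrow>
      full_rank {v\<in>S. \<eta> v = 0} {N\<in>V. N x = 0} (n - 1)"
    and irr: "\<not> reducible S V"
  shows "full_rank S V n"
proof (rule ccontr)
  note t = tsD[OF ts] and Vs = ts_Vsub[OF ts]
  assume "\<not> full_rank S V n"
  then obtain u0 where u0: "u0 \<in> S" "u0 \<noteq> 0" "X.dm (ev V u0) \<noteq> n * d - 1" unfolding full_rank_def by auto
  have n1: "n \<ge> 1"
  proof (rule ccontr)
    assume "\<not> ?thesis"
    then have "n = 0" by simp
    then show False using dm_ev_less[OF ts u0(1,2)] by simp
  qed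
  obtain x where x: "x \<in> S" "x \<noteq> 0" "X.dm (ev V x) = n * d - 1"
    using max_good[OF ts opt big n1] by blast
  obtain \<eta> where an: "annihilator S V x \<eta>" using annihilator_ex[OF ts x] by blast
  note eta = annD[OF ts an] and xx = x(1,2)
  have ex: "e (\<eta> x) \<noteq> 0" by (rule ann_nz[OF ts an x(1,2)])
  have etax: "\<eta> x \<noteq> 0" using ex by auto
  let ?K = "{v\<in>S. \<eta> v = 0}" and ?W = "{N\<in>V. N x = 0}"
  note kills = good_kills[OF ts opt big x an] and st = good_stab[OF ts opt big x an]
    and dec = good_decomp[OF ts opt big x an]
  have fr: "full_rank ?K ?W (n - 1)" by (rule stab[OF x an])
  have K: "dsub ?K" "X.fd ?K" "X.dm ?K = (n - 1) * d" using tsD[OF st(1)] by blast+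
  note notline = dm_ev_stabiliser[OF ts opt big x an fr]
  have u0line: "u0 \<notin> dline x"
  proof
    assume "u0 \<in> dline x"
    then obtain c where c: "u0 = sc x c" unfolding dline_def by blast
    then have "c \<noteq> 0" using u0(2) by auto
    then show False using ev_sc[OF ts x(1)] u0(3) x(3) c by simp
  qed
  have Wu_sub: "ev ?W u \<subseteq> {z\<in>ev V u. \<eta> z = 0}" if "u \<in> S" for u
    unfolding ev_def using kills that by auto
  have n2: "n \<ge> 2" using notline[OF u0(1) u0line] by blast
  \<comment> \<open>Inside the kernel of \<open>\<eta>\<close>, \<open>V u0\<close> contains the
    \<open>(n - 1) * d - 1\<close> dimensions of \<open>ev ?W u0\<close>; a surjective
    \<open>\<eta>\<close> would add \<open>d\<close> more and make \<open>u0\<close> good.\<close>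
  have etaV0: "\<eta> ` ev V u0 \<noteq> UNIV"
  proof
    assume surj: "\<eta> ` ev V u0 = UNIV"
    have lin: "XD.flin (ev V u0) \<eta>" using XD.flin_mono[OF dfun_flin[OF eta] ev_X[OF ts u0(1)]] .
    have "X.dm (ev ?W u0) \<le> X.dm {z\<in>ev V u0. \<eta> z = 0}"
      by (rule X.fd_mono(2)[OF XD.rank_nullity(2)[OF ev_sub(2)[OF ts] lin] ev_sub(1)[OF st(1)] Wu_sub[OF u0(1)]])
    then have "X.dm (ev V u0) \<ge> d + ((n - 1) * d - 1)"
      using XD.rank_nullity(3)[OF ev_sub(2)[OF ts] lin] surj dm_D notline[OF u0(1) u0line] by simp
    moreover have "d + ((n - 1) * d - 1) = n * d - 1"
    proof -
      have "(n - 1) * d \<ge> 1" using n2 d_pos by (simp add: Suc_le_eq)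
      then show ?thesis using n2 by (cases n) auto
    qed
    ultimately show False using dm_ev_less[OF ts u0(1,2)] u0(3) by simp
  qed
  have "D.fsub (\<eta> ` ev V u0)"
    by (rule XD.fsub_image[OF ev_sub(1)[OF ts] XD.flin_mono[OF dfun_flin[OF eta] ev_X[OF ts u0(1)]]])
  then obtain l where l: "l \<noteq> 0" "\<And>z. z \<in> \<eta> ` ev V u0 \<Longrightarrow> e (l * z) = 0" using e_separates etaV0 by blast
  \<comment> \<open>By the choice of \<open>l\<close>, \<open>e \<circ> \<eta>\<close> vanishes on
    \<open>V\<close> applied to \<open>sc u0 l\<close>. A correction along \<open>x\<close> by an
    element of \<open>F\<close> preserves this, and the present \<open>s\<close> also makes
    \<open>e (\<eta> u) = 0\<close>.\<close>
  define s where "s = e (\<eta> (sc u0 l)) * inverse (e (\<eta> x))"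
  have sF: "s \<in> F" unfolding s_def by (rule F_mult[OF e_F F_inverse[OF e_F]])
  define u where "u = sc u0 l + sc x (- s)"
  have u0l: "sc u0 l \<in> S" using dsub_sc[OF t(1) u0(1)] .
  have u: "u \<in> S" unfolding u_def by (rule dsub_add[OF t(1) u0l dsub_sc[OF t(1) x(1)]])
  have uline: "u \<notin> dline x"
  proof
    assume "u \<in> dline x"
    moreover have "sc x (- s) \<in> dline x" unfolding dline_def by simp
    ultimately have "u - sc x (- s) \<in> dline x" by (rule dsub_diff[OF dsub_dline])
    then have "sc u0 l \<in> dline x" by (simp add: u_def)
    then show False using u0line dsub_sc_iff[OF dsub_dline l(1)] by blast
  qed
  have "u \<noteq> 0" using uline dsub_0[OF dsub_dline] by metis
  have eu: "e (\<eta> u) = 0"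
  proof -
    have "e (\<eta> u) = e (\<eta> (sc u0 l)) - s * e (\<eta> x)"
      unfolding u_def using dfun_add[OF eta u0l dsub_sc[OF t(1) x(1)]] dfun_sc[OF eta x(1)] sF
      by (simp add: e_add e_diff e_uminus e_sm_right)
    then show ?thesis using ex by (simp add: s_def mult.assoc)
  qed
  have eNu: "e (\<eta> (N u)) = 0" if N: "N \<in> V" for N
  proof -
    have "N u = sc (N u0) l + sc (N x) (- s)"
      unfolding u_def using ev_add[OF ts N u0l x(1)] dlin_sc[OF t(5)[OF N] u0(1)] by simp
    then have "\<eta> (N u) = \<eta> (N u0) * l + \<eta> (N x) * (- s)"
      using t(6)[OF N] u0(1) x(1) dsub_sc[OF t(1)] by (simp add: dfun_add[OF eta] dfun_sc[OF eta])
    then have "e (\<eta> (N u)) = e (l * \<eta> (N u0)) - s * e (\<eta> (N x))"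
      using sF e_comm[of l] by (simp add: e_add e_diff e_uminus e_sm_right)
    moreover have "\<eta> (N u0) \<in> \<eta> ` ev V u0" unfolding ev_def using N by blast
    ultimately show ?thesis using l(2) ann_ev[OF ts an N x(1)] by simp
  qed
  \<comment> \<open>\<open>V u\<close> is contained in the kernel of \<open>e \<circ> \<eta>\<close>
    and misses \<open>u\<close>, which belongs to that kernel.\<close>
  have ubad: "X.dm (ev V u) < n * d - 1"
  proof -
    let ?H = "{v\<in>S. e (\<eta> v) = 0}"
    have H: "X.fsub ?H" using XD.fsub_ker[OF dsub_fsub[OF t(1)] dfun_e_flin[OF eta]] .
    have fH: "X.fd ?H" using X.fd_mono(1)[OF t(2) H] by blast
    have "X.dm S = X.dm ?H + 1"
      by (rule dm_form_kernel(2)[OF t(2) X.fmod_axioms dfun_e_flin[OF eta] _ x(1) ex]) (use e_F in auto)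
    moreover have "ev V u \<subset> ?H"
    proof
      show "ev V u \<subseteq> ?H" using t(6) u eNu unfolding ev_def by auto
      show "ev V u \<noteq> ?H" using ev_notin[OF ts u \<open>u \<noteq> 0\<close>] u eu by blast
    qed
    ultimately show ?thesis using X.dm_strict[OF fH ev_sub(1)[OF ts], of u] t(3) by simp
  qed
  \<comment> \<open>The pencil of \<open>x\<close> and \<open>u\<close> gives a good
    \<open>y\<close>; because \<open>e \<circ> \<eta>\<close> kills both \<open>V x\<close> and
    \<open>V u\<close>, this \<open>y\<close> has the annihilator \<open>\<eta>\<close> too.\<close>
  have "\<exists>a\<in>F. a \<noteq> 0 \<and> X.dm ((\<lambda>N. N x) ` V) \<le> X.dm ((\<lambda>N. N x + sc (N u) a) ` V)"
  proof (rule EX.pencil_rank[OF t(4) ev_lin ev_lin])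
    show "X.dm ((\<lambda>N. N u) ` V) < X.dm ((\<lambda>N. N x) ` V)" using ubad x(3) by (simp add: ev_def)
    show "big F (X.dm ((\<lambda>N. N x) ` V) + 1)"
      by (rule big_mono[OF big]) (use dm_ev_less[OF ts x(1,2)] in \<open>simp add: ev_def\<close>)
  qed (rule ts)+
  then obtain a where a: "a \<in> F" "a \<noteq> 0" "n * d - 1 \<le> X.dm ((\<lambda>N. N x + sc (N u) a) ` V)"
    using x(3) unfolding ev_def by auto
  define y where "y = x + sc u a"
  have yS: "y \<in> S" unfolding y_def by (rule dsub_add[OF t(1) x(1) dsub_sc[OF t(1) u]])
  have evy: "N y = N x + sc (N u) a" if "N \<in> V" for N unfolding y_def by (rule ev_add[OF ts that x(1) u])
  have ey: "e (\<eta> y) \<noteq> 0"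
    using dfun_add[OF eta x(1) dsub_sc[OF t(1) u]] dfun_sc[OF eta u] a(1) eu ex
    by (simp add: y_def e_add e_sm_right)
  then have y0: "y \<noteq> 0" using dfun_0[OF t(1) eta] by auto
  have ry: "X.dm (ev V y) = n * d - 1"
  proof -
    have "ev V y = (\<lambda>N. N x + sc (N u) a) ` V" unfolding ev_def by (rule image_cong) (use evy in auto)
    then show ?thesis using a(3) dm_ev_less[OF ts yS y0] by simp
  qed
  have any: "annihilator S V y \<eta>"
  proof (rule annihilator_exists[OF ts yS y0 ry eta _ yS])
    fix v assume "v \<in> ev V y"
    then obtain N where N: "N \<in> V" "v = N x + sc (N u) a" unfolding ev_def using evy by auto
    then show "e (\<eta> v) = 0"
      using dfun_add[OF eta t(6)[OF N(1) x(1)] dsub_sc[OF t(1) t(6)[OF N(1) u]]] dfun_sc[OF eta t(6)[OF N(1) u]]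
        ann_ev[OF ts an N(1) x(1)] eNu[OF N(1)] a(1) by (simp add: e_add e_sm_right)
  qed (use ey in auto)
  note killsy = good_kills[OF ts opt big yS y0 ry any] and sty = good_stab[OF ts opt big yS y0 ry any]
  define Z where "Z = {N\<in>V. \<forall>v\<in>S. \<eta> (N v) = 0}"
  have Zsub: "E.fsub Z"
    unfolding Z_def using E.fsub_0[OF Vs] E.fsub_add[OF Vs] E.fsub_sm[OF Vs]
      dfun_0[OF t(1) eta] dfun_add[OF eta t(6) t(6)] dfun_sc[OF eta t(6)]
    by (intro E.fsubI) auto
  have ZV: "Z \<subseteq> V" unfolding Z_def by blast
  have Zfd: "E.fd Z" using E.fd_mono(1)[OF t(4) Zsub ZV] .
  have WZ: "?W \<subseteq> Z" unfolding Z_def using kills by blast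
  have rZ: "E.dm Z = X.dm (ev Z v) + E.dm {N\<in>Z. N v = 0}" and fZ: "X.fd (ev Z v)" for v
  proof -
    have lin: "EX.flin Z (\<lambda>N. N v)" by (rule EX.flinI) auto
    show "E.dm Z = X.dm (ev Z v) + E.dm {N\<in>Z. N v = 0}"
      unfolding ev_def using EX.rank_nullity(3)[OF Zfd lin] .
    show "X.fd (ev Z v)" unfolding ev_def using EX.rank_nullity(1)[OF Zfd lin] .
  qed
  \<comment> \<open>The stabiliser of \<open>y\<close> lies in \<open>Z\<close> and has dimension
    \<open>bound (n - 1)\<close>. The stabiliser of \<open>x\<close> lies in \<open>Z\<close> as
    well and contributes its values at \<open>y\<close>, which are those at \<open>u\<close>
    multiplied by \<open>a\<close>.\<close>
  have dZ: "E.dm Z \<ge> ((n - 1) * d - 1) + bound (n - 1)"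
  proof -
    have "{N\<in>Z. N y = 0} = {N\<in>V. N y = 0}" unfolding Z_def using killsy by blast
    then have 1: "E.dm {N\<in>Z. N y = 0} = bound (n - 1)" using sty(3) by simp
    have "(\<lambda>v. sc v a) ` ev ?W u \<subseteq> ev Z y"
    proof clarify
      fix v assume "v \<in> ev ?W u"
      then obtain N where N: "N \<in> ?W" "v = N u" unfolding ev_def by blast
      then have "N y = sc v a" using evy[of N] by simp
      moreover have "N \<in> Z" using N(1) WZ by blast
      ultimately show "sc v a \<in> ev Z y" using evI[of N Z y] by simp
    qed
    then have "X.dm ((\<lambda>v. sc v a) ` ev ?W u) \<le> X.dm (ev Z y)"
      by (rule X.fd_mono(2)[OF fZ XX.fsub_image[OF ev_sub(1)[OF st(1)] flin_sc]])
    moreover have "X.dm ((\<lambda>v. sc v a) ` ev ?W u) = X.dm (ev ?W u)"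
      by (rule XX.dm_inj[OF ev_sub(2)[OF st(1)] flin_sc]) (use a(2) in \<open>simp add: sc_eq_0\<close>)
    ultimately have "X.dm (ev Z y) \<ge> (n - 1) * d - 1" using notline[OF u uline] by simp
    then show ?thesis using rZ[of y] 1 by simp
  qed
  define R where "R w = rank_one_range S V ?K w" for w
  have Rsub: "X.fsub (R w)" "R w \<subseteq> ?K" "X.fd (R w)" for w
  proof -
    show 1: "X.fsub (R w)" unfolding R_def by (rule fsub_rank_one_range[OF Vs K(1)])
    show 2: "R w \<subseteq> ?K" unfolding R_def rank_one_range_def by blast
    show "X.fd (R w)" by (rule X.fd_mono(1)[OF K(2) 1 2])
  qed
  define w where "w N v = \<eta> (v + N v)" for N v
  have wx: "e (w N x) = e (\<eta> x)" if "N \<in> V" for N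
    using dfun_add[OF eta x(1) t(6)[OF that x(1)]] ann_ev[OF ts an that x(1)] by (simp add: w_def e_add)
  have wx0: "w N x \<noteq> 0" if "N \<in> V" for N using wx[OF that] ex by auto
  have dR: "E.dm Z \<le> bound (n - 1) + X.dm (R (w N))" if "N \<in> V" for N
    unfolding Z_def R_def w_def
    by (rule dm_rank_one_range_ge[OF ts big n1 eta x(1) that]) (use wx0[OF that] in \<open>simp add: w_def\<close>)
  obtain m where m: "n = 2 + m" using le_Suc_ex[OF n2] by blast
  have nd: "(n - 1) * d \<ge> 1" "n * d = (n - 1) * d + d" unfolding m using d_pos by auto
  \<comment> \<open>With a larger \<open>Z\<close>, every \<open>z\<close> of the hyperplane would
    be in \<open>R (w N)\<close> for each \<open>N\<close>. If \<open>w N z \<noteq> 0\<close>, a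
    multiple of \<open>z\<close> then gives an operator fixing \<open>z\<close>; so
    \<open>w N\<close> would vanish on the hyperplane, which would be invariant under
    \<open>V\<close>.\<close>
  have dZ_eq: "E.dm Z = ((n - 1) * d - 1) + bound (n - 1)"
  proof (rule ccontr)
    assume "E.dm Z \<noteq> ((n - 1) * d - 1) + bound (n - 1)"
    then have big_dZ: "E.dm Z \<ge> (n - 1) * d + bound (n - 1)" using dZ nd(1) by linarith
    have RK: "R (w N) = ?K" if "N \<in> V" for N
    proof -
      have "X.dm (R (w N)) = X.dm ?K"
        using dR[OF that] big_dZ K(3) X.fd_mono(2)[OF K(2) Rsub(1,2), of "w N"] by simp
      then show ?thesis by (rule X.fd_mono(3)[OF K(2) Rsub(1,2)])
    qed
    have "N ` ?K \<subseteq> ?K" if N: "N \<in> V" for N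
    proof clarify
      fix z assume z: "z \<in> S" "\<eta> z = 0"
      have "w N z = 0"
      proof (rule ccontr)
        assume nz: "w N z \<noteq> 0"
        define c where "c = inverse (w N z)"
        have "sc z c \<in> ?K" using dsub_sc[OF K(1), of z] z by blast
        then have "sc z c \<in> R (w N)" using RK[OF N] by simp
        then obtain M where M: "M \<in> V" "\<And>v. v \<in> S \<Longrightarrow> M v = sc (sc z c) (w N v)"
          unfolding R_def rank_one_range_def by blast
        have "M z = z" using M(2)[OF z(1)] nz by (simp add: c_def)
        then have "z = 0" by (rule t(8)[OF M(1) z(1)])
        then show False using nz dfun_0[OF t(1) eta] dlin_0[OF t(1) t(5)[OF N]] by (simp add: w_def)
      qed
      then have "\<eta> (N z) = 0" using dfun_add[OF eta z(1) t(6)[OF N z(1)]] z(2) by (simp add: w_def)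
      then show "N z \<in> S \<and> \<eta> (N z) = 0" using t(6)[OF N z(1)] by simp
    qed
    moreover have "?K \<noteq> {0}" using K(3) nd(1) X.dm_zero by auto
    moreover have "?K \<noteq> S" using x(1) etax by blast
    ultimately have "reducible S V" unfolding reducible_def
      by (intro exI[of _ ?K]) (use K(1) in auto)
    then show False using irr by blast
  qed
  have dRge: "X.dm (R (w N)) \<ge> (n - 1) * d - 1" if "N \<in> V" for N using dR[OF that] dZ_eq by simp
  define Zx where "Zx = ev Z x"
  have "{N\<in>Z. N x = 0} = ?W" using WZ ZV by blast
  then have dZx: "X.dm Zx = (n - 1) * d - 1" using rZ[of x] dZ_eq st(3) by (simp add: Zx_def)
  \<comment> \<open>Evaluation at \<open>x\<close> of the operators belonging to
    \<open>R (w N)\<close> maps onto \<open>Zx\<close> by dimension. Hence \<open>R (w N)\<close>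
    depends on \<open>N\<close> only through the value \<open>w N x\<close>.\<close>
  have RZx: "z \<in> R (w N) \<longleftrightarrow> sc z (w N x) \<in> Zx" if N: "N \<in> V" and z: "z \<in> ?K" for N z
  proof -
    let ?c = "w N x"
    have sub: "(\<lambda>z. sc z ?c) ` R (w N) \<subseteq> Zx"
    proof clarify
      fix z assume "z \<in> R (w N)"
      then obtain M where M: "z \<in> ?K" "M \<in> V" "\<And>v. v \<in> S \<Longrightarrow> M v = sc z (w N v)"
        unfolding R_def rank_one_range_def by blast
      have "\<eta> (M v) = 0" if "v \<in> S" for v using M(1) M(3)[OF that] dfun_sc[OF eta, of z] by simp
      then have "M \<in> Z" unfolding Z_def using M(2) by blast
      then show "sc z ?c \<in> Zx" using evI[of M Z x] M(3)[OF x(1)] by (simp add: Zx_def)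
    qed
    have "X.dm ((\<lambda>z. sc z ?c) ` R (w N)) = X.dm (R (w N))"
      by (rule XX.dm_inj[OF Rsub(3) flin_sc]) (use wx0[OF N] in \<open>simp add: sc_eq_0\<close>)
    moreover have fZx: "X.fd Zx" unfolding Zx_def by (rule fZ)
    moreover have ssub: "X.fsub ((\<lambda>z. sc z ?c) ` R (w N))" by (rule XX.fsub_image[OF Rsub(1) flin_sc])
    ultimately have eq: "(\<lambda>z. sc z ?c) ` R (w N) = Zx"
      using X.fd_mono(2,3)[OF fZx ssub sub] dZx dRge[OF N] by simp
    show ?thesis
    proof
      assume "sc z ?c \<in> Zx"
      then obtain z' where "z' \<in> R (w N)" "sc z ?c = sc z' ?c" using eq by blast
      then show "z \<in> R (w N)" using sc_inverse[OF wx0[OF N]] by metis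
    qed (use sub in blast)
  qed
  have evke: "\<exists>N\<in>V. \<eta> (N x) = c" if c: "e c = 0" for c
  proof -
    define v where "v = sc x (inverse (\<eta> x) * c)"
    have v: "v \<in> S" "\<eta> v = c" unfolding v_def using dsub_sc[OF t(1) x(1)] dfun_sc[OF eta x(1)] etax
      by (auto simp: mult.assoc[symmetric])
    then have "v \<in> ev V x" using an c unfolding annihilator_def by blast
    then show ?thesis unfolding ev_def using v(2) by blast
  qed
  \<comment> \<open>The condition \<open>\<eta> (N x) = 0\<close> costs only \<open>d - 1\<close>
    dimensions, which leaves one more than the dimension of \<open>Z\<close>.\<close>
  have "\<exists>N0\<in>V. \<eta> (N0 x) = 0 \<and> N0 \<notin> Z"
  proof (rule ccontr)
    assume "\<not> ?thesis"
    then have sub: "{N\<in>V. \<eta> (N x) = 0} \<subseteq> Z" by blast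
    interpret ED: fmod2 F "\<lambda>a (f :: 'v \<Rightarrow> 'v) v. sc (f v) a" "(*)" ..
    have lin: "ED.flin V (\<lambda>N. \<eta> (N x))"
    proof (rule ED.flinI)
      fix a N assume a: "a \<in> F" and N: "N \<in> V"
      show "\<eta> (sc (N x) a) = a * \<eta> (N x)"
        using dfun_sc[OF eta t(6)[OF N x(1)], of a] F_comm[OF a, of "\<eta> (N x)"] by simp
    qed (use dfun_add[OF eta t(6) t(6)] x(1) in auto)
    have "(\<lambda>N. \<eta> (N x)) ` V = {c. e c = 0}"
    proof
      show "(\<lambda>N. \<eta> (N x)) ` V \<subseteq> {c. e c = 0}" using ann_ev[OF ts an _ x(1)] by blast
      show "{c. e c = 0} \<subseteq> (\<lambda>N. \<eta> (N x)) ` V" using evke by blast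
    qed
    then have "E.dm V = (d - 1) + E.dm {N\<in>V. \<eta> (N x) = 0}"
      using ED.rank_nullity(3)[OF t(4) lin] dm_ker_e by simp
    moreover have "E.dm {N\<in>V. \<eta> (N x) = 0} \<le> E.dm Z"
      by (rule E.fd_mono(2)[OF Zfd E.fd_fsub[OF ED.rank_nullity(2)[OF t(4) lin]] sub])
    moreover have "bound n = n * d - 1 + bound (n - 1)" using bound_Suc[of "n - 1"] n1 by simp
    ultimately show False using opt dZ_eq nd d_pos by linarith
  qed
  then obtain N0 where N0: "N0 \<in> V" "\<eta> (N0 x) = 0" "N0 \<notin> Z" by blast
  define \<rho> where "\<rho> v = \<eta> (N0 v)" for v
  have rho: "dfun S \<rho>" unfolding \<rho>_def dfun_def
    using dlin_add[OF t(5)[OF N0(1)]] dlin_sc[OF t(5)[OF N0(1)]] dfun_add[OF eta t(6)[OF N0(1)] t(6)[OF N0(1)]]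
      dfun_sc[OF eta t(6)[OF N0(1)]] by simp
  obtain q where q: "q \<in> S" "\<rho> q \<noteq> 0" using N0(1,3) unfolding Z_def \<rho>_def by blast
  obtain q' where q': "q' \<in> ?K" "\<rho> q' \<noteq> 0"
  proof
    let ?c = "inverse (\<eta> x) * \<eta> q"
    show "q - sc x ?c \<in> ?K" by (rule dec[OF q(1)])
    have "\<rho> (q - sc x ?c) = \<rho> q - \<rho> x * ?c"
      using dfun_diff[OF t(1) rho q(1) dsub_sc[OF t(1) x(1)]] dfun_sc[OF rho x(1)] by simp
    then show "\<rho> (q - sc x ?c) \<noteq> 0" using q(2) N0(2) by (simp add: \<rho>_def)
  qed
  \<comment> \<open>Adding \<open>N0\<close> to \<open>N\<close> does not change the value at
    \<open>x\<close>, so it does not change \<open>R (w N)\<close> either; the difference of the two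
    operators of rank one is \<open>v \<mapsto> sc z (\<rho> v)\<close>.\<close>
  have RR: "R (w N) \<subseteq> R \<rho>" if N: "N \<in> V" for N
  proof
    fix z assume zR: "z \<in> R (w N)"
    have z: "z \<in> ?K" using zR Rsub(2) by blast
    have NN: "N + N0 \<in> V" using E.fsub_add[OF Vs N N0(1)] .
    have wN: "w (N + N0) v = w N v + \<rho> v" if v: "v \<in> S" for v
    proof -
      have "v + (N + N0) v = (v + N v) + N0 v" by (simp add: add.assoc)
      then show ?thesis unfolding w_def \<rho>_def
        using dfun_add[OF eta dsub_add[OF t(1) v t(6)[OF N v]] t(6)[OF N0(1) v]] by (simp add: add.assoc)
    qed
    have "w (N + N0) x = w N x" using wN[OF x(1)] N0(2) by (simp add: \<rho>_def)
    then have "z \<in> R (w (N + N0))" using RZx[OF N z] RZx[OF NN z] zR by simp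
    then obtain M' where M': "M' \<in> V" "\<And>v. v \<in> S \<Longrightarrow> M' v = sc z (w (N + N0) v)"
      unfolding R_def rank_one_range_def by blast
    obtain M where M: "M \<in> V" "\<And>v. v \<in> S \<Longrightarrow> M v = sc z (w N v)"
      using zR unfolding R_def rank_one_range_def by blast
    show "z \<in> R \<rho>" unfolding R_def
    proof (rule rank_one_rangeI[OF z E.fsub_diff[OF Vs M'(1) M(1)]])
      fix v assume v: "v \<in> S"
      show "(M' - M) v = sc z (\<rho> v)" using M'(2)[OF v] M(2)[OF v] wN[OF v] by (simp add: sc_add_right)
    qed
  qed
  have RW: "\<exists>N\<in>?W. \<forall>v\<in>S. N v = sc z (\<rho> v)" if zr: "z \<in> R \<rho>" for z
  proof -
    obtain N where N: "N \<in> V" "\<And>v. v \<in> S \<Longrightarrow> N v = sc z (\<rho> v)"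
      using zr unfolding R_def rank_one_range_def by blast
    have "N x = 0" using N(2)[OF x(1)] N0(2) by (simp add: \<rho>_def)
    then show ?thesis using N by blast
  qed
  have zV: "0 \<in> V" using E.fsub_0[OF Vs] .
  show False
  proof (cases "n \<ge> 3")
    case True
    \<comment> \<open>\<open>\<rho>\<close> omits the value \<open>1\<close> on
      \<open>R \<rho>\<close>, so its rank there is below \<open>d\<close>, and
      \<open>n \<ge> 3\<close> leaves a nonzero \<open>z\<close> with \<open>\<rho> z = 0\<close>.
      The operator of \<open>z\<close> and \<open>\<rho>\<close> is in the stabiliser, kills
      \<open>z\<close> and takes nonzero multiples of \<open>z\<close> as values, against
      \<open>good_kills\<close> for the stabiliser.\<close>
    have RS: "R \<rho> \<subseteq> S" using Rsub(2)[of \<rho>] by auto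
    have lin: "XD.flin (R \<rho>) \<rho>" by (rule XD.flin_mono[OF dfun_flin[OF rho] RS])
    have "1 \<notin> \<rho> ` R \<rho>"
    proof
      assume "1 \<in> \<rho> ` R \<rho>"
      then obtain z where z: "z \<in> R \<rho>" "\<rho> z = 1" by force
      have "z = 0" by (rule rank_one_range_fixed[OF ts z(1)[unfolded R_def] subsetD[OF RS z(1)] z(2)])
      then show False using z(2) dfun_0[OF t(1) rho] by simp
    qed
    then have "\<rho> ` R \<rho> \<subset> UNIV" by blast
    then have "D.dm (\<rho> ` R \<rho>) < d" using D.dm_strict[OF fd_D XD.fsub_image[OF Rsub(1) lin]] dm_D by simp
    moreover have "X.dm (R \<rho>) \<ge> (n - 1) * d - 1"
      by (rule order_trans[OF dRge[OF zV] X.fd_mono(2)[OF Rsub(3) Rsub(1) RR[OF zV]]])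
    moreover have "(n - 1) * d \<ge> 2 * d" using True by (intro mult_le_mono1) simp
    ultimately have "X.dm {z\<in>R \<rho>. \<rho> z = 0} \<noteq> 0" using XD.rank_nullity(3)[OF Rsub(3) lin] d_pos by linarith
    then have "{z\<in>R \<rho>. \<rho> z = 0} \<noteq> {0}" using X.dm_zero by auto
    moreover have "0 \<in> {z\<in>R \<rho>. \<rho> z = 0}" using X.fsub_0[OF Rsub(1)] dfun_0[OF t(1) rho] by simp
    ultimately obtain z where z: "z \<in> R \<rho>" "\<rho> z = 0" "z \<noteq> 0" by blast
    have zK: "z \<in> ?K" using z(1) Rsub(2)[of \<rho>] by blast
    obtain N where N: "N \<in> ?W" "\<And>v. v \<in> S \<Longrightarrow> N v = sc z (\<rho> v)" using RW[OF z(1)] by blast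
    have rz: "X.dm (ev ?W z) = (n - 1) * d - 1" using fr zK z(3) unfolding full_rank_def by blast
    obtain \<eta>' where an': "annihilator ?K ?W z \<eta>'" using annihilator_ex[OF st(1) zK z(3) rz] by blast
    have "N z = 0" using N(2)[of z] zK z(2) by simp
    then have "\<eta>' (N q') = 0" using good_kills[OF st(1,3,4) zK z(3) rz an' N(1) _ q'(1)] by blast
    then have "\<eta>' z * \<rho> q' = 0" using N(2)[of q'] q'(1) dfun_sc[OF annD[OF st(1) an'] zK] by simp
    then show False using q'(2) ann_nz'[OF st(1) an' zK z(3)] by simp
  next
    case False
    then have n: "n = 2" using n2 by simp
    have dK: "X.dm ?K = d" using K(3) n by simp
    \<comment> \<open>For \<open>n = 2\<close> the stabiliser has dimension \<open>d - 1\<close>,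
      and \<open>z\<close> is recovered from its operator by evaluation.\<close>
    have "X.dm (R \<rho>) \<le> d - 1"
    proof -
      let ?T = "\<lambda>N. N (sc q (inverse (\<rho> q)))"
      have qS: "sc q (inverse (\<rho> q)) \<in> S" using dsub_sc[OF t(1) q(1)] .
      have "R \<rho> \<subseteq> ?T ` ?W"
      proof
        fix z assume "z \<in> R \<rho>"
        then obtain N where N: "N \<in> ?W" "\<forall>v\<in>S. N v = sc z (\<rho> v)" using RW by blast
        have "?T N = z" using N(2) qS dfun_sc[OF rho q(1)] q(2) by simp
        then show "z \<in> ?T ` ?W" using imageI[OF N(1), of ?T] by simp
      qed
      moreover have "X.dm (?T ` ?W) \<le> d - 1"
      proof -
        have "EX.flin ?W ?T" by (rule EX.flinI) auto
        then have "X.dm (?T ` ?W) \<le> E.dm ?W" using EX.rank_nullity(3)[OF tsD(4)[OF st(1)]] by simp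
        then show ?thesis using st(3) n bound_Suc[of 0] bound_0 by simp
      qed
      moreover have "X.fd (?T ` ?W)"
      proof (rule EX.rank_nullity(1)[OF tsD(4)[OF st(1)]])
        show "EX.flin ?W ?T" by (rule EX.flinI) auto
      qed
      ultimately show ?thesis using X.fd_mono(2)[OF _ Rsub(1)] by fastforce
    qed
    then have Req: "R (w N) = R \<rho>" if "N \<in> V" for N
      using X.fd_mono(2,3)[OF Rsub(3) Rsub(1) RR[OF that]] dRge[OF that] n by simp
    have dR: "X.dm (R \<rho>) = d - 1"
      using \<open>X.dm (R \<rho>) \<le> d - 1\<close> dRge[OF zV] Req[OF zV] n by simp
    have c0: "w 0 x = \<eta> x" by (simp add: w_def)
    have Rc: "sc z (\<eta> x) \<in> Zx \<longleftrightarrow> z \<in> R \<rho>" if "z \<in> ?K" for z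
      using RZx[OF zV that] Req[OF zV] c0 by simp
    \<comment> \<open>A suitable \<open>N\<close> changes the value at \<open>x\<close> from
      \<open>\<eta> x\<close> to \<open>(1 + b) * \<eta> x\<close> without changing
      \<open>R (w N)\<close>.\<close>
    have Rb: "sc z b \<in> R \<rho>" if z: "z \<in> R \<rho>" and b: "e (b * \<eta> x) = 0" for z b
    proof -
      have zK: "z \<in> ?K" using z Rsub(2)[of \<rho>] by blast
      obtain N where N: "N \<in> V" "\<eta> (N x) = b * \<eta> x" using evke[OF b] by blast
      have "w N x = (1 + b) * \<eta> x"
        using dfun_add[OF eta x(1) t(6)[OF N(1) x(1)]] N(2) by (simp add: w_def distrib_right)
      then have "sc (sc z (1 + b)) (\<eta> x) \<in> Zx"
        using RZx[OF N(1) zK] Req[OF N(1)] z by (simp add: sc_mult[symmetric])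
      then have "sc z (1 + b) \<in> R \<rho>" using Rc[OF dsub_sc[OF K(1) zK, of "1 + b"]] by simp
      then have "sc z (1 + b) - z \<in> R \<rho>" by (rule X.fsub_diff[OF Rsub(1) _ z])
      then show ?thesis by (simp add: sc_add_right)
    qed
    \<comment> \<open>\<open>R \<rho>\<close> is stable under \<open>F\<close> and under all
      \<open>b\<close> with \<open>e (b * \<eta> x) = 0\<close>, which together span the division
      ring. Having dimension \<open>d - 1\<close>, it must then be zero, so
      \<open>d = 1\<close>.\<close>
    have Rd: "dsub (R \<rho>)"
    proof (rule dsubI)
      show "0 \<in> R \<rho>" using X.fsub_0[OF Rsub(1)] .
      show "v + v' \<in> R \<rho>" if "v \<in> R \<rho>" "v' \<in> R \<rho>" for v v' by (rule X.fsub_add[OF Rsub(1) that])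
      fix z c assume z: "z \<in> R \<rho>"
      define f where "f = e (c * \<eta> x) * inverse (e (\<eta> x))"
      have f: "f \<in> F" unfolding f_def by (rule F_mult[OF e_F F_inverse[OF e_F]])
      have "e ((c - f) * \<eta> x) = e (c * \<eta> x) - f * e (\<eta> x)"
        using f by (simp add: left_diff_distrib e_diff e_sm)
      then have "e ((c - f) * \<eta> x) = 0" using ex by (simp add: f_def mult.assoc)
      then have "sc z (c - f) + sc z f \<in> R \<rho>"
        by (rule X.fsub_add[OF Rsub(1) Rb[OF z] X.fsub_sm[OF Rsub(1) f z]])
      then show "sc z c \<in> R \<rho>" by (simp add: sc_add_right[symmetric])
    qed
    have "R \<rho> = {0}"
    proof (rule ccontr)
      assume "R \<rho> \<noteq> {0}"
      then have "d \<le> X.dm (R \<rho>)" by (rule dm_dsub_ge[OF Rd Rsub(3)])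
      then show False using dR d_pos by simp
    qed
    then have d1: "d = 1" using dR X.dm_zero d_pos by simp
    have "D.dm {a. e a = 0} = 0" using dm_ker_e d1 by simp
    moreover have "D.fsub {a. e a = 0}" by (rule D.fsubI) (auto simp: e_add e_sm)
    ultimately have "{a. e a = 0} = {0}" using D.dm_0_iff fd_subD(1) by blast
    then have einj: "a = 0" if "e a = 0" for a using that by blast
    \<comment> \<open>With \<open>d = 1\<close> the form \<open>e\<close> is injective, so
      \<open>\<rho>\<close> vanishes on \<open>x\<close> and on \<open>u\<close>, which span
      \<open>S\<close>; but \<open>\<rho> q \<noteq> 0\<close>.\<close>
    have "X.fplus (dline x) (dline u) = S"
    proof (rule X.fd_mono(3)[OF t(2) dsub_fsub[OF dsub_fplus[OF dsub_dline dsub_dline]]])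
      show "X.fplus (dline x) (dline u) \<subseteq> S"
        by (rule X.fplus_sub[OF dsub_fsub[OF t(1)] dline_sub[OF t(1) x(1)] dline_sub[OF t(1) u]])
      show "X.dm (X.fplus (dline x) (dline u)) = X.dm S"
        using dm_add_dline(2)[OF dsub_dline fd_dline uline] dm_dline[OF x(2)] t(3) n by simp
    qed
    then obtain c1 c2 where qq: "q = sc x c1 + sc u c2"
      using q(1) unfolding X.fplus_def dline_def by blast
    have "\<rho> q = \<rho> x * c1 + \<rho> u * c2"
      unfolding qq using dfun_add[OF rho dsub_sc[OF t(1) x(1)] dsub_sc[OF t(1) u]] dfun_sc[OF rho x(1)] dfun_sc[OF rho u] by simp
    moreover have "\<rho> u = 0" using einj[OF eNu[OF N0(1)]] by (simp add: \<rho>_def)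
    ultimately show False using q(2) N0(2) by (simp add: \<rho>_def)
  qed
qed

text \<open>By induction the stabiliser of a good vector has full rank or is reducible. Reducibility
  lifts to \<open>V\<close>; if all these stabilisers have full rank, \<open>full_rank_step\<close>
  applies.\<close>

theorem full_rank_or_reducible:
  assumes "trivial_spectrum S V n" "E.dm V = bound n" "big F (n * d)"
  shows "full_rank S V n \<or> reducible S V"
  using assms
proof (induction n arbitrary: S V)
  case 0
  note t = tsD[OF 0(1)]
  have "S = {0}" using t(2,3) X.dm_0_iff by simp
  then show ?case unfolding full_rank_def by blast
next
  case (Suc n)
  show ?case
  proof (rule ccontr)
    assume no: "\<not> ?thesis"
    have "full_rank S V (Suc n)"
    proof (rule full_rank_step[OF Suc.prems])
      fix x \<eta> assume x: "x \<in> S" "x \<noteq> 0" "X.dm (ev V x) = Suc n * d - 1" and an: "annihilator S V x \<eta>"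
      note st = good_stab[OF Suc.prems x an]
      have "full_rank {v\<in>S. \<eta> v = 0} {N\<in>V. N x = 0} n \<or> reducible {v\<in>S. \<eta> v = 0} {N\<in>V. N x = 0}"
        by (rule Suc.IH) (use st in auto)
      then show "full_rank {v\<in>S. \<eta> v = 0} {N\<in>V. N x = 0} (Suc n - 1)"
        using reducible_from_stabiliser[OF Suc.prems x an] no by auto
    qed (use no in blast)
    then show False using no by blast
  qed
qed

end

section \<open>The semilinear form of a space of full rank\<close>

context rspace
begin

context
  fixes S V n
  assumes ts: "trivial_spectrum S V n" and opt: "E.dm V = bound n" and big: "big F (n * d)"
    and fr: "full_rank S V n"
begin

lemmas ft = tsD[OF ts]

lemma fr_rank: "x \<in> S \<Longrightarrow> x \<noteq> 0 \<Longrightarrow> X.dm (ev V x) = n * d - 1"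
  using fr unfolding full_rank_def by blast

text \<open>A reducible stabiliser would contain an operator \<open>v \<mapsto> sc z (w v)\<close>
  with \<open>z \<in> U\<close> and \<open>w\<close> zero on \<open>U\<close>. It kills
  \<open>z\<close> and has \<open>z\<close> in its image, against \<open>good_kills\<close> at
  \<open>z\<close>, which is a good vector for \<open>V\<close> as well.\<close>

lemma stabiliser_full_rank:
  assumes x: "x \<in> S" "x \<noteq> 0" and an: "annihilator S V x \<eta>"
  shows "full_rank {v\<in>S. \<eta> v = 0} {N\<in>V. N x = 0} (n - 1)"
proof (rule ccontr)
  let ?K = "{v\<in>S. \<eta> v = 0}" and ?W = "{N\<in>V. N x = 0}"
  note st = good_stab[OF ts opt big x fr_rank[OF x] an]
  assume "\<not> full_rank ?K ?W (n - 1)"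
  then have "reducible ?K ?W" using full_rank_or_reducible[OF st(1,3,4)] by blast
  then obtain U where U0: "dsub U \<and> U \<subseteq> ?K \<and> U \<noteq> {0} \<and> U \<noteq> ?K \<and> (\<forall>N\<in>?W. N ` U \<subseteq> U)"
    unfolding reducible_def by (rule exE)
  then have U: "dsub U" "U \<subseteq> ?K" "U \<noteq> {0}" "U \<noteq> ?K" by simp_all
  have Uinv: "N ` U \<subseteq> U" if "N \<in> ?W" for N using U0 that by blast
  obtain z where z: "z \<in> U" "z \<noteq> 0" using dsub_0[OF U(1)] U(3) by blast
  obtain q where q: "q \<in> ?K" "q \<notin> U" using U(2,4) by blast
  obtain w where w: "dfun ?K w" "\<And>v. v \<in> U \<Longrightarrow> w v = 0" "w q = 1"
    using dfun_separates_dsub[OF tsD(1,2)[OF st(1)] U(1,2) q] by blast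
  obtain N where N: "N \<in> ?W" "\<And>v. v \<in> ?K \<Longrightarrow> N v = sc z (w v)"
    using invariant_contains[OF st(1,3,4) U(1,2) Uinv z(1) w(1,2)] by blast
  have zS: "z \<in> S" "z \<in> ?K" using z(1) U(2) by auto
  obtain \<zeta> where ze: "annihilator S V z \<zeta>" using annihilator_ex[OF ts zS(1) z(2) fr_rank[OF zS(1) z(2)]] by blast
  have "N z = 0" using N(2)[OF zS(2)] w(2)[OF z(1)] by simp
  moreover have "N \<in> V" "q \<in> S" using N(1) q(1) by auto
  ultimately have "\<zeta> (N q) = 0" using good_kills[OF ts opt big zS(1) z(2) fr_rank[OF zS(1) z(2)] ze] by blast
  then show False using N(2)[OF q(1)] w(3) ann_nz'[OF ts ze zS(1) z(2)] by simp
qed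

lemma annI:
  assumes "x \<in> S" "x \<noteq> 0" "dfun S \<eta>" "\<And>N. N \<in> V \<Longrightarrow> e (\<eta> (N x)) = 0" "p \<in> S" "\<eta> p \<noteq> 0"
  shows "annihilator S V x \<eta>"
proof (rule annihilator_exists[OF ts assms(1,2) fr_rank[OF assms(1,2)] assms(3) _ assms(5,6)])
  fix v assume "v \<in> ev V x"
  then show "e (\<eta> v) = 0" using assms(4) unfolding ev_def by auto
qed

lemma ann_ex: "x \<in> S \<Longrightarrow> x \<noteq> 0 \<Longrightarrow> \<exists>\<eta>. annihilator S V x \<eta>"
  using annihilator_ex[OF ts _ _ fr_rank] by metis

text \<open>The factors \<open>inverse c\<close> and \<open>c\<close> cancel under \<open>e\<close>,
  because \<open>e (x * y) = e (y * x)\<close>.\<close>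

lemma ann_sc:
  assumes "x \<in> S" "x \<noteq> 0" "annihilator S V x \<eta>" "c \<noteq> 0"
  shows "annihilator S V (sc x c) (\<lambda>v. inverse c * \<eta> v)"
proof (rule annI)
  show "sc x c \<in> S" using dsub_sc[OF ft(1) assms(1)] .
  show "sc x c \<noteq> 0" using assms(2,4) sc_eq_0 by simp
  show "dfun S (\<lambda>v. inverse c * \<eta> v)" by (rule dfun_scale[OF annD[OF ts assms(3)]])
  show "x \<in> S" by fact
  show "inverse c * \<eta> x \<noteq> 0" using ann_nz'[OF ts assms(3,1,2)] assms(4) by simp
  fix N assume N: "N \<in> V"
  have "inverse c * \<eta> (N (sc x c)) = inverse c * (\<eta> (N x) * c)"
    using dlin_sc[OF ft(5)[OF N] assms(1)] dfun_sc[OF annD[OF ts assms(3)] ft(6)[OF N assms(1)]] by simp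
  also have "e \<dots> = e (\<eta> (N x) * c * inverse c)" by (rule e_comm)
  also have "\<eta> (N x) * c * inverse c = \<eta> (N x)" using assms(4) by (simp add: mult.assoc)
  finally show "e (inverse c * \<eta> (N (sc x c))) = 0" using ann_ev[OF ts assms(3) N assms(1)] by simp
qed

text \<open>By dimension, the values at \<open>u\<close> of the stabiliser of \<open>x\<close> fill
  the kernel of \<open>e \<circ> \<eta>'\<close> inside the kernel of \<open>\<eta>\<close>. There
  \<open>\<zeta>\<close> is thus an \<open>F\<close>-multiple of \<open>\<eta>'\<close>, and the
  rest vanishes on the kernel of \<open>\<eta>\<close>, so it is a left multiple of
  \<open>\<eta>\<close>.\<close>

lemma pair_combination:
  assumes x: "x \<in> S" "x \<noteq> 0" and u: "u \<in> S" "u \<notin> dline x"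
    and an: "annihilator S V x \<eta>" and an': "annihilator S V u \<eta>'"
    and p: "p \<in> S" "\<eta> p = 0" "\<eta>' p \<noteq> 0"
    and ze: "dfun S \<zeta>" "\<And>N. N \<in> V \<Longrightarrow> N x = 0 \<Longrightarrow> e (\<zeta> (N u)) = 0"
  shows "\<exists>l. \<exists>c\<in>F. \<forall>v\<in>S. \<zeta> v = l * \<eta> v + c * \<eta>' v"
proof -
  let ?K = "{v\<in>S. \<eta> v = 0}" and ?W = "{N\<in>V. N x = 0}"
  note r = fr_rank[OF x]
  note st = good_stab[OF ts opt big x r an]
  have K: "dsub ?K" "X.fd ?K" "X.dm ?K = (n - 1) * d" using tsD[OF st(1)] by blast+
  have dW: "X.dm (ev ?W u) = (n - 1) * d - 1"
    using dm_ev_stabiliser[OF ts opt big x r an stabiliser_full_rank[OF x an] u] by blast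
  have KS: "?K \<subseteq> S" by blast
  have e': "dfun ?K \<eta>'" by (rule dfun_mono[OF annD[OF ts an'] KS])
  have z': "dfun ?K \<zeta>" by (rule dfun_mono[OF ze(1) KS])
  have pK: "p \<in> ?K" using p by simp
  obtain q where q: "q \<in> ?K" "e (\<eta>' q) \<noteq> 0"
  proof (rule ccontr)
    assume "\<not> thesis"
    then have "e (\<eta>' v) = 0" if "v \<in> ?K" for v using that \<open>\<And>q. q \<in> ?K \<Longrightarrow> e (\<eta>' q) \<noteq> 0 \<Longrightarrow> thesis\<close> by blast
    then show False using e_dfun_zero[OF K(1) e' _ pK] p(3) by blast
  qed
  let ?H = "{v\<in>?K. e (\<eta>' v) = 0}"
  have H: "X.fsub ?H" using XD.fsub_ker[OF dsub_fsub[OF K(1)] dfun_e_flin[OF e']] .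
  have fH: "X.fd ?H" by (rule X.fd_mono(1)[OF K(2) H]) blast
  have "X.dm ?K = X.dm ?H + 1"
    by (rule dm_form_kernel(2)[OF K(2) X.fmod_axioms dfun_e_flin[OF e'] _ q]) (use e_F in auto)
  then have dH: "X.dm (ev ?W u) = X.dm ?H" using dW K(3) by simp
  have "ev ?W u \<subseteq> ?H"
    unfolding ev_def using good_kills[OF ts opt big x r an _ _ u(1)] ann_ev[OF ts an' _ u(1)] ft(6)[OF _ u(1)] by auto
  then have eqH: "ev ?W u = ?H" by (rule X.fd_mono(3)[OF fH ev_sub(1)[OF st(1)] _ dH])
  obtain c where c: "c \<in> F" "\<And>v. v \<in> ?K \<Longrightarrow> \<zeta> v = c * \<eta>' v"
  proof (rule e_proportional[OF K(1) e' z'])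
    fix v assume "v \<in> ?K" "e (\<eta>' v) = 0"
    then have "v \<in> ev ?W u" using eqH by blast
    then show "e (\<zeta> v) = 0" using ze(2) unfolding ev_def by auto
  qed blast
  have d: "dfun S (\<lambda>v. \<zeta> v - c * \<eta>' v)" by (rule dfun_minus[OF ze(1) dfun_scale[OF annD[OF ts an']]])
  obtain l where l: "\<And>v. v \<in> S \<Longrightarrow> \<zeta> v - c * \<eta>' v = l * \<eta> v"
  proof (rule dfun_proportional[OF ft(1) annD[OF ts an] d])
    fix v assume "v \<in> S" "\<eta> v = 0"
    then show "\<zeta> v - c * \<eta>' v = 0" using c(2)[of v] by simp
  qed blast
  have "\<zeta> v = l * \<eta> v + c * \<eta>' v" if "v \<in> S" for v using l[OF that] by (simp add: algebra_simps)
  then show ?thesis using c(1) by blast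
qed

text \<open>Otherwise a multiple \<open>v\<close> of \<open>u\<close> has the same annihilator
  \<open>\<eta>\<close> as \<open>x\<close>. Write \<open>v = u' + sc x c\<close> with
  \<open>\<eta> u' = 0\<close>. Operators killing \<open>u'\<close> agree at \<open>v\<close> and at
  \<open>sc x c\<close>, so \<open>pair_combination\<close> applies and forces
  \<open>c \<in> F\<close>. Then \<open>e \<circ> \<eta>\<close> kills \<open>V u'\<close> too,
  which makes \<open>\<eta>\<close> a multiple of the annihilator \<open>\<theta>\<close> of
  \<open>u'\<close>; but \<open>\<eta> u' = 0\<close> while
  \<open>\<theta> u' \<noteq> 0\<close>.\<close>

lemma ann_independent:
  assumes x: "x \<in> S" "x \<noteq> 0" and u: "u \<in> S" "u \<notin> dline x"
    and an: "annihilator S V x \<eta>" and an': "annihilator S V u \<eta>'"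
  obtains p where "p \<in> S" "\<eta> p = 0" "\<eta>' p \<noteq> 0"
proof (rule ccontr)
  assume "\<not> thesis"
  then have ker: "\<eta>' p = 0" if "p \<in> S" "\<eta> p = 0" for p
    using that \<open>\<And>p. p \<in> S \<Longrightarrow> \<eta> p = 0 \<Longrightarrow> \<eta>' p \<noteq> 0 \<Longrightarrow> thesis\<close> by blast
  note eta = annD[OF ts an]
  have u0: "u \<noteq> 0" using u(2) dsub_0[OF dsub_dline] by metis
  obtain l where l: "\<And>v. v \<in> S \<Longrightarrow> \<eta>' v = l * \<eta> v"
    using dfun_proportional[OF ft(1) eta annD[OF ts an'] ker] by blast
  have l0: "l \<noteq> 0" using l[OF u(1)] ann_nz'[OF ts an' u(1) u0] by auto
  define v where "v = sc u l"
  have v: "v \<in> S" "v \<notin> dline x" "v \<noteq> 0"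
    unfolding v_def using dsub_sc[OF ft(1) u(1)] dsub_sc_iff[OF dsub_dline l0] u(2) u0 l0 sc_eq_0 by auto
  have anv: "annihilator S V v \<eta>"
  proof -
    have 1: "annihilator S V v (\<lambda>v. inverse l * \<eta>' v)" unfolding v_def by (rule ann_sc[OF u(1) u0 an' l0])
    show ?thesis
    proof (rule annI[OF v(1,3) eta _ x(1) ann_nz'[OF ts an x]])
      fix N assume N: "N \<in> V"
      have "e (inverse l * \<eta>' (N v)) = 0" using ann_ev[OF ts 1 N v(1)] .
      then show "e (\<eta> (N v)) = 0" using l[OF ft(6)[OF N v(1)]] l0 by (simp add: mult.assoc[symmetric])
    qed
  qed
  define c where "c = inverse (\<eta> x) * \<eta> v"
  define u' where "u' = v - sc x c"
  have u'K: "u' \<in> {v\<in>S. \<eta> v = 0}" unfolding u'_def c_def by (rule good_decomp[OF ts opt big x fr_rank[OF x] an v(1)])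
  have c0: "c \<noteq> 0" using ann_nz'[OF ts anv v(1,3)] ann_nz'[OF ts an x] by (simp add: c_def)
  have xc: "sc x c \<in> S" "sc x c \<noteq> 0" using dsub_sc[OF ft(1) x(1)] x(2) c0 sc_eq_0 by auto
  have u'0: "u' \<noteq> 0" using v(2) unfolding u'_def dline_def by auto
  have u'S: "u' \<in> S" "\<eta> u' = 0" using u'K by auto
  obtain \<theta> where th: "annihilator S V u' \<theta>" using ann_ex[OF u'S(1) u'0] by blast
  have th0: "\<theta> u' \<noteq> 0" by (rule ann_nz'[OF ts th u'S(1) u'0])
  have line: "sc x c \<notin> dline u'"
  proof
    assume "sc x c \<in> dline u'"
    then obtain a where a: "sc x c = sc u' a" unfolding dline_def by blast
    have "\<eta> (sc x c) = 0" unfolding a using dfun_sc[OF eta u'S(1)] u'S(2) by simp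
    then show False using dfun_sc[OF eta x(1)] ann_nz'[OF ts an x] c0 by simp
  qed
  have anx: "annihilator S V (sc x c) (\<lambda>v. inverse c * \<eta> v)" by (rule ann_sc[OF x an c0])
  have vN: "N v = N u' + N (sc x c)" if N: "N \<in> V" for N
    using dlin_add[OF ft(5)[OF N] u'S(1) xc(1)] by (simp add: u'_def)
  have "\<exists>l. \<exists>g\<in>F. \<forall>v\<in>S. \<eta> v = l * \<theta> v + g * (inverse c * \<eta> v)"
  proof -
    define \<theta>' where "\<theta>' p = inverse c * \<eta> p" for p
    obtain p where p: "p \<in> S" "\<theta> p = 0" "inverse c * \<eta> p \<noteq> 0"
    proof -
      \<comment> \<open>\<open>x\<close> corrected along \<open>u'\<close> so that
        \<open>\<theta>\<close> vanishes; the correction does not affect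
        \<open>\<eta>\<close>.\<close>
      define p where "p = x - sc u' (inverse (\<theta> u') * \<theta> x)"
      have s: "sc u' (inverse (\<theta> u') * \<theta> x) \<in> S" using dsub_sc[OF ft(1) u'S(1)] .
      have 1: "p \<in> S" unfolding p_def by (rule dsub_diff[OF ft(1) x(1) s])
      have 2: "\<theta> p = 0" unfolding p_def
        using dfun_diff[OF ft(1) annD[OF ts th] x(1) s] dfun_sc[OF annD[OF ts th] u'S(1)] th0 by (simp add: mult.assoc[symmetric])
      have "\<eta> p = \<eta> x" unfolding p_def
        using dfun_diff[OF ft(1) eta x(1) s] dfun_sc[OF eta u'S(1)] u'S(2) by simp
      then have "inverse c * \<eta> p \<noteq> 0" using ann_nz'[OF ts an x] c0 by simp
      then show thesis using that 1 2 by blast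
    qed
    show ?thesis
    proof (rule pair_combination[OF u'S(1) u'0 xc(1) line th anx p eta])
      fix N assume N: "N \<in> V" "N u' = 0"
      then show "e (\<eta> (N (sc x c))) = 0" using ann_ev[OF ts anv N(1) v(1)] vN[OF N(1)] by simp
    qed
  qed
  then obtain l2 g where g: "g \<in> F" "\<And>v. v \<in> S \<Longrightarrow> \<eta> v = l2 * \<theta> v + g * (inverse c * \<eta> v)" by blast
  have "l2 = 0" using g(2)[OF u'S(1)] u'S(2) th0 by simp
  then have "1 * \<eta> x = (g * inverse c) * \<eta> x" using g(2)[OF x(1)] by (simp add: mult.assoc)
  then have "1 = g * inverse c" using ann_nz'[OF ts an x] mult_right_cancel[of "\<eta> x" 1 "g * inverse c"] by blast
  then have "1 * c = g * inverse c * c" by simp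
  then have "c = g" using c0 by (simp add: mult.assoc)
  then have cF: "c \<in> F" using g(1) by simp
  have "e (\<eta> (N u')) = 0" if N: "N \<in> V" for N
  proof -
    have 1: "e (\<eta> (N (sc x c))) = 0"
      using dlin_sc[OF ft(5)[OF N] x(1)] dfun_sc[OF eta ft(6)[OF N x(1)]] ann_ev[OF ts an N x(1)] cF by (simp add: e_sm_right)
    have "\<eta> (N v) = \<eta> (N u') + \<eta> (N (sc x c))"
      using vN[OF N] dfun_add[OF eta ft(6)[OF N u'S(1)] ft(6)[OF N xc(1)]] by simp
    then show ?thesis using ann_ev[OF ts anv N v(1)] 1 by (simp add: e_add)
  qed
  then obtain k where k: "k \<in> F" "\<And>v. v \<in> S \<Longrightarrow> \<eta> v = k * \<theta> v"
    using ann_unique[OF ts th u'S(1) eta] by blast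
  have "k = 0" using k(2)[OF u'S(1)] u'S(2) th0 by simp
  then show False using k(2)[OF x(1)] ann_nz'[OF ts an x] by simp
qed

text \<open>The stabiliser of \<open>x\<close> puts the coefficient of \<open>\<eta>'\<close> into
  \<open>F\<close>, the stabiliser of \<open>u\<close> that of \<open>\<eta>\<close>. Independence
  of the annihilators identifies the two expressions and excludes zero coefficients.\<close>

lemma ann_sum:
  assumes x: "x \<in> S" "x \<noteq> 0" and u: "u \<in> S" "u \<notin> dline x"
    and an: "annihilator S V x \<eta>" and an': "annihilator S V u \<eta>'"
    and ze: "annihilator S V (x + u) \<zeta>"
  obtains a b where "a \<in> F" "b \<in> F" "a \<noteq> 0" "b \<noteq> 0" "\<And>v. v \<in> S \<Longrightarrow> \<zeta> v = a * \<eta> v + b * \<eta>' v"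
proof -
  note eta = annD[OF ts an] and eta' = annD[OF ts an'] and zeta = annD[OF ts ze]
  have u0: "u \<noteq> 0" using u(2) dsub_0[OF dsub_dline] by metis
  have swap: "x' \<notin> dline u'" if "x' \<noteq> 0" "u' \<notin> dline x'" for x' u'
  proof
    assume "x' \<in> dline u'"
    then obtain a where a: "x' = sc u' a" unfolding dline_def by blast
    then have "a \<noteq> 0" using that(1) by auto
    then have "u' = sc x' (inverse a)" using a by simp
    then show False using that(2) unfolding dline_def by simp
  qed
  have xu: "x + u \<in> S" using dsub_add[OF ft(1) x(1) u(1)] .
  have xux: "x + u \<notin> dline x"
  proof
    assume "x + u \<in> dline x"
    then have "x + u - x \<in> dline x" using dsub_diff[OF dsub_dline _ in_dline] by blast
    then show False using u(2) by simp
  qed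
  have xuu: "x + u \<notin> dline u"
  proof
    assume "x + u \<in> dline u"
    then have "x + u - u \<in> dline u" using dsub_diff[OF dsub_dline _ in_dline] by blast
    then show False using swap[OF x(2) u(2)] by simp
  qed
  have Nxu: "N (x + u) = N x + N u" if "N \<in> V" for N using dlin_add[OF ft(5)[OF that] x(1) u(1)] .
  obtain p where p: "p \<in> S" "\<eta> p = 0" "\<eta>' p \<noteq> 0" using ann_independent[OF x u an an'] by blast
  obtain p' where p': "p' \<in> S" "\<eta>' p' = 0" "\<eta> p' \<noteq> 0"
    using ann_independent[OF u(1) u0 x(1) swap[OF x(2) u(2)] an' an] by blast
  have "\<exists>l. \<exists>c\<in>F. \<forall>v\<in>S. \<zeta> v = l * \<eta> v + c * \<eta>' v"
  proof (rule pair_combination[OF x u an an' p zeta])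
    fix N assume "N \<in> V" "N x = 0"
    then show "e (\<zeta> (N u)) = 0" using ann_ev[OF ts ze _ xu, of N] Nxu[of N] by simp
  qed
  then obtain l c where c: "c \<in> F" "\<And>v. v \<in> S \<Longrightarrow> \<zeta> v = l * \<eta> v + c * \<eta>' v" by blast
  have "\<exists>l. \<exists>c\<in>F. \<forall>v\<in>S. \<zeta> v = l * \<eta>' v + c * \<eta> v"
  proof (rule pair_combination[OF u(1) u0 x(1) swap[OF x(2) u(2)] an' an p' zeta])
    fix N assume "N \<in> V" "N u = 0"
    then show "e (\<zeta> (N x)) = 0" using ann_ev[OF ts ze _ xu, of N] Nxu[of N] by simp
  qed
  then obtain l' c' where c': "c' \<in> F" "\<And>v. v \<in> S \<Longrightarrow> \<zeta> v = l' * \<eta>' v + c' * \<eta> v" by blast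
  have "l = c'" using c(2)[OF p'(1)] c'(2)[OF p'(1)] p'(2,3) by simp
  then have rep: "\<zeta> v = c' * \<eta> v + c * \<eta>' v" if "v \<in> S" for v using c(2)[OF that] by simp
  have xu0: "x + u \<noteq> 0" using xux dsub_0[OF dsub_dline] by metis
  obtain p1 where p1: "p1 \<in> S" "\<eta> p1 = 0" "\<zeta> p1 \<noteq> 0" using ann_independent[OF x xu xux an ze] by blast
  obtain p2 where p2: "p2 \<in> S" "\<eta>' p2 = 0" "\<zeta> p2 \<noteq> 0" using ann_independent[OF u(1) u0 xu xuu an' ze] by blast
  have "c \<noteq> 0" using rep[OF p1(1)] p1(2,3) by auto
  moreover have "c' \<noteq> 0" using rep[OF p2(1)] p2(2,3) by auto
  ultimately show ?thesis using that[OF c'(1) c(1) _ _ rep] by blast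
qed

section \<open>Normalised annihilators and their semilinearity\<close>

context
  fixes x0 \<eta>0 assumes x0: "x0 \<in> S" "x0 \<noteq> 0" and an0: "annihilator S V x0 \<eta>0"
begin

text \<open>The multiple of the annihilator of \<open>v\<close> normalised by the requirement that \<open>\<eta>0 + \<theta>\<close>
  annihilates \<open>x0 + v\<close>; with this choice \<open>\<theta>\<close> depends \<open>\<sigma>\<close>-semilinearly on \<open>v\<close>.\<close>

definition normalised :: "'v \<Rightarrow> ('v \<Rightarrow> 'a) \<Rightarrow> bool" where
  "normalised v \<theta> \<longleftrightarrow> annihilator S V v \<theta> \<and> (\<forall>N\<in>V. e (\<theta> (N x0)) = - e (\<eta>0 (N v)))"

lemma nD: "normalised v \<theta> \<Longrightarrow> annihilator S V v \<theta>" "normalised v \<theta> \<Longrightarrow> dfun S \<theta>"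
  "normalised v \<theta> \<Longrightarrow> N \<in> V \<Longrightarrow> e (\<theta> (N x0)) = - e (\<eta>0 (N v))"
  unfolding normalised_def using annD[OF ts] by auto

lemma outside_nz: "v \<notin> dline x0 \<Longrightarrow> v \<noteq> 0"
  using dsub_0[OF dsub_dline] by metis

lemma outside_swap: "v \<notin> dline x0 \<Longrightarrow> x0 \<notin> dline v"
proof
  assume v: "v \<notin> dline x0" "x0 \<in> dline v"
  then obtain a where a: "x0 = sc v a" unfolding dline_def by blast
  then have "a \<noteq> 0" using x0(2) by auto
  then have "v = sc x0 (inverse a)" using a by simp
  then show False using v(1) unfolding dline_def by simp
qed

lemma outside_comb:
  assumes "v \<notin> dline x0" "t \<noteq> 0"
  shows "sc x0 s + sc v t \<notin> dline x0"
proof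
  assume "sc x0 s + sc v t \<in> dline x0"
  moreover have "sc x0 s \<in> dline x0" unfolding dline_def by simp
  ultimately have "(sc x0 s + sc v t) - sc x0 s \<in> dline x0" by (rule dsub_diff[OF dsub_dline])
  then have "sc v t \<in> dline x0" by simp
  then show False using assms dsub_sc_iff[OF dsub_dline assms(2)] by blast
qed

text \<open>The equation in \<open>normalised\<close> says that the cross terms of
  \<open>e ((\<eta>0 + \<theta>) (N (x0 + v)))\<close> cancel. An annihilator
  \<open>a \<eta>0 + b \<eta>\<close> of \<open>x0 + v\<close>, divided by \<open>a\<close>,
  provides \<open>\<theta>\<close>.\<close>

lemma n_ex:
  assumes v: "v \<in> S" "v \<notin> dline x0"
  shows "\<exists>\<theta>. normalised v \<theta>"
proof -
  note v0 = outside_nz[OF v(2)]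
  obtain \<eta> where an: "annihilator S V v \<eta>" using ann_ex[OF v(1) v0] by blast
  have s: "x0 + v \<in> S" using dsub_add[OF ft(1) x0(1) v(1)] .
  have "x0 + v \<noteq> 0" using outside_nz[OF outside_comb[OF v(2), of 1 1]] by simp
  then obtain \<zeta> where ze: "annihilator S V (x0 + v) \<zeta>" using ann_ex[OF s] by blast
  obtain a b where ab: "a \<in> F" "b \<in> F" "a \<noteq> 0" "b \<noteq> 0" "\<And>p. p \<in> S \<Longrightarrow> \<zeta> p = a * \<eta>0 p + b * \<eta> p"
    using ann_sum[OF x0 v an0 an ze] by blast
  define c where "c = inverse a * b"
  have c: "c \<in> F" "c \<noteq> 0" unfolding c_def using F_mult[OF F_inverse[OF ab(1)] ab(2)] ab(3,4) by auto
  have "normalised v (\<lambda>p. c * \<eta> p)" unfolding normalised_def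
  proof (intro conjI ballI)
    show "annihilator S V v (\<lambda>p. c * \<eta> p)"
      by (rule annI[OF v(1) v0 dfun_scale[OF annD[OF ts an]] _ v(1)])
        (use ann_ev[OF ts an _ v(1)] ann_nz'[OF ts an v(1) v0] c in \<open>auto simp: e_sm\<close>)
    fix N assume N: "N \<in> V"
    note Ns = ft(6)[OF N x0(1)] ft(6)[OF N v(1)]
    have "N (x0 + v) = N x0 + N v" using dlin_add[OF ft(5)[OF N] x0(1) v(1)] .
    then have "e (\<zeta> (N x0)) + e (\<zeta> (N v)) = 0"
      using ann_ev[OF ts ze N s] dfun_add[OF annD[OF ts ze] Ns] by (simp add: e_add)
    moreover have "e (\<zeta> (N x0)) = b * e (\<eta> (N x0))"
      using ab(5)[OF Ns(1)] ann_ev[OF ts an0 N x0(1)] ab(1,2) by (simp add: e_add e_sm)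
    moreover have "e (\<zeta> (N v)) = a * e (\<eta>0 (N v))"
      using ab(5)[OF Ns(2)] ann_ev[OF ts an N v(1)] ab(1,2) by (simp add: e_add e_sm)
    ultimately have "b * e (\<eta> (N x0)) = - (a * e (\<eta>0 (N v)))" by (simp add: eq_neg_iff_add_eq_0)
    then have "inverse a * (b * e (\<eta> (N x0))) = - e (\<eta>0 (N v))"
      using ab(3) by (simp add: mult.assoc[symmetric])
    then have "c * e (\<eta> (N x0)) = - e (\<eta>0 (N v))" by (simp add: c_def mult.assoc)
    then show "e (c * \<eta> (N x0)) = - e (\<eta>0 (N v))" using e_sm[OF c(1)] by simp
  qed
  then show ?thesis by blast
qed

lemma ann_proportional:
  assumes "v \<in> S" "annihilator S V v \<theta>" "annihilator S V v \<theta>'"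
  obtains c where "c \<in> F" "\<And>p. p \<in> S \<Longrightarrow> \<theta>' p = c * \<theta> p"
proof (rule ann_unique[OF ts assms(2,1) annD[OF ts assms(3)]])
  show "e (\<theta>' (N v)) = 0" if "N \<in> V" for N using ann_ev[OF ts assms(3) that assms(1)] .
qed blast

lemma n_not_x0:
  assumes v: "v \<in> S" "v \<notin> dline x0" and th: "normalised v \<theta>"
  obtains N where "N \<in> V" "e (\<theta> (N x0)) \<noteq> 0"
proof (rule ccontr)
  assume "\<not> thesis"
  then have "\<And>N. N \<in> V \<Longrightarrow> e (\<theta> (N x0)) = 0" using that by blast
  then obtain k where k: "\<And>p. p \<in> S \<Longrightarrow> \<theta> p = k * \<eta>0 p" using ann_unique[OF ts an0 x0(1) nD(2)[OF th]] by blast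
  obtain p where "p \<in> S" "\<eta>0 p = 0" "\<theta> p \<noteq> 0" using ann_independent[OF x0 v an0 nD(1)[OF th]] by blast
  then show False using k by simp
qed

text \<open>Two candidates differ by a factor in \<open>F\<close>, and the prescribed values at the
  vectors \<open>N x0\<close>, not all zero, determine the factor.\<close>

lemma n_unique:
  assumes v: "v \<in> S" "v \<notin> dline x0" and th: "normalised v \<theta>" "normalised v \<theta>'" and p: "p \<in> S"
  shows "\<theta>' p = \<theta> p"
proof -
  obtain c where c: "c \<in> F" "\<And>p. p \<in> S \<Longrightarrow> \<theta>' p = c * \<theta> p" using ann_proportional[OF v(1) nD(1)[OF th(1)] nD(1)[OF th(2)]] by blast
  obtain N where N: "N \<in> V" "e (\<theta> (N x0)) \<noteq> 0" using n_not_x0[OF v th(1)] by blast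
  have "c * e (\<theta> (N x0)) = e (c * \<theta> (N x0))" using e_sm[OF c(1)] by simp
  also have "\<dots> = e (\<theta>' (N x0))" using c(2)[OF ft(6)[OF N(1) x0(1)]] by simp
  also have "\<dots> = e (\<theta> (N x0))" using nD(3)[OF th(1) N(1)] nD(3)[OF th(2) N(1)] by simp
  finally have "c * e (\<theta> (N x0)) = e (\<theta> (N x0))" .
  then have "c = 1" using N(2) by simp
  then show ?thesis using c(2)[OF p] by simp
qed

text \<open>The cross terms \<open>s * a * e (\<eta>0 (N v))\<close> and
  \<open>a * s * e (\<theta> (N x0))\<close> cancel by the normalisation. This needs
  \<open>s\<close> and \<open>a\<close> in \<open>F\<close>; general scalars are reached only
  through \<open>n_add\<close>.\<close>

lemma n_comb:
  assumes v: "v \<in> S" "v \<notin> dline x0" and th: "normalised v \<theta>" and s: "s \<in> F" and a: "a \<in> F" "a \<noteq> 0"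
  shows "normalised (sc x0 s + sc v a) (\<lambda>p. s * \<eta>0 p + a * \<theta> p)"
proof -
  let ?y = "sc x0 s + sc v a" and ?z = "\<lambda>p. s * \<eta>0 p + a * \<theta> p"
  note S0 = dsub_sc[OF ft(1) x0(1), of s] and Sv = dsub_sc[OF ft(1) v(1), of a]
  have y: "?y \<in> S" "?y \<noteq> 0" using dsub_add[OF ft(1) S0 Sv] outside_nz[OF outside_comb[OF v(2) a(2)]] by auto
  have Ny: "N ?y = sc (N x0) s + sc (N v) a" if N: "N \<in> V" for N
    using dlin_add[OF ft(5)[OF N] S0 Sv] dlin_sc[OF ft(5)[OF N] x0(1)] dlin_sc[OF ft(5)[OF N] v(1)] by simp
  have ez: "e (w (N ?y)) = s * e (w (N x0)) + a * e (w (N v))" if N: "N \<in> V" and w: "dfun S w" for N w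
    using Ny[OF N] dfun_add[OF w dsub_sc[OF ft(1) ft(6)[OF N x0(1)]] dsub_sc[OF ft(1) ft(6)[OF N v(1)]]]
      dfun_sc[OF w ft(6)[OF N x0(1)]] dfun_sc[OF w ft(6)[OF N v(1)]] s a(1) by (simp add: e_add e_sm_right)
  have z: "dfun S ?z" by (rule dfun_plus[OF dfun_scale[OF annD[OF ts an0]] dfun_scale[OF nD(2)[OF th]]])
  obtain p where p: "p \<in> S" "\<eta>0 p = 0" "\<theta> p \<noteq> 0" using ann_independent[OF x0 v an0 nD(1)[OF th]] by blast
  have "annihilator S V ?y ?z"
  proof (rule annI[OF y z _ p(1)])
    fix N assume N: "N \<in> V"
    have 1: "e (\<eta>0 (N x0)) = 0" "e (\<theta> (N v)) = 0" "e (\<theta> (N x0)) = - e (\<eta>0 (N v))"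
      using ann_ev[OF ts an0 N x0(1)] ann_ev[OF ts nD(1)[OF th] N v(1)] nD(3)[OF th N] by auto
    have "e (?z (N ?y)) = s * e (\<eta>0 (N ?y)) + a * e (\<theta> (N ?y))" using s a(1) by (simp add: e_add e_sm)
    also have "\<dots> = s * (a * e (\<eta>0 (N v))) - a * (s * e (\<eta>0 (N v)))"
      using ez[OF N annD[OF ts an0]] ez[OF N nD(2)[OF th]] 1 by simp
    also have "\<dots> = 0" using F_left_comm[OF s, of a "e (\<eta>0 (N v))"] by simp
    finally show "e (?z (N ?y)) = 0" .
  next
    show "s * \<eta>0 p + a * \<theta> p \<noteq> 0" using p(2,3) a(2) by simp
  qed
  moreover have "e (?z (N x0)) = - e (\<eta>0 (N ?y))" if N: "N \<in> V" for N
    using ez[OF N annD[OF ts an0]] ann_ev[OF ts an0 N x0(1)] nD(3)[OF th N] s a(1) by (simp add: e_add e_sm)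
  ultimately show ?thesis unfolding normalised_def by blast
qed

text \<open>For independent \<open>v\<close> and \<open>w\<close>, \<open>ann_sum\<close> gives
  \<open>\<zeta> = a \<theta> + b \<theta>'\<close>. The defects \<open>1 - a\<close> and
  \<open>1 - b\<close> are coordinates of a vector \<open>y\<close> with
  \<open>e (\<eta>0 (N y)) = 0\<close> for all \<open>N\<close>. Either \<open>y = 0\<close> and
  \<open>a = b = 1\<close>, or \<open>y\<close> is an \<open>F\<close>-multiple of
  \<open>x0\<close>, and then \<open>n_comb\<close> computes the forms at \<open>w\<close> and
  \<open>v + w\<close> from that at \<open>v\<close>. Dependent \<open>v\<close> and
  \<open>w\<close> are made independent by adding \<open>x0\<close> to \<open>w\<close>.\<close>

lemma n_add:
  assumes v: "v \<in> S" "v \<notin> dline x0" and w: "w \<in> S" "w \<notin> dline x0" and vw: "v + w \<notin> dline x0"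
    and th: "normalised v \<theta>" "normalised w \<theta>'" "normalised (v + w) \<zeta>" and p: "p \<in> S"
  shows "\<zeta> p = \<theta> p + \<theta>' p"
proof -
  have indep: "\<zeta> p = \<theta> p + \<theta>' p"
    if v: "v \<in> S" "v \<notin> dline x0" and w: "w \<in> S" "w \<notin> dline x0" and vw: "v + w \<notin> dline x0"
      and th: "normalised v \<theta>" "normalised w \<theta>'" "normalised (v + w) \<zeta>" and wv: "w \<notin> dline v" and p: "p \<in> S"
    for v w \<theta> \<theta>' \<zeta> p
  proof -
    note v0 = outside_nz[OF v(2)] and w0 = outside_nz[OF w(2)]
    obtain a b where ab: "a \<in> F" "b \<in> F" "\<And>p. p \<in> S \<Longrightarrow> \<zeta> p = a * \<theta> p + b * \<theta>' p"
      using ann_sum[OF v(1) v0 w(1) wv nD(1)[OF th(1)] nD(1)[OF th(2)] nD(1)[OF th(3)]] by blast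
    define a' b' where "a' = 1 - a" and "b' = 1 - b"
    have F': "a' \<in> F" "b' \<in> F" unfolding a'_def b'_def using F_diff F_1 ab(1,2) by blast+
    define y where "y = sc v a' + sc w b'"
    have Sy: "sc v a' \<in> S" "sc w b' \<in> S" using dsub_sc[OF ft(1)] v(1) w(1) by blast+
    then have y: "y \<in> S" unfolding y_def by (rule dsub_add[OF ft(1)])
    have diff: "\<theta> p + \<theta>' p - \<zeta> p = a' * \<theta> p + b' * \<theta>' p" if "p \<in> S" for p
      using ab(3)[OF that] by (simp add: a'_def b'_def left_diff_distrib)
    have rel: "e (\<eta>0 (N y)) = - e (\<theta> (N x0) + \<theta>' (N x0) - \<zeta> (N x0))" if N: "N \<in> V" for N
    proof -
      have "N y = sc (N v) a' + sc (N w) b'"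
        unfolding y_def using dlin_add[OF ft(5)[OF N] Sy] dlin_sc[OF ft(5)[OF N] v(1)] dlin_sc[OF ft(5)[OF N] w(1)] by simp
      then have "e (\<eta>0 (N y)) = a' * e (\<eta>0 (N v)) + b' * e (\<eta>0 (N w))"
        using dfun_add[OF annD[OF ts an0] dsub_sc[OF ft(1) ft(6)[OF N v(1)]] dsub_sc[OF ft(1) ft(6)[OF N w(1)]]]
          dfun_sc[OF annD[OF ts an0] ft(6)[OF N v(1)]] dfun_sc[OF annD[OF ts an0] ft(6)[OF N w(1)]] F'
        by (simp add: e_add e_sm_right)
      also have "\<dots> = - e (a' * \<theta> (N x0) + b' * \<theta>' (N x0))"
        using nD(3)[OF th(1) N] nD(3)[OF th(2) N] F' by (simp add: e_add e_sm)
      finally show ?thesis using diff[OF ft(6)[OF N x0(1)]] by simp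
    qed
    have zero: "e (\<theta> (N x0) + \<theta>' (N x0) - \<zeta> (N x0)) = 0" if N: "N \<in> V" for N
    proof -
      have "N (v + w) = N v + N w" using dlin_add[OF ft(5)[OF N] v(1) w(1)] .
      then show ?thesis
        using nD(3)[OF th(1) N] nD(3)[OF th(2) N] nD(3)[OF th(3) N]
          dfun_add[OF annD[OF ts an0] ft(6)[OF N v(1)] ft(6)[OF N w(1)]] by (simp add: e_add e_diff)
    qed
    show ?thesis
    proof (cases "y = 0")
      case True
      have "b' = 0"
      proof (rule ccontr)
        assume b0: "b' \<noteq> 0"
        have "sc w b' = sc v (- a')" using True unfolding y_def by (simp add: sc_uminus_right eq_neg_iff_add_eq_0 add.commute)
        then have "sc w b' \<in> dline v" unfolding dline_def by simp
        then show False using dsub_sc_iff[OF dsub_dline b0] wv by blast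
      qed
      moreover from this have "a' = 0" using True v0 sc_eq_0 unfolding y_def by simp
      ultimately show ?thesis using diff[OF p] by simp
    next
      case False
      have ey: "e (\<eta>0 (N y)) = 0" if "N \<in> V" for N using rel[OF that] zero[OF that] by simp
      have any: "annihilator S V y \<eta>0"
        by (rule annI[OF y False annD[OF ts an0] _ x0(1) ann_nz'[OF ts an0 x0]]) (rule ey)
      \<comment> \<open>Vectors with a common annihilator are dependent. The factor \<open>c\<close>
        in \<open>y = sc x0 c\<close> will be in \<open>F\<close>, because
        \<open>inverse c * \<eta>0\<close> annihilates \<open>y\<close> too.\<close>
      have "y \<in> dline x0"
      proof (rule ccontr)
        assume "y \<notin> dline x0"
        then obtain q where "q \<in> S" "\<eta>0 q = 0" "\<eta>0 q \<noteq> 0" using ann_independent[OF x0 y _ an0 any] by blast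
        then show False by simp
      qed
      then obtain c where c: "y = sc x0 c" unfolding dline_def by blast
      have c0: "c \<noteq> 0" using c False by auto
      have anc: "annihilator S V y (\<lambda>v. inverse c * \<eta>0 v)" unfolding c by (rule ann_sc[OF x0 an0 c0])
      obtain k where k: "k \<in> F" "\<And>q. q \<in> S \<Longrightarrow> inverse c * \<eta>0 q = k * \<eta>0 q"
        using ann_proportional[OF y any anc] by blast
      have "inverse c = k" using k(2)[OF x0(1)] ann_nz'[OF ts an0 x0] by simp
      then have cF: "c \<in> F" using F_inverse[OF k(1)] by (metis inverse_inverse_eq)
      have b0: "b' \<noteq> 0"
      proof
        assume "b' = 0"
        then have "sc v a' \<in> dline x0" using c unfolding y_def dline_def by auto
        moreover have "a' \<noteq> 0" using False \<open>b' = 0\<close> unfolding y_def by auto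
        ultimately show False using dsub_sc_iff[OF dsub_dline] v(2) by blast
      qed
      define s t where "s = c * inverse b'" and "t = - (a' * inverse b')"
      have st: "s \<in> F" "t \<in> F" unfolding s_def t_def
        using F_mult[OF cF F_inverse[OF F'(2)]] F_uminus[OF F_mult[OF F'(1) F_inverse[OF F'(2)]]] by auto
      have weq: "w = sc x0 s + sc v t"
      proof -
        have "sc w b' = y + sc v (- a')" unfolding y_def by (simp add: sc_uminus_right)
        then have "sc w b' = sc x0 c + sc v (- a')" using c by simp
        then have "sc (sc w b') (inverse b') = sc (sc x0 c) (inverse b') + sc (sc v (- a')) (inverse b')"
          by (simp add: sc_add)
        then show ?thesis using b0 by (simp add: s_def t_def sc_mult[symmetric])
      qed
      have t0: "t \<noteq> 0"
      proof
        assume "t = 0"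
        then show False using weq w(2) unfolding dline_def by simp
      qed
      have vweq: "v + w = sc x0 s + sc v (t + 1)" using weq by (simp add: sc_add_right algebra_simps)
      have t1: "t + 1 \<noteq> 0"
      proof
        assume "t + 1 = 0"
        then show False using vweq vw unfolding dline_def by simp
      qed
      have "\<theta>' p = s * \<eta>0 p + t * \<theta> p"
        by (rule n_unique[OF w _ th(2) p]) (unfold weq, rule n_comb[OF v th(1) st t0])
      moreover have "\<zeta> p = s * \<eta>0 p + (t + 1) * \<theta> p"
        by (rule n_unique[OF dsub_add[OF ft(1) v(1) w(1)] vw _ th(3) p])
          (unfold vweq, rule n_comb[OF v th(1) st(1) F_add[OF st(2) F_1] t1])
      ultimately show ?thesis by (simp add: algebra_simps)
    qed
  qed
  show ?thesis
  proof (cases "w \<in> dline v")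
    case False
    then show ?thesis using indep[OF v w vw th _ p] by blast
  next
    case True
    have x0v: "x0 \<notin> dline v" by (rule outside_swap[OF v(2)])
    have shift: "x0 + u \<in> S" "x0 + u \<notin> dline x0" "normalised (x0 + u) (\<lambda>p. \<eta>0 p + \<tau> p)"
      if "u \<in> S" "u \<notin> dline x0" "normalised u \<tau>" for u \<tau>
      using dsub_add[OF ft(1) x0(1) that(1)] outside_comb[OF that(2), of 1 1] n_comb[OF that F_1 F_1] by auto
    have xw: "x0 + w \<notin> dline v"
    proof
      assume "x0 + w \<in> dline v"
      then have "x0 + w - w \<in> dline v" by (rule dsub_diff[OF dsub_dline _ True])
      then show False using x0v by simp
    qed
    have vwS: "v + w \<in> S" using dsub_add[OF ft(1) v(1) w(1)] .
    \<comment> \<open>The independent case for \<open>v\<close> and \<open>x0 + w\<close>; the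
      additional \<open>\<eta>0\<close> cancels.\<close>
    have eq: "v + (x0 + w) = x0 + (v + w)" by (simp add: algebra_simps)
    have "\<eta>0 p + \<zeta> p = \<theta> p + (\<eta>0 p + \<theta>' p)"
      by (rule indep[OF v shift(1,2)[OF w th(2)] _ th(1) shift(3)[OF w th(2)] _ xw p])
        (unfold eq, rule shift(2)[OF vwS vw th(3)], rule shift(3)[OF vwS vw th(3)])
    then show ?thesis by (simp add: algebra_simps)
  qed
qed

text \<open>By \<open>ann_sc\<close> and \<open>s_inverse\<close> the form at \<open>sc v l\<close>
  is \<open>k * \<sigma> l * \<theta>\<close> with \<open>k \<in> F\<close>, and similarly with
  \<open>k'\<close> for \<open>l + 1\<close>. Additivity gives
  \<open>k' * (\<sigma> l + 1) = k * \<sigma> l + 1\<close>; for \<open>l\<close> outside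
  \<open>F\<close> this forces \<open>k = k' = 1\<close>.\<close>

lemma n_sc:
  assumes v: "v \<in> S" "v \<notin> dline x0" and th: "normalised v \<theta>" and l: "l \<noteq> 0"
  shows "normalised (sc v l) (\<lambda>p. \<sigma> l * \<theta> p)"
proof (cases "l \<in> F")
  case True
  then show ?thesis using n_comb[OF v th F_0 True l] by (simp add: s_F)
next
  case False
  note v0 = outside_nz[OF v(2)]
  have prp: "\<exists>k\<in>F. \<exists>\<zeta>. normalised (sc v m) \<zeta> \<and> (\<forall>p\<in>S. \<zeta> p = k * (\<sigma> m * \<theta> p))" if m: "m \<noteq> 0" for m
  proof -
    have vm: "sc v m \<in> S" "sc v m \<notin> dline x0"
      using dsub_sc[OF ft(1) v(1)] dsub_sc_iff[OF dsub_dline m] v(2) by auto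
    obtain \<zeta> where ze: "normalised (sc v m) \<zeta>" using n_ex[OF vm] by blast
    have an: "annihilator S V (sc v m) (\<lambda>p. inverse m * \<theta> p)" by (rule ann_sc[OF v(1) v0 nD(1)[OF th] m])
    obtain k where k: "k \<in> F" "\<And>p. p \<in> S \<Longrightarrow> \<zeta> p = k * (inverse m * \<theta> p)"
      using ann_proportional[OF vm(1) an nD(1)[OF ze]] by blast
    obtain c where c: "c \<in> F" "inverse m = c * \<sigma> m" using s_inverse[OF m] by blast
    have "\<zeta> p = (k * c) * (\<sigma> m * \<theta> p)" if "p \<in> S" for p using k(2)[OF that] c(2) by (simp add: mult.assoc)
    then show ?thesis using F_mult[OF k(1) c(1)] ze by blast
  qed
  obtain k \<zeta> where k: "k \<in> F" "normalised (sc v l) \<zeta>" "\<forall>p\<in>S. \<zeta> p = k * (\<sigma> l * \<theta> p)" using prp[OF l] by blast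
  have l1: "l + 1 \<noteq> 0"
  proof
    assume "l + 1 = 0"
    then have "l = - 1" by (simp add: eq_neg_iff_add_eq_0)
    then show False using False F_uminus[OF F_1] by simp
  qed
  obtain k' \<zeta>' where k': "k' \<in> F" "normalised (sc v (l + 1)) \<zeta>'" "\<forall>p\<in>S. \<zeta>' p = k' * (\<sigma> (l + 1) * \<theta> p)"
    using prp[OF l1] by blast
  have vl: "sc v l \<in> S" "sc v l \<notin> dline x0" "sc v (l + 1) \<notin> dline x0"
    using dsub_sc[OF ft(1) v(1)] dsub_sc_iff[OF dsub_dline l] dsub_sc_iff[OF dsub_dline l1] v(2) by auto
  have eq: "sc v l + v = sc v (l + 1)" by (simp add: sc_add_right)
  have "\<zeta>' v = \<zeta> v + \<theta> v"
    by (rule n_add[OF vl(1,2) v _ k(2) th _ v(1)]) (use vl(3) k'(2) eq in auto)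
  then have "k' * (\<sigma> (l + 1) * \<theta> v) = k * (\<sigma> l * \<theta> v) + \<theta> v" using k(3) k'(3) v(1) by simp
  then have "(k' * \<sigma> (l + 1)) * \<theta> v = (k * \<sigma> l + 1) * \<theta> v" by (simp add: mult.assoc distrib_right)
  then have "k' * (\<sigma> l + 1) = k * \<sigma> l + 1"
    using ann_nz'[OF ts nD(1)[OF th] v(1) v0] by (simp add: s_add)
  then have kk: "(k' - k) * \<sigma> l = 1 - k'" by (simp add: algebra_simps)
  have "k' = k"
  proof (rule ccontr)
    assume "k' \<noteq> k"
    then have "\<sigma> l = inverse (k' - k) * (1 - k')" using kk by (simp add: kk[symmetric] mult.assoc[symmetric])
    then have "\<sigma> l \<in> F" using F_mult[OF F_inverse[OF F_diff[OF k'(1) k(1)]] F_diff[OF F_1 k'(1)]] by simp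
    then have "l \<in> F" using s_F s_s by metis
    then show False using False by simp
  qed
  then have "k = 1" using kk by simp
  then have ze: "\<zeta> p = \<sigma> l * \<theta> p" if "p \<in> S" for p using k(3) that by simp
  have "annihilator S V (sc v l) (\<lambda>p. \<sigma> l * \<theta> p)"
    using nD(1)[OF k(2)] ze dfun_scale[OF nD(2)[OF th]] unfolding annihilator_def by auto
  moreover have "e (\<sigma> l * \<theta> (N x0)) = - e (\<eta>0 (N (sc v l)))" if "N \<in> V" for N
    using nD(3)[OF k(2) that] ze[OF ft(6)[OF that x0(1)]] by simp
  ultimately show ?thesis unfolding normalised_def by blast
qed

end

text \<open>Normalised forms are available only off the line of \<open>x0\<close>. They are used on
  the hyperplane \<open>K\<close>, which meets that line in zero, while \<open>\<eta>0\<close>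
  serves on the line itself; \<open>\<Theta>\<close> combines the two along the decomposition
  \<open>z = sc x0 l + v\<close>.\<close>

theorem semilinear_form:
  assumes "n \<ge> 1"
  obtains \<Theta> where "\<And>z. z \<in> S \<Longrightarrow> dfun S (\<Theta> z)"
    "\<And>y z p. y \<in> S \<Longrightarrow> z \<in> S \<Longrightarrow> p \<in> S \<Longrightarrow> \<Theta> (y + z) p = \<Theta> y p + \<Theta> z p"
    "\<And>z l p. z \<in> S \<Longrightarrow> p \<in> S \<Longrightarrow> \<Theta> (sc z l) p = \<sigma> l * \<Theta> z p"
    "\<And>z N. z \<in> S \<Longrightarrow> N \<in> V \<Longrightarrow> e (\<Theta> z (N z)) = 0"
    "\<And>z. z \<in> S \<Longrightarrow> z \<noteq> 0 \<Longrightarrow> \<exists>p\<in>S. \<Theta> z p \<noteq> 0"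
proof -
  obtain x0 where x0: "x0 \<in> S" "x0 \<noteq> 0" using max_good[OF ts opt big assms] by blast
  obtain \<eta>0 where an0: "annihilator S V x0 \<eta>0" using ann_ex[OF x0] by blast
  note eta = annD[OF ts an0] and etax = ann_nz'[OF ts an0 x0]
  note Na = n_add[OF x0 an0] and Nc = n_comb[OF x0 an0] and Ns = n_sc[OF x0 an0]
    and Nu = n_unique[OF x0 an0] and Nx = n_ex[OF x0 an0]
    and NDa = nD(1)[OF x0 an0] and NDd = nD(2)[OF x0 an0] and NDe = nD(3)[OF x0 an0]
  let ?n = "normalised x0 \<eta>0"
  define K where "K = {v\<in>S. \<eta>0 v = 0}"
  have Kd: "dsub K" unfolding K_def by (rule dsub_ker[OF ft(1) eta])
  have KS: "v \<in> S" if "v \<in> K" for v using that unfolding K_def by blast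
  have Kout: "v \<notin> dline x0" if v: "v \<in> K" "v \<noteq> 0" for v
  proof
    assume "v \<in> dline x0"
    then obtain a where a: "v = sc x0 a" unfolding dline_def by blast
    have "\<eta>0 x0 * a = 0" using v(1) dfun_sc[OF eta x0(1)] unfolding K_def a by simp
    then show False using etax v(2) a by simp
  qed
  \<comment> \<open>The choice is unique on \<open>S\<close> by \<open>n_unique\<close>; the value
    at \<open>0\<close> is the one that additivity requires.\<close>
  define T where "T v = (if v = 0 then (\<lambda>p. 0) else (SOME \<theta>. ?n v \<theta>))" for v
  have T: "?n v (T v)" if v: "v \<in> K" "v \<noteq> 0" for v
    unfolding T_def using someI_ex[OF Nx[OF KS[OF v(1)] Kout[OF v]]] v(2) by simp
  have T0: "T 0 p = 0" for p by (simp add: T_def)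
  have Td: "dfun S (T v)" if "v \<in> K" for v
    using NDd[OF T[OF that]] by (cases "v = 0") (auto simp: T_def dfun_def)
  have Tsc: "T (sc v l) p = \<sigma> l * T v p" if v: "v \<in> K" and p: "p \<in> S" for v l p
  proof (cases "v = 0 \<or> l = 0")
    case True
    then show ?thesis by (auto simp: T0)
  next
    case False
    then have vl: "sc v l \<in> K" "sc v l \<noteq> 0" using dsub_sc[OF Kd v] sc_eq_0 by auto
    show ?thesis
      by (rule Nu[OF KS[OF vl(1)] Kout[OF vl] _ T[OF vl] p]) (use Ns[OF KS[OF v] Kout[OF v]] T[OF v] False in auto)
  qed
  have Tadd: "T (v + w) p = T v p + T w p" if v: "v \<in> K" and w: "w \<in> K" and p: "p \<in> S" for v w p
  proof (cases "v = 0 \<or> w = 0")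
    case True
    then show ?thesis by (auto simp: T0)
  next
    case False
    then have v0: "v \<noteq> 0" and w0: "w \<noteq> 0" by auto
    show ?thesis
    proof (cases "v + w = 0")
      case True
      then have "w = sc v (- 1)" by (simp add: sc_uminus_right eq_neg_iff_add_eq_0 add.commute)
      then have "T w p = - T v p" using Tsc[OF v p, of "- 1"] s_uminus[of 1] by simp
      then show ?thesis using True T0 by simp
    next
      case vw: False
      have vwK: "v + w \<in> K" using dsub_add[OF Kd v w] .
      show ?thesis
        by (rule Na[OF KS[OF v] Kout[OF v v0] KS[OF w] Kout[OF w w0] Kout[OF vwK vw] T[OF v v0] T[OF w w0] T[OF vwK vw] p])
    qed
  qed
  define co where "co z = inverse (\<eta>0 x0) * \<eta>0 z" for z
  define pr where "pr z = z - sc x0 (co z)" for z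
  have pr: "pr z \<in> K" if "z \<in> S" for z
    unfolding pr_def co_def K_def by (rule good_decomp[OF ts opt big x0 fr_rank[OF x0] an0 that])
  have co_add: "co (y + z) = co y + co z" if "y \<in> S" "z \<in> S" for y z
    unfolding co_def using dfun_add[OF eta that] by (simp add: distrib_left)
  have co_sc: "co (sc z l) = co z * l" if "z \<in> S" for z l
    unfolding co_def using dfun_sc[OF eta that] by (simp add: mult.assoc)
  have pr_add: "pr (y + z) = pr y + pr z" if "y \<in> S" "z \<in> S" for y z
    unfolding pr_def using co_add[OF that] by (simp add: sc_add_right)
  have pr_sc: "pr (sc z l) = sc (pr z) l" if "z \<in> S" for z l
    unfolding pr_def using co_sc[OF that] by (simp add: sc_diff sc_mult)
  define \<Theta> where "\<Theta> z p = \<sigma> (co z) * \<eta>0 p + T (pr z) p" for z p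
  show ?thesis
  proof (rule that[of \<Theta>])
    fix z assume z: "z \<in> S"
    show "dfun S (\<Theta> z)" unfolding \<Theta>_def by (rule dfun_plus[OF dfun_scale[OF eta] Td[OF pr[OF z]]])
  next
    fix y z p assume "y \<in> S" "z \<in> S" "p \<in> S"
    then show "\<Theta> (y + z) p = \<Theta> y p + \<Theta> z p"
      unfolding \<Theta>_def using Tadd[OF pr pr] by (simp add: co_add pr_add s_add distrib_right)
  next
    fix z l p assume "z \<in> S" "p \<in> S"
    then show "\<Theta> (sc z l) p = \<sigma> l * \<Theta> z p"
      unfolding \<Theta>_def using Tsc[OF pr] by (simp add: co_sc pr_sc s_mult distrib_left mult.assoc)
  next
    fix z N assume z: "z \<in> S" and N: "N \<in> V"
    define l v where "l = co z" and "v = pr z"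
    have vK: "v \<in> K" unfolding v_def by (rule pr[OF z])
    have vS: "v \<in> S" using KS[OF vK] .
    have zl: "z = sc x0 l + v" by (simp add: l_def v_def pr_def)
    note NS = ft(6)[OF N x0(1)] ft(6)[OF N vS]
    have Nz: "N z = sc (N x0) l + N v"
      unfolding zl using dlin_add[OF ft(5)[OF N] dsub_sc[OF ft(1) x0(1)] vS] dlin_sc[OF ft(5)[OF N] x0(1)] by simp
    have w: "w (N z) = w (N x0) * l + w (N v)" if "dfun S w" for w
      unfolding Nz using dfun_add[OF that dsub_sc[OF ft(1) NS(1)] NS(2)] dfun_sc[OF that NS(1)] by simp
    have "e (\<Theta> z (N z)) = e (\<sigma> l * (\<eta>0 (N x0) * l)) + e (\<sigma> l * \<eta>0 (N v)) + (e (T v (N x0) * l) + e (T v (N v)))"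
      unfolding \<Theta>_def l_def[symmetric] v_def[symmetric] using w[OF eta] w[OF Td[OF vK]]
      by (simp add: distrib_left e_add)
    moreover have "e (\<sigma> l * (\<eta>0 (N x0) * l)) = 0"
    proof -
      \<comment> \<open>Cyclic rotation under \<open>e\<close> brings the norm
        \<open>l * \<sigma> l\<close>, an element of \<open>F\<close>, to the front.\<close>
      have "e (\<sigma> l * (\<eta>0 (N x0) * l)) = e (l * \<sigma> l * \<eta>0 (N x0))"
        using e_comm[of "\<sigma> l * \<eta>0 (N x0)" l] by (simp add: mult.assoc)
      then show ?thesis using e_sm[OF s_norm] ann_ev[OF ts an0 N x0(1)] by simp
    qed
    moreover have "e (T v (N v)) = 0"
      using ann_ev[OF ts NDa[OF T[OF vK]] N vS] by (cases "v = 0") (auto simp: T0)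
    moreover have "e (\<sigma> l * \<eta>0 (N v)) + e (T v (N x0) * l) = 0"
    proof (cases "v = 0 \<or> l = 0")
      case True
      then show ?thesis using dlin_0[OF ft(1) ft(5)[OF N]] dfun_0[OF ft(1) eta] by (auto simp: T0)
    next
      case False
      \<comment> \<open>The normalisation at this vector is exactly the cancellation of the two
        mixed terms.\<close>
      let ?v = "sc v (\<sigma> l)"
      have v': "?v \<in> K" "?v \<noteq> 0" using dsub_sc[OF Kd vK] False sc_eq_0 by auto
      have "e (T ?v (N x0)) = - e (\<eta>0 (N ?v))" by (rule NDe[OF T[OF v'] N])
      moreover have "T ?v (N x0) = l * T v (N x0)" using Tsc[OF vK NS(1)] by simp
      moreover have "\<eta>0 (N ?v) = \<eta>0 (N v) * \<sigma> l"
        using dlin_sc[OF ft(5)[OF N] vS] dfun_sc[OF eta NS(2)] by simp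
      ultimately show ?thesis using e_comm[of l] e_comm[of "\<sigma> l"] by simp
    qed
    ultimately show "e (\<Theta> z (N z)) = 0" by (simp add: algebra_simps)
  next
    fix z assume z: "z \<in> S" "z \<noteq> 0"
    have vK: "pr z \<in> K" by (rule pr[OF z(1)])
    show "\<exists>p\<in>S. \<Theta> z p \<noteq> 0"
    proof (cases "pr z = 0")
      case True
      then have "co z \<noteq> 0" using z(2) unfolding pr_def by auto
      then show ?thesis using True etax x0(1) by (intro bexI[of _ x0]) (auto simp: \<Theta>_def T0)
    next
      case False
      obtain p where "p \<in> S" "\<eta>0 p = 0" "T (pr z) p \<noteq> 0"
        using ann_independent[OF x0 KS[OF vK] Kout[OF vK False] an0 NDa[OF T[OF vK False]]] by blast
      then show ?thesis by (intro bexI[of _ p]) (auto simp: \<Theta>_def)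
    qed
  qed
qed

end

end

section \<open>Division rings of quadratic type\<close>

text \<open>Stated for arbitrary records, so that the spaces occurring in the theorem can be
  compared with those of \<open>fmod\<close>.\<close>

lemma (in linear_map) dim_bij:
  assumes fin: "V.fin_dim" and inj: "\<And>v. v \<in> carrier V \<Longrightarrow> T v = \<zero>\<^bsub>W\<^esub> \<Longrightarrow> v = \<zero>\<^bsub>V\<^esub>" and im: "T ` carrier V = carrier W"
  shows "W.fin_dim" "W.dim = V.dim"
proof -
  have i: "imT = carrier W" using im by (simp add: im_def)
  have k: "kerT = {\<zero>\<^bsub>V\<^esub>}" 
  proof
    show "kerT \<subseteq> {\<zero>\<^bsub>V\<^esub>}" unfolding ker_def using inj by blast
    show "{\<zero>\<^bsub>V\<^esub>} \<subseteq> kerT" unfolding ker_def by simp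
  qed
  interpret Z: vectorspace K "V.vs kerT" by (rule V.subspace_is_vs[OF kerT_is_subspace])
  have "Z.span {} = {\<zero>\<^bsub>V\<^esub>}" using Z.span_empty by simp
  moreover have "Z.lin_indpt {}" by (simp add: Z.lin_dep_def)
  ultimately have "Z.basis {}" unfolding Z.basis_def using k by simp
  then have "Z.dim = 0" using Z.dim_basis[of "{}"] by simp
  then show "W.fin_dim" "W.dim = V.dim"
    using rank_nullity_main[OF fin] i im by simp_all
qed

context central_sub
begin

text \<open>\<open>ring_module\<close> and \<open>frec UNIV\<close> are different records on the
  same space; the identity is an isomorphism between them.\<close>

lemma degree_dm:
  assumes "finite_degree F" "degree_over F = d"
  shows "fmod.fd F (*) (UNIV :: 'a set)" "fmod.dm F (*) (UNIV :: 'a set) = d"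
proof -
  interpret D: fmod F "(*)" by unfold_locales (auto simp: algebra_simps)
  have R: "module (scalars F) (ring_module :: ('a, 'a) module)"
    using D.vectorspace_frec[OF D.fsub_UNIV] unfolding vectorspace_def module_def module_axioms_def abelian_group_def
      abelian_group_axioms_def abelian_monoid_def comm_group_def comm_monoid_def comm_monoid_axioms_def group_def group_axioms_def
      monoid_def D.frec_def ring_module_def by (simp add: Units_def)
  interpret L: linear_map "scalars F" "ring_module :: ('a, 'a) module" "D.frec UNIV" "\<lambda>x. x"
    using D.vectorspace_frec[OF D.fsub_UNIV] R field_scalars
    unfolding linear_map_def mod_hom_def mod_hom_axioms_def vectorspace_def module_hom_def
    by (auto simp: ring_module_def)
  have "L.V.fin_dim" using assms(1) unfolding finite_degree_def .
  from L.dim_bij[OF this] have "L.W.fin_dim" "L.W.dim = L.V.dim" by (auto simp: ring_module_def)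
  then show "D.fd UNIV" "D.dm UNIV = d"
    using assms(2) D.fsub_UNIV by (auto simp: D.fd_def D.dm_def degree_over_def)
qed

lemma quad_of_associated_pair:
  assumes fin: "finite_degree F" and deg: "degree_over F = d" and pair: "associated_pair F \<sigma> e"
  shows "quad F \<sigma> e d"
proof -
  interpret D: fmod F "(*)" by unfold_locales (auto simp: algebra_simps)
  note fd = degree_dm(1)[OF fin deg] and dm = degree_dm(2)[OF fin deg]
  have lin: "e x \<in> F" "e (x + y) = e x + e y" "a \<in> F \<Longrightarrow> e (a * x) = a * e x" for x y a
    using pair unfolding associated_pair_def linear_form_def linear_over_def by auto
  have Fl: "D.fline 1 = F" by (auto simp: D.fline_def)
  have dF: "D.dm F = 1" "D.fd F" using D.dm_fline[of 1] D.fline_fd[of 1] Fl by auto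
  have neg: "x = - x" if "(1 :: 'a) = - 1" for x :: 'a
    using arg_cong[where f="\<lambda>c. c * x", OF that] by (simp only: mult_1 mult_minus_left)
  have quadI: "quad F \<sigma> e d" if "\<And>x y. e (x * y) = e (y * x)" "\<exists>x. e x \<noteq> 0"
     "\<And>x y. \<sigma> (x + y) = \<sigma> x + \<sigma> y" "\<And>x y. \<sigma> (x * y) = \<sigma> y * \<sigma> x" "\<And>x. \<sigma> (\<sigma> x) = x" "\<And>a. a \<in> F \<Longrightarrow> \<sigma> a = a"
     "\<And>x. x * \<sigma> x \<in> F" "\<And>x. e (\<sigma> x) = e x" "\<And>x. e x = 0 \<Longrightarrow> \<sigma> x = - x"
    by (unfold_locales; fact lin that fd dm)
  \<comment> \<open>This serves cases (ii) and (iii), where \<open>e\<close> is the sum of the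
    identity and \<open>\<sigma>\<close>.\<close>
  have sum: "quad F \<sigma> e d" if e: "\<And>x. e x = x + \<sigma> x" and n: "\<exists>x. e x \<noteq> 0"
      and s: "\<And>x y. \<sigma> (x + y) = \<sigma> x + \<sigma> y" "\<And>x y. \<sigma> (x * y) = \<sigma> y * \<sigma> x" "\<And>x. \<sigma> (\<sigma> x) = x"
        "\<And>a. a \<in> F \<Longrightarrow> \<sigma> a = a" "\<And>x. x * \<sigma> x \<in> F"
  proof (rule quadI[OF _ n s])
    show "e (x * y) = e (y * x)" for x y
    proof -
      have se: "\<sigma> x = e x - x" "\<sigma> y = e y - y" using e by simp_all
      have c: "e x * y = y * e x" "e y * x = x * e y" "e y * e x = e x * e y" using F_comm[OF lin(1)] by blast+
      show ?thesis unfolding e[of "x * y"] e[of "y * x"] s(2) se by (simp add: algebra_simps c)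
    qed
    show "e (\<sigma> x) = e x" for x using e s(3) by (simp add: add.commute)
    show "\<sigma> x = - x" if "e x = 0" for x using that e by (simp add: eq_neg_iff_add_eq_0 add.commute)
  qed
  consider (i) "quad_type_i F" "\<sigma> = id" | (ii) "quad_type_ii F" "\<sigma> \<in> field_automorphisms F" "\<sigma> \<noteq> id"
    | (iii) "quad_type_iii F" "quaternionic_conjugation F \<sigma>" | (iv) "quad_type_iv F" "\<sigma> = id"
    using pair unfolding associated_pair_def standard_involution_def by blast
  then show ?thesis
  proof cases
    case i
    \<comment> \<open>In degree \<open>1\<close> the only automorphism over \<open>F\<close> is the
      identity, so the trace is the identity.\<close>
    have "D.dm UNIV = 1" using i(1) dm deg unfolding quad_type_i_def by simp
    then have F: "F = UNIV" using D.fd_mono(3)[OF fd D.fd_fsub[OF dF(2)]] dF(1) by simp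
    have "field_automorphisms F = {id}" unfolding field_automorphisms_def F by auto
    then have e: "e x = x" for x using pair i(1) unfolding associated_pair_def galois_trace_def by simp
    show ?thesis by (rule quadI) (use F F_comm i(2) e in \<open>auto intro!: exI[of _ 1]\<close>)
  next
    case ii
    have comm: "x * y = y * x" for x y :: 'a
      using ii(1) unfolding quad_type_ii_def separable_field_extension_def commutative_ring_def by blast
    have aut: "\<tau> (x + y) = \<tau> x + \<tau> y" "\<tau> (x * y) = \<tau> x * \<tau> y" "a \<in> F \<Longrightarrow> \<tau> a = a"
      if "\<tau> \<in> field_automorphisms F" for \<tau> x y a using that unfolding field_automorphisms_def by auto
    note s = aut[OF ii(2)]
    obtain x0 where x0: "\<sigma> x0 \<noteq> x0" using ii(3) by (auto simp: fun_eq_iff)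
    \<comment> \<open>In degree \<open>2\<close>, \<open>1\<close> and any \<open>x\<close> outside
      \<open>F\<close> form a basis, so an automorphism is determined by its value at
      \<open>x\<close>.\<close>
    have span: "\<exists>a\<in>F. \<exists>b\<in>F. y = a + b * x" if x: "x \<notin> F" for x y
    proof -
      have xn: "x \<noteq> 0" using x by auto
      have "F \<inter> D.fline x = {0}"
      proof -
        have "z = 0" if z: "z \<in> F" "z \<in> D.fline x" for z
        proof (rule ccontr)
          assume z0: "z \<noteq> 0"
          obtain c where c: "c \<in> F" "z = c * x" using z(2) unfolding D.fline_def by auto
          then have "c \<noteq> 0" using z0 by auto
          then have "x = inverse c * z" using c(2) by (simp add: mult.assoc[symmetric])
          then show False using x F_mult[OF F_inverse[OF c(1)] z(1)] by simp
        qed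
        then show ?thesis using D.fsub_0[OF D.fsub_fline] by auto
      qed
      note p = D.dm_fplus[OF dF(2) D.fline_fd this]
      have "D.dm (D.fplus F (D.fline x)) = D.dm UNIV"
        using p(2) dF(1) D.dm_fline[OF xn] dm deg ii(1) unfolding quad_type_ii_def by simp
      then have "D.fplus F (D.fline x) = UNIV" by (rule D.fd_mono(3)[OF fd D.fd_fsub[OF p(1)] subset_UNIV])
      then have "y \<in> D.fplus F (D.fline x)" by simp
      then show ?thesis unfolding D.fplus_def D.fline_def by auto
    qed
    have x0F: "x0 \<notin> F" using x0 s(3) by blast
    obtain b a where ab: "a \<in> F" "b \<in> F" "x0 * x0 = b + a * x0" using span[OF x0F] by blast
    \<comment> \<open>Any \<open>\<tau>\<close> sends \<open>x0\<close> to a root of the quadratic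
      equation of \<open>x0\<close>, and these roots are \<open>x0\<close> and
      \<open>a - x0\<close>. It follows that \<open>id\<close> and \<open>\<sigma>\<close> are the
      only automorphisms.\<close>
    have root: "\<tau> x0 = x0 \<or> \<tau> x0 = a - x0" if t: "\<tau> \<in> field_automorphisms F" for \<tau>
    proof -
      have "\<tau> x0 * \<tau> x0 = b + a * \<tau> x0"
        using arg_cong[OF ab(3), of \<tau>] aut[OF t] ab(1,2) by simp
      then have "(\<tau> x0 - x0) * (\<tau> x0 - (a - x0)) = 0"
        using ab(3) comm[of x0 "\<tau> x0"] comm[of x0 a] comm[of "\<tau> x0" a] by (simp add: algebra_simps)
      then show ?thesis by simp
    qed
    have determined: "\<tau> y = \<tau>' y" if t: "\<tau> \<in> field_automorphisms F" "\<tau>' \<in> field_automorphisms F" "\<tau> x = \<tau>' x" "x \<notin> F" for \<tau> \<tau>' x y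
      using span[OF t(4), of y] aut[OF t(1)] aut[OF t(2)] t(3) by auto
    have idA: "id \<in> field_automorphisms F" unfolding field_automorphisms_def by simp
    have sx: "\<sigma> x0 = a - x0" using root[OF ii(2)] x0 by blast
    have fixed: "y \<in> F" if "\<sigma> y = y" for y
    proof (rule ccontr)
      assume "y \<notin> F"
      then have "\<sigma> x0 = id x0" using determined[OF ii(2) idA, of y x0] that by simp
      then show False using x0 by simp
    qed
    have "\<tau> = id \<or> \<tau> = \<sigma>" if t: "\<tau> \<in> field_automorphisms F" for \<tau>
    proof (cases "\<tau> x0 = x0")
      case True
      then have "\<tau> x0 = id x0" by simp
      have "\<tau> = id" by (rule ext) (rule determined[OF t idA \<open>\<tau> x0 = id x0\<close> x0F])
      then show ?thesis by (rule disjI1)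
    next
      case False
      then have "\<tau> x0 = \<sigma> x0" using root[OF t] sx by simp
      have "\<tau> = \<sigma>" by (rule ext) (rule determined[OF t ii(2) \<open>\<tau> x0 = \<sigma> x0\<close> x0F])
      then show ?thesis by (rule disjI2)
    qed
    then have fa: "field_automorphisms F = {id, \<sigma>}" using idA ii(2) by blast
    have e: "e x = x + \<sigma> x" for x
      using pair ii(1,3) fa unfolding associated_pair_def galois_trace_def by simp
    have ss: "\<sigma> (\<sigma> y) = y" for y
    proof -
      obtain u v where uv: "u \<in> F" "v \<in> F" "y = u + v * x0" using span[OF x0F] by blast
      have "\<sigma> (a - x0) = x0" using s(1)[of "a - x0" x0] s(3)[OF ab(1)] sx by (simp add: algebra_simps)
      then show ?thesis unfolding uv(3) s(1,2) sx using s(1-3) uv(1,2) sx by simp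
    qed
    show ?thesis
    proof (rule sum[OF e _ s(1) _ ss s(3)])
      \<comment> \<open>A vanishing trace gives \<open>1 = - 1\<close> and
        \<open>\<sigma> x0 = - x0 = x0\<close>, against the choice of \<open>x0\<close>.\<close>
      show "\<exists>x. e x \<noteq> 0"
      proof (rule ccontr)
        assume "\<nexists>x. e x \<noteq> 0"
        then have z: "x + \<sigma> x = 0" for x using e by simp
        have "(1 :: 'a) = - 1" using z[of 1] s(3)[OF F_1] by (simp add: eq_neg_iff_add_eq_0)
        then have "x0 = - x0" by (rule neg)
        moreover have "\<sigma> x0 = - x0" using z[of x0] by (simp only: add_eq_0_iff)
        ultimately show False using x0 by metis
      qed
      show "\<sigma> (x * y) = \<sigma> y * \<sigma> x" for x y using s(2) comm by simp
      show "x * \<sigma> x \<in> F" for x by (rule fixed) (simp add: s(2) ss comm)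
    qed
  next
    case iii
    have s: "\<sigma> (x + y) = \<sigma> x + \<sigma> y" "\<sigma> (x * y) = \<sigma> y * \<sigma> x" "\<sigma> (\<sigma> x) = x" "x * \<sigma> x \<in> F" "a \<in> F \<Longrightarrow> \<sigma> (a * x) = a * \<sigma> x" for x y a
      using iii(2) unfolding quaternionic_conjugation_def linear_over_def by auto
    have e: "e x = x + \<sigma> x" for x using pair iii(1) unfolding associated_pair_def by simp
    have "\<sigma> 1 * \<sigma> 1 = \<sigma> 1 * 1" using s(2)[of 1 1] by simp
    moreover have "\<sigma> 1 \<noteq> 0"
    proof
      assume "\<sigma> 1 = 0"
      then have "\<sigma> 0 = 1" using s(3)[of 1] by simp
      moreover have "\<sigma> 0 = 0" using s(1)[of 0 0] by simp
      ultimately show False by simp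
    qed
    ultimately have s1: "\<sigma> 1 = 1" by (simp only: mult_left_cancel not_False_eq_True)
    have sF: "\<sigma> a = a" if "a \<in> F" for a using s(5)[OF that, of 1] s1 by simp
    show ?thesis
    proof (rule sum[OF e _ s(1,2,3) sF s(4)])
      \<comment> \<open>If \<open>e\<close> vanished, \<open>\<sigma>\<close> would be the identity;
        the division ring would be commutative and so equal to its centre \<open>F\<close>, against
        degree \<open>4\<close>.\<close>
      show "\<exists>x. e x \<noteq> 0"
      proof (rule ccontr)
        assume "\<nexists>x. e x \<noteq> 0"
        then have z: "x + \<sigma> x = 0" for x using e by simp
        have one: "(1 :: 'a) = - 1" using z[of 1] s1 by (simp add: eq_neg_iff_add_eq_0)
        have sid: "\<sigma> x = x" for x
        proof -
          have "\<sigma> x = - x" using z[of x] by (simp only: add_eq_0_iff)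
          then show ?thesis using neg[OF one, of x] by metis
        qed
        have "x * y = y * x" for x y :: 'a using s(2)[of x y] sid by simp
        then have "F = UNIV" using iii(1) unfolding quad_type_iii_def quaternion_algebra_def by blast
        then have "D.dm UNIV = 1" using dF(1) by simp
        then show False using iii(1) dm deg unfolding quad_type_iii_def by simp
      qed
    qed
  next
    case iv
    \<comment> \<open>In characteristic \<open>2\<close> the identity satisfies
      \<open>s_skew\<close>, and the norm \<open>x * \<sigma> x\<close> is the square of
      \<open>x\<close>.\<close>
    have two: "x = - x" for x :: 'a
    proof -
      have "(of_nat CHAR('a) :: 'a) = 0" by (rule of_nat_CHAR)
      moreover have "CHAR('a) = 2" using iv(1) unfolding quad_type_iv_def by blast
      ultimately have "(2 :: 'a) = 0" by (simp only: of_nat_numeral)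
      then have "x + x = 0" using mult_2[of x] by simp
      then show ?thesis by (simp add: eq_neg_iff_add_eq_0)
    qed
    show ?thesis
      by (rule quadI) (use iv pair two in \<open>auto simp: quad_type_iv_def commutative_ring_def associated_pair_def fun_eq_iff power2_eq_square\<close>)
  qed
qed

end

section \<open>Matrices as linear maps\<close>

locale quad_mat = quad F \<sigma> e d for F :: "'a::division_ring set" and \<sigma> e d
begin

sublocale R: rspace F \<sigma> e d "\<lambda>(v :: nat \<Rightarrow> 'a) a i. v i * a"
  by unfold_locales (auto simp: fun_eq_iff distrib_left distrib_right mult.assoc)

sublocale L: fmod F "\<lambda>a (v :: nat \<Rightarrow> 'a) i. a * v i" by (rule D.fmod_fun)
sublocale LX: fmod2 F "\<lambda>a (v :: nat \<Rightarrow> 'a) i. a * v i" "\<lambda>a (v :: nat \<Rightarrow> 'a) i. v i * a" ..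
sublocale M: fmod F "\<lambda>a (g :: nat \<times> nat \<Rightarrow> 'a) i. a * g i" by (rule D.fmod_fun)
sublocale MM: fmod2 F "\<lambda>a (g :: nat \<times> nat \<Rightarrow> 'a) i. a * g i" "\<lambda>a (g :: nat \<times> nat \<Rightarrow> 'a) i. a * g i" ..
sublocale ME: fmod2 F "\<lambda>a (g :: nat \<times> nat \<Rightarrow> 'a) i. a * g i" "\<lambda>a (f :: (nat \<Rightarrow> 'a) \<Rightarrow> nat \<Rightarrow> 'a) v i. f v i * a" ..

text \<open>Columns of length \<open>n\<close> are functions vanishing from \<open>n\<close> on, so
  that all sizes live in one type and become subspaces in the sense of
  \<open>rspace\<close>.\<close>

definition sp :: "nat \<Rightarrow> (nat \<Rightarrow> 'a) set" where "sp n = {v. \<forall>i\<ge>n. v i = 0}"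

definition act :: "nat \<Rightarrow> 'a mat \<Rightarrow> (nat \<Rightarrow> 'a) \<Rightarrow> nat \<Rightarrow> 'a" where
  "act n A x = (\<lambda>i. if i < n then (\<Sum>j<n. A $$ (i, j) * x j) else 0)"

definition unit :: "nat \<Rightarrow> nat \<Rightarrow> 'a" where "unit j = (\<lambda>i. if i = j then 1 else 0)"

lemma spI: "(\<And>i. i \<ge> n \<Longrightarrow> v i = 0) \<Longrightarrow> v \<in> sp n" by (simp add: sp_def)
lemma spD: "v \<in> sp n \<Longrightarrow> i \<ge> n \<Longrightarrow> v i = 0" by (simp add: sp_def)
lemma sp_eqI: "v \<in> sp n \<Longrightarrow> w \<in> sp n \<Longrightarrow> (\<And>i. i < n \<Longrightarrow> v i = w i) \<Longrightarrow> v = w"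
proof (rule ext)
  fix i assume "v \<in> sp n" "w \<in> sp n" "\<And>i. i < n \<Longrightarrow> v i = w i"
  then show "v i = w i" using spD[of v n i] spD[of w n i] by (cases "i < n") simp_all
qed

lemma unit_sp [simp]: "j < n \<Longrightarrow> unit j \<in> sp n" by (auto simp: sp_def unit_def)
lemma unit_nz [simp]: "unit j \<noteq> 0"
proof
  assume "unit j = 0"
  then have "unit j j = 0" by simp
  then show False by (simp add: unit_def)
qed

lemma sp_dsub: "R.dsub (sp n)" by (auto simp: R.dsub_def sp_def)

lemma sp_fd: "R.X.fd (sp n)" and sp_dm: "R.X.dm (sp n) = n * d"
proof -
  have s: "{v :: nat \<Rightarrow> 'a. (\<forall>i. i \<notin> {..<n} \<longrightarrow> v i = 0) \<and> (\<forall>i\<in>{..<n}. v i \<in> UNIV)} = sp n"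
    by (auto simp: sp_def)
  have 1: "L.fd (sp n) \<and> L.dm (sp n) = n * d" using D.fd_fun[OF finite_lessThan fd_D, of n] unfolding s dm_D by simp
  have lin: "LX.flin (sp n) (\<lambda>v. v)" by (rule LX.flinI) (simp, simp add: fun_eq_iff F_comm[symmetric])
  show "R.X.fd (sp n)" using LX.rank_nullity(1)[OF conjunct1[OF 1] lin] by simp
  show "R.X.dm (sp n) = n * d" using LX.dm_inj[OF conjunct1[OF 1] lin] 1 by simp
qed

lemma act_sp [simp]: "act n A x \<in> sp n" by (simp add: sp_def act_def)
lemma act_add: "act n A (x + y) = act n A x + act n A y"
  by (auto simp: act_def fun_eq_iff distrib_left sum.distrib)
lemma act_sc: "act n A (\<lambda>i. x i * a) = (\<lambda>i. act n A x i * a)"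
  by (auto simp: act_def fun_eq_iff sum_distrib_right mult.assoc)
lemma act_0 [simp]: "act n A 0 = 0" by (auto simp: act_def fun_eq_iff)
lemma act_dlin: "R.dlin S (act n A)" by (simp add: R.dlin_def act_add act_sc)
lemma act_diff: "act n A (x - y) = act n A x - act n A y"
  by (auto simp: act_def fun_eq_iff right_diff_distrib sum_subtractf)

lemma act_mat_add: "A \<in> carrier_mat n n \<Longrightarrow> B \<in> carrier_mat n n \<Longrightarrow> act n (A + B) x = act n A x + act n B x"
  by (auto simp: act_def fun_eq_iff distrib_right sum.distrib)

lemma act_mat_uminus: "A \<in> carrier_mat n n \<Longrightarrow> act n (- A) x = - act n A x"
  by (auto simp: act_def fun_eq_iff sum_negf)

lemma mult_entry:
  "A \<in> carrier_mat n m \<Longrightarrow> B \<in> carrier_mat m k \<Longrightarrow> i < n \<Longrightarrow> j < k \<Longrightarrow> (A * B) $$ (i, j) = (\<Sum>l<m. A $$ (i, l) * B $$ (l, j))"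
  by (auto simp: scalar_prod_def atLeast0LessThan intro!: sum.cong)

lemma act_mult:
  assumes "A \<in> carrier_mat n n" "B \<in> carrier_mat n n"
  shows "act n (A * B) x = act n A (act n B x)"
proof
  fix i
  show "act n (A * B) x i = act n A (act n B x) i"
  proof (cases "i < n")
    case True
    have "act n (A * B) x i = (\<Sum>j<n. \<Sum>l<n. A $$ (i, l) * B $$ (l, j) * x j)"
      using True by (simp add: act_def mult_entry[OF assms] sum_distrib_right)
    also have "\<dots> = (\<Sum>l<n. \<Sum>j<n. A $$ (i, l) * B $$ (l, j) * x j)" by (rule sum.swap)
    also have "\<dots> = act n A (act n B x) i" using True by (simp add: act_def sum_distrib_left mult.assoc)
    finally show ?thesis .
  qed (simp add: act_def)
qed

lemma act_one: "x \<in> sp n \<Longrightarrow> act n (1\<^sub>m n) x = x"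
  by (rule sp_eqI[OF act_sp]) (auto simp: act_def if_distrib[where f = "\<lambda>c. c * _"] cong: if_cong)

lemma act_unit: "i < n \<Longrightarrow> j < n \<Longrightarrow> act n A (unit j) i = A $$ (i, j)"
  by (auto simp: act_def unit_def if_distrib[where f = "\<lambda>c. _ * c"] cong: if_cong)

lemma act_inj:
  assumes "A \<in> carrier_mat n n" "B \<in> carrier_mat n n" "\<And>x. x \<in> sp n \<Longrightarrow> act n A x = act n B x"
  shows "A = B"
proof (rule eq_matI)
  fix i j assume "i < dim_row B" "j < dim_col B"
  then show "A $$ (i, j) = B $$ (i, j)" using act_unit[of i n j A] act_unit[of i n j B] assms by simp
qed (use assms in auto)

lemma sum_apply: "(\<Sum>j\<in>J. g j) i = (\<Sum>j\<in>J. g j i :: 'a)"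
  by (induction J rule: infinite_finite_induct) auto

lemma act_expand: assumes "x \<in> sp n" shows "x = (\<Sum>j<n. (\<lambda>i. unit j i * x j))"
proof
  fix i
  have "(\<Sum>j<n. (\<lambda>i. unit j i * x j)) i = (\<Sum>j<n. if i = j then x j else 0)"
    unfolding sum_apply by (rule sum.cong) (auto simp: unit_def)
  then show "x i = (\<Sum>j<n. (\<lambda>i. unit j i * x j)) i" using spD[OF assms, of i] by (simp add: not_less)
qed

lemma GL_I:
  assumes "A \<in> carrier_mat n n" "B \<in> carrier_mat n n" "A * B = 1\<^sub>m n" "B * A = 1\<^sub>m n"
  shows "A \<in> GL n"
  using assms unfolding GL_def invertible_mat_def inverts_mat_def by auto

lemma GL_carrier [simp]: "A \<in> GL n \<Longrightarrow> A \<in> carrier_mat n n" by (simp add: GL_def)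

lemma GL_obtain:
  assumes "A \<in> GL n" obtains B where "B \<in> GL n" "A * B = 1\<^sub>m n" "B * A = 1\<^sub>m n"
proof -
  have A: "A \<in> carrier_mat n n" using assms by simp
  obtain B where B: "A * B = 1\<^sub>m (dim_row A)" "B * A = 1\<^sub>m (dim_row B)"
    using assms unfolding GL_def invertible_mat_def inverts_mat_def by auto
  have "dim_col (A * B) = n" "dim_col (B * A) = dim_row B" using A B by auto
  then have "B \<in> carrier_mat n n" using A by auto
  then show ?thesis using that GL_I A B by auto
qed

lemma GL_one [simp]: "1\<^sub>m n \<in> GL n" by (rule GL_I[of _ _ "1\<^sub>m n"]) auto

lemma GL_mult: assumes "A \<in> GL n" "B \<in> GL n" shows "A * B \<in> GL n"
proof -
  obtain A' where A: "A' \<in> GL n" "A * A' = 1\<^sub>m n" "A' * A = 1\<^sub>m n" by (rule GL_obtain[OF assms(1)])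
  obtain B' where B: "B' \<in> GL n" "B * B' = 1\<^sub>m n" "B' * B = 1\<^sub>m n" by (rule GL_obtain[OF assms(2)])
  note c = GL_carrier[OF assms(1)] GL_carrier[OF assms(2)] GL_carrier[OF A(1)] GL_carrier[OF B(1)]
  have "A * B * (B' * A') = A * (B * B') * A'"
    using c by (simp add: assoc_mult_mat[of _ n n _ n _ n])
  moreover have "B' * A' * (A * B) = B' * (A' * A) * B"
    using c by (simp add: assoc_mult_mat[of _ n n _ n _ n])
  ultimately show ?thesis using A B c by (intro GL_I[OF mult_carrier_mat[OF c(1,2)] mult_carrier_mat[OF c(4,3)]]) simp_all
qed

lemma GL_inj: assumes "A \<in> GL n" "x \<in> sp n" "act n A x = 0" shows "x = 0"
proof -
  obtain B where B: "B \<in> GL n" "A * B = 1\<^sub>m n" "B * A = 1\<^sub>m n" by (rule GL_obtain[OF assms(1)])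
  have "x = act n (B * A) x" using act_one[OF assms(2)] B(3) by simp
  then show ?thesis using act_mult[OF GL_carrier[OF B(1)] GL_carrier[OF assms(1)]] assms(3) by simp
qed

lemma act_surj:
  assumes "\<And>x. x \<in> sp n \<Longrightarrow> act n A x = 0 \<Longrightarrow> x = 0"
  shows "act n A ` sp n = sp n"
proof -
  note lin = R.dlin_flin[OF act_dlin, of "sp n" n A]
  have 1: "R.X.dm (act n A ` sp n) = R.X.dm (sp n)" by (rule R.XX.dm_inj[OF sp_fd lin assms])
  have 2: "R.X.fsub (act n A ` sp n)" by (rule R.X.fd_fsub[OF R.XX.rank_nullity(1)[OF sp_fd lin]])
  show ?thesis by (rule R.X.fd_mono(3)[OF sp_fd 2 _ 1]) auto
qed

lemma right_inverse_ex:
  assumes A: "A \<in> carrier_mat n n" and inj: "\<And>x. x \<in> sp n \<Longrightarrow> act n A x = 0 \<Longrightarrow> x = 0"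
  obtains B where "B \<in> carrier_mat n n" "A * B = 1\<^sub>m n"
proof -
  have "\<exists>b. b \<in> sp n \<and> act n A b = unit j" if j: "j < n" for j
  proof -
    have "unit j \<in> act n A ` sp n" using act_surj[OF inj] unit_sp[OF j] by blast
    then show ?thesis by auto
  qed
  then obtain b where b: "\<And>j. j < n \<Longrightarrow> b j \<in> sp n \<and> act n A (b j) = unit j" by metis
  define B where "B = mat n n (\<lambda>(i, j). b j i)"
  have B: "B \<in> carrier_mat n n" by (simp add: B_def)
  have "A * B = 1\<^sub>m n"
  proof (rule eq_matI)
    fix i j assume ij: "i < dim_row (1\<^sub>m n :: 'a mat)" "j < dim_col (1\<^sub>m n :: 'a mat)"
    then have "(A * B) $$ (i, j) = act n A (b j) i" using mult_entry[OF A B] by (simp add: act_def B_def)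
    then show "(A * B) $$ (i, j) = 1\<^sub>m n $$ (i, j)" using b ij by (auto simp: unit_def)
  qed (use A B in auto)
  then show ?thesis using that B by blast
qed

text \<open>Solving for the unit vectors gives a right inverse \<open>B\<close> of \<open>A\<close>.
  Then \<open>B\<close> is injective as well and has a right inverse, which can only be
  \<open>A\<close>.\<close>

lemma inj_GL:
  assumes A: "A \<in> carrier_mat n n" and inj: "\<And>x. x \<in> sp n \<Longrightarrow> act n A x = 0 \<Longrightarrow> x = 0"
  shows "A \<in> GL n"
proof -
  obtain B where B: "B \<in> carrier_mat n n" "A * B = 1\<^sub>m n" by (rule right_inverse_ex[OF A inj])
  have "x = 0" if x: "x \<in> sp n" "act n B x = 0" for x
    using act_mult[OF A B(1), of x] act_one[OF x(1)] B(2) x(2) by simp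
  then obtain C where C: "C \<in> carrier_mat n n" "B * C = 1\<^sub>m n" using right_inverse_ex[OF B(1)] by metis
  have "A = A * (B * C)" using A C(2) by simp
  also have "\<dots> = A * B * C" using A B(1) C(1) by simp
  finally have "A = C" using B(2) C(1) by simp
  then show ?thesis using GL_I[OF A B] C(2) by simp
qed

lemma GL_surj: assumes "A \<in> GL n" "y \<in> sp n" obtains x where "x \<in> sp n" "act n A x = y"
proof -
  have "act n A ` sp n = sp n" by (rule act_surj) (rule GL_inj[OF assms(1)])
  then show ?thesis using that assms(2) by (metis imageE)
qed

text \<open>Padding by zeros places matrices of every size in one vector space of functions, to
  which the dimension theory of \<open>fmod\<close> applies.\<close>

definition flat :: "'a mat \<Rightarrow> nat \<times> nat \<Rightarrow> 'a" where
  "flat A = (\<lambda>(i, j). if i < dim_row A \<and> j < dim_col A then A $$ (i, j) else 0)"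

definition msub :: "nat \<Rightarrow> 'a mat set \<Rightarrow> bool" where
  "msub n W \<longleftrightarrow> W \<subseteq> carrier_mat n n \<and> 0\<^sub>m n n \<in> W \<and> (\<forall>A\<in>W. \<forall>B\<in>W. A + B \<in> W) \<and> (\<forall>a\<in>F. \<forall>A\<in>W. a \<cdot>\<^sub>m A \<in> W)"

definition mdim :: "'a mat set \<Rightarrow> nat" where "mdim W = M.dm (flat ` W)"

definition mlin :: "nat \<Rightarrow> 'a mat set \<Rightarrow> ('a mat \<Rightarrow> 'a mat) \<Rightarrow> bool" where
  "mlin m W f \<longleftrightarrow> f ` W \<subseteq> carrier_mat m m \<and> (\<forall>A\<in>W. \<forall>B\<in>W. f (A + B) = f A + f B) \<and> (\<forall>a\<in>F. \<forall>A\<in>W. f (a \<cdot>\<^sub>m A) = a \<cdot>\<^sub>m f A)"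

lemma msubD: "msub n W \<Longrightarrow> W \<subseteq> carrier_mat n n" "msub n W \<Longrightarrow> 0\<^sub>m n n \<in> W"
  "msub n W \<Longrightarrow> A \<in> W \<Longrightarrow> B \<in> W \<Longrightarrow> A + B \<in> W" "msub n W \<Longrightarrow> a \<in> F \<Longrightarrow> A \<in> W \<Longrightarrow> a \<cdot>\<^sub>m A \<in> W"
  by (auto simp: msub_def)

lemma msub_uminus: assumes "msub n W" "A \<in> W" shows "- A \<in> W"
proof -
  have "- A = (- 1) \<cdot>\<^sub>m A" by (rule eq_matI) auto
  then show ?thesis using msubD(4)[OF assms(1) F_uminus[OF F_1] assms(2)] by simp
qed

lemma msub_diff: assumes "msub n W" "A \<in> W" "B \<in> W" shows "A - B \<in> W"
proof -
  have "A \<in> carrier_mat n n" "B \<in> carrier_mat n n" using msubD(1)[OF assms(1)] assms(2,3) by auto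
  then have "A - B = A + (- B)" by (intro eq_matI) auto
  then show ?thesis using msubD(3)[OF assms(1,2) msub_uminus[OF assms(1,3)]] by simp
qed

lemma flat_mat: "A \<in> carrier_mat n n \<Longrightarrow> mat n n (flat A) = A"
  by (rule eq_matI) (auto simp: flat_def)
lemma flat_inj: "A \<in> carrier_mat n n \<Longrightarrow> B \<in> carrier_mat n n \<Longrightarrow> flat A = flat B \<Longrightarrow> A = B"
  using flat_mat by metis
lemma flat_add: "A \<in> carrier_mat n n \<Longrightarrow> B \<in> carrier_mat n n \<Longrightarrow> flat (A + B) = flat A + flat B"
  by (auto simp: flat_def fun_eq_iff)
lemma flat_smult: "flat (a \<cdot>\<^sub>m A) = (\<lambda>p. a * flat A p)"
  by (auto simp: flat_def fun_eq_iff)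
lemma flat_0: "flat (0\<^sub>m n n) = 0"
  by (auto simp: flat_def fun_eq_iff)
lemma flat_eq_0: "A \<in> carrier_mat n n \<Longrightarrow> flat A = 0 \<longleftrightarrow> A = 0\<^sub>m n n"
  using flat_inj[of A n "0\<^sub>m n n"] flat_0 by auto

definition supp_mat :: "nat \<Rightarrow> (nat \<times> nat) set \<Rightarrow> 'a set \<Rightarrow> 'a mat set" where
  "supp_mat n I K = {A \<in> carrier_mat n n. \<forall>i<n. \<forall>j<n. A $$ (i, j) \<in> (if (i, j) \<in> I then K else {0})}"

lemma flat_supp:
  assumes "I \<subseteq> {..<n} \<times> {..<n}" "D.fd K"
  shows "M.fd (flat ` supp_mat n I K)" "mdim (supp_mat n I K) = card I * D.dm K"
proof -
  have "flat ` supp_mat n I K = {g. (\<forall>i. i \<notin> I \<longrightarrow> g i = 0) \<and> (\<forall>i\<in>I. g i \<in> K)}" (is "_ = ?G")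
  proof (intro equalityI subsetI)
    fix g assume "g \<in> flat ` supp_mat n I K"
    then obtain A where A: "A \<in> carrier_mat n n" "\<And>i j. i < n \<Longrightarrow> j < n \<Longrightarrow> A $$ (i, j) \<in> (if (i, j) \<in> I then K else {0})" "g = flat A"
      unfolding supp_mat_def by blast
    have "flat A (i, j) = 0" if "(i, j) \<notin> I" for i j using A(1) A(2)[of i j] that by (auto simp: flat_def)
    moreover have "flat A (i, j) \<in> K" if "(i, j) \<in> I" for i j
    proof -
      have "i < n" "j < n" using that assms(1) by auto
      then show ?thesis using A(1) A(2)[of i j] that by (simp add: flat_def)
    qed
    ultimately show "g \<in> ?G" using A(3) by auto
  next
    fix g assume g: "g \<in> ?G"
    have "g = flat (mat n n g)" using g assms(1) by (auto simp: flat_def fun_eq_iff)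
    moreover have "mat n n g \<in> supp_mat n I K" using g by (auto simp: supp_mat_def)
    ultimately show "g \<in> flat ` supp_mat n I K" by blast
  qed
  moreover have "finite I" using assms(1) finite_subset by blast
  ultimately show "M.fd (flat ` supp_mat n I K)" "mdim (supp_mat n I K) = card I * D.dm K"
    using D.fd_fun[OF _ assms(2), of I] by (simp_all add: mdim_def)
qed

lemma msub_fsub: assumes "msub n W" shows "M.fsub (flat ` W)"
proof (rule M.fsubI)
  show "0 \<in> flat ` W" using msubD(2)[OF assms] flat_0 by (metis imageI)
next
  fix v w assume "v \<in> flat ` W" "w \<in> flat ` W"
  then obtain A B where AB: "A \<in> W" "B \<in> W" "v = flat A" "w = flat B" by blast
  note c = subsetD[OF msubD(1)[OF assms] AB(1)] subsetD[OF msubD(1)[OF assms] AB(2)]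
  have "v + w = flat (A + B)" using flat_add[OF c] AB(3,4) by simp
  then show "v + w \<in> flat ` W" by (rule image_eqI[OF _ msubD(3)[OF assms AB(1,2)]])
next
  fix a v assume a: "a \<in> F" and "v \<in> flat ` W"
  then obtain A where A: "A \<in> W" "v = flat A" by blast
  then have "(\<lambda>i. a * v i) = flat (a \<cdot>\<^sub>m A)" by (simp add: flat_smult)
  then show "(\<lambda>i. a * v i) \<in> flat ` W" by (rule image_eqI[OF _ msubD(4)[OF assms a A(1)]])
qed

lemma flat_carrier: "M.fd (flat ` carrier_mat n n)"
proof -
  have "supp_mat n ({..<n} \<times> {..<n}) UNIV = carrier_mat n n" by (auto simp: supp_mat_def)
  then show ?thesis using flat_supp(1)[of "{..<n} \<times> {..<n}" n UNIV] fd_D by simp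
qed

lemma msub_fd: assumes "msub n W" shows "M.fd (flat ` W)"
  by (rule M.fd_mono(1)[OF flat_carrier[of n] msub_fsub[OF assms]]) (use msubD(1)[OF assms] in blast)

lemma mdim_mono:
  assumes "msub n W" "msub n W'" "W \<subseteq> W'"
  shows "mdim W \<le> mdim W'" "mdim W = mdim W' \<Longrightarrow> W = W'"
proof -
  note f = msub_fd[OF assms(2)] msub_fsub[OF assms(1)] image_mono[OF assms(3), of flat]
  show "mdim W \<le> mdim W'" unfolding mdim_def by (rule M.fd_mono(2)[OF f])
  assume "mdim W = mdim W'"
  then have e: "flat ` W = flat ` W'" unfolding mdim_def by (rule M.fd_mono(3)[OF f])
  have "inj_on flat (carrier_mat n n)" using flat_inj by (auto intro!: inj_onI)
  then show "W = W'" using inj_on_image_eq_iff[of flat "carrier_mat n n" W W'] e msubD(1) assms(1,2) by blast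
qed

lemma mlinD: "mlin m W f \<Longrightarrow> A \<in> W \<Longrightarrow> f A \<in> carrier_mat m m"
  "mlin m W f \<Longrightarrow> A \<in> W \<Longrightarrow> B \<in> W \<Longrightarrow> f (A + B) = f A + f B"
  "mlin m W f \<Longrightarrow> a \<in> F \<Longrightarrow> A \<in> W \<Longrightarrow> f (a \<cdot>\<^sub>m A) = a \<cdot>\<^sub>m f A"
  by (auto simp: mlin_def)

lemma mlin_0: assumes "msub n W" "mlin m W f" shows "f (0\<^sub>m n n) = 0\<^sub>m m m"
proof -
  have "0 \<cdot>\<^sub>m 0\<^sub>m n n = (0\<^sub>m n n :: 'a mat)" by (rule eq_matI) auto
  then have "f (0\<^sub>m n n) = 0 \<cdot>\<^sub>m f (0\<^sub>m n n)" using mlinD(3)[OF assms(2) F_0 msubD(2)[OF assms(1)]] by simp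
  also have "\<dots> = 0\<^sub>m m m" using mlinD(1)[OF assms(2) msubD(2)[OF assms(1)]] by (intro eq_matI) auto
  finally show ?thesis .
qed

lemma msub_image: assumes "msub n W" "mlin m W f" shows "msub m (f ` W)"
proof -
  have "0\<^sub>m m m \<in> f ` W" using mlin_0[OF assms] msubD(2)[OF assms(1)] by (metis imageI)
  moreover have "f A + f B \<in> f ` W" if "A \<in> W" "B \<in> W" for A B
    using mlinD(2)[OF assms(2) that] msubD(3)[OF assms(1) that] by (metis imageI)
  moreover have "a \<cdot>\<^sub>m f A \<in> f ` W" if "a \<in> F" "A \<in> W" for a A
    using mlinD(3)[OF assms(2) that] msubD(4)[OF assms(1) that] by (metis imageI)
  ultimately show ?thesis using assms(2) unfolding msub_def mlin_def by auto
qed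

lemma msub_ker: assumes "msub n W" "mlin m W f" shows "msub n {A\<in>W. f A = 0\<^sub>m m m}"
  unfolding msub_def using assms mlin_0[OF assms] msubD[OF assms(1)] mlinD(2,3)[OF assms(2)] by auto

lemma mdim_rank_nullity:
  assumes "msub n W" "mlin m W f"
  shows "mdim W = mdim (f ` W) + mdim {A\<in>W. f A = 0\<^sub>m m m}"
proof -
  let ?f = "\<lambda>g. flat (f (mat n n g))"
  have fl: "?f (flat A) = flat (f A)" if "A \<in> W" for A using flat_mat that msubD(1)[OF assms(1)] by (metis subsetD)
  have lin: "MM.flin (flat ` W) ?f"
  proof (rule MM.flinI)
    fix v w assume "v \<in> flat ` W" "w \<in> flat ` W"
    then obtain A B where AB: "A \<in> W" "B \<in> W" "v = flat A" "w = flat B" by blast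
    note c = subsetD[OF msubD(1)[OF assms(1)] AB(1)] subsetD[OF msubD(1)[OF assms(1)] AB(2)]
    have "v + w = flat (A + B)" using flat_add[OF c] AB(3,4) by simp
    then show "?f (v + w) = ?f v + ?f w"
      using fl[OF msubD(3)[OF assms(1) AB(1,2)]] fl[OF AB(1)] fl[OF AB(2)] AB(3,4) mlinD(2)[OF assms(2) AB(1,2)]
        flat_add[OF mlinD(1)[OF assms(2) AB(1)] mlinD(1)[OF assms(2) AB(2)]] by simp
  next
    fix a v assume a: "a \<in> F" and "v \<in> flat ` W"
    then obtain A where A: "A \<in> W" "v = flat A" by blast
    have "(\<lambda>i. a * v i) = flat (a \<cdot>\<^sub>m A)" using A by (simp add: flat_smult)
    then show "?f (\<lambda>i. a * v i) = (\<lambda>i. a * ?f v i)"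
      using fl[OF msubD(4)[OF assms(1) a A(1)]] fl[OF A(1)] A(2) mlinD(3)[OF assms(2) a A(1)] flat_smult by simp
  qed
  have "?f ` flat ` W = flat ` f ` W" unfolding image_image by (rule image_cong) (auto simp: fl)
  moreover have "{v \<in> flat ` W. ?f v = 0} = flat ` {A\<in>W. f A = 0\<^sub>m m m}"
    using fl flat_eq_0[OF mlinD(1)[OF assms(2)]] flat_0[of m] by auto
  ultimately show ?thesis using MM.rank_nullity(3)[OF msub_fd[OF assms(1)] lin] by (simp add: mdim_def)
qed

lemma mdim_zero: "mdim {0\<^sub>m n n} = 0" using M.dm_zero by (simp add: mdim_def flat_0)

lemma mdim_inj:
  assumes "msub n W" "mlin m W f" "\<And>A. A \<in> W \<Longrightarrow> f A = 0\<^sub>m m m \<Longrightarrow> A = 0\<^sub>m n n"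
  shows "mdim (f ` W) = mdim W"
proof -
  have "{A\<in>W. f A = 0\<^sub>m m m} = {0\<^sub>m n n}"
  proof
    show "{A\<in>W. f A = 0\<^sub>m m m} \<subseteq> {0\<^sub>m n n}" using assms(3) by blast
    show "{0\<^sub>m n n} \<subseteq> {A\<in>W. f A = 0\<^sub>m m m}" using mlin_0[OF assms(1,2)] msubD(2)[OF assms(1)] by simp
  qed
  then show ?thesis using mdim_rank_nullity[OF assms(1,2)] mdim_zero by simp
qed

lemma vectorspace_module_mat: "vectorspace (scalars F) (module_mat TYPE('a) n n)"
proof (rule vs_criteria)
  show "\<forall>v\<in>carrier (module_mat TYPE('a) n n). \<exists>w\<in>carrier (module_mat TYPE('a) n n).
      v \<oplus>\<^bsub>module_mat TYPE('a) n n\<^esub> w = \<zero>\<^bsub>module_mat TYPE('a) n n\<^esub>"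
  proof
    fix v :: "'a mat" assume "v \<in> carrier (module_mat TYPE('a) n n)"
    then show "\<exists>w\<in>carrier (module_mat TYPE('a) n n). v \<oplus>\<^bsub>module_mat TYPE('a) n n\<^esub> w = \<zero>\<^bsub>module_mat TYPE('a) n n\<^esub>"
      by (intro bexI[of _ "- v"]) (auto simp: module_mat_def)
  qed
qed (auto simp: field_scalars module_mat_def comm_add_mat assoc_add_mat[of _ n n] distrib_left distrib_right mult.assoc
    intro!: eq_matI)

lemma subspace_msub: "VectorSpace.subspace (scalars F) W (module_mat TYPE('a) n n) \<longleftrightarrow> msub n W"
  using vectorspace_module_mat[of n]
  by (auto simp: VectorSpace.subspace_def submodule_def msub_def vectorspace_def module_mat_def)

text \<open>\<open>mat n n\<close> inverts \<open>flat\<close> on \<open>W\<close>, so the two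
  spaces are isomorphic. This ties \<open>affine_dimension\<close> to \<open>mdim\<close>.\<close>

lemma dim_msub:
  assumes "msub n W"
  shows "vectorspace.dim (scalars F) ((module_mat TYPE('a) n n)\<lparr>carrier := W\<rparr>) = mdim W"
proof -
  interpret V: vectorspace "scalars F" "module_mat TYPE('a) n n" by (rule vectorspace_module_mat)
  have W: "VectorSpace.subspace (scalars F) W (module_mat TYPE('a) n n)" using assms subspace_msub by blast
  note fs = msub_fsub[OF assms]
  have vs: "vectorspace (scalars F) (M.frec (flat ` W))" "vectorspace (scalars F) (V.vs W)"
    by (rule M.vectorspace_frec[OF fs]) (rule V.subspace_is_vs[OF W])
  have m: "mat n n (flat A) = A" if "A \<in> W" for A using flat_mat msubD(1)[OF assms] that by blast
  have c: "A \<in> carrier_mat n n" if "A \<in> W" for A using msubD(1)[OF assms] that by blast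
  have m_add: "mat n n (flat A + flat B) = A + B" if "A \<in> W" "B \<in> W" for A B
    using flat_add[OF c[OF that(1)] c[OF that(2)]] m[OF msubD(3)[OF assms that]] by simp
  have m_smult: "mat n n (\<lambda>i. a * flat A i) = a \<cdot>\<^sub>m A" if "a \<in> F" "A \<in> W" for a A
    using flat_smult[of a A] m[OF msubD(4)[OF assms that]] by simp
  have "mat n n \<in> module_hom (scalars F) (M.frec (flat ` W)) (V.vs W)"
    unfolding module_hom_def using m m_add m_smult by (auto simp: module_mat_def)
  then interpret T: linear_map "scalars F" "M.frec (flat ` W)" "V.vs W" "mat n n"
    using vs unfolding linear_map_def mod_hom_def mod_hom_axioms_def vectorspace_def by auto
  have "T.V.fin_dim" using msub_fd[OF assms] unfolding M.fd_def by blast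
  then have "T.W.dim = T.V.dim"
  proof (rule T.dim_bij(2))
    fix v assume "v \<in> carrier (M.frec (flat ` W))" "mat n n v = \<zero>\<^bsub>V.vs W\<^esub>"
    then obtain A where A: "A \<in> W" "v = flat A" "A = 0\<^sub>m n n" using m by (auto simp: module_mat_def)
    then show "v = \<zero>\<^bsub>M.frec (flat ` W)\<^esub>" by (simp add: flat_0)
  next
    show "mat n n ` carrier (M.frec (flat ` W)) = carrier (V.vs W)" using m by (auto simp: image_image)
  qed
  then show ?thesis by (simp add: mdim_def M.dm_def)
qed

definition affine :: "nat \<Rightarrow> nat \<Rightarrow> 'a mat set \<Rightarrow> bool" where
  "affine n k S \<longleftrightarrow> (\<exists>A\<in>carrier_mat n n. \<exists>W. msub n W \<and> mdim W = k \<and> S = (+) A ` W)"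

lemma direction_translate:
  assumes "A \<in> carrier_mat n n" "msub n W" shows "affine_direction ((+) A ` W) = W"
proof (intro equalityI subsetI)
  fix B assume "B \<in> affine_direction ((+) A ` W)"
  then obtain w w' where w: "w \<in> W" "w' \<in> W" "B = (A + w) - (A + w')" unfolding affine_direction_def by blast
  moreover have "(A + w) - (A + w') = w - w'"
    using subsetD[OF msubD(1)[OF assms(2)] w(1)] subsetD[OF msubD(1)[OF assms(2)] w(2)] assms(1) by (intro eq_matI) auto
  ultimately show "B \<in> W" using msub_diff[OF assms(2)] by simp
next
  fix B assume B: "B \<in> W"
  have "B = (A + B) - (A + 0\<^sub>m n n)" using subsetD[OF msubD(1)[OF assms(2)] B] assms(1) by (intro eq_matI) auto
  then show "B \<in> affine_direction ((+) A ` W)"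
    unfolding affine_direction_def using imageI[OF B, of "(+) A"] imageI[OF msubD(2)[OF assms(2)], of "(+) A"] by auto
qed

lemma affine_subspace_iff: "affine_subspace F n S \<longleftrightarrow> (\<exists>k. affine n k S)"
  unfolding affine_subspace_def affine_def subspace_msub by blast

lemma affine_dimension_eq: "affine n k S \<Longrightarrow> affine_dimension F n S = k"
  unfolding affine_def affine_dimension_def by (auto simp: direction_translate dim_msub)

end

section \<open>Skew-Hermitian matrices\<close>

context quad_mat
begin

definition hf :: "nat \<Rightarrow> (nat \<Rightarrow> 'a) \<Rightarrow> (nat \<Rightarrow> 'a) \<Rightarrow> 'a" where
  "hf n x y = (\<Sum>i<n. \<sigma> (x i) * y i)"

lemma hf_add_right: "hf n x (y + z) = hf n x y + hf n x z"
  by (simp add: hf_def distrib_left sum.distrib)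
lemma hf_add_left: "hf n (x + y) z = hf n x z + hf n y z"
  by (simp add: hf_def s_add distrib_right sum.distrib)
lemma hf_sc_right: "hf n x (\<lambda>i. y i * a) = hf n x y * a"
  by (simp add: hf_def sum_distrib_right mult.assoc)
lemma hf_sc_left: "hf n (\<lambda>i. x i * a) y = \<sigma> a * hf n x y"
  by (simp add: hf_def sum_distrib_left s_mult mult.assoc)
lemma hf_0_right [simp]: "hf n x 0 = 0" by (simp add: hf_def)
lemma hf_dfun: "R.dfun S (hf n x)" by (simp add: R.dfun_def hf_add_right hf_sc_right)
lemma s_hf: "\<sigma> (hf n x y) = hf n y x" by (simp add: hf_def s_sum s_mult)
lemma hf_unit_right: "i < n \<Longrightarrow> hf n x (unit i) = \<sigma> (x i)"
  by (simp add: hf_def unit_def if_distrib[where f = "\<lambda>c. _ * c"] cong: if_cong)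
lemma hf_unit_left: "i < n \<Longrightarrow> hf n (unit i) x = x i"
  using s_hf[of n x "unit i"] hf_unit_right[of i n x] by simp

lemma star_carrier [simp]: "A \<in> carrier_mat n m \<Longrightarrow> star_mat \<sigma> A \<in> carrier_mat m n"
  by (simp add: star_mat_def)
lemma star_entry: "A \<in> carrier_mat n m \<Longrightarrow> i < m \<Longrightarrow> j < n \<Longrightarrow> star_mat \<sigma> A $$ (i, j) = \<sigma> (A $$ (j, i))"
  by (simp add: star_mat_def)
lemma star_star: "A \<in> carrier_mat n m \<Longrightarrow> star_mat \<sigma> (star_mat \<sigma> A) = A"
  by (rule eq_matI) (auto simp: star_mat_def)
lemma star_mult:
  assumes "A \<in> carrier_mat n n" "B \<in> carrier_mat n n"
  shows "star_mat \<sigma> (A * B) = star_mat \<sigma> B * star_mat \<sigma> A"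
proof (rule eq_matI)
  fix i j assume "i < dim_row (star_mat \<sigma> B * star_mat \<sigma> A)" "j < dim_col (star_mat \<sigma> B * star_mat \<sigma> A)"
  then have ij: "i < n" "j < n" using assms by (auto simp: star_mat_def)
  have "star_mat \<sigma> (A * B) $$ (i, j) = \<sigma> ((A * B) $$ (j, i))"
    using star_entry[OF mult_carrier_mat[OF assms] ij] .
  also have "\<dots> = (\<Sum>l<n. \<sigma> (B $$ (l, i)) * \<sigma> (A $$ (j, l)))"
    unfolding mult_entry[OF assms ij(2,1)] by (simp add: s_sum s_mult)
  also have "\<dots> = (\<Sum>l<n. star_mat \<sigma> B $$ (i, l) * star_mat \<sigma> A $$ (l, j))"
    using ij by (intro sum.cong) (auto simp: star_entry[OF assms(1)] star_entry[OF assms(2)])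
  also have "\<dots> = (star_mat \<sigma> B * star_mat \<sigma> A) $$ (i, j)"
    using mult_entry[OF star_carrier[OF assms(2)] star_carrier[OF assms(1)] ij] by simp
  finally show "star_mat \<sigma> (A * B) $$ (i, j) = (star_mat \<sigma> B * star_mat \<sigma> A) $$ (i, j)" .
qed (use assms in \<open>auto simp: star_mat_def\<close>)

lemma star_one: "star_mat \<sigma> (1\<^sub>m n) = 1\<^sub>m n"
  by (rule eq_matI) (auto simp: star_mat_def)

lemma star_GL: assumes "A \<in> GL n" shows "star_mat \<sigma> A \<in> GL n"
proof -
  obtain B where B: "B \<in> GL n" "A * B = 1\<^sub>m n" "B * A = 1\<^sub>m n" by (rule GL_obtain[OF assms])
  note c = GL_carrier[OF assms] GL_carrier[OF B(1)]
  show ?thesis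
    by (rule GL_I[OF star_carrier[OF c(1)] star_carrier[OF c(2)]])
      (simp_all add: star_mult[OF c(1,2), symmetric] star_mult[OF c(2,1), symmetric] B(2,3) star_one)
qed

lemma hf_adjoint:
  assumes "A \<in> carrier_mat n n"
  shows "hf n x (act n A y) = hf n (act n (star_mat \<sigma> A) x) y"
proof -
  have "hf n x (act n A y) = (\<Sum>i<n. \<Sum>j<n. \<sigma> (x i) * A $$ (i, j) * y j)"
    by (simp add: hf_def act_def sum_distrib_left mult.assoc)
  also have "\<dots> = (\<Sum>j<n. \<Sum>i<n. \<sigma> (x i) * A $$ (i, j) * y j)" by (rule sum.swap)
  also have "\<dots> = hf n (act n (star_mat \<sigma> A) x) y"
    by (simp add: hf_def act_def star_entry[OF assms] s_sum s_mult sum_distrib_right)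
  finally show ?thesis .
qed

lemma SH_iff: "H \<in> SH \<sigma> e n \<longleftrightarrow> H \<in> carrier_mat n n \<and> (\<forall>i<n. \<forall>j<n. \<sigma> (H $$ (j, i)) = - H $$ (i, j)) \<and> (\<forall>i<n. e (H $$ (i, i)) = 0)"
proof (cases "H \<in> carrier_mat n n")
  case True
  have "star_mat \<sigma> H = - H \<longleftrightarrow> (\<forall>i<n. \<forall>j<n. \<sigma> (H $$ (j, i)) = - H $$ (i, j))"
  proof
    assume h: "star_mat \<sigma> H = - H"
    show "\<forall>i<n. \<forall>j<n. \<sigma> (H $$ (j, i)) = - H $$ (i, j)"
      using arg_cong[OF h, of "\<lambda>A. A $$ (_, _)"] star_entry[OF True] True
      by (metis carrier_matD(1) carrier_matD(2) h index_uminus_mat(1))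
  next
    assume "\<forall>i<n. \<forall>j<n. \<sigma> (H $$ (j, i)) = - H $$ (i, j)"
    then show "star_mat \<sigma> H = - H" using True by (intro eq_matI) (auto simp: star_mat_def)
  qed
  then show ?thesis using True by (auto simp: SH_def)
qed (simp add: SH_def)

lemma SH_carrier [simp]: "H \<in> SH \<sigma> e n \<Longrightarrow> H \<in> carrier_mat n n" by (simp add: SH_def)

lemma msub_SH: "msub n (SH \<sigma> e n)"
proof -
  have "0\<^sub>m n n \<in> SH \<sigma> e n" by (simp add: SH_iff)
  moreover have "A + B \<in> SH \<sigma> e n" if "A \<in> SH \<sigma> e n" "B \<in> SH \<sigma> e n" for A B
    using that unfolding SH_iff by (auto simp: s_add e_add)
  moreover have "a \<cdot>\<^sub>m A \<in> SH \<sigma> e n" if "a \<in> F" "A \<in> SH \<sigma> e n" for a A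
    using that unfolding SH_iff by (auto simp: s_mult s_F F_comm[OF that(1)] e_sm_right)
  ultimately show ?thesis unfolding msub_def by auto
qed

lemma alternating_sum:
  fixes f :: "nat \<Rightarrow> nat \<Rightarrow> 'a"
  assumes "\<And>i j. i < n \<Longrightarrow> j < n \<Longrightarrow> f i j + f j i = 0" "\<And>i. i < n \<Longrightarrow> f i i = 0"
  shows "(\<Sum>i<n. \<Sum>j<n. f i j) = 0"
  using assms
proof (induction n)
  case (Suc n)
  have "(\<Sum>i<Suc n. \<Sum>j<Suc n. f i j) = (\<Sum>i<n. \<Sum>j<n. f i j) + (\<Sum>i<n. f i n + f n i) + f n n"
    by (simp add: sum.distrib algebra_simps)
  also have "\<dots> = 0" using Suc by simp
  finally show ?case .
qed simp

lemma e_conj: "e (\<sigma> x * (y * x)) = x * \<sigma> x * e y"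
proof -
  have "e (\<sigma> x * (y * x)) = e (x * (\<sigma> x * y))" using e_comm[of "\<sigma> x * y" x] by (simp add: mult.assoc)
  then show ?thesis using e_sm[OF s_norm, of x y] by (simp add: mult.assoc)
qed

text \<open>The terms at \<open>(i, j)\<close> and \<open>(j, i)\<close> cancel, since
  \<open>H\<close> is skew and \<open>e (\<sigma> z) = e z\<close>. A diagonal term is the norm of
  \<open>x i\<close> times \<open>e (H $$ (i, i))\<close>, which is zero.\<close>

lemma SH_isotropic: assumes "H \<in> SH \<sigma> e n" shows "e (hf n x (act n H x)) = 0"
proof -
  have H: "\<sigma> (H $$ (j, i)) = - H $$ (i, j)" "e (H $$ (i, i)) = 0" if "i < n" "j < n" for i j
    using assms that unfolding SH_iff by auto
  have "e (hf n x (act n H x)) = (\<Sum>i<n. \<Sum>j<n. e (\<sigma> (x i) * (H $$ (i, j) * x j)))"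
    by (simp add: hf_def act_def e_sum sum_distrib_left)
  also have "\<dots> = 0"
  proof (rule alternating_sum)
    fix i j assume ij: "i < n" "j < n"
    have "e (\<sigma> (x i) * (H $$ (i, j) * x j)) = e (\<sigma> (\<sigma> (x i) * (H $$ (i, j) * x j)))" by (simp add: e_s)
    also have "\<dots> = - e (\<sigma> (x j) * (H $$ (j, i) * x i))"
      using H(1)[OF ij(2,1)] by (simp add: s_mult mult.assoc e_uminus)
    finally show "e (\<sigma> (x i) * (H $$ (i, j) * x j)) + e (\<sigma> (x j) * (H $$ (j, i) * x i)) = 0" by simp
  next
    fix i assume "i < n"
    then show "e (\<sigma> (x i) * (H $$ (i, i) * x i)) = 0" using H(2)[of i i] by (simp add: e_conj)
  qed
  finally show ?thesis .
qed

text \<open>Polarisation with \<open>unit i\<close> and the multiple of \<open>unit j\<close> by an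
  arbitrary \<open>l\<close> gives an identity under \<open>e\<close>, from which nondegeneracy of
  the pairing extracts skewness. Together with \<open>SH_isotropic\<close> this characterises
  \<open>SH\<close>.\<close>

lemma SH_I:
  assumes G: "G \<in> carrier_mat n n" and iso: "\<And>x. x \<in> sp n \<Longrightarrow> e (hf n x (act n G x)) = 0"
  shows "G \<in> SH \<sigma> e n"
proof -
  have pol: "e (hf n x (act n G y)) + e (hf n y (act n G x)) = 0" if "x \<in> sp n" "y \<in> sp n" for x y
  proof -
    have "e (hf n (x + y) (act n G (x + y))) = 0" using iso[OF R.dsub_add[OF sp_dsub that]] .
    then show ?thesis using iso[OF that(1)] iso[OF that(2)]
      by (simp add: act_add hf_add_left hf_add_right e_add add.commute)
  qed
  have "\<sigma> (G $$ (j, i)) = - G $$ (i, j)" if ij: "i < n" "j < n" for i j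
  proof -
    have "e ((G $$ (i, j) + \<sigma> (G $$ (j, i))) * l) = 0" for l
    proof -
      let ?y = "\<lambda>k. unit j k * l"
      have y: "?y \<in> sp n" using R.dsub_sc[OF sp_dsub unit_sp[OF ij(2)]] .
      have "hf n (unit i) (act n G ?y) = G $$ (i, j) * l"
        unfolding act_sc hf_sc_right hf_unit_left[OF ij(1)] act_unit[OF ij] ..
      moreover have "hf n ?y (act n G (unit i)) = \<sigma> l * G $$ (j, i)"
        unfolding hf_sc_left hf_unit_left[OF ij(2)] act_unit[OF ij(2,1)] ..
      moreover have "e (\<sigma> l * G $$ (j, i)) = e (\<sigma> (G $$ (j, i)) * l)"
        using e_s[of "\<sigma> l * G $$ (j, i)"] by (simp add: s_mult)
      ultimately show ?thesis using pol[OF unit_sp[OF ij(1)] y] by (simp add: distrib_right e_add)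
    qed
    then have "G $$ (i, j) + \<sigma> (G $$ (j, i)) = 0" by (rule e_nondegenerate)
    then show ?thesis by (simp add: add_eq_0_iff)
  qed
  moreover have "e (G $$ (i, i)) = 0" if "i < n" for i
    using iso[OF unit_sp[OF that]] hf_unit_left[OF that] act_unit[OF that that] by simp
  ultimately show ?thesis using G unfolding SH_iff by blast
qed

text \<open>One nonzero coordinate \<open>v i\<close> suffices. Column \<open>i\<close> is solved
  for the other coordinates of \<open>z\<close>, row \<open>i\<close> follows by skewness, and the
  diagonal entry \<open>h\<close> is what coordinate \<open>i\<close> of \<open>z\<close> requires.
  The condition on \<open>z\<close> then says precisely that \<open>e h = 0\<close>.\<close>

lemma SH_transitive:
  assumes v: "v \<in> sp n" "v \<noteq> 0" and z: "z \<in> sp n" and ez: "e (hf n v z) = 0"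
  obtains H where "H \<in> SH \<sigma> e n" "act n H v = z"
proof -
  have "\<exists>i<n. v i \<noteq> 0"
  proof (rule ccontr)
    assume "\<not> ?thesis"
    then have "v i = 0" for i using spD[OF v(1), of i] by (cases "i < n") auto
    then have "v = 0" by (intro ext) simp
    then show False using v(2) by simp
  qed
  then obtain i where i: "i < n" "v i \<noteq> 0" by blast
  define c where "c k = z k * inverse (v i)" for k
  define s where "s = (\<Sum>k\<in>{..<n} - {i}. \<sigma> (c k) * v k)"
  define h where "h = (z i + s) * inverse (v i)"
  define H where "H = mat n n (\<lambda>(k, l). if k = i then (if l = i then h else - \<sigma> (c l)) else if l = i then c k else 0)"
  have cv: "c k * v i = z k" for k using i(2) by (simp add: c_def mult.assoc)
  have hv: "h * v i = z i + s" using i(2) by (simp add: h_def mult.assoc)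
  \<comment> \<open>Multiplication by \<open>\<sigma> (v i)\<close> clears the inverses hidden in
    the \<open>c k\<close>.\<close>
  have "\<sigma> (v i) * (h * v i) = \<sigma> (v i) * z i + (\<Sum>k\<in>{..<n} - {i}. \<sigma> (z k) * v k)"
  proof -
    have "\<sigma> (v i) * (\<sigma> (c k) * v k) = \<sigma> (z k) * v k" for k
      using cv[of k] s_mult[of "c k" "v i"] by (simp add: mult.assoc[symmetric])
    then show ?thesis unfolding hv s_def by (simp add: distrib_left sum_distrib_left)
  qed
  then have "e (\<sigma> (v i) * (h * v i)) = e (\<sigma> (v i) * z i) + (\<Sum>k\<in>{..<n} - {i}. e (\<sigma> (z k) * v k))"
    by (simp add: e_add e_sum)
  also have "(\<Sum>k\<in>{..<n} - {i}. e (\<sigma> (z k) * v k)) = (\<Sum>k\<in>{..<n} - {i}. e (\<sigma> (v k) * z k))"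
  proof (rule sum.cong[OF refl])
    show "e (\<sigma> (z k) * v k) = e (\<sigma> (v k) * z k)" for k using e_s[of "\<sigma> (z k) * v k"] by (simp add: s_mult)
  qed
  also have "e (\<sigma> (v i) * z i) + (\<Sum>k\<in>{..<n} - {i}. e (\<sigma> (v k) * z k)) = e (hf n v z)"
    unfolding hf_def e_sum using i(1) by (subst (2) sum.remove[of _ i]) auto
  finally have "v i * \<sigma> (v i) * e h = 0" using ez by (simp add: e_conj)
  then have eh: "e h = 0" using i(2) by simp
  have H: "H $$ (k, l) = (if k = i then (if l = i then h else - \<sigma> (c l)) else if l = i then c k else 0)" if "k < n" "l < n" for k l
    using that by (simp add: H_def)
  have SH: "H \<in> SH \<sigma> e n" unfolding SH_iff
  proof (intro conjI allI impI)
    show "H \<in> carrier_mat n n" by (simp add: H_def)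
    show "\<sigma> (H $$ (l, k)) = - H $$ (k, l)" if "k < n" "l < n" for k l
      using s_skew[OF eh] that by (auto simp: H s_uminus)
    show "e (H $$ (k, k)) = 0" if "k < n" for k using that eh by (simp add: H)
  qed
  have "act n H v = z"
  proof (rule sp_eqI[OF act_sp z])
    fix k assume k: "k < n"
    show "act n H v k = z k"
    proof (cases "k = i")
      case True
      have "act n H v k = h * v i + (\<Sum>l\<in>{..<n} - {i}. H $$ (i, l) * v l)"
        unfolding act_def using i(1) True H[OF i(1) i(1)] by (subst (1) sum.remove[of _ i]) auto
      also have "(\<Sum>l\<in>{..<n} - {i}. H $$ (i, l) * v l) = (\<Sum>l\<in>{..<n} - {i}. - (\<sigma> (c l) * v l))"
        using i(1) by (intro sum.cong) (auto simp: H)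
      also have "\<dots> = - s" unfolding s_def by (rule sum_negf)
      finally show ?thesis using hv True by simp
    next
      case False
      have "(\<Sum>l<n. H $$ (k, l) * v l) = (\<Sum>l<n. if l = i then z k else 0)"
        by (rule sum.cong) (use k False in \<open>auto simp: H cv\<close>)
      then show ?thesis using i(1) k by (simp add: act_def)
    qed
  qed
  then show ?thesis using that SH by blast
qed

lemma sum_lessThan_id: "(\<Sum>j<n. j) = n * (n - 1) div (2 :: nat)"
proof (cases n)
  case (Suc m)
  have "(\<Sum>j<n. j) = (\<Sum>j = 0..m. j)" unfolding Suc by (rule sum.cong) auto
  then show ?thesis using gauss_sum_nat[of m] Suc by (simp add: mult.commute)
qed simp

lemma card_strict_upper: "card {(i, j). i < j \<and> j < n} = n * (n - 1) div 2"
proof -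
  have "{(i, j). i < j \<and> j < n} = prod.swap ` (SIGMA j:{..<n}. {..<j})" by auto
  then have "card {(i, j). i < j \<and> j < n} = card (SIGMA j:{..<n}. {..<j})" by (simp add: card_image)
  also have "\<dots> = (\<Sum>j<n. j)" by simp
  finally show ?thesis using sum_lessThan_id by simp
qed

text \<open>The part above the diagonal is arbitrary and contributes \<open>d\<close> for each
  position. Where it vanishes, the matrix is diagonal with entries in the kernel of
  \<open>e\<close>, and such matrices are skew by \<open>s_skew\<close>.\<close>

lemma mdim_SH: "mdim (SH \<sigma> e n) = R.bound n"
proof -
  let ?f = "\<lambda>H :: 'a mat. mat n n (\<lambda>(i, j). if i < j then H $$ (i, j) else 0)"
  let ?I = "{(i, j). i < j \<and> j < n}" and ?J = "(\<lambda>i. (i, i)) ` {..<n}"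
  have lin: "mlin n (SH \<sigma> e n) ?f" unfolding mlin_def
    by (auto intro!: eq_matI dest!: SH_carrier)
  have "?f ` SH \<sigma> e n = supp_mat n ?I UNIV"
  proof (intro equalityI subsetI)
    fix B assume "B \<in> ?f ` SH \<sigma> e n"
    then show "B \<in> supp_mat n ?I UNIV" by (auto simp: supp_mat_def)
  next
    fix B assume B: "B \<in> supp_mat n ?I UNIV"
    let ?H = "mat n n (\<lambda>(i, j). if i < j then B $$ (i, j) else if j < i then - \<sigma> (B $$ (j, i)) else 0)"
    have "?H \<in> SH \<sigma> e n" unfolding SH_iff by (auto simp: s_uminus)
    moreover have "B = ?f ?H" using B by (intro eq_matI) (auto simp: supp_mat_def split: if_splits)
    ultimately show "B \<in> ?f ` SH \<sigma> e n" by blast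
  qed
  moreover have "{H \<in> SH \<sigma> e n. ?f H = 0\<^sub>m n n} = supp_mat n ?J {a. e a = 0}"
  proof (intro equalityI subsetI)
    fix H assume "H \<in> {H \<in> SH \<sigma> e n. ?f H = 0\<^sub>m n n}"
    then have H: "H \<in> SH \<sigma> e n" "?f H = 0\<^sub>m n n" by auto
    have up: "H $$ (i, j) = 0" if "i < j" "j < n" for i j
    proof -
      have "?f H $$ (i, j) = 0\<^sub>m n n $$ (i, j)" using H(2) by simp
      then show ?thesis using that by simp
    qed
    have "H $$ (i, j) = 0" if "i < n" "j < n" "i \<noteq> j" for i j
    proof (cases "i < j")
      case False
      then have "H $$ (j, i) = 0" using up that by simp
      moreover have "\<sigma> (H $$ (j, i)) = - H $$ (i, j)" using H(1) that unfolding SH_iff by blast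
      ultimately show ?thesis by simp
    qed (use up that in simp)
    then show "H \<in> supp_mat n ?J {a. e a = 0}" using H(1) by (auto simp: supp_mat_def SH_iff)
  next
    fix H assume "H \<in> supp_mat n ?J {a. e a = 0}"
    then have c: "H \<in> carrier_mat n n" and H: "\<And>i j. i < n \<Longrightarrow> j < n \<Longrightarrow> H $$ (i, j) \<in> (if (i, j) \<in> ?J then {a. e a = 0} else {0})"
      unfolding supp_mat_def by blast+
    have off: "H $$ (i, j) = 0" if "i < n" "j < n" "i \<noteq> j" for i j using H[OF that(1,2)] that by (auto split: if_splits)
    have dia: "e (H $$ (i, i)) = 0" if "i < n" for i using H[OF that that] that by (auto split: if_splits)
    have "\<sigma> (H $$ (j, i)) = - H $$ (i, j)" if "i < n" "j < n" for i j
      using off[OF that] off[OF that(2,1)] dia[OF that(1)] s_skew by (cases "i = j") auto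
    then show "H \<in> {H \<in> SH \<sigma> e n. ?f H = 0\<^sub>m n n}" using c dia off by (auto simp: SH_iff intro!: eq_matI)
  qed
  moreover have "mdim (supp_mat n ?I UNIV) = d * (n * (n - 1) div 2)"
  proof -
    have I: "?I \<subseteq> {..<n} \<times> {..<n}" by auto
    show ?thesis using flat_supp(2)[OF I fd_D] card_strict_upper[of n] dm_D by (simp add: mult.commute)
  qed
  moreover have "mdim (supp_mat n ?J {a. e a = 0}) = n * (d - 1)"
  proof -
    have "D.fsub {a. e a = 0}" using DD.fsub_ker[OF D.fsub_UNIV e_lin(1)] by simp
    then have K: "D.fd {a. e a = 0}" by (rule fd_subD(1))
    have J: "?J \<subseteq> {..<n} \<times> {..<n}" "card ?J = n" by (auto simp: card_image inj_on_def)
    show ?thesis using flat_supp(2)[OF J(1) K] J(2) dm_ker_e by simp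
  qed
  ultimately show ?thesis using mdim_rank_nullity[OF msub_SH lin] by (simp add: R.bound_def)
qed

lemma act_vec: "A \<in> carrier_mat n n \<Longrightarrow> A *\<^sub>v vec n x = vec n (act n A x)"
  by (rule eq_vecI) (auto simp: act_def scalar_prod_def atLeast0LessThan intro!: sum.cong)

lemma star_form_hf: assumes "P \<in> carrier_mat n n" shows "star_form \<sigma> P (vec n x) = hf n x (act n P x)"
  unfolding star_form_def act_vec[OF assms] by (simp add: hf_def scalar_prod_def atLeast0LessThan)

lemma all_vec: "(\<forall>v\<in>carrier_vec n. Q v) \<longleftrightarrow> (\<forall>x\<in>sp n. Q (vec n x))"
proof
  assume *: "\<forall>x\<in>sp n. Q (vec n x)"
  show "\<forall>v\<in>carrier_vec n. Q v"
  proof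
    fix v :: "'a vec" assume v: "v \<in> carrier_vec n"
    let ?x = "\<lambda>i. if i < n then v $ i else 0"
    have "?x \<in> sp n" by (simp add: sp_def)
    moreover have "v = vec n ?x" using v by (intro eq_vecI) auto
    ultimately show "Q v" using * by metis
  qed
qed auto

lemma vec_eq_0: "x \<in> sp n \<Longrightarrow> vec n x = 0\<^sub>v n \<longleftrightarrow> x = 0"
proof
  assume x: "x \<in> sp n" and "vec n x = 0\<^sub>v n"
  then have "vec n x $ i = 0\<^sub>v n $ i" for i by simp
  then have "x i = 0 i" if "i < n" for i using that by (metis index_vec index_zero_vec(1) zero_fun_apply)
  then show "x = 0" by (intro sp_eqI[OF x]) (auto simp: sp_def)
qed auto

lemma nonisotropic_iff:
  "nonisotropic \<sigma> e n P \<longleftrightarrow> P \<in> carrier_mat n n \<and> (\<forall>x\<in>sp n. x \<noteq> 0 \<longrightarrow> e (hf n x (act n P x)) \<noteq> 0)"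
  unfolding nonisotropic_def all_vec using star_form_hf vec_eq_0 by auto

end

section \<open>Block triangular matrices\<close>

lemma sum_lessThan_add: "(\<Sum>j<m + k. f j) = (\<Sum>j<m. f j) + (\<Sum>j<k. f (m + j) :: 'b::comm_monoid_add)" for m k :: nat
  by (induction k) (simp_all add: add.assoc)

lemma less_add_cases: assumes "i < m + k" obtains "i < m" | i' where "i = m + i'" "i' < (k :: nat)"
  using assms by (metis add_less_cancel_left le_Suc_ex linorder_not_less)

context quad_mat
begin

definition ul :: "nat \<Rightarrow> 'a mat \<Rightarrow> 'a mat" where "ul m A = mat m m (\<lambda>(i, j). A $$ (i, j))"
definition lr :: "nat \<Rightarrow> nat \<Rightarrow> 'a mat \<Rightarrow> 'a mat" where "lr m k A = mat k k (\<lambda>(i, j). A $$ (m + i, m + j))"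
definition upper :: "nat \<Rightarrow> nat \<Rightarrow> 'a mat \<Rightarrow> bool" where "upper m k A \<longleftrightarrow> (\<forall>i<k. \<forall>j<m. A $$ (m + i, j) = 0)"

text \<open>The joint of two sets with the block sizes fixed in advance; \<open>bd\<close> below
  provides its block diagonal members.\<close>

definition blk :: "nat \<Rightarrow> nat \<Rightarrow> 'a mat set \<Rightarrow> 'a mat set \<Rightarrow> 'a mat set" where
  "blk m k S T = {A \<in> carrier_mat (m + k) (m + k). upper m k A \<and> ul m A \<in> S \<and> lr m k A \<in> T}"

definition bd :: "nat \<Rightarrow> nat \<Rightarrow> 'a mat \<Rightarrow> 'a mat \<Rightarrow> 'a mat" where
  "bd m k A C = four_block_mat A (0\<^sub>m m k) (0\<^sub>m k m) C"

lemma ul_carrier [simp]: "ul m A \<in> carrier_mat m m" by (simp add: ul_def)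
lemma lr_carrier [simp]: "lr m k A \<in> carrier_mat k k" by (simp add: lr_def)
lemma ul_entry: "i < m \<Longrightarrow> j < m \<Longrightarrow> ul m A $$ (i, j) = A $$ (i, j)" by (simp add: ul_def)
lemma lr_entry: "i < k \<Longrightarrow> j < k \<Longrightarrow> lr m k A $$ (i, j) = A $$ (m + i, m + j)" by (simp add: lr_def)

lemma four_block_parts:
  assumes "A \<in> carrier_mat m m" "B \<in> carrier_mat m k" "C \<in> carrier_mat k k"
  shows "four_block_mat A B (0\<^sub>m k m) C \<in> carrier_mat (m + k) (m + k)"
    "upper m k (four_block_mat A B (0\<^sub>m k m) C)" "ul m (four_block_mat A B (0\<^sub>m k m) C) = A"
    "lr m k (four_block_mat A B (0\<^sub>m k m) C) = C"
  using assms by (auto simp: four_block_mat_def Let_def upper_def ul_def lr_def intro!: eq_matI)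

lemma bd_parts:
  assumes "A \<in> carrier_mat m m" "C \<in> carrier_mat k k"
  shows "bd m k A C \<in> carrier_mat (m + k) (m + k)" "upper m k (bd m k A C)" "ul m (bd m k A C) = A" "lr m k (bd m k A C) = C"
  unfolding bd_def by (rule four_block_parts[OF assms(1) _ assms(2)]; simp)+

lemma joint_Cons:
  assumes S: "S \<subseteq> carrier_mat m m" and Ss: "joint Ss \<subseteq> carrier_mat k k"
  shows "joint (S # Ss) = blk m k S (joint Ss)"
proof (intro equalityI subsetI)
  fix M assume "M \<in> joint (S # Ss)"
  then obtain A B C where M: "M = four_block_mat A B (0\<^sub>m (dim_row C) (dim_col A)) C" "A \<in> S" "C \<in> joint Ss"
    "B \<in> carrier_mat (dim_row A) (dim_col C)" by auto
  have c: "A \<in> carrier_mat m m" "C \<in> carrier_mat k k" using S Ss M(2,3) by auto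
  have B: "B \<in> carrier_mat m k" using M(4) c by auto
  have "M = four_block_mat A B (0\<^sub>m k m) C" using M(1) c by auto
  then show "M \<in> blk m k S (joint Ss)" unfolding blk_def using four_block_parts[OF c(1) B c(2)] M(2,3) by auto
next
  fix M assume "M \<in> blk m k S (joint Ss)"
  then have M: "M \<in> carrier_mat (m + k) (m + k)" "upper m k M" "ul m M \<in> S" "lr m k M \<in> joint Ss" unfolding blk_def by auto
  let ?B = "mat m k (\<lambda>(i, j). M $$ (i, m + j))"
  have "M = four_block_mat (ul m M) ?B (0\<^sub>m (dim_row (lr m k M)) (dim_col (ul m M))) (lr m k M)"
  proof (rule eq_matI)
    fix i j assume "i < dim_row (four_block_mat (ul m M) ?B (0\<^sub>m (dim_row (lr m k M)) (dim_col (ul m M))) (lr m k M))"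
      "j < dim_col (four_block_mat (ul m M) ?B (0\<^sub>m (dim_row (lr m k M)) (dim_col (ul m M))) (lr m k M))"
    then have ij: "i < m + k" "j < m + k" by (auto simp: ul_def lr_def)
    show "M $$ (i, j) = four_block_mat (ul m M) ?B (0\<^sub>m (dim_row (lr m k M)) (dim_col (ul m M))) (lr m k M) $$ (i, j)"
      using less_add_cases[OF ij(1)]
    proof cases
      case 1
      then show ?thesis using ij(2) by (auto simp: four_block_mat_def Let_def ul_def lr_def)
    next
      case (2 i')
      then show ?thesis using ij(2) M(2) by (auto simp: four_block_mat_def Let_def ul_def lr_def upper_def)
    qed
  qed (use M(1) in \<open>auto simp: ul_def lr_def\<close>)
  moreover have "?B \<in> carrier_mat (dim_row (ul m M)) (dim_col (lr m k M))" by (simp add: ul_def lr_def)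
  ultimately show "M \<in> joint (S # Ss)" using M(3,4) by auto
qed

lemma blk_carrier: "blk m k S T \<subseteq> carrier_mat (m + k) (m + k)" by (auto simp: blk_def)

lemma blk_empty: assumes "S \<subseteq> carrier_mat k k" shows "blk 0 k (carrier_mat 0 0) S = S"
proof -
  have "lr 0 k A = A" if "A \<in> carrier_mat k k" for A using that by (intro eq_matI) (auto simp: lr_def)
  then show ?thesis using assms by (auto simp: blk_def upper_def ul_def)
qed

lemma blk_empty_right: assumes "S \<subseteq> carrier_mat k k" shows "blk k 0 S (carrier_mat 0 0) = S"
proof -
  have "ul k A = A" if "A \<in> carrier_mat k k" for A using that by (intro eq_matI) (auto simp: ul_def)
  then show ?thesis using assms by (auto simp: blk_def upper_def lr_def)
qed

lemma blk_assoc: "blk (a + b) k (blk a b S J) T = blk a (b + k) S (blk b k J T)"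
proof -
  have 1: "ul a (ul (a + b) A) = ul a A" "lr a b (ul (a + b) A) = ul b (lr a (b + k) A)"
    "lr b k (lr a (b + k) A) = lr (a + b) k A" for A
    by (auto simp: ul_def lr_def add.assoc intro!: eq_matI)
  have 2: "upper (a + b) k A \<and> upper a b (ul (a + b) A) \<longleftrightarrow> upper a (b + k) A \<and> upper b k (lr a (b + k) A)" for A
  proof
    assume l: "upper (a + b) k A \<and> upper a b (ul (a + b) A)"
    have "A $$ (a + i, j) = 0" if i: "i < b + k" and "j < a" for i j
      using less_add_cases[OF i]
    proof cases
      case 1
      then show ?thesis using l that(2) by (auto simp: upper_def ul_def)
    next
      case (2 i')
      then show ?thesis using l that(2) by (auto simp: upper_def add.assoc[symmetric])
    qed
    then show "upper a (b + k) A \<and> upper b k (lr a (b + k) A)"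
      using l by (auto simp: upper_def lr_def add.assoc)
  next
    assume r: "upper a (b + k) A \<and> upper b k (lr a (b + k) A)"
    have "A $$ (a + b + i, j) = 0" if "i < k" and j: "j < a + b" for i j
      using less_add_cases[OF j]
    proof cases
      case 1
      then show ?thesis using r that(1) by (auto simp: upper_def add.assoc)
    next
      case (2 j')
      have "lr a (b + k) A $$ (b + i, j') = 0" using r that(1) 2 by (auto simp: upper_def)
      then show ?thesis using 2 that(1) by (simp add: lr_def add.assoc)
    qed
    then show "upper (a + b) k A \<and> upper a b (ul (a + b) A)"
      using r by (auto simp: upper_def ul_def)
  qed
  show ?thesis unfolding blk_def using 1 2 by (auto simp: add.assoc)
qed

definition tail :: "nat \<Rightarrow> nat \<Rightarrow> (nat \<Rightarrow> 'a) \<Rightarrow> nat \<Rightarrow> 'a" where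
  "tail m k x = (\<lambda>i. if i < k then x (m + i) else 0)"

lemma tail_sp [simp]: "tail m k x \<in> sp k" by (simp add: tail_def sp_def)

lemma tail_eq_0: "x \<in> sp m \<Longrightarrow> tail m k x = 0"
  by (rule ext) (simp add: tail_def spD)

lemma act_tail: assumes "upper m k A" shows "tail m k (act (m + k) A x) = act k (lr m k A) (tail m k x)"
proof
  fix i
  show "tail m k (act (m + k) A x) i = act k (lr m k A) (tail m k x) i"
    using assms by (cases "i < k") (auto simp: tail_def act_def lr_def upper_def sum_lessThan_add)
qed

lemma act_top: assumes "x \<in> sp m" "i < m" shows "act (m + k) A x i = act m (ul m A) x i"
  using assms by (simp add: act_def ul_def sum_lessThan_add spD)

lemma sp_mono: "m \<le> n \<Longrightarrow> x \<in> sp m \<Longrightarrow> x \<in> sp n" by (auto simp: sp_def)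

lemma sp_tail: assumes "x \<in> sp (m + k)" "tail m k x = 0" shows "x \<in> sp m"
proof (rule spI)
  fix i assume "i \<ge> m"
  then obtain j where j: "i = m + j" by (metis le_Suc_ex)
  show "x i = 0"
  proof (cases "j < k")
    case True
    then have "x (m + j) = tail m k x j" by (simp add: tail_def)
    then show ?thesis using assms(2) j by simp
  qed (use j spD[OF assms(1), of i] in simp)
qed

lemma act_upper_sp:
  assumes "upper m k A" "x \<in> sp m" shows "act (m + k) A x = act m (ul m A) x"
proof (rule sp_eqI[of _ "m + k"])
  have b: "tail m k x = 0" by (rule tail_eq_0[OF assms(2)])
  have "tail m k (act (m + k) A x) = 0" unfolding act_tail[OF assms(1)] b by simp
  then have s: "act (m + k) A x \<in> sp m" by (rule sp_tail[OF act_sp])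
  fix i assume "i < m + k"
  show "act (m + k) A x i = act m (ul m A) x i"
  proof (cases "i < m")
    case False
    then show ?thesis using spD[OF s, of i] spD[OF act_sp[of m "ul m A" x], of i] by simp
  qed (rule act_top[OF assms(2)])
qed (use sp_mono[OF _ act_sp, of m "m + k"] in auto)

text \<open>Kernel vectors are followed through the blocks: the tail of a kernel vector is killed by
  the lower block, and on vectors with zero tail only the upper block acts.\<close>

lemma blk_GL:
  assumes A: "A \<in> carrier_mat (m + k) (m + k)" "upper m k A"
  shows "A \<in> GL (m + k) \<longleftrightarrow> ul m A \<in> GL m \<and> lr m k A \<in> GL k"
proof
  assume g: "ul m A \<in> GL m \<and> lr m k A \<in> GL k"
  show "A \<in> GL (m + k)"
  proof (rule inj_GL[OF A(1)])
    fix x assume x: "x \<in> sp (m + k)" "act (m + k) A x = 0"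
    have "act k (lr m k A) (tail m k x) = 0" using act_tail[OF A(2), of x] x(2) tail_eq_0[of 0 m k] R.dsub_0[OF sp_dsub] by simp
    then have "tail m k x = 0" by (rule GL_inj[OF conjunct2[OF g] tail_sp])
    then have xm: "x \<in> sp m" by (rule sp_tail[OF x(1)])
    then show "x = 0" using GL_inj[OF conjunct1[OF g] xm] act_upper_sp[OF A(2) xm] x(2) by simp
  qed
next
  assume g: "A \<in> GL (m + k)"
  have u: "ul m A \<in> GL m"
  proof (rule inj_GL[OF ul_carrier])
    fix x assume x: "x \<in> sp m" "act m (ul m A) x = 0"
    show "x = 0" using GL_inj[OF g sp_mono[OF _ x(1)]] act_upper_sp[OF A(2) x(1)] x(2) by simp
  qed
  have "lr m k A \<in> GL k"
  proof (rule inj_GL[OF lr_carrier])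
    fix y assume y: "y \<in> sp k" "act k (lr m k A) y = 0"
    \<comment> \<open>\<open>y\<close> padded by zeros. Its image lies in the first \<open>m\<close>
      coordinates, and subtracting a preimage from there gives a kernel vector of \<open>A\<close>
      with the same tail.\<close>
    define y' where "y' = (\<lambda>i. if i < m then 0 else y (i - m))"
    have y': "y' \<in> sp (m + k)" "tail m k y' = y" using y(1) by (auto simp: y'_def sp_def tail_def fun_eq_iff)
    have "tail m k (act (m + k) A y') = 0" using act_tail[OF A(2), of y'] y(2) y'(2) by simp
    then have "act (m + k) A y' \<in> sp m" by (rule sp_tail[OF act_sp])
    then obtain x where x: "x \<in> sp m" "act m (ul m A) x = act (m + k) A y'" by (rule GL_surj[OF u])
    have xk: "x \<in> sp (m + k)" using sp_mono[OF _ x(1)] by simp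
    have "act (m + k) A (y' - x) = 0" unfolding act_diff using act_upper_sp[OF A(2) x(1)] x(2) by simp
    then have "y' - x = 0" by (rule GL_inj[OF g R.dsub_diff[OF sp_dsub y'(1) xk]])
    then have "tail m k y' = tail m k x" by simp
    also have "\<dots> = 0" by (rule tail_eq_0[OF x(1)])
    finally show "y = 0" using y'(2) by simp
  qed
  then show "ul m A \<in> GL m \<and> lr m k A \<in> GL k" using u by blast
qed

context
  fixes m k :: nat and A B :: "'a mat" assumes A: "A \<in> carrier_mat (m + k) (m + k)" and B: "B \<in> carrier_mat (m + k) (m + k)"
begin

lemma lower_mult: "upper m k A \<Longrightarrow> i < k \<Longrightarrow> j < m + k \<Longrightarrow> (A * B) $$ (m + i, j) = (\<Sum>l<k. lr m k A $$ (i, l) * B $$ (m + l, j))"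
proof -
  assume u: "upper m k A" and ij: "i < k" "j < m + k"
  have "(A * B) $$ (m + i, j) = (\<Sum>l<m. A $$ (m + i, l) * B $$ (l, j)) + (\<Sum>l<k. A $$ (m + i, m + l) * B $$ (m + l, j))"
    using mult_entry[OF A B, of "m + i" j] ij unfolding sum_lessThan_add by simp
  also have "(\<Sum>l<m. A $$ (m + i, l) * B $$ (l, j)) = 0" using u ij(1) by (intro sum.neutral) (simp add: upper_def)
  also have "(\<Sum>l<k. A $$ (m + i, m + l) * B $$ (m + l, j)) = (\<Sum>l<k. lr m k A $$ (i, l) * B $$ (m + l, j))"
    using ij(1) by (intro sum.cong) (auto simp: lr_entry)
  finally show ?thesis by simp
qed

lemma lr_mult: assumes "upper m k A" shows "lr m k (A * B) = lr m k A * lr m k B"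
proof (rule eq_matI)
  fix i j assume "i < dim_row (lr m k A * lr m k B)" "j < dim_col (lr m k A * lr m k B)"
  then have ij: "i < k" "j < k" by (auto simp: lr_def)
  have "lr m k (A * B) $$ (i, j) = (\<Sum>l<k. lr m k A $$ (i, l) * B $$ (m + l, m + j))"
    using lower_mult[OF assms ij(1), of "m + j"] ij by (simp add: lr_entry)
  also have "\<dots> = (\<Sum>l<k. lr m k A $$ (i, l) * lr m k B $$ (l, j))"
    using ij by (intro sum.cong) (auto simp: lr_entry)
  finally show "lr m k (A * B) $$ (i, j) = (lr m k A * lr m k B) $$ (i, j)"
    using mult_entry[OF lr_carrier lr_carrier ij] by simp
qed (auto simp: lr_def)

lemma upper_mult: "upper m k A \<Longrightarrow> upper m k B \<Longrightarrow> upper m k (A * B)"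
  unfolding upper_def[of m k "A * B"] using lower_mult by (auto simp: upper_def intro!: sum.neutral)

lemma ul_mult: assumes "upper m k B" shows "ul m (A * B) = ul m A * ul m B"
proof (rule eq_matI)
  fix i j assume "i < dim_row (ul m A * ul m B)" "j < dim_col (ul m A * ul m B)"
  then have ij: "i < m" "j < m" by (auto simp: ul_def)
  have "(A * B) $$ (i, j) = (\<Sum>l<m. A $$ (i, l) * B $$ (l, j)) + (\<Sum>l<k. A $$ (i, m + l) * B $$ (m + l, j))"
    using mult_entry[OF A B, of i j] ij unfolding sum_lessThan_add by simp
  also have "(\<Sum>l<k. A $$ (i, m + l) * B $$ (m + l, j)) = 0" using assms ij by (intro sum.neutral) (simp add: upper_def)
  finally show "ul m (A * B) $$ (i, j) = (ul m A * ul m B) $$ (i, j)"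
    using ij mult_entry[OF ul_carrier ul_carrier ij, of A B] by (simp add: ul_entry)
qed (auto simp: ul_def)

text \<open>Each column of the lower left block of \<open>B\<close> is killed by the lower diagonal
  block of \<open>A\<close>, which is invertible.\<close>

lemma upper_left_factor:
  assumes "upper m k A" "A \<in> GL (m + k)" "upper m k (A * B)" shows "upper m k B"
  unfolding upper_def
proof (intro allI impI)
  fix i j assume ij: "i < k" "j < m"
  define y where "y = (\<lambda>l. if l < k then B $$ (m + l, j) else 0)"
  have y: "y \<in> sp k" by (simp add: y_def sp_def)
  have "act k (lr m k A) y = 0"
  proof (rule sp_eqI[OF act_sp])
    fix l assume l: "l < k"
    have "act k (lr m k A) y l = (A * B) $$ (m + l, j)"
      using lower_mult[OF assms(1) l, of j] ij l by (simp add: act_def y_def)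
    then show "act k (lr m k A) y l = 0 l" using assms(3) l ij by (simp add: upper_def)
  qed (simp add: sp_def)
  then have "y = 0" using GL_inj[OF _ y] blk_GL[OF A assms(1)] assms(2) by blast
  then have "y i = 0" by simp
  then show "B $$ (m + i, j) = 0" using ij by (simp add: y_def)
qed

end

section \<open>Equivalence of sets of matrices\<close>

lemma conj_image_inverse:
  assumes P: "P \<in> GL n" "P' \<in> GL n" "P * P' = 1\<^sub>m n" "P' * P = 1\<^sub>m n"
    and Q: "Q \<in> GL n" "Q' \<in> GL n" "Q * Q' = 1\<^sub>m n" "Q' * Q = 1\<^sub>m n" and M: "M \<in> carrier_mat n n"
  shows "P' * (P * M * Q) * Q' = M"
proof -
  note c = GL_carrier[OF P(1)] GL_carrier[OF P(2)] GL_carrier[OF Q(1)] GL_carrier[OF Q(2)]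
  have "P' * (P * M * Q) * Q' = (P' * P) * M * (Q * Q')"
    using c M by (simp add: assoc_mult_mat[of _ n n _ n _ n])
  then show ?thesis using P(4) Q(3) M by simp
qed

lemma equivalent_sym: assumes "S \<subseteq> carrier_mat n n" "mat_equivalent n S T" shows "mat_equivalent n T S"
proof -
  obtain P Q where PQ: "P \<in> GL n" "Q \<in> GL n" "T = (\<lambda>M. P * M * Q) ` S" using assms(2) unfolding mat_equivalent_def by blast
  obtain P' where P: "P' \<in> GL n" "P * P' = 1\<^sub>m n" "P' * P = 1\<^sub>m n" by (rule GL_obtain[OF PQ(1)])
  obtain Q' where Q: "Q' \<in> GL n" "Q * Q' = 1\<^sub>m n" "Q' * Q = 1\<^sub>m n" by (rule GL_obtain[OF PQ(2)])
  have "S = (\<lambda>M. P' * (P * M * Q) * Q') ` S"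
    using conj_image_inverse[OF PQ(1) P PQ(2) Q] assms(1) by (metis (no_types, lifting) image_cong image_ident subsetD)
  then have "S = (\<lambda>M. P' * M * Q') ` T" unfolding PQ(3) image_image .
  then show ?thesis unfolding mat_equivalent_def using P(1) Q(1) by blast
qed

lemma equivalent_trans:
  assumes "S \<subseteq> carrier_mat n n" "mat_equivalent n S T" "mat_equivalent n T U" shows "mat_equivalent n S U"
proof -
  obtain P Q where PQ: "P \<in> GL n" "Q \<in> GL n" "T = (\<lambda>M. P * M * Q) ` S" using assms(2) unfolding mat_equivalent_def by blast
  obtain P' Q' where PQ': "P' \<in> GL n" "Q' \<in> GL n" "U = (\<lambda>M. P' * M * Q') ` T" using assms(3) unfolding mat_equivalent_def by blast
  note c = GL_carrier[OF PQ(1)] GL_carrier[OF PQ(2)] GL_carrier[OF PQ'(1)] GL_carrier[OF PQ'(2)]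
  have "U = (\<lambda>M. (P' * P) * M * (Q * Q')) ` S" unfolding PQ'(3) PQ(3) image_image
  proof (rule image_cong[OF refl])
    fix M assume "M \<in> S"
    then show "P' * (P * M * Q) * Q' = (P' * P) * M * (Q * Q')"
      using c assms(1) by (auto simp: assoc_mult_mat[of _ n n _ n _ n])
  qed
  then show ?thesis unfolding mat_equivalent_def using GL_mult[OF PQ'(1) PQ(1)] GL_mult[OF PQ(2) PQ'(2)] by blast
qed

lemma bd_GL: "A \<in> GL m \<Longrightarrow> C \<in> GL k \<Longrightarrow> bd m k A C \<in> GL (m + k)"
  using blk_GL[OF bd_parts(1,2)] bd_parts(3,4) by simp

lemma upper_conj:
  assumes "P \<in> carrier_mat (m + k) (m + k)" "Q \<in> carrier_mat (m + k) (m + k)" "M \<in> carrier_mat (m + k) (m + k)"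
    and "upper m k P" "upper m k Q" "upper m k M"
  shows "upper m k (P * M * Q)" "ul m (P * M * Q) = ul m P * ul m M * ul m Q" "lr m k (P * M * Q) = lr m k P * lr m k M * lr m k Q"
proof -
  have PM: "P * M \<in> carrier_mat (m + k) (m + k)" "upper m k (P * M)"
    using assms upper_mult[OF assms(1,3)] by auto
  show "upper m k (P * M * Q)" using upper_mult[OF PM(1) assms(2) PM(2) assms(5)] .
  show "ul m (P * M * Q) = ul m P * ul m M * ul m Q"
    using ul_mult[OF PM(1) assms(2,5)] ul_mult[OF assms(1,3,6)] by simp
  show "lr m k (P * M * Q) = lr m k P * lr m k M * lr m k Q"
    using lr_mult[OF PM(1) assms(2) PM(2)] lr_mult[OF assms(1,3,4)] by simp
qed

text \<open>Block triangular factors act separately on the diagonal blocks. The reverse inclusion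
  uses their inverses, which are block triangular by \<open>upper_left_factor\<close>.\<close>

lemma conj_blk:
  assumes P: "P \<in> GL (m + k)" "upper m k P" and Q: "Q \<in> GL (m + k)" "upper m k Q"
    and S: "S \<subseteq> carrier_mat m m" and T: "T \<subseteq> carrier_mat k k"
  shows "(\<lambda>M. P * M * Q) ` blk m k S T =
    blk m k ((\<lambda>M. ul m P * M * ul m Q) ` S) ((\<lambda>M. lr m k P * M * lr m k Q) ` T)"
proof (intro equalityI subsetI)
  fix N assume "N \<in> (\<lambda>M. P * M * Q) ` blk m k S T"
  then obtain M where M: "M \<in> blk m k S T" "N = P * M * Q" by blast
  then have M': "M \<in> carrier_mat (m + k) (m + k)" "upper m k M" "ul m M \<in> S" "lr m k M \<in> T" unfolding blk_def by auto
  note c = upper_conj[OF GL_carrier[OF P(1)] GL_carrier[OF Q(1)] M'(1) P(2) Q(2) M'(2)]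
  show "N \<in> blk m k ((\<lambda>M. ul m P * M * ul m Q) ` S) ((\<lambda>M. lr m k P * M * lr m k Q) ` T)"
    unfolding blk_def M(2) using c M'(3,4) GL_carrier[OF P(1)] GL_carrier[OF Q(1)] M'(1) by auto
next
  fix N assume "N \<in> blk m k ((\<lambda>M. ul m P * M * ul m Q) ` S) ((\<lambda>M. lr m k P * M * lr m k Q) ` T)"
  then obtain s t where N: "N \<in> carrier_mat (m + k) (m + k)" "upper m k N" "s \<in> S" "ul m N = ul m P * s * ul m Q"
    "t \<in> T" "lr m k N = lr m k P * t * lr m k Q" unfolding blk_def by auto
  obtain P' where P': "P' \<in> GL (m + k)" "P * P' = 1\<^sub>m (m + k)" "P' * P = 1\<^sub>m (m + k)" by (rule GL_obtain[OF P(1)])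
  obtain Q' where Q': "Q' \<in> GL (m + k)" "Q * Q' = 1\<^sub>m (m + k)" "Q' * Q = 1\<^sub>m (m + k)" by (rule GL_obtain[OF Q(1)])
  have one: "upper m k (1\<^sub>m (m + k))" "ul m (1\<^sub>m (m + k)) = 1\<^sub>m m" "lr m k (1\<^sub>m (m + k)) = 1\<^sub>m k"
    by (auto simp: upper_def ul_def lr_def intro!: eq_matI)
  note cP = GL_carrier[OF P(1)] GL_carrier[OF P'(1)] and cQ = GL_carrier[OF Q(1)] GL_carrier[OF Q'(1)]
  have uP: "upper m k P'" by (rule upper_left_factor[OF cP P(2,1)]) (simp add: P'(2) one)
  have uQ: "upper m k Q'" by (rule upper_left_factor[OF cQ Q(2,1)]) (simp add: Q'(2) one)
  define M where "M = P' * N * Q'"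
  have Mc: "M \<in> carrier_mat (m + k) (m + k)" unfolding M_def using cP cQ N(1) by auto
  note c = upper_conj[OF cP(2) cQ(2) N(1) uP uQ N(2)]
  have ulP: "ul m P * ul m P' = 1\<^sub>m m" "ul m P' * ul m P = 1\<^sub>m m" "lr m k P * lr m k P' = 1\<^sub>m k" "lr m k P' * lr m k P = 1\<^sub>m k"
    using ul_mult[OF cP uP] ul_mult[OF cP(2,1) P(2)] lr_mult[OF cP P(2)] lr_mult[OF cP(2,1) uP] P' one by auto
  have ulQ: "ul m Q * ul m Q' = 1\<^sub>m m" "ul m Q' * ul m Q = 1\<^sub>m m" "lr m k Q * lr m k Q' = 1\<^sub>m k" "lr m k Q' * lr m k Q = 1\<^sub>m k"
    using ul_mult[OF cQ uQ] ul_mult[OF cQ(2,1) Q(2)] lr_mult[OF cQ Q(2)] lr_mult[OF cQ(2,1) uQ] Q' one by auto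
  note g = GL_I[OF ul_carrier ul_carrier] GL_I[OF lr_carrier lr_carrier]
  have sT: "s \<in> carrier_mat m m" "t \<in> carrier_mat k k" using S T N(3,5) by auto
  have "ul m M = s" unfolding M_def c(2) N(4)
    by (rule conj_image_inverse[OF g(1)[OF ulP(1,2)] g(1)[OF ulP(2,1)] ulP(1,2) g(1)[OF ulQ(1,2)] g(1)[OF ulQ(2,1)] ulQ(1,2) sT(1)])
  moreover have "lr m k M = t" unfolding M_def c(3) N(6)
    by (rule conj_image_inverse[OF g(2)[OF ulP(3,4)] g(2)[OF ulP(4,3)] ulP(3,4) g(2)[OF ulQ(3,4)] g(2)[OF ulQ(4,3)] ulQ(3,4) sT(2)])
  ultimately have "M \<in> blk m k S T" unfolding blk_def using Mc c(1) N(3,5) M_def by auto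
  moreover have "P * M * Q = N" unfolding M_def
    by (rule conj_image_inverse[OF P'(1) P(1) P'(3,2) Q'(1) Q(1) Q'(3,2) N(1)])
  ultimately show "N \<in> (\<lambda>M. P * M * Q) ` blk m k S T" by blast
qed

lemma equivalent_blk:
  assumes "S \<subseteq> carrier_mat m m" "T \<subseteq> carrier_mat k k" "mat_equivalent m S S'" "mat_equivalent k T T'"
  shows "mat_equivalent (m + k) (blk m k S T) (blk m k S' T')"
proof -
  obtain P Q where PQ: "P \<in> GL m" "Q \<in> GL m" "S' = (\<lambda>M. P * M * Q) ` S" using assms(3) unfolding mat_equivalent_def by blast
  obtain P' Q' where PQ': "P' \<in> GL k" "Q' \<in> GL k" "T' = (\<lambda>M. P' * M * Q') ` T" using assms(4) unfolding mat_equivalent_def by blast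
  note p = bd_parts[OF GL_carrier[OF PQ(1)] GL_carrier[OF PQ'(1)]] and q = bd_parts[OF GL_carrier[OF PQ(2)] GL_carrier[OF PQ'(2)]]
  note g = bd_GL[OF PQ(1) PQ'(1)] bd_GL[OF PQ(2) PQ'(2)]
  have "blk m k S' T' = (\<lambda>M. bd m k P P' * M * bd m k Q Q') ` blk m k S T"
    unfolding conj_blk[OF g(1) p(2) g(2) q(2) assms(1,2)] p q PQ(3) PQ'(3) ..
  then show ?thesis unfolding mat_equivalent_def using g by blast
qed

section \<open>Dimensions and translates of block triangular spaces\<close>

lemma ul_add: "A \<in> carrier_mat (m + k) (m + k) \<Longrightarrow> B \<in> carrier_mat (m + k) (m + k) \<Longrightarrow> ul m (A + B) = ul m A + ul m B"
  and lr_add: "A \<in> carrier_mat (m + k) (m + k) \<Longrightarrow> B \<in> carrier_mat (m + k) (m + k) \<Longrightarrow> lr m k (A + B) = lr m k A + lr m k B"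
  and ul_smult: "A \<in> carrier_mat (m + k) (m + k) \<Longrightarrow> ul m (a \<cdot>\<^sub>m A) = a \<cdot>\<^sub>m ul m A"
  and lr_smult: "A \<in> carrier_mat (m + k) (m + k) \<Longrightarrow> lr m k (a \<cdot>\<^sub>m A) = a \<cdot>\<^sub>m lr m k A"
  and upper_add: "A \<in> carrier_mat (m + k) (m + k) \<Longrightarrow> B \<in> carrier_mat (m + k) (m + k) \<Longrightarrow> upper m k A \<Longrightarrow> upper m k B \<Longrightarrow> upper m k (A + B)"
  and upper_smult: "A \<in> carrier_mat (m + k) (m + k) \<Longrightarrow> upper m k A \<Longrightarrow> upper m k (a \<cdot>\<^sub>m A)"
  by (auto simp: ul_def lr_def upper_def intro!: eq_matI)

lemma msub_blk: assumes "msub m W" "msub k W'" shows "msub (m + k) (blk m k W W')"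
proof -
  have "upper m k (0\<^sub>m (m + k) (m + k))" "ul m (0\<^sub>m (m + k) (m + k)) = 0\<^sub>m m m" "lr m k (0\<^sub>m (m + k) (m + k)) = 0\<^sub>m k k"
    by (auto simp: ul_def lr_def upper_def intro!: eq_matI)
  then show ?thesis unfolding msub_def blk_def
    using msubD[OF assms(1)] msubD[OF assms(2)]
    by (auto simp: ul_add[of _ m k] lr_add ul_smult[of _ m k] lr_smult upper_add upper_smult)
qed

lemma mlin_parts: assumes "W \<subseteq> carrier_mat (m + k) (m + k)" shows "mlin m W (ul m)" "mlin k W (lr m k)"
proof -
  have c: "A \<in> carrier_mat (m + k) (m + k)" if "A \<in> W" for A using assms that by blast
  show "mlin m W (ul m)" unfolding mlin_def using ul_add[OF c c] ul_smult[OF c] by auto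
  show "mlin k W (lr m k)" unfolding mlin_def using lr_add[OF c c] lr_smult[OF c] by auto
qed

text \<open>Reading off the upper and then the lower diagonal block leaves the corner, with
  \<open>m * k\<close> free entries.\<close>

lemma mdim_blk:
  assumes W: "msub m W" and W': "msub k W'"
  shows "mdim (blk m k W W') = mdim W + mdim W' + m * k * d"
proof -
  let ?B = "blk m k W W'"
  let ?K = "{A\<in>?B. ul m A = 0\<^sub>m m m}"
  note B = msub_blk[OF W W'] and p = mlin_parts[OF blk_carrier, of m k]
  note K = msub_ker[OF B p(1)]
  have Kc: "?K \<subseteq> carrier_mat (m + k) (m + k)" using blk_carrier[of m k] by blast
  have bd: "bd m k A C \<in> ?B" if "A \<in> W" "C \<in> W'" for A C
    using bd_parts[OF subsetD[OF msubD(1)[OF W] that(1)] subsetD[OF msubD(1)[OF W'] that(2)]] that unfolding blk_def by simp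
  have "ul m ` ?B = W"
  proof (intro equalityI subsetI)
    fix A assume A: "A \<in> W"
    have "ul m (bd m k A (0\<^sub>m k k)) = A" using bd_parts(3)[OF subsetD[OF msubD(1)[OF W] A] zero_carrier_mat] by simp
    then show "A \<in> ul m ` ?B" using bd[OF A msubD(2)[OF W']] by (intro image_eqI[of _ _ "bd m k A (0\<^sub>m k k)"]) simp_all
  qed (auto simp: blk_def)
  moreover have "lr m k ` ?K = W'"
  proof (intro equalityI subsetI)
    fix C assume C: "C \<in> W'"
    have "lr m k (bd m k (0\<^sub>m m m) C) = C" "ul m (bd m k (0\<^sub>m m m) C) = 0\<^sub>m m m"
      using bd_parts(3,4)[OF zero_carrier_mat subsetD[OF msubD(1)[OF W'] C]] by simp_all
    then show "C \<in> lr m k ` ?K" using bd[OF msubD(2)[OF W] C] by (intro image_eqI[of _ _ "bd m k (0\<^sub>m m m) C"]) simp_all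
  qed (auto simp: blk_def)
  moreover have "{A\<in>?K. lr m k A = 0\<^sub>m k k} = supp_mat (m + k) ({..<m} \<times> {m..<m + k}) UNIV"
  proof (intro equalityI subsetI)
    fix A assume "A \<in> {A\<in>?K. lr m k A = 0\<^sub>m k k}"
    then have A: "A \<in> carrier_mat (m + k) (m + k)" "upper m k A" "ul m A = 0\<^sub>m m m" "lr m k A = 0\<^sub>m k k" unfolding blk_def by auto
    have "A $$ (i, j) = 0" if ij: "i < m + k" "j < m + k" "\<not> (i < m \<and> m \<le> j)" for i j
      using less_add_cases[OF ij(1)]
    proof cases
      case 1
      then have "ul m A $$ (i, j) = A $$ (i, j)" using ij(3) by (simp add: ul_entry)
      then show ?thesis using A(3) 1 ij(3) by simp
    next
      case (2 i')
      note i' = this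
      show ?thesis using less_add_cases[OF ij(2)]
      proof cases
        case 1
        then show ?thesis using A(2) i' by (simp add: upper_def)
      next
        case (2 j')
        then have "lr m k A $$ (i', j') = A $$ (i, j)" using i' by (simp add: lr_entry)
        then show ?thesis using A(4) i' 2 by simp
      qed
    qed
    then show "A \<in> supp_mat (m + k) ({..<m} \<times> {m..<m + k}) UNIV" using A(1) unfolding supp_mat_def by auto
  next
    fix A assume "A \<in> supp_mat (m + k) ({..<m} \<times> {m..<m + k}) UNIV"
    then have c: "A \<in> carrier_mat (m + k) (m + k)" and z: "A $$ (i, j) = 0" if "i < m + k" "j < m + k" "\<not> (i < m \<and> m \<le> j)" for i j
      using that unfolding supp_mat_def by (auto split: if_splits)
    have c: "A \<in> carrier_mat (m + k) (m + k)" using \<open>A \<in> supp_mat _ _ _\<close> unfolding supp_mat_def by blast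
    have "upper m k A" "ul m A = 0\<^sub>m m m" "lr m k A = 0\<^sub>m k k"
      using z by (auto simp: upper_def ul_def lr_def intro!: eq_matI)
    then show "A \<in> {A\<in>?K. lr m k A = 0\<^sub>m k k}" using c msubD(2)[OF W] msubD(2)[OF W'] unfolding blk_def by auto
  qed
  moreover have "mdim (supp_mat (m + k) ({..<m} \<times> {m..<m + k}) UNIV) = m * k * d"
  proof -
    have I: "{..<m} \<times> {m..<m + k} \<subseteq> {..<m + k} \<times> {..<m + k}" by auto
    show ?thesis using flat_supp(2)[OF I fd_D] dm_D by (simp add: card_cartesian_product)
  qed
  ultimately show ?thesis
    using mdim_rank_nullity[OF B p(1)] mdim_rank_nullity[OF K mlin_parts(2)[OF Kc]] by simp
qed

lemma blk_translate:
  assumes A: "A \<in> carrier_mat m m" "W \<subseteq> carrier_mat m m" and C: "C \<in> carrier_mat k k" "W' \<subseteq> carrier_mat k k"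
  shows "blk m k ((+) A ` W) ((+) C ` W') = (+) (bd m k A C) ` blk m k W W'"
proof -
  note b = bd_parts[OF A(1) C(1)]
  show ?thesis
  proof (intro equalityI subsetI)
    fix M assume "M \<in> blk m k ((+) A ` W) ((+) C ` W')"
    then obtain w w' where M: "M \<in> carrier_mat (m + k) (m + k)" "upper m k M" "w \<in> W" "ul m M = A + w" "w' \<in> W'" "lr m k M = C + w'"
      unfolding blk_def by auto
    define N where "N = M + (- bd m k A C)"
    have N: "N \<in> carrier_mat (m + k) (m + k)" unfolding N_def using M(1) b(1) by auto
    have MN: "M = bd m k A C + N" unfolding N_def using M(1) b(1) by (intro eq_matI) auto
    have "ul m M = A + ul m N" "lr m k M = C + lr m k N" using ul_add[OF b(1) N] lr_add[OF b(1) N] b(3,4) MN by auto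
    moreover have "w \<in> carrier_mat m m" "w' \<in> carrier_mat k k" using M(3,5) A(2) C(2) by auto
    ultimately have "ul m N = w" "lr m k N = w'"
      using M(4,6) A(1) C(1) by (auto simp: mat_eq_iff ul_def lr_def)
    moreover have "upper m k N" using M(1,2) b(1,2) unfolding N_def upper_def by auto
    ultimately show "M \<in> (+) (bd m k A C) ` blk m k W W'" using MN N M(3,5) unfolding blk_def by auto
  next
    fix M assume "M \<in> (+) (bd m k A C) ` blk m k W W'"
    then obtain N where N: "M = bd m k A C + N" "N \<in> carrier_mat (m + k) (m + k)" "upper m k N" "ul m N \<in> W" "lr m k N \<in> W'"
      unfolding blk_def by auto
    have "upper m k M" "ul m M = A + ul m N" "lr m k M = C + lr m k N"
      unfolding N(1) using upper_add[OF b(1) N(2) b(2) N(3)] ul_add[OF b(1) N(2)] lr_add[OF b(1) N(2)] b(3,4) by auto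
    then show "M \<in> blk m k ((+) A ` W) ((+) C ` W')" unfolding blk_def using N b(1) by auto
  qed
qed

lemma affine_blk:
  assumes "affine m p S" "affine k q T" shows "affine (m + k) (p + q + m * k * d) (blk m k S T)"
proof -
  obtain A W where A: "A \<in> carrier_mat m m" "msub m W" "mdim W = p" "S = (+) A ` W" using assms(1) unfolding affine_def by blast
  obtain C W' where C: "C \<in> carrier_mat k k" "msub k W'" "mdim W' = q" "T = (+) C ` W'" using assms(2) unfolding affine_def by blast
  note b = bd_parts[OF A(1) C(1)]
  have "blk m k S T = (+) (bd m k A C) ` blk m k W W'"
    unfolding A(4) C(4) by (rule blk_translate[OF A(1) msubD(1)[OF A(2)] C(1) msubD(1)[OF C(2)]])
  then show ?thesis unfolding affine_def
    using b(1) msub_blk[OF A(2) C(2)] mdim_blk[OF A(2) C(2)] A(3) C(3) by blast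
qed

end

section \<open>Classification of the optimal spaces\<close>

context quad_mat
begin

text \<open>Each set is recovered as a set of diagonal blocks; the other set must be nonempty for
  this.\<close>

lemma blk_eqD:
  assumes "blk m k S T = blk m k S' T'" "S \<subseteq> carrier_mat m m" "S' \<subseteq> carrier_mat m m" "T \<subseteq> carrier_mat k k" "T' \<subseteq> carrier_mat k k"
    "S \<noteq> {}" "T \<noteq> {}" "S' \<noteq> {}" "T' \<noteq> {}"
  shows "S = S'" "T = T'"
proof -
  have p: "ul m ` blk m k S T = S \<and> lr m k ` blk m k S T = T"
    if ne: "S \<subseteq> carrier_mat m m" "T \<subseteq> carrier_mat k k" "S \<noteq> {}" "T \<noteq> {}" for S T
  proof -
    obtain s t where st: "s \<in> S" "t \<in> T" using ne(3,4) by blast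
    have b: "bd m k A C \<in> blk m k S T \<and> ul m (bd m k A C) = A \<and> lr m k (bd m k A C) = C" if AC: "A \<in> S" "C \<in> T" for A C
      using bd_parts[OF subsetD[OF ne(1) AC(1)] subsetD[OF ne(2) AC(2)]] AC
      unfolding blk_def by simp
    have 1: "A \<in> ul m ` blk m k S T" if "A \<in> S" for A using b[OF that st(2)] by (intro image_eqI[of _ _ "bd m k A t"]) simp_all
    have 2: "C \<in> lr m k ` blk m k S T" if "C \<in> T" for C using b[OF st(1) that] by (intro image_eqI[of _ _ "bd m k s C"]) simp_all
    have 3: "ul m ` blk m k S T \<subseteq> S" "lr m k ` blk m k S T \<subseteq> T" by (auto simp: blk_def)
    show ?thesis by (intro conjI equalityI 3 subsetI; (erule 1 | erule 2))
  qed
  show "S = S'"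
    by (rule trans[OF conjunct1[OF p[OF assms(2,4,6,7)], symmetric]], unfold assms(1), rule conjunct1[OF p[OF assms(3,5,8,9)]])
  show "T = T'"
    by (rule trans[OF conjunct2[OF p[OF assms(2,4,6,7)], symmetric]], unfold assms(1), rule conjunct2[OF p[OF assms(3,5,8,9)]])
qed

lemma affine_nonempty: "affine n k S \<Longrightarrow> S \<noteq> {}"
  unfolding affine_def using msubD(2) by blast

lemma GL_sub: "S \<subseteq> GL n \<Longrightarrow> S \<subseteq> carrier_mat n n" by auto

lemma blk_unital: assumes "S \<subseteq> GL m" "T \<subseteq> GL k" shows "blk m k S T \<subseteq> GL (m + k)"
proof
  fix A assume "A \<in> blk m k S T"
  then have A: "A \<in> carrier_mat (m + k) (m + k)" "upper m k A" "ul m A \<in> S" "lr m k A \<in> T" unfolding blk_def by auto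
  then show "A \<in> GL (m + k)" using blk_GL[OF A(1,2)] assms by blast
qed

text \<open>The last term is the dimension of the corner, as in \<open>mdim_blk\<close>; so joints
  of spaces attaining the bound attain it too.\<close>

lemma bound_add: "R.bound (m + k) = R.bound m + R.bound k + m * k * d"
proof -
  have "(\<Sum>j<m + k. j) = (\<Sum>j<m. j) + (\<Sum>j<k. j) + m * k"
    unfolding sum_lessThan_add by (simp add: sum.distrib)
  then have "(m + k) * (m + k - 1) div 2 = m * (m - 1) div 2 + k * (k - 1) div 2 + m * k"
    unfolding sum_lessThan_id .
  then show ?thesis unfolding R.bound_def by (simp only: distrib_left distrib_right) (simp add: ac_simps)
qed

lemma nonisotropic_carrier: "nonisotropic \<sigma> e n P \<Longrightarrow> P \<in> carrier_mat n n" by (simp add: nonisotropic_def)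

text \<open>\<open>H\<close> contributes nothing to \<open>e (hf n x (act n (P + H) x))\<close>, so
  a kernel vector of \<open>P + H\<close> would be isotropic for \<open>P\<close>.\<close>

lemma nonisotropic_unital: assumes "nonisotropic \<sigma> e n P" shows "(+) P ` SH \<sigma> e n \<subseteq> GL n"
proof
  fix M assume "M \<in> (+) P ` SH \<sigma> e n"
  then obtain H where H: "H \<in> SH \<sigma> e n" "M = P + H" by blast
  note P = nonisotropic_carrier[OF assms]
  show "M \<in> GL n"
  proof (rule inj_GL)
    show "M \<in> carrier_mat n n" using H SH_carrier[OF H(1)] P by simp
    fix x assume x: "x \<in> sp n" "act n M x = 0"
    have "e (hf n x (act n M x)) = e (hf n x (act n P x)) + e (hf n x (act n H x))"
      unfolding H(2) act_mat_add[OF P SH_carrier[OF H(1)]] by (simp add: hf_add_right e_add)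
    then have "e (hf n x (act n P x)) = 0" using x(2) SH_isotropic[OF H(1)] by simp
    then show "x = 0" using assms x(1) unfolding nonisotropic_iff by blast
  qed
qed

lemma nonisotropic_GL: assumes "nonisotropic \<sigma> e n P" shows "P \<in> GL n"
proof -
  have "P + 0\<^sub>m n n \<in> GL n" using nonisotropic_unital[OF assms] msubD(2)[OF msub_SH] by blast
  then show ?thesis using nonisotropic_carrier[OF assms] by simp
qed

lemma nonisotropic_affine: "nonisotropic \<sigma> e n P \<Longrightarrow> affine n (R.bound n) ((+) P ` SH \<sigma> e n)"
  unfolding affine_def using nonisotropic_carrier msub_SH mdim_SH by blast

lemma nlist_Cons: "nonisotropic_list \<sigma> e (n # ns) (P # Ps) \<longleftrightarrow> nonisotropic \<sigma> e n P \<and> nonisotropic_list \<sigma> e ns Ps"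
proof
  assume l: "nonisotropic_list \<sigma> e (n # ns) (P # Ps)"
  then have "\<forall>k<Suc (length ns). (P # Ps) ! k \<in> GL ((n # ns) ! k) \<and> nonisotropic \<sigma> e ((n # ns) ! k) ((P # Ps) ! k)" "length Ps = length ns"
    unfolding nonisotropic_list_def by auto
  then have "\<forall>k<length ns. Ps ! k \<in> GL (ns ! k) \<and> nonisotropic \<sigma> e (ns ! k) (Ps ! k)" "nonisotropic \<sigma> e n P"
    by (metis Suc_mono nth_Cons_Suc, metis nth_Cons_0 zero_less_Suc)
  then show "nonisotropic \<sigma> e n P \<and> nonisotropic_list \<sigma> e ns Ps"
    using \<open>length Ps = length ns\<close> unfolding nonisotropic_list_def by blast
next
  assume "nonisotropic \<sigma> e n P \<and> nonisotropic_list \<sigma> e ns Ps"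
  then show "nonisotropic_list \<sigma> e (n # ns) (P # Ps)"
    unfolding nonisotropic_list_def using nonisotropic_GL by (auto simp: nth_Cons split: nat.splits)
qed

lemma nlist_induct [consumes 1, case_names Nil Cons]:
  assumes "nonisotropic_list \<sigma> e ns Ps" "Q [] []"
    "\<And>n P ns Ps. nonisotropic \<sigma> e n P \<Longrightarrow> nonisotropic_list \<sigma> e ns Ps \<Longrightarrow> Q ns Ps \<Longrightarrow> Q (n # ns) (P # Ps)"
  shows "Q ns Ps"
proof -
  have "length ns = length Ps" using assms(1) unfolding nonisotropic_list_def by simp
  then show ?thesis using assms(1)
    by (induction ns Ps rule: list_induct2) (use assms(2,3) nlist_Cons in blast)+
qed

lemma SH_joint_Nil: "SH_joint \<sigma> e [] [] = carrier_mat 0 0" by (simp add: SH_joint_def)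

lemma SH_joint_Cons_aux: "SH_joint \<sigma> e (n # ns) (P # Ps) = joint ((+) P ` SH \<sigma> e n # map2 (\<lambda>m P. (\<lambda>N. P + N) ` SH \<sigma> e m) ns Ps)"
  by (simp add: SH_joint_def)

lemma SH_joint_carrier: "nonisotropic_list \<sigma> e ns Ps \<Longrightarrow> SH_joint \<sigma> e ns Ps \<subseteq> carrier_mat (sum_list ns) (sum_list ns)"
proof (induction rule: nlist_induct)
  case Nil
  then show ?case by (simp add: SH_joint_Nil)
next
  case (Cons n P ns Ps)
  have "joint ((+) P ` SH \<sigma> e n # map2 (\<lambda>m P. (\<lambda>N. P + N) ` SH \<sigma> e m) ns Ps) \<subseteq> carrier_mat (n + sum_list ns) (n + sum_list ns)"
    using joint_Cons[OF GL_sub[OF nonisotropic_unital[OF Cons(1)]] Cons(3)[unfolded SH_joint_def]] blk_carrier by simp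
  then show ?case unfolding SH_joint_Cons_aux by simp
qed

lemma SH_joint_Cons:
  assumes "nonisotropic \<sigma> e n P" "nonisotropic_list \<sigma> e ns Ps"
  shows "SH_joint \<sigma> e (n # ns) (P # Ps) = blk n (sum_list ns) ((+) P ` SH \<sigma> e n) (SH_joint \<sigma> e ns Ps)"
  unfolding SH_joint_Cons_aux
  using joint_Cons[OF GL_sub[OF nonisotropic_unital[OF assms(1)]] SH_joint_carrier[OF assms(2), unfolded SH_joint_def]]
  by (simp add: SH_joint_def)

lemma carrier_0: "A \<in> carrier_mat 0 0 \<Longrightarrow> A = (1\<^sub>m 0 :: 'a mat)" by (rule eq_matI) auto

lemma SH_joint_optimal:
  "nonisotropic_list \<sigma> e ns Ps \<Longrightarrow>
    SH_joint \<sigma> e ns Ps \<subseteq> GL (sum_list ns) \<and> affine (sum_list ns) (R.bound (sum_list ns)) (SH_joint \<sigma> e ns Ps)"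
proof (induction rule: nlist_induct)
  case Nil
  have c: "carrier_mat 0 0 = {1\<^sub>m 0 :: 'a mat}" using carrier_0 by auto
  have "msub 0 {0\<^sub>m 0 0}" by (auto simp: msub_def)
  moreover have "{1\<^sub>m 0 :: 'a mat} = (+) (1\<^sub>m 0) ` {0\<^sub>m 0 0}" by (auto intro!: eq_matI)
  ultimately have "affine 0 0 {1\<^sub>m 0 :: 'a mat}" unfolding affine_def using mdim_zero[of 0] by (metis one_carrier_mat)
  then show ?case unfolding SH_joint_Nil c by (simp add: R.bound_def)
next
  case (Cons n P ns Ps)
  then show ?case unfolding SH_joint_Cons[OF Cons(1,2)]
    using affine_blk[OF nonisotropic_affine[OF Cons(1)], of "sum_list ns"] blk_unital[OF nonisotropic_unital[OF Cons(1)]]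
    by (simp add: bound_add)
qed

lemma SH_joint_append:
  assumes "nonisotropic_list \<sigma> e ns Ps" "nonisotropic_list \<sigma> e ms Qs"
  shows "nonisotropic_list \<sigma> e (ns @ ms) (Ps @ Qs) \<and>
    SH_joint \<sigma> e (ns @ ms) (Ps @ Qs) = blk (sum_list ns) (sum_list ms) (SH_joint \<sigma> e ns Ps) (SH_joint \<sigma> e ms Qs)"
  using assms(1)
proof (induction rule: nlist_induct)
  case Nil
  then show ?case using assms(2) blk_empty[OF SH_joint_carrier[OF assms(2)]] by (simp add: SH_joint_Nil)
next
  case (Cons n P ns Ps)
  have l: "nonisotropic_list \<sigma> e (ns @ ms) (Ps @ Qs)" using Cons(3) by blast
  then show ?case using Cons(3) SH_joint_Cons[OF Cons(1) l] SH_joint_Cons[OF Cons(1,2)] nlist_Cons Cons(1)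
      blk_assoc[of n "sum_list ns" "sum_list ms"] by simp
qed

lemma mlin_mult: assumes "C \<in> carrier_mat n n" "W \<subseteq> carrier_mat n n" "Q \<in> carrier_mat n n" shows "mlin n W (\<lambda>w. C * w * Q)"
  unfolding mlin_def
proof (intro conjI ballI)
  show "(\<lambda>w. C * w * Q) ` W \<subseteq> carrier_mat n n" using assms by auto
  fix A assume "A \<in> W"
  then have A: "A \<in> carrier_mat n n" using assms(2) by blast
  show "C * (A + B) * Q = C * A * Q + C * B * Q" if "B \<in> W" for B
  proof -
    have B: "B \<in> carrier_mat n n" using that assms(2) by blast
    have "C * (A + B) = C * A + C * B" by (rule mult_add_distrib_mat[OF assms(1) A B])
    moreover have "(C * A + C * B) * Q = C * A * Q + C * B * Q"
      by (rule add_mult_distrib_mat[OF mult_carrier_mat[OF assms(1) A] mult_carrier_mat[OF assms(1) B] assms(3)])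
    ultimately show ?thesis by simp
  qed
  fix a assume a: "a \<in> F"
  note c = assms(1) A assms(3) smult_carrier_mat[OF A] mult_carrier_mat[OF assms(1) A]
  have "C * (a \<cdot>\<^sub>m A) = a \<cdot>\<^sub>m (C * A)"
  proof (rule eq_matI)
    fix i j assume "i < dim_row (a \<cdot>\<^sub>m (C * A))" "j < dim_col (a \<cdot>\<^sub>m (C * A))"
    then have ij: "i < n" "j < n" using c by auto
    have "(C * (a \<cdot>\<^sub>m A)) $$ (i, j) = (\<Sum>l<n. C $$ (i, l) * (a * A $$ (l, j)))"
      unfolding mult_entry[OF c(1,4) ij] using ij A by (intro sum.cong) auto
    also have "\<dots> = a * (\<Sum>l<n. C $$ (i, l) * A $$ (l, j))" unfolding sum_distrib_left F_left_comm[OF a] ..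
    finally show "(C * (a \<cdot>\<^sub>m A)) $$ (i, j) = (a \<cdot>\<^sub>m (C * A)) $$ (i, j)"
      using ij c mult_entry[OF c(1,2) ij] by simp
  qed (use c in auto)
  moreover have "(a \<cdot>\<^sub>m (C * A)) * Q = a \<cdot>\<^sub>m (C * A * Q)"
  proof (rule eq_matI)
    fix i j assume "i < dim_row (a \<cdot>\<^sub>m (C * A * Q))" "j < dim_col (a \<cdot>\<^sub>m (C * A * Q))"
    then have ij: "i < n" "j < n" using c by auto
    have "((a \<cdot>\<^sub>m (C * A)) * Q) $$ (i, j) = (\<Sum>l<n. a * (C * A) $$ (i, l) * Q $$ (l, j))"
      unfolding mult_entry[OF smult_carrier_mat[OF c(5)] c(3) ij] using ij c by (intro sum.cong) auto
    also have "\<dots> = a * (\<Sum>l<n. (C * A) $$ (i, l) * Q $$ (l, j))" unfolding sum_distrib_left mult.assoc ..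
    finally show "((a \<cdot>\<^sub>m (C * A)) * Q) $$ (i, j) = (a \<cdot>\<^sub>m (C * A * Q)) $$ (i, j)"
      using ij c mult_entry[OF c(5,3) ij] by simp
  qed (use c in auto)
  ultimately show "C * (a \<cdot>\<^sub>m A) * Q = a \<cdot>\<^sub>m (C * A * Q)" by simp
qed

lemma mult_GL_cancel:
  assumes "C \<in> GL n" "Q \<in> GL n" "A \<in> carrier_mat n n" "C * A * Q = 0\<^sub>m n n" shows "A = 0\<^sub>m n n"
proof -
  obtain C' where C: "C' \<in> GL n" "C * C' = 1\<^sub>m n" "C' * C = 1\<^sub>m n" by (rule GL_obtain[OF assms(1)])
  obtain Q' where Q: "Q' \<in> GL n" "Q * Q' = 1\<^sub>m n" "Q' * Q = 1\<^sub>m n" by (rule GL_obtain[OF assms(2)])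
  have "C' * (C * A * Q) * Q' = A" by (rule conj_image_inverse[OF assms(1) C assms(2) Q assms(3)])
  moreover have "C' * 0\<^sub>m n n * Q' = 0\<^sub>m n n"
    using right_mult_zero_mat[OF GL_carrier[OF C(1)], of n] left_mult_zero_mat[OF GL_carrier[OF Q(1)], of n] by simp
  ultimately show ?thesis unfolding assms(4) by simp
qed

lemma mdim_mult:
  assumes "C \<in> GL n" "Q \<in> GL n" "msub n W"
  shows "msub n ((\<lambda>w. C * w * Q) ` W)" "mdim ((\<lambda>w. C * w * Q) ` W) = mdim W"
proof -
  note l = mlin_mult[OF GL_carrier[OF assms(1)] msubD(1)[OF assms(3)] GL_carrier[OF assms(2)]]
  show "msub n ((\<lambda>w. C * w * Q) ` W)" by (rule msub_image[OF assms(3) l])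
  show "mdim ((\<lambda>w. C * w * Q) ` W) = mdim W"
    by (rule mdim_inj[OF assms(3) l]) (use mult_GL_cancel[OF assms(1,2)] msubD(1)[OF assms(3)] in blast)
qed

lemma act_cong: "(\<And>j. j < n \<Longrightarrow> x j = y j) \<Longrightarrow> act n A x = act n A y"
  unfolding act_def by (rule ext, rule if_cong[OF refl _ refl], rule sum.cong[OF refl]) simp

lemma act_image_dm:
  assumes "msub n W" shows "R.E.fd (act n ` W)" "R.E.dm (act n ` W) = mdim W"
proof -
  define \<psi> where "\<psi> = (\<lambda>(g :: nat \<times> nat \<Rightarrow> 'a) v i. if i < n then (\<Sum>j<n. g (i, j) * v j) else 0)"
  have lin: "ME.flin (flat ` W) \<psi>"
  proof (rule ME.flinI)
    fix g h show "\<psi> (g + h) = \<psi> g + \<psi> h"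
      by (rule ext, rule ext) (simp add: \<psi>_def distrib_right sum.distrib)
  next
    fix a g assume a: "a \<in> F"
    show "\<psi> (\<lambda>i. a * g i) = (\<lambda>v i. \<psi> g v i * a)"
      by (rule ext, rule ext) (simp add: \<psi>_def mult.assoc sum_distrib_left[symmetric], simp add: F_comm[OF a])
  qed
  have a: "\<psi> (flat A) = act n A" if "A \<in> W" for A
    using subsetD[OF msubD(1)[OF assms] that] by (intro ext) (auto simp: \<psi>_def act_def flat_def intro!: sum.cong)
  have im: "\<psi> ` flat ` W = act n ` W" unfolding image_image by (rule image_cong) (auto simp: a)
  show "R.E.fd (act n ` W)" using ME.rank_nullity(1)[OF msub_fd[OF assms] lin] im by simp
  have "R.E.dm (\<psi> ` flat ` W) = M.dm (flat ` W)"
  proof (rule ME.dm_inj[OF msub_fd[OF assms] lin])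
    fix v assume "v \<in> flat ` W" "\<psi> v = 0"
    then obtain A where A: "A \<in> W" "v = flat A" "act n A = 0" using a by auto
    have c: "A \<in> carrier_mat n n" using msubD(1)[OF assms] A(1) by blast
    have "act n A x = act n (0\<^sub>m n n) x" for x unfolding A(3) by (simp add: act_def fun_eq_iff)
    then have "A = 0\<^sub>m n n" by (rule act_inj[OF c zero_carrier_mat])
    then show "v = 0" using A(2) flat_0 by simp
  qed
  then show "R.E.dm (act n ` W) = mdim W" unfolding im mdim_def .
qed

text \<open>If \<open>B * w\<close> fixes \<open>v\<close>, then \<open>A - w\<close> kills
  \<open>v\<close>, and \<open>A - w\<close> belongs to the affine space. The factor
  \<open>1\<^sub>m n\<close> gives the product the shape that \<open>mdim_mult\<close>
  expects.\<close>

lemma unital_trivial_spectrum: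
  assumes A: "A \<in> carrier_mat n n" "msub n W" "(+) A ` W \<subseteq> GL n" and B: "B \<in> GL n" "A * B = 1\<^sub>m n" "B * A = 1\<^sub>m n"
  shows "R.trivial_spectrum (sp n) (act n ` (\<lambda>w. B * w * 1\<^sub>m n) ` W) n"
    "R.E.dm (act n ` (\<lambda>w. B * w * 1\<^sub>m n) ` W) = mdim W"
proof -
  note m = mdim_mult[OF B(1) GL_one A(2)]
  note D = act_image_dm[OF m(1)]
  show "R.E.dm (act n ` (\<lambda>w. B * w * 1\<^sub>m n) ` W) = mdim W" using D(2) m(2) by simp
  have "N = 0" if N: "N \<in> act n ` (\<lambda>w. B * w * 1\<^sub>m n) ` W" and z: "\<forall>v\<in>sp n. N v = 0" for N
  proof -
    \<comment> \<open>\<open>act n C\<close> reads only the first \<open>n\<close> coordinates, so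
      its values on \<open>sp n\<close> determine it.\<close>
    obtain C where C: "N = act n C" using N by (rule imageE)
    show ?thesis
    proof (rule ext)
      fix v
      have "N v = N (\<lambda>i. if i < n then v i else 0)" unfolding C by (rule act_cong) simp
      also have "\<dots> = 0" by (rule bspec[OF z]) (simp add: sp_def)
      finally show "N v = 0 v" by simp
    qed
  qed
  moreover have "v = 0" if N: "N \<in> act n ` (\<lambda>w. B * w * 1\<^sub>m n) ` W" and v: "v \<in> sp n" "N v = v" for N v
  proof -
    obtain w where w: "w \<in> W" "N = act n (B * w * 1\<^sub>m n)" using N unfolding image_image by (rule imageE)
    note wc = subsetD[OF msubD(1)[OF A(2)] w(1)] and Bc = GL_carrier[OF B(1)]
    have "A * (B * w * 1\<^sub>m n) = A * B * w" using A(1) wc Bc by (simp add: assoc_mult_mat[of _ n n _ n _ n])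
    then have "A * (B * w * 1\<^sub>m n) = w" using B(2) wc by simp
    then have "act n A v = act n w v"
      using act_mult[OF A(1), of "B * w * 1\<^sub>m n" v] wc Bc v(2) w(2) by simp
    then have "act n (A + (- w)) v = 0" using act_mat_add[OF A(1), of "- w" v] act_mat_uminus[OF wc, of v] wc by simp
    moreover have "A + (- w) \<in> GL n" using A(3) msub_uminus[OF A(2) w(1)] by blast
    ultimately show ?thesis using GL_inj v(1) by blast
  qed
  moreover have "R.dlin (sp n) N \<and> N ` sp n \<subseteq> sp n" if "N \<in> act n ` (\<lambda>w. B * w * 1\<^sub>m n) ` W" for N
    using that act_dlin by auto
  ultimately show "R.trivial_spectrum (sp n) (act n ` (\<lambda>w. B * w * 1\<^sub>m n) ` W) n"
    unfolding R.trivial_spectrum_def using sp_dsub sp_fd sp_dm D(1) by (intro conjI ballI impI) simp_all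
qed

lemma affine_unital_bound:
  assumes "affine n k S" "S \<subseteq> GL n" "big F (n * d)" shows "k \<le> R.bound n"
proof -
  obtain A W where A: "A \<in> carrier_mat n n" "msub n W" "mdim W = k" "S = (+) A ` W" using assms(1) unfolding affine_def by blast
  have "A + 0\<^sub>m n n \<in> GL n" using assms(2) A(4) msubD(2)[OF A(2)] by blast
  then have "A \<in> GL n" using A(1) by simp
  then obtain B where B: "B \<in> GL n" "A * B = 1\<^sub>m n" "B * A = 1\<^sub>m n" by (rule GL_obtain)
  have u: "(+) A ` W \<subseteq> GL n" using assms(2) A(4) by simp
  show ?thesis using R.dm_trivial_spectrum[OF unital_trivial_spectrum(1)[OF A(1,2) u B] assms(3)]
      unital_trivial_spectrum(2)[OF A(1,2) u B] A(3) by simp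
qed

text \<open>Blocks of size one: if \<open>e p \<noteq> 0\<close>, then
  \<open>e (\<sigma> x * (p * x))\<close> is the norm of \<open>x\<close> times \<open>e p\<close>.
  This shows that the bound is attained in every size.\<close>

lemma nonisotropic_list_exists: "\<exists>ns Ps. ordered_partition n ns \<and> nonisotropic_list \<sigma> e ns Ps"
proof -
  obtain p where p: "e p \<noteq> 0" using e_nz by blast
  let ?P = "mat 1 1 (\<lambda>_. p)"
  have P: "nonisotropic \<sigma> e 1 ?P" unfolding nonisotropic_iff
  proof (intro conjI ballI impI)
    fix x :: "nat \<Rightarrow> 'a" assume x: "x \<in> sp 1" "x \<noteq> 0"
    have "x 0 \<noteq> 0"
    proof
      assume "x 0 = 0"
      then have "x i = 0" for i using spD[OF x(1), of i] by (cases i) auto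
      then show False using x(2) by (auto simp: fun_eq_iff)
    qed
    moreover have "hf 1 x (act 1 ?P x) = \<sigma> (x 0) * (p * x 0)" by (simp add: hf_def act_def)
    ultimately show "e (hf 1 x (act 1 ?P x)) \<noteq> 0" using p by (simp add: e_conj)
  qed simp
  have "ordered_partition n (replicate n 1) \<and> nonisotropic_list \<sigma> e (replicate n 1) (replicate n ?P)"
    unfolding ordered_partition_def nonisotropic_list_def using P nonisotropic_GL[OF P] by (simp add: sum_list_replicate)
  then show ?thesis by blast
qed

text \<open>The upper bound of \<open>affine_unital_bound\<close> is attained by some joint of
  nonisotropic blocks, so optimality reduces to a condition on the dimension.\<close>

lemma optimal_iff:
  assumes "big F (n * d)"
  shows "optimal F n S \<longleftrightarrow> S \<subseteq> GL n \<and> affine n (R.bound n) S"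
proof -
  have u: "unital_affine_subspace F n T \<longleftrightarrow> T \<subseteq> GL n \<and> (\<exists>k. affine n k T)" for T
    unfolding unital_affine_subspace_def affine_subspace_iff by blast
  obtain ns Ps where "ordered_partition n ns" "nonisotropic_list \<sigma> e ns Ps" using nonisotropic_list_exists by blast
  then obtain T where T: "T \<subseteq> GL n" "affine n (R.bound n) T" using SH_joint_optimal[of ns Ps] unfolding ordered_partition_def by blast
  show ?thesis
  proof
    assume o: "optimal F n S"
    then obtain k where k: "affine n k S" "S \<subseteq> GL n" unfolding optimal_def u by blast
    have "affine_dimension F n T \<le> affine_dimension F n S" using o T unfolding optimal_def u by blast
    then have "R.bound n \<le> k" using affine_dimension_eq[OF T(2)] affine_dimension_eq[OF k(1)] by simp
    then have "k = R.bound n" using affine_unital_bound[OF k assms] by simp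
    then show "S \<subseteq> GL n \<and> affine n (R.bound n) S" using k by simp
  next
    assume s: "S \<subseteq> GL n \<and> affine n (R.bound n) S"
    show "optimal F n S" unfolding optimal_def u
    proof (intro conjI allI impI)
      fix T' assume "T' \<subseteq> GL n \<and> (\<exists>k. affine n k T')"
      then obtain k where k: "affine n k T'" "T' \<subseteq> GL n" by blast
      show "affine_dimension F n T' \<le> affine_dimension F n S"
        using affine_unital_bound[OF k assms] affine_dimension_eq[OF k(1)] affine_dimension_eq[OF conjunct2[OF s]] by simp
    qed (use s in auto)
  qed
qed

section \<open>Bases adapted to a subspace\<close>

definition comb :: "(nat \<Rightarrow> nat \<Rightarrow> 'a) \<Rightarrow> nat \<Rightarrow> (nat \<Rightarrow> 'a) \<Rightarrow> nat \<Rightarrow> 'a" where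
  "comb q k x = (\<lambda>i. \<Sum>j<k. q j i * x j)"

lemma comb_dlin: "R.dlin T (comb q k)"
  by (auto simp: R.dlin_def comb_def fun_eq_iff distrib_left sum.distrib sum_distrib_right mult.assoc)

lemma comb_in: "R.dsub T \<Longrightarrow> (\<And>j. j < k \<Longrightarrow> q j \<in> T) \<Longrightarrow> comb q k x \<in> T"
proof (induction k)
  case 0
  have "comb q 0 x = 0" by (simp add: comb_def fun_eq_iff)
  then show ?case using R.dsub_0[OF 0(1)] by (simp only:)
next
  case (Suc k)
  have "comb q (Suc k) x = comb q k x + (\<lambda>i. q k i * x k)" by (simp add: comb_def fun_eq_iff)
  moreover have "comb q k x + (\<lambda>i. q k i * x k) \<in> T"
  proof (rule R.dsub_add[OF Suc(2) _ R.dsub_sc[OF Suc(2) Suc(3)]])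
    show "comb q k x \<in> T" by (rule Suc(1)[OF Suc(2)]) (simp add: Suc(3))
  qed simp
  ultimately show ?case by (simp only:)
qed

lemma comb_dm:
  assumes "\<And>x. x \<in> sp k \<Longrightarrow> comb q k x = 0 \<Longrightarrow> x = 0"
  shows "R.X.fsub (comb q k ` sp k)" "R.X.dm (comb q k ` sp k) = k * d"
proof -
  note l = R.dlin_flin[OF comb_dlin, of "sp k" q k]
  show "R.X.fsub (comb q k ` sp k)" by (rule R.XX.fsub_image[OF R.dsub_fsub[OF sp_dsub] l])
  show "R.X.dm (comb q k ` sp k) = k * d" using R.XX.dm_inj[OF sp_fd l assms] sp_dm by simp
qed

text \<open>A vector outside the current span can always be appended. An independent family of
  length \<open>k\<close> spans \<open>k * d\<close> dimensions, so its length cannot exceed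
  \<open>R.X.dm T\<close> and the process stops.\<close>

lemma extend_basis:
  assumes T: "R.dsub T" "R.X.fd T"
  shows "(\<And>j. j < k \<Longrightarrow> q j \<in> T) \<Longrightarrow> (\<And>x. x \<in> sp k \<Longrightarrow> comb q k x = 0 \<Longrightarrow> x = 0) \<Longrightarrow>
    \<exists>q' m. k \<le> m \<and> (\<forall>j<k. q' j = q j) \<and> (\<forall>j<m. q' j \<in> T) \<and> (\<forall>x\<in>sp m. comb q' m x = 0 \<longrightarrow> x = 0) \<and> comb q' m ` sp m = T"
proof (induction "R.X.dm T - k" arbitrary: k q rule: less_induct)
  case less
  have "comb q k x \<in> T" for x by (rule comb_in[OF T(1)]) (rule less(2))
  then have im: "comb q k ` sp k \<subseteq> T" by (rule image_subsetI)
  show ?case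
  proof (cases "comb q k ` sp k = T")
    case True
    then show ?thesis using less(2,3) by (intro exI[of _ q] exI[of _ k]) simp
  next
    case False
    then obtain v where v: "v \<in> T" "v \<notin> comb q k ` sp k" using im by blast
    define q1 where "q1 = q(k := v)"
    have S: "comb q1 (Suc k) x = comb q k x + (\<lambda>i. v i * x k)" for x by (simp add: comb_def q1_def fun_eq_iff)
    have inT: "q1 j \<in> T" if "j < Suc k" for j
    proof (cases "j = k")
      case False
      then show ?thesis using that less(2)[of j] by (simp add: q1_def)
    qed (simp add: q1_def v(1))
    have inj: "x = 0" if x: "x \<in> sp (Suc k)" "comb q1 (Suc k) x = 0" for x :: "nat \<Rightarrow> 'a"
    proof (cases "x k = 0")
      case True
      have xs: "x \<in> sp k"
      proof (rule spI)
        fix i assume "i \<ge> k"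
        then show "x i = 0" using True spD[OF x(1), of i] by (cases "i = k") auto
      qed
      have "(\<lambda>i. v i * x k) = 0" using True by (simp add: fun_eq_iff)
      then show ?thesis using less(3)[OF xs] x(2) S[of x] by simp
    next
      case False
      define y where "y = (\<lambda>j. if j < k then - x j * inverse (x k) else 0)"
      have "v = comb q k y"
      proof
        fix i
        have "(comb q k x + (\<lambda>i. v i * x k)) i = 0" using x(2) S[of x] by simp
        then have "v i * x k = - comb q k x i" by (simp add: eq_neg_iff_add_eq_0 add.commute)
        then have "v i * x k * inverse (x k) = - comb q k x i * inverse (x k)" by simp
        then have "v i = - comb q k x i * inverse (x k)" using False by (simp add: mult.assoc)
        also have "\<dots> = comb q k y i"
          by (simp add: comb_def y_def sum_distrib_right sum_negf[symmetric] mult.assoc)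
        finally show "v i = comb q k y i" .
      qed
      moreover have "y \<in> sp k" by (simp add: y_def sp_def)
      ultimately show ?thesis using v(2) by blast
    qed
    have "comb q1 (Suc k) x \<in> T" for x by (rule comb_in[OF T(1)]) (rule inT)
    then have "comb q1 (Suc k) ` sp (Suc k) \<subseteq> T" by (rule image_subsetI)
    moreover have "R.X.fsub (comb q1 (Suc k) ` sp (Suc k))" by (rule comb_dm(1)) (rule inj)
    ultimately have "R.X.dm (comb q1 (Suc k) ` sp (Suc k)) \<le> R.X.dm T" by (intro R.X.fd_mono(2)[OF T(2)])
    moreover have "R.X.dm (comb q1 (Suc k) ` sp (Suc k)) = Suc k * d" by (rule comb_dm(2)) (rule inj)
    ultimately have "Suc k * d \<le> R.X.dm T" by (simp only:)
    moreover have "Suc k * 1 \<le> Suc k * d" using d_pos by (intro mult_le_mono) auto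
    ultimately have "Suc k \<le> R.X.dm T" by (metis le_trans mult.right_neutral)
    then have "R.X.dm T - Suc k < R.X.dm T - k" by arith
    then have "\<exists>q' m. Suc k \<le> m \<and> (\<forall>j<Suc k. q' j = q1 j) \<and> (\<forall>j<m. q' j \<in> T) \<and>
      (\<forall>x\<in>sp m. comb q' m x = 0 \<longrightarrow> x = 0) \<and> comb q' m ` sp m = T"
      by (rule less(1)) (erule inT, rule inj)
    then obtain q' where "\<exists>m. Suc k \<le> m \<and> (\<forall>j<Suc k. q' j = q1 j) \<and> (\<forall>j<m. q' j \<in> T) \<and>
      (\<forall>x\<in>sp m. comb q' m x = 0 \<longrightarrow> x = 0) \<and> comb q' m ` sp m = T" by (rule exE)
    then obtain m where "Suc k \<le> m \<and> (\<forall>j<Suc k. q' j = q1 j) \<and> (\<forall>j<m. q' j \<in> T) \<and>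
      (\<forall>x\<in>sp m. comb q' m x = 0 \<longrightarrow> x = 0) \<and> comb q' m ` sp m = T" by (rule exE)
    then have q': "Suc k \<le> m" "\<forall>j<Suc k. q' j = q1 j" "\<forall>j<m. q' j \<in> T"
      "\<forall>x\<in>sp m. comb q' m x = 0 \<longrightarrow> x = 0" "comb q' m ` sp m = T" by simp_all
    have "\<forall>j<k. q' j = q j" using q'(2) by (auto simp: q1_def)
    then show ?thesis using q' by (intro exI[of _ q'] exI[of _ m]) simp
  qed
qed

text \<open>A basis of \<open>U\<close> is extended to one of \<open>sp n\<close>; it has
  \<open>n\<close> members by dimension, and they become the columns of \<open>Q\<close>.\<close>

lemma adapted_basis:
  assumes U: "R.dsub U" "U \<subseteq> sp n"
  obtains Q m where "Q \<in> GL n" "m \<le> n" "act n Q ` sp m = U"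
proof -
  have fU: "R.X.fd U" by (rule R.X.fd_mono(1)[OF sp_fd R.dsub_fsub[OF U(1)] U(2)])
  define q0 :: "nat \<Rightarrow> nat \<Rightarrow> 'a" where "q0 = (\<lambda>_ _. 0)"
  have "\<exists>q' m. 0 \<le> m \<and> (\<forall>j<0. q' j = q0 j) \<and> (\<forall>j<m. q' j \<in> U) \<and> (\<forall>x\<in>sp m. comb q' m x = 0 \<longrightarrow> x = 0) \<and> comb q' m ` sp m = U"
    by (rule extend_basis[where k = 0 and q = q0, OF U(1) fU]) (auto simp: sp_def fun_eq_iff)
  then obtain q where "\<exists>m. 0 \<le> m \<and> (\<forall>j<0. q j = q0 j) \<and> (\<forall>j<m. q j \<in> U) \<and> (\<forall>x\<in>sp m. comb q m x = 0 \<longrightarrow> x = 0) \<and> comb q m ` sp m = U"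
    by (rule exE)
  then obtain m where "0 \<le> m \<and> (\<forall>j<0. q j = q0 j) \<and> (\<forall>j<m. q j \<in> U) \<and> (\<forall>x\<in>sp m. comb q m x = 0 \<longrightarrow> x = 0) \<and> comb q m ` sp m = U"
    by (rule exE)
  then have q: "\<forall>j<m. q j \<in> U" "\<forall>x\<in>sp m. comb q m x = 0 \<longrightarrow> x = 0" "comb q m ` sp m = U" by simp_all
  have "\<exists>q' m'. m \<le> m' \<and> (\<forall>j<m. q' j = q j) \<and> (\<forall>j<m'. q' j \<in> sp n) \<and> (\<forall>x\<in>sp m'. comb q' m' x = 0 \<longrightarrow> x = 0) \<and> comb q' m' ` sp m' = sp n"
  proof (rule extend_basis[where T = "sp n" and k = m and q = q, OF sp_dsub sp_fd])
    show "q j \<in> sp n" if "j < m" for j using q(1) U(2) that by blast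
    show "x = 0" if "x \<in> sp m" "comb q m x = 0" for x using q(2)[rule_format, OF that] .
  qed
  then obtain q' where "\<exists>m'. m \<le> m' \<and> (\<forall>j<m. q' j = q j) \<and> (\<forall>j<m'. q' j \<in> sp n) \<and> (\<forall>x\<in>sp m'. comb q' m' x = 0 \<longrightarrow> x = 0) \<and> comb q' m' ` sp m' = sp n"
    by (rule exE)
  then obtain m' where "m \<le> m' \<and> (\<forall>j<m. q' j = q j) \<and> (\<forall>j<m'. q' j \<in> sp n) \<and> (\<forall>x\<in>sp m'. comb q' m' x = 0 \<longrightarrow> x = 0) \<and> comb q' m' ` sp m' = sp n"
    by (rule exE)
  then have q': "m \<le> m'" "\<forall>j<m. q' j = q j" "\<forall>j<m'. q' j \<in> sp n" "\<forall>x\<in>sp m'. comb q' m' x = 0 \<longrightarrow> x = 0"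
    "comb q' m' ` sp m' = sp n" by simp_all
  have inj: "x = 0" if "x \<in> sp m'" "comb q' m' x = 0" for x using q'(4)[rule_format, OF that] .
  have "R.X.dm (comb q' m' ` sp m') = m' * d" by (rule comb_dm(2)) (rule inj)
  then have "m' * d = n * d" unfolding q'(5) sp_dm by (rule sym)
  then have n: "m' = n" using d_pos by simp
  define Q where "Q = mat n n (\<lambda>(i, j). q' j i)"
  have Q: "act n Q x = comb q' n x" for x
  proof
    fix i
    show "act n Q x i = comb q' n x i"
    proof (cases "i < n")
      case False
      have "q' j i = 0" if "j < n" for j using spD[of "q' j" n i] q'(3) that n False by simp
      then show ?thesis using False by (simp add: act_def comb_def)
    qed (simp add: act_def Q_def comb_def)
  qed
  have Qc: "Q \<in> carrier_mat n n" by (simp add: Q_def)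
  have "Q \<in> GL n" by (rule inj_GL[OF Qc]) (rule inj, simp_all add: n Q)
  moreover have "act n Q x = comb q m x" if x: "x \<in> sp m" for x
  proof
    fix i
    have "comb q' n x i = (\<Sum>j<m. q' j i * x j)" unfolding comb_def
      by (rule sum.mono_neutral_right) (use q'(1) n spD[OF x] in auto)
    also have "\<dots> = comb q m x i" unfolding comb_def using q'(2) by (intro sum.cong) auto
    finally show "act n Q x i = comb q m x i" using Q by simp
  qed
  then have "act n Q ` sp m = comb q m ` sp m" by (rule image_cong[OF refl])
  ultimately show ?thesis using that[of Q m] q'(1) n q(3) by simp
qed

lemma additive_expand:
  fixes f :: "(nat \<Rightarrow> 'a) \<Rightarrow> 'a"
  assumes add: "\<And>y z. y \<in> sp n \<Longrightarrow> z \<in> sp n \<Longrightarrow> f (y + z) = f y + f z" and z: "z \<in> sp n"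
  shows "f z = (\<Sum>i<n. f (\<lambda>k. unit i k * z i))"
proof -
  have z0: "(0 :: nat \<Rightarrow> 'a) \<in> sp n" by (rule R.dsub_0[OF sp_dsub])
  have f0: "f 0 = 0" using add[OF z0 z0] by simp
  have "m \<le> n \<Longrightarrow> (\<Sum>i<m. (\<lambda>k. unit i k * z i)) \<in> sp n \<and> f (\<Sum>i<m. (\<lambda>k. unit i k * z i)) = (\<Sum>i<m. f (\<lambda>k. unit i k * z i))" for m
  proof (induction m)
    case (Suc m)
    have u: "(\<lambda>k. unit m k * z m) \<in> sp n" using R.dsub_sc[OF sp_dsub unit_sp[of m n]] Suc(2) by simp
    have v: "(\<Sum>i<m. (\<lambda>k. unit i k * z i)) \<in> sp n" "f (\<Sum>i<m. (\<lambda>k. unit i k * z i)) = (\<Sum>i<m. f (\<lambda>k. unit i k * z i))"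
      using Suc by simp_all
    show ?case unfolding sum.lessThan_Suc
      by (intro conjI R.dsub_add[OF sp_dsub v(1) u]) (simp only: add[OF v(1) u] v(2))
  qed (use f0 z0 in auto)
  then have "f (\<Sum>i<n. (\<lambda>k. unit i k * z i)) = (\<Sum>i<n. f (\<lambda>k. unit i k * z i))" by blast
  then show ?thesis unfolding act_expand[OF z, symmetric] .
qed

text \<open>\<open>G\<close> is the matrix of the form from \<open>semilinear_form\<close>. Each
  \<open>G * B * w\<close> satisfies the isotropy condition of \<open>SH_I\<close>, so it is in
  \<open>SH\<close>, and the dimensions agree because \<open>G\<close> is invertible.\<close>

lemma full_rank_case:
  assumes A: "A \<in> carrier_mat n n" "msub n W" "(+) A ` W \<subseteq> GL n" and B: "B \<in> GL n" "A * B = 1\<^sub>m n" "B * A = 1\<^sub>m n"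
    and dim: "mdim W = R.bound n" and big: "big F (n * d)" and n: "n \<ge> 1"
    and fr: "R.full_rank (sp n) (act n ` (\<lambda>w. B * w * 1\<^sub>m n) ` W) n"
  shows "\<exists>G. nonisotropic \<sigma> e n G \<and> mat_equivalent n ((+) A ` W) ((+) G ` SH \<sigma> e n)"
proof -
  note ts = unital_trivial_spectrum[OF A B]
  have opt: "R.E.dm (act n ` (\<lambda>w. B * w * 1\<^sub>m n) ` W) = R.bound n" using ts(2) dim by simp
  obtain \<Theta> where th: "\<And>z. z \<in> sp n \<Longrightarrow> R.dfun (sp n) (\<Theta> z)"
    "\<And>y z p. y \<in> sp n \<Longrightarrow> z \<in> sp n \<Longrightarrow> p \<in> sp n \<Longrightarrow> \<Theta> (y + z) p = \<Theta> y p + \<Theta> z p"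
    "\<And>z l p. z \<in> sp n \<Longrightarrow> p \<in> sp n \<Longrightarrow> \<Theta> (\<lambda>i. z i * l) p = \<sigma> l * \<Theta> z p"
    "\<And>z N. z \<in> sp n \<Longrightarrow> N \<in> act n ` (\<lambda>w. B * w * 1\<^sub>m n) ` W \<Longrightarrow> e (\<Theta> z (N z)) = 0"
    "\<And>z. z \<in> sp n \<Longrightarrow> z \<noteq> 0 \<Longrightarrow> \<exists>p\<in>sp n. \<Theta> z p \<noteq> 0"
  proof (rule R.semilinear_form[OF ts(1) opt big fr n])
    fix \<Theta> assume a: "\<And>z. z \<in> sp n \<Longrightarrow> R.dfun (sp n) (\<Theta> z)"
    "\<And>y z p. y \<in> sp n \<Longrightarrow> z \<in> sp n \<Longrightarrow> p \<in> sp n \<Longrightarrow> \<Theta> (y + z) p = \<Theta> y p + \<Theta> z p"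
    "\<And>z l p. z \<in> sp n \<Longrightarrow> p \<in> sp n \<Longrightarrow> \<Theta> (\<lambda>i. z i * l) p = \<sigma> l * \<Theta> z p"
    "\<And>z N. z \<in> sp n \<Longrightarrow> N \<in> act n ` (\<lambda>w. B * w * 1\<^sub>m n) ` W \<Longrightarrow> e (\<Theta> z (N z)) = 0"
    "\<And>z. z \<in> sp n \<Longrightarrow> z \<noteq> 0 \<Longrightarrow> \<exists>p\<in>sp n. \<Theta> z p \<noteq> 0"
    show thesis by (rule that) (fact a)+
  qed
  define G where "G = mat n n (\<lambda>(i, j). \<Theta> (unit i) (unit j))"
  have Gc: "G \<in> carrier_mat n n" by (simp add: G_def)
  have rep: "\<Theta> z p = hf n z (act n G p)" if z: "z \<in> sp n" and p: "p \<in> sp n" for z p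
  proof -
    have "\<Theta> z p = (\<Sum>i<n. \<Theta> (\<lambda>k. unit i k * z i) p)"
      by (rule additive_expand[of n "\<lambda>z. \<Theta> z p", OF _ z]) (rule th(2)[OF _ _ p])
    also have "\<dots> = (\<Sum>i<n. \<sigma> (z i) * \<Theta> (unit i) p)" using th(3)[OF unit_sp p] by (intro sum.cong) auto
    also have "\<dots> = (\<Sum>i<n. \<sigma> (z i) * act n G p i)"
    proof (rule sum.cong[OF refl])
      fix i assume "i \<in> {..<n}"
      then have i: "i < n" by simp
      have "\<Theta> (unit i) p = (\<Sum>j<n. \<Theta> (unit i) (\<lambda>k. unit j k * p j))"
        by (rule additive_expand[of n "\<Theta> (unit i)", OF _ p]) (rule R.dfun_add[OF th(1)[OF unit_sp[OF i]]])
      also have "\<dots> = (\<Sum>j<n. \<Theta> (unit i) (unit j) * p j)"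
        using R.dfun_sc[OF th(1)[OF unit_sp[OF i]] unit_sp] by (intro sum.cong) auto
      also have "\<dots> = act n G p i" using i by (simp add: act_def G_def)
      finally show "\<sigma> (z i) * \<Theta> (unit i) p = \<sigma> (z i) * act n G p i" by simp
    qed
    finally show ?thesis unfolding hf_def .
  qed
  \<comment> \<open>Invertibility is read off the adjoint: \<open>\<Theta> z \<noteq> 0\<close> for
    \<open>z \<noteq> 0\<close> is injectivity in the first argument.\<close>
  have "star_mat \<sigma> G \<in> GL n"
  proof (rule inj_GL[OF star_carrier[OF Gc]])
    fix z assume z: "z \<in> sp n" "act n (star_mat \<sigma> G) z = 0"
    have "\<Theta> z p = 0" if "p \<in> sp n" for p
      unfolding rep[OF z(1) that] hf_adjoint[OF Gc] z(2) by (simp add: hf_def)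
    then show "z = 0" using th(5)[OF z(1)] by blast
  qed
  then have G: "G \<in> GL n" using star_GL star_star[OF Gc] by metis
  have GB: "G * B \<in> GL n" by (rule GL_mult[OF G B(1)])
  have "(\<lambda>w. G * B * w * 1\<^sub>m n) ` W \<subseteq> SH \<sigma> e n"
  proof
    fix M assume "M \<in> (\<lambda>w. G * B * w * 1\<^sub>m n) ` W"
    then obtain w where w: "w \<in> W" "M = G * B * w * 1\<^sub>m n" by blast
    note wc = subsetD[OF msubD(1)[OF A(2)] w(1)] and Bc = GL_carrier[OF B(1)]
    have M: "M = G * (B * w * 1\<^sub>m n)" "B * w * 1\<^sub>m n \<in> carrier_mat n n"
      unfolding w(2) using wc Bc Gc by (simp_all add: assoc_mult_mat[of _ n n _ n _ n])
    show "M \<in> SH \<sigma> e n"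
    proof (rule SH_I)
      show "M \<in> carrier_mat n n" using M Gc by simp
      fix x assume x: "x \<in> sp n"
      have "e (\<Theta> x (act n (B * w * 1\<^sub>m n) x)) = 0" using th(4)[OF x] w(1) by blast
      then show "e (hf n x (act n M x)) = 0" using rep[OF x act_sp] act_mult[OF Gc M(2), of x] M(1) by simp
    qed
  qed
  then have im: "(\<lambda>w. G * B * w * 1\<^sub>m n) ` W = SH \<sigma> e n"
    using mdim_mono(2)[OF mdim_mult(1)[OF GB GL_one A(2)] msub_SH] mdim_mult(2)[OF GB GL_one A(2)] dim mdim_SH by simp
  have tr: "(\<lambda>M. G * B * M * 1\<^sub>m n) ` (+) A ` W = (+) G ` SH \<sigma> e n"
    unfolding im[symmetric] image_image
  proof (rule image_cong[OF refl])
    fix w assume "w \<in> W"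
    then have wc: "w \<in> carrier_mat n n" using msubD(1)[OF A(2)] by blast
    note c = GL_carrier[OF GB] GL_carrier[OF B(1)]
    have "G * B * (A + w) = G * B * A + G * B * w" by (rule mult_add_distrib_mat[OF c(1) A(1) wc])
    also have "G * B * A = G * (B * A)" using Gc c(2) A(1) by (rule assoc_mult_mat)
    finally show "G * B * (A + w) * 1\<^sub>m n = G + G * B * w * 1\<^sub>m n" using B(3) Gc c wc A(1) by simp
  qed
  then have eq: "mat_equivalent n ((+) A ` W) ((+) G ` SH \<sigma> e n)"
    unfolding mat_equivalent_def by (intro bexI[of _ "G * B"] bexI[of _ "1\<^sub>m n"] tr[symmetric] GB GL_one)
  \<comment> \<open>If \<open>e\<close> of the form vanished at \<open>x\<close>, some
    \<open>H\<close> in \<open>SH\<close> would send \<open>x\<close> to \<open>- act n G x\<close>;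
    then \<open>G + H\<close> would be singular, although it belongs to a set equivalent to the
    given unital one.\<close>
  have "nonisotropic \<sigma> e n G" unfolding nonisotropic_iff
  proof (intro conjI ballI impI notI)
    fix x assume x: "x \<in> sp n" "x \<noteq> 0" and z: "e (hf n x (act n G x)) = 0"
    have "- act n G x \<in> sp n" using R.dsub_uminus[OF sp_dsub act_sp] .
    moreover have "hf n x (- act n G x) = - hf n x (act n G x)" by (simp add: hf_def sum_negf)
    ultimately obtain H where H: "H \<in> SH \<sigma> e n" "act n H x = - act n G x"
      using SH_transitive[OF x, of "- act n G x"] z e_uminus by (metis neg_0_equal_iff_equal)
    have "act n (G + H) x = 0" using act_mat_add[OF Gc SH_carrier[OF H(1)]] H(2) by simp
    moreover have "G + H \<in> GL n"
    proof -
      have "G + H \<in> (\<lambda>M. G * B * M * 1\<^sub>m n) ` (+) A ` W" unfolding tr using H(1) by blast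
      then obtain M where "M \<in> (+) A ` W" "G + H = G * B * M * 1\<^sub>m n" by blast
      then show ?thesis using GL_mult[OF GL_mult[OF GB] GL_one] A(3) by auto
    qed
    ultimately show False using GL_inj x by blast
  qed (rule Gc)
  then show ?thesis using eq by blast
qed

text \<open>In a basis adapted to the invariant subspace the space becomes \<open>1 + W1\<close>
  with \<open>W1\<close> block triangular. Its diagonal parts obey
  \<open>affine_unital_bound\<close>, and by \<open>bound_add\<close> there is no slack: both attain
  their bounds, and the corner is arbitrary.\<close>

lemma reducible_case:
  assumes A: "A \<in> carrier_mat n n" "msub n W" "(+) A ` W \<subseteq> GL n" and B: "B \<in> GL n" "A * B = 1\<^sub>m n" "B * A = 1\<^sub>m n"
    and dim: "mdim W = R.bound n" and big: "big F (n * d)"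
    and red: "R.reducible (sp n) (act n ` (\<lambda>w. B * w * 1\<^sub>m n) ` W)"
  obtains m k S T where "n = m + k" "m > 0" "k > 0" "S \<subseteq> GL m" "affine m (R.bound m) S" "T \<subseteq> GL k" "affine k (R.bound k) T"
    "mat_equivalent n ((+) A ` W) (blk m k S T)"
proof -
  obtain U where U0: "R.dsub U \<and> U \<subseteq> sp n \<and> U \<noteq> {0} \<and> U \<noteq> sp n \<and> (\<forall>N\<in>act n ` (\<lambda>w. B * w * 1\<^sub>m n) ` W. N ` U \<subseteq> U)"
    using red unfolding R.reducible_def by (rule exE)
  then have U: "R.dsub U" "U \<subseteq> sp n" "U \<noteq> {0}" "U \<noteq> sp n" by simp_all
  have inv: "act n (B * w * 1\<^sub>m n) u \<in> U" if "w \<in> W" "u \<in> U" for w u using U0 that by blast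
  obtain Q m where Q: "Q \<in> GL n" "m \<le> n" "act n Q ` sp m = U" by (rule adapted_basis[OF U(1,2)])
  obtain Q' where Q': "Q' \<in> GL n" "Q * Q' = 1\<^sub>m n" "Q' * Q = 1\<^sub>m n" by (rule GL_obtain[OF Q(1)])
  define k where "k = n - m"
  have nk: "n = m + k" using Q(2) k_def by simp
  have m0: "m > 0"
  proof (rule ccontr)
    assume "\<not> m > 0"
    then have "sp m = {0}" by (auto simp: sp_def fun_eq_iff)
    then show False using Q(3) U(3) by simp
  qed
  have k0: "k > 0"
  proof (rule ccontr)
    assume "\<not> k > 0"
    then have "m = n" using nk by simp
    moreover have "act n Q ` sp n = sp n" by (rule act_surj) (rule GL_inj[OF Q(1)])
    ultimately show False using Q(3) U(4) by simp
  qed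
  \<comment> \<open>With this left factor and the right factor \<open>Q\<close>, the matrix
    \<open>A\<close> goes to the identity.\<close>
  define C where "C = Q' * B"
  have C: "C \<in> GL n" unfolding C_def by (rule GL_mult[OF Q'(1) B(1)])
  define W1 where "W1 = (\<lambda>w. C * w * Q) ` W"
  note c = GL_carrier[OF C] GL_carrier[OF Q(1)] GL_carrier[OF Q'(1)] GL_carrier[OF B(1)] A(1)
  have W1: "msub n W1" "mdim W1 = R.bound n" unfolding W1_def using mdim_mult[OF C Q(1) A(2)] dim by simp_all
  have tr: "(\<lambda>M. C * M * Q) ` (+) A ` W = (+) (1\<^sub>m n) ` W1" unfolding W1_def image_image
  proof (rule image_cong[OF refl])
    fix w assume "w \<in> W"
    then have wc: "w \<in> carrier_mat n n" using msubD(1)[OF A(2)] by blast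
    have "C * A * Q = Q' * (B * A) * Q" unfolding C_def using c by (simp add: assoc_mult_mat[of _ n n _ n _ n])
    then have 1: "C * A * Q = 1\<^sub>m n" using B(3) Q'(3) c by simp
    have "C * (A + w) * Q = (C * A + C * w) * Q" using mult_add_distrib_mat[OF c(1) A(1) wc] by simp
    also have "\<dots> = C * A * Q + C * w * Q"
      by (rule add_mult_distrib_mat[OF mult_carrier_mat[OF c(1) A(1)] mult_carrier_mat[OF c(1) wc] c(2)])
    finally show "C * (A + w) * Q = 1\<^sub>m n + C * w * Q" using 1 by simp
  qed
  have up: "upper m k M" if M: "M \<in> W1" for M
  proof -
    obtain w where w: "w \<in> W" "M = C * w * Q" using M unfolding W1_def by blast
    note wc = subsetD[OF msubD(1)[OF A(2)] w(1)]
    have Bw: "B * w * 1\<^sub>m n \<in> carrier_mat n n" using c wc by simp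
    have Meq: "M = Q' * (B * w * 1\<^sub>m n * Q)" unfolding w(2) C_def using c wc by (simp add: assoc_mult_mat[of _ n n _ n _ n])
    have Mx: "act n M x \<in> sp m" if x: "x \<in> sp m" for x
    proof -
      have "act n Q x \<in> U" using Q(3) x by blast
      then have "act n (B * w * 1\<^sub>m n) (act n Q x) \<in> act n Q ` sp m" using inv[OF w(1)] Q(3) by simp
      then obtain y where y: "y \<in> sp m" "act n (B * w * 1\<^sub>m n) (act n Q x) = act n Q y" by blast
      have "act n M x = act n Q' (act n Q y)"
        unfolding Meq act_mult[OF c(3) mult_carrier_mat[OF Bw c(2)]] act_mult[OF Bw c(2)] y(2) ..
      also have "\<dots> = act n (Q' * Q) y" using act_mult[OF c(3,2)] by simp
      also have "\<dots> = y" unfolding Q'(3) by (rule act_one[OF sp_mono[OF Q(2) y(1)]])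
      finally show ?thesis using y(1) by simp
    qed
    show ?thesis unfolding upper_def
    proof (intro allI impI)
      fix i j assume ij: "i < k" "j < m"
      have "act n M (unit j) (m + i) = 0" using spD[OF Mx[OF unit_sp[OF ij(2)]], of "m + i"] by simp
      then show "M $$ (m + i, j) = 0" using act_unit[of "m + i" n j M] ij nk by simp
    qed
  qed
  have W1c: "W1 \<subseteq> carrier_mat (m + k) (m + k)" using msubD(1)[OF W1(1)] nk by simp
  have W1s: "msub (m + k) W1" using W1(1) nk by simp
  note p = mlin_parts[OF W1c]
  note X1 = msub_image[OF W1s p(1)] and X2 = msub_image[OF W1s p(2)]
  have sub: "W1 \<subseteq> blk m k (ul m ` W1) (lr m k ` W1)" unfolding blk_def using W1c up by auto
  have one: "1\<^sub>m (m + k) \<in> carrier_mat (m + k) (m + k)" "upper m k (1\<^sub>m (m + k))" "ul m (1\<^sub>m (m + k)) = 1\<^sub>m m" "lr m k (1\<^sub>m (m + k)) = 1\<^sub>m k"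
    by (auto simp: upper_def ul_def lr_def intro!: eq_matI)
  have gl: "1\<^sub>m (m + k) + M \<in> GL (m + k)" if M: "M \<in> W1" for M
  proof -
    have "1\<^sub>m n + M \<in> (\<lambda>M. C * M * Q) ` (+) A ` W" unfolding tr using M by blast
    then obtain N where N: "N \<in> (+) A ` W" "1\<^sub>m n + M = C * N * Q" by blast
    have "C * N * Q \<in> GL n" using GL_mult[OF GL_mult[OF C] Q(1)] A(3) N(1) by blast
    then show ?thesis using N(2) nk by simp
  qed
  have parts: "1\<^sub>m m + ul m M \<in> GL m \<and> 1\<^sub>m k + lr m k M \<in> GL k" if M: "M \<in> W1" for M
  proof -
    have Mc: "M \<in> carrier_mat (m + k) (m + k)" using W1c M by blast
    have "1\<^sub>m (m + k) + M \<in> carrier_mat (m + k) (m + k)" using Mc by simp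
    from blk_GL[OF this upper_add[OF one(1) Mc one(2) up[OF M]]] gl[OF M]
    show ?thesis unfolding ul_add[OF one(1) Mc] lr_add[OF one(1) Mc] one by blast
  qed
  have g1: "(+) (1\<^sub>m m) ` ul m ` W1 \<subseteq> GL m" and g2: "(+) (1\<^sub>m k) ` lr m k ` W1 \<subseteq> GL k" using parts by auto
  have aff: "affine m (mdim (ul m ` W1)) ((+) (1\<^sub>m m) ` ul m ` W1)" "affine k (mdim (lr m k ` W1)) ((+) (1\<^sub>m k) ` lr m k ` W1)"
    unfolding affine_def using X1 X2 one_carrier_mat by blast+
  have b: "mdim (ul m ` W1) \<le> R.bound m" "mdim (lr m k ` W1) \<le> R.bound k"
    by (rule affine_unital_bound[OF aff(1) g1 big_mono[OF big]], simp add: nk)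
      (rule affine_unital_bound[OF aff(2) g2 big_mono[OF big]], simp add: nk)
  note mono = mdim_mono[OF W1s msub_blk[OF X1 X2] sub]
  have "R.bound n = R.bound m + R.bound k + m * k * d" using bound_add nk by simp
  then have e: "mdim (ul m ` W1) = R.bound m" "mdim (lr m k ` W1) = R.bound k" "mdim W1 = mdim (blk m k (ul m ` W1) (lr m k ` W1))"
    using mono(1) W1(2) b mdim_blk[OF X1 X2] by linarith+
  have W1eq: "W1 = blk m k (ul m ` W1) (lr m k ` W1)" by (rule mono(2)[OF e(3)])
  have bd1: "bd m k (1\<^sub>m m) (1\<^sub>m k) = 1\<^sub>m (m + k)" unfolding bd_def by (rule four_block_one_mat)
  have "(+) (1\<^sub>m n) ` W1 = blk m k ((+) (1\<^sub>m m) ` ul m ` W1) ((+) (1\<^sub>m k) ` lr m k ` W1)"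
    unfolding blk_translate[OF one_carrier_mat msubD(1)[OF X1] one_carrier_mat msubD(1)[OF X2]] W1eq[symmetric] bd1 nk ..
  then have eq: "mat_equivalent n ((+) A ` W) (blk m k ((+) (1\<^sub>m m) ` ul m ` W1) ((+) (1\<^sub>m k) ` lr m k ` W1))"
    unfolding mat_equivalent_def using tr by (intro bexI[of _ C] bexI[of _ Q] C Q(1)) simp
  show ?thesis by (rule that[OF nk m0 k0 g1 _ g2 _ eq]) (use aff e in auto)
qed

theorem optimal_classification:
  assumes "S \<subseteq> GL n" "affine n (R.bound n) S" "big F (n * d)"
  shows "\<exists>ns Ps. ordered_partition n ns \<and> nonisotropic_list \<sigma> e ns Ps \<and> mat_equivalent n S (SH_joint \<sigma> e ns Ps)"
  using assms
proof (induction n arbitrary: S rule: less_induct)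
  case (less n)
  obtain A W where A: "A \<in> carrier_mat n n" "msub n W" "mdim W = R.bound n" "S = (+) A ` W" using less(3) unfolding affine_def by blast
  have u: "(+) A ` W \<subseteq> GL n" using less(2) A(4) by simp
  have "A + 0\<^sub>m n n \<in> GL n" using u msubD(2)[OF A(2)] by blast
  then have "A \<in> GL n" using A(1) by simp
  then obtain B where B: "B \<in> GL n" "A * B = 1\<^sub>m n" "B * A = 1\<^sub>m n" by (rule GL_obtain)
  note ts = unital_trivial_spectrum[OF A(1,2) u B]
  consider "n = 0" | "n \<ge> 1" "R.full_rank (sp n) (act n ` (\<lambda>w. B * w * 1\<^sub>m n) ` W) n"
    | "R.reducible (sp n) (act n ` (\<lambda>w. B * w * 1\<^sub>m n) ` W)"
  proof -
    have "R.full_rank (sp n) (act n ` (\<lambda>w. B * w * 1\<^sub>m n) ` W) n \<or> R.reducible (sp n) (act n ` (\<lambda>w. B * w * 1\<^sub>m n) ` W)"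
      by (rule R.full_rank_or_reducible[OF ts(1) _ less(4)]) (simp only: ts(2) A(3))
    moreover have "n = 0 \<or> n \<ge> 1" by linarith
    ultimately show thesis using that by blast
  qed
  then show ?case
  proof cases
    case 1
    \<comment> \<open>For \<open>n = 0\<close> the empty partition serves; its joint consists of the
      \<open>0\<close> by \<open>0\<close> matrix.\<close>
    have S0: "S = {1\<^sub>m 0}" using affine_nonempty[OF less(3)] GL_sub[OF less(2)] carrier_0 1 by blast
    have "mat_equivalent n S (SH_joint \<sigma> e [] [])" unfolding mat_equivalent_def
      by (rule bexI[of _ "1\<^sub>m n"], rule bexI[of _ "1\<^sub>m n"]) (auto simp: S0 1 SH_joint_Nil dest: carrier_0)
    moreover have "ordered_partition n []" "nonisotropic_list \<sigma> e [] []" using 1 by (auto simp: ordered_partition_def nonisotropic_list_def)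
    ultimately show ?thesis by blast
  next
    case 2
    obtain G where G: "nonisotropic \<sigma> e n G" "mat_equivalent n ((+) A ` W) ((+) G ` SH \<sigma> e n)"
      using full_rank_case[OF A(1,2) u B A(3) less(4) 2] by blast
    have l: "nonisotropic_list \<sigma> e [] []" by (simp add: nonisotropic_list_def)
    have "SH_joint \<sigma> e [n] [G] = (+) G ` SH \<sigma> e n"
      unfolding SH_joint_Cons[OF G(1) l] SH_joint_Nil using blk_empty_right[OF GL_sub[OF nonisotropic_unital[OF G(1)]]] by simp
    moreover have "ordered_partition n [n]" "nonisotropic_list \<sigma> e [n] [G]" using 2(1) G(1) l nlist_Cons by (auto simp: ordered_partition_def)
    ultimately show ?thesis using G(2) A(4) by metis
  next
    case 3
    obtain m k S1 S2 where s: "n = m + k" "m > 0" "k > 0" "S1 \<subseteq> GL m" "affine m (R.bound m) S1" "S2 \<subseteq> GL k" "affine k (R.bound k) S2"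
      "mat_equivalent n ((+) A ` W) (blk m k S1 S2)" by (rule reducible_case[OF A(1,2) u B A(3) less(4) 3])
    have "m < n" "k < n" "big F (m * d)" "big F (k * d)" using s(1-3) big_mono[OF less(4)] by auto
    then obtain ns Ps ms Qs where i: "ordered_partition m ns" "nonisotropic_list \<sigma> e ns Ps" "mat_equivalent m S1 (SH_joint \<sigma> e ns Ps)"
      "ordered_partition k ms" "nonisotropic_list \<sigma> e ms Qs" "mat_equivalent k S2 (SH_joint \<sigma> e ms Qs)"
      using less(1)[OF _ s(4,5)] less(1)[OF _ s(6,7)] by blast
    have sm: "sum_list ns = m" "sum_list ms = k" using i(1,4) unfolding ordered_partition_def by auto
    note ap = SH_joint_append[OF i(2,5), unfolded sm]
    have "mat_equivalent (m + k) (blk m k S1 S2) (SH_joint \<sigma> e (ns @ ms) (Ps @ Qs))"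
      using equivalent_blk[OF GL_sub[OF s(4)] GL_sub[OF s(6)] i(3,6)] ap by simp
    then have "mat_equivalent n S (SH_joint \<sigma> e (ns @ ms) (Ps @ Qs))"
      using equivalent_trans[OF GL_sub[OF u] s(8)] s(1) A(4) by simp
    moreover have "ordered_partition n (ns @ ms)" using i(1,4) s(1) unfolding ordered_partition_def by auto
    ultimately show ?thesis using ap by blast
  qed
qed

end

section \<open>Uniqueness\<close>

context quad_mat
begin

text \<open>This makes the size of the first block an invariant of the equivalence class of a joint.\<close>

lemma bad_row:
  assumes P: "nonisotropic \<sigma> e n P" and T: "t \<in> T" "T \<subseteq> carrier_mat k k"
    and v: "v \<in> sp (n + k)" "v \<noteq> 0"
    and bad: "\<And>A. A \<in> blk n k ((+) P ` SH \<sigma> e n) T \<Longrightarrow> hf (n + k) y (act (n + k) A v) = 0" and i: "i < n"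
  shows "y i = 0"
proof -
  note Pc = nonisotropic_carrier[OF P] and tc = subsetD[OF T(2,1)]
  have mem: "bd n k (P + H) t \<in> blk n k ((+) P ` SH \<sigma> e n) T \<and> bd n k (P + H) t \<in> carrier_mat (n + k) (n + k) \<and>
      upper n k (bd n k (P + H) t) \<and> ul n (bd n k (P + H) t) = P + H \<and> lr n k (bd n k (P + H) t) = t"
    if H: "H \<in> SH \<sigma> e n" for H
  proof -
    have "P + H \<in> carrier_mat n n" using Pc SH_carrier[OF H] by simp
    from bd_parts[OF this tc] show ?thesis unfolding blk_def using H T(1) by simp
  qed
  have H0: "0\<^sub>m n n \<in> SH \<sigma> e n" by (rule msubD(2)[OF msub_SH])
  show ?thesis
  proof (cases "tail n k v = 0")
    case False
    have "\<exists>l<k. v (n + l) \<noteq> 0"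
    proof (rule ccontr)
      assume "\<not> ?thesis"
      then have "tail n k v = 0" by (intro ext) (simp add: tail_def)
      then show False using False by simp
    qed
    then obtain l where l: "l < k" "v (n + l) \<noteq> 0" by blast
    define A where "A = bd n k (P + 0\<^sub>m n n) t"
    note A = mem[OF H0, folded A_def]
    \<comment> \<open>\<open>D\<close> puts an entry into row \<open>i\<close> of the corner. Both
      \<open>A\<close> and \<open>A + D\<close> are in the joint, so their difference gives
      \<open>\<sigma> (y i) * v (n + l) = 0\<close>.\<close>
    define D where "D = mat (n + k) (n + k) (\<lambda>(p, q). if p = i \<and> q = n + l then (1 :: 'a) else 0)"
    have D: "D \<in> carrier_mat (n + k) (n + k)" by (simp add: D_def)
    have D0: "upper n k D" "ul n D = 0\<^sub>m n n" "lr n k D = 0\<^sub>m k k"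
      using i l(1) by (auto simp: D_def upper_def ul_def lr_def intro!: eq_matI)
    have Ac: "A \<in> carrier_mat (n + k) (n + k)" "upper n k A" using A by auto
    have "A + D \<in> blk n k ((+) P ` SH \<sigma> e n) T"
    proof -
      have "ul n (A + D) = P + 0\<^sub>m n n" unfolding ul_add[OF Ac(1) D] D0 using A Pc by simp
      moreover have "lr n k (A + D) = t" unfolding lr_add[OF Ac(1) D] D0 using A tc by simp
      ultimately show ?thesis unfolding blk_def
        using upper_add[OF Ac(1) D Ac(2) D0(1)] Ac(1) D H0 T(1) by simp
    qed
    then have "hf (n + k) y (act (n + k) A v + act (n + k) D v) = 0"
      using bad[of "A + D"] act_mat_add[OF Ac(1) D] by simp
    then have z: "hf (n + k) y (act (n + k) D v) = 0" using bad[of A] A by (simp add: hf_add_right)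
    have "act (n + k) D v p = (if p = i then v (n + l) else 0)" for p
    proof (cases "p < n + k")
      case True
      have "(\<Sum>j<n + k. D $$ (p, j) * v j) = (\<Sum>j<n + k. if j = n + l then (if p = i then v (n + l) else 0) else 0)"
        using True by (intro sum.cong) (auto simp: D_def)
      then show ?thesis using True l(1) by (simp add: act_def)
    qed (use i in \<open>simp add: act_def\<close>)
    then have "hf (n + k) y (act (n + k) D v) = (\<Sum>p<n + k. if p = i then \<sigma> (y i) * v (n + l) else 0)"
      unfolding hf_def by (intro sum.cong) auto
    then have "\<sigma> (y i) * v (n + l) = 0" using z i by simp
    then show ?thesis using l(2) by simp
  next
    case True
    \<comment> \<open>Now \<open>v\<close> lives in the first block. The form given by
      \<open>y\<close> kills \<open>P v\<close> and every \<open>H v\<close>, and by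
      \<open>SH_transitive\<close> the latter fill the kernel of \<open>e \<circ> hf n v\<close>; so
      this form is an \<open>F\<close>-multiple of \<open>hf n v\<close>, and nonisotropy of
      \<open>P\<close> makes the factor zero.\<close>
    have vn: "v \<in> sp n" by (rule sp_tail[OF v(1) True])
    have trunc: "hf (n + k) y z = hf n y z" if "z \<in> sp n" for z
      unfolding hf_def by (rule sum.mono_neutral_right) (use spD[OF that] in auto)
    have PH: "hf n y (act n P v) + hf n y (act n H v) = 0" if H: "H \<in> SH \<sigma> e n" for H
    proof -
      have "act (n + k) (bd n k (P + H) t) v = act n (P + H) v"
        using act_upper_sp[OF _ vn, of k "bd n k (P + H) t"] mem[OF H] by simp
      then show ?thesis using bad[of "bd n k (P + H) t"] mem[OF H] trunc[OF act_sp]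
          act_mat_add[OF Pc SH_carrier[OF H], of v] by (simp add: hf_add_right)
    qed
    have "act n (0\<^sub>m n n) v = 0" by (intro ext) (simp add: act_def)
    then have P0: "hf n y (act n P v) = 0" using PH[OF H0] by simp
    have kill: "hf n y z = 0" if z: "z \<in> sp n" "e (hf n v z) = 0" for z
    proof -
      obtain H where "H \<in> SH \<sigma> e n" "act n H v = z" by (rule SH_transitive[OF vn v(2) z])
      then show ?thesis using PH P0 by auto
    qed
    obtain c where c: "c \<in> F" "\<And>z. z \<in> sp n \<Longrightarrow> hf n y z = c * hf n v z"
    proof (rule R.e_proportional[OF sp_dsub hf_dfun hf_dfun])
      show "e (hf n y z) = 0" if "z \<in> sp n" "e (hf n v z) = 0" for z using kill[OF that] by simp
    qed blast
    have "e (hf n v (act n P v)) \<noteq> 0" using P vn v(2) unfolding nonisotropic_iff by blast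
    then have "hf n v (act n P v) \<noteq> 0" by auto
    then have "c = 0" using c(2)[OF act_sp, of P v] P0 by simp
    then have "hf n y (unit i) = 0" using c(2)[OF unit_sp[OF i]] by simp
    then show ?thesis using hf_unit_right[OF i] by simp
  qed
qed

text \<open>\<open>U * M * Y\<close> sends \<open>unit 0\<close> into the first \<open>m'\<close>
  coordinates, so a row of \<open>U\<close> below these annihilates \<open>M\<close> applied to
  \<open>act N Y (unit 0)\<close>, for every \<open>M\<close>. By \<open>bad_row\<close> such a row
  vanishes on the first \<open>m\<close> coordinates; hence \<open>U\<close> embeds the first
  \<open>m\<close> coordinates into the first \<open>m'\<close>.\<close>

lemma first_block_le:
  assumes P: "nonisotropic \<sigma> e m P" and S: "S \<subseteq> carrier_mat k k" "S \<noteq> {}" and m': "m' > 0"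
    and N: "m + k = N" "m' + k' = N" and U: "U \<in> GL N" and Y: "Y \<in> GL N"
    and T: "\<And>M. M \<in> blk m k ((+) P ` SH \<sigma> e m) S \<Longrightarrow> upper m' k' (U * M * Y)"
  shows "\<forall>i<k'. \<forall>j<m. U $$ (m' + i, j) = 0" "m \<le> m'"
proof -
  note Xc = GL_carrier[OF U] and Yc = GL_carrier[OF Y]
  obtain s where s: "s \<in> S" using S(2) by blast
  show z: "\<forall>i<k'. \<forall>j<m. U $$ (m' + i, j) = 0"
  proof (intro allI impI)
    fix i j assume ij: "i < k'" "j < m"
    have u0: "(unit 0 :: nat \<Rightarrow> 'a) \<in> sp m'" "(unit 0 :: nat \<Rightarrow> 'a) \<in> sp N" using m' N by simp_all
    have v: "act N Y (unit 0) \<in> sp (m + k)" "act N Y (unit 0) \<noteq> 0" using GL_inj[OF Y u0(2)] N(1) by (simp, auto)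
    have "act N (star_mat \<sigma> U) (unit (m' + i)) j = 0"
    proof (rule bad_row[OF P s S(1) v _ ij(2)])
      fix M assume M: "M \<in> blk m k ((+) P ` SH \<sigma> e m) S"
      have Mc: "M \<in> carrier_mat N N" using M blk_carrier[of m k] N(1) by auto
      have XM: "U * M \<in> carrier_mat N N" "U * M * Y \<in> carrier_mat N N" using Xc Mc Yc by auto
      have "act N (U * M * Y) (unit 0) = act (m' + k') (U * M * Y) (unit 0)" using N(2) by simp
      also have "\<dots> = act m' (ul m' (U * M * Y)) (unit 0)" by (rule act_upper_sp[OF T[OF M] u0(1)])
      finally have "act N (U * M * Y) (unit 0) (m' + i) = 0" by (simp add: act_def)
      moreover have "act N (U * M * Y) (unit 0) = act N U (act N M (act N Y (unit 0)))"
        unfolding act_mult[OF XM(1) Yc] act_mult[OF Xc Mc] ..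
      ultimately have "hf N (unit (m' + i)) (act N U (act N M (act N Y (unit 0)))) = 0"
        using hf_unit_left[of "m' + i" N] ij(1) N(2) by simp
      then show "hf (m + k) (act N (star_mat \<sigma> U) (unit (m' + i))) (act (m + k) M (act N Y (unit 0))) = 0"
        unfolding hf_adjoint[OF Xc] N(1) .
    qed
    then have "star_mat \<sigma> U $$ (j, m' + i) = 0" using act_unit[of j N "m' + i"] ij N by simp
    then show "U $$ (m' + i, j) = 0" using star_entry[OF Xc, of j "m' + i"] ij N by simp
  qed
  have im: "act N U x \<in> sp m'" if x: "x \<in> sp m" for x
  proof (rule sp_tail)
    show "act N U x \<in> sp (m' + k')" using N(2) by simp
    show "tail m' k' (act N U x) = 0"
    proof (rule ext)
      fix i
      have "act N U x (m' + i) = 0" if "i < k'"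
        unfolding act_def using that N(2) z spD[OF x]
        by (auto intro!: sum.neutral) (metis linorder_not_less mult_zero_left mult_zero_right)
      then show "tail m' k' (act N U x) i = 0 i" by (simp add: tail_def)
    qed
  qed
  have mN: "m \<le> N" using N(1) by simp
  note l = R.dlin_flin[OF act_dlin, of "sp m" N U]
  have "R.X.dm (act N U ` sp m) = R.X.dm (sp m)"
    by (rule R.XX.dm_inj[OF sp_fd l]) (rule GL_inj[OF U sp_mono[OF mN]])
  moreover have "R.X.dm (act N U ` sp m) \<le> R.X.dm (sp m')"
    by (rule R.X.fd_mono(2)[OF sp_fd R.X.fd_fsub[OF R.XX.rank_nullity(1)[OF sp_fd l]] image_subsetI]) (rule im)
  ultimately have "m * d \<le> m' * d" using sp_dm by simp
  then show "m \<le> m'" using d_pos by simp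
qed

text \<open>The vectors \<open>H (Y x)\<close> fill the kernel of
  \<open>e \<circ> hf n (Y x)\<close>, and this kernel is contained in the corresponding one for the
  star of \<open>U\<close> applied to \<open>x\<close>; so the two vectors are proportional over
  \<open>F\<close>. Comparison at \<open>unit j\<close>, \<open>unit 0\<close> and their sum shows
  that the factor does not depend on the vector.\<close>

lemma SH_conj_proportional:
  assumes n: "n > 0" and U: "U \<in> GL n" and Y: "Y \<in> GL n" and XY: "\<And>H. H \<in> SH \<sigma> e n \<Longrightarrow> U * H * Y \<in> SH \<sigma> e n"
  obtains \<alpha> where "\<alpha> \<in> F - {0}" "\<And>x. x \<in> sp n \<Longrightarrow> act n (star_mat \<sigma> U) x = (\<lambda>i. act n Y x i * \<alpha>)"
proof -
  note Xc = GL_carrier[OF U] and Yc = GL_carrier[OF Y]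
  let ?U = "star_mat \<sigma> U"
  have ex: "\<exists>c. c \<in> F \<and> act n ?U x = (\<lambda>i. act n Y x i * c)" if x: "x \<in> sp n" "x \<noteq> 0" for x
  proof -
    have u: "act n Y x \<noteq> 0" using GL_inj[OF Y x(1)] x(2) by blast
    have kill: "e (hf n (act n ?U x) z) = 0" if z: "z \<in> sp n" "e (hf n (act n Y x) z) = 0" for z
    proof -
      obtain H where H: "H \<in> SH \<sigma> e n" "act n H (act n Y x) = z" by (rule SH_transitive[OF act_sp u z])
      note Hc = SH_carrier[OF H(1)]
      have "act n (U * H * Y) x = act n U z"
        unfolding act_mult[OF mult_carrier_mat[OF Xc Hc] Yc] act_mult[OF Xc Hc] H(2) ..
      then have "e (hf n x (act n U z)) = 0" using SH_isotropic[OF XY[OF H(1)], of x] by simp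
      then show ?thesis unfolding hf_adjoint[OF Xc] .
    qed
    obtain c where c: "c \<in> F" "\<And>z. z \<in> sp n \<Longrightarrow> hf n (act n ?U x) z = c * hf n (act n Y x) z"
    proof (rule R.e_proportional[OF sp_dsub hf_dfun hf_dfun])
      show "e (hf n (act n ?U x) z) = 0" if "z \<in> sp n" "e (hf n (act n Y x) z) = 0" for z using kill[OF that] .
    qed blast
    have "act n ?U x = (\<lambda>i. act n Y x i * c)"
    proof (rule sp_eqI[OF act_sp R.dsub_sc[OF sp_dsub act_sp]])
      fix i assume i: "i < n"
      have "\<sigma> (act n ?U x i) = c * \<sigma> (act n Y x i)"
        using c(2)[OF unit_sp[OF i]] unfolding hf_unit_right[OF i] .
      then have "\<sigma> (\<sigma> (act n ?U x i)) = \<sigma> (c * \<sigma> (act n Y x i))" by simp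
      then show "act n ?U x i = act n Y x i * c" unfolding s_mult s_s s_F[OF c(1)] .
    qed
    then show ?thesis using c(1) by blast
  qed
  have "\<exists>\<alpha>. \<alpha> \<in> F \<and> act n ?U (unit 0) = (\<lambda>i. act n Y (unit 0) i * \<alpha>)" by (rule ex) (use n in simp_all)
  then obtain \<alpha> where a: "\<alpha> \<in> F" "act n ?U (unit 0) = (\<lambda>i. act n Y (unit 0) i * \<alpha>)" by blast
  have all: "act n ?U (unit j) = (\<lambda>i. act n Y (unit j) i * \<alpha>)" if j: "j < n" for j
  proof (cases "j = 0")
    case False
    have us: "(unit j :: nat \<Rightarrow> 'a) \<in> sp n" "(unit 0 :: nat \<Rightarrow> 'a) \<in> sp n" using j n by simp_all
    note ss = R.dsub_add[OF sp_dsub us]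
    have nz: "(unit j + unit 0 :: nat \<Rightarrow> 'a) \<noteq> 0"
    proof
      assume "(unit j + unit 0 :: nat \<Rightarrow> 'a) = 0"
      then have "(unit j + unit 0 :: nat \<Rightarrow> 'a) 0 = 0" by (simp only: zero_fun_apply)
      then show False using False by (simp add: unit_def)
    qed
    obtain b where b: "b \<in> F" "act n ?U (unit j) = (\<lambda>i. act n Y (unit j) i * b)" using ex[OF us(1) unit_nz] by blast
    obtain c where c: "c \<in> F" "act n ?U (unit j + unit 0) = (\<lambda>i. act n Y (unit j + unit 0) i * c)" using ex[OF ss nz] by blast
    \<comment> \<open>The relation between \<open>unit j\<close> and \<open>unit 0\<close> that
      unequal factors would produce after application of \<open>Y\<close>.\<close>
    define w where "w = (\<lambda>i. unit j i * (b - c)) + (\<lambda>i. unit 0 i * (\<alpha> - c))"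
    have "w \<in> sp n" unfolding w_def by (rule R.dsub_add[OF sp_dsub R.dsub_sc[OF sp_dsub us(1)] R.dsub_sc[OF sp_dsub us(2)]])
    moreover have "act n Y w = 0"
    proof (rule ext)
      fix i
      have "act n Y (unit j) i * b + act n Y (unit 0) i * \<alpha> = (act n Y (unit j) i + act n Y (unit 0) i) * c"
        using fun_cong[OF c(2), of i] unfolding act_add plus_fun_apply b(2) a(2) .
      moreover have "act n Y (unit j) i * (b - c) + act n Y (unit 0) i * (\<alpha> - c) =
        (act n Y (unit j) i * b + act n Y (unit 0) i * \<alpha>) - (act n Y (unit j) i + act n Y (unit 0) i) * c"
        by (simp add: algebra_simps)
      ultimately show "act n Y w i = 0 i" unfolding w_def act_add act_sc by simp
    qed
    ultimately have w0: "w = 0" by (rule GL_inj[OF Y])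
    have "w j = 0" "w 0 = 0" unfolding w0 by simp_all
    then have "b = c" "\<alpha> = c" using False by (simp_all add: w_def unit_def)
    then show ?thesis using b(2) by simp
  qed (use a in simp)
  have ent: "?U $$ (i, j) = Y $$ (i, j) * \<alpha>" if "i < n" "j < n" for i j
    using fun_cong[OF all[OF that(2)], of i] unfolding act_unit[OF that] .
  have res: "act n ?U x = (\<lambda>i. act n Y x i * \<alpha>)" for x
  proof (rule ext)
    fix i
    show "act n ?U x i = act n Y x i * \<alpha>"
    proof (cases "i < n")
      case True
      have "(\<Sum>j<n. ?U $$ (i, j) * x j) = (\<Sum>j<n. Y $$ (i, j) * x j * \<alpha>)"
        using ent[OF True] by (intro sum.cong) (auto simp: mult.assoc F_comm[OF a(1)])
      then show ?thesis using True by (simp add: act_def sum_distrib_right)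
    qed (simp add: act_def)
  qed
  have "\<alpha> \<noteq> 0"
  proof
    assume "\<alpha> = 0"
    then have "act n ?U (unit 0) = 0" unfolding res by (simp add: fun_eq_iff)
    then show False using GL_inj[OF star_GL[OF U] unit_sp[OF n]] by simp
  qed
  then show ?thesis using that[of \<alpha>] a(1) res by simp
qed

definition similar :: "nat \<Rightarrow> 'a mat \<Rightarrow> 'a mat \<Rightarrow> bool" where
  "similar n P P' \<longleftrightarrow> (\<exists>Q\<in>GL n. \<exists>\<alpha>\<in>F - {0}. \<forall>x\<in>sp n.
    e (hf n x (act n P' x)) = \<alpha> * e (hf n (act n Q x) (act n P (act n Q x))))"

text \<open>On directions the equivalence maps \<open>SH\<close> into \<open>SH\<close>, so the star
  of \<open>U\<close> is \<open>Y\<close> times a scalar \<open>\<alpha>\<close> of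
  \<open>F\<close>. The map \<open>M \<mapsto> U * M * Y\<close> is then a congruence by
  \<open>Y\<close> up to \<open>\<alpha>\<close>, and members of \<open>SH\<close> drop out under
  \<open>e\<close>.\<close>

lemma similar_of_equivalent:
  assumes n: "n > 0" and P: "P \<in> carrier_mat n n" "P' \<in> carrier_mat n n" and U: "U \<in> GL n" and Y: "Y \<in> GL n"
    and eq: "(+) P' ` SH \<sigma> e n = (\<lambda>M. U * M * Y) ` (+) P ` SH \<sigma> e n"
  shows "similar n P P'"
proof -
  note Xc = GL_carrier[OF U] and Yc = GL_carrier[OF Y]
  have H0: "0\<^sub>m n n \<in> SH \<sigma> e n" by (rule msubD(2)[OF msub_SH])
  have img: "\<exists>K\<in>SH \<sigma> e n. U * (P + H) * Y = P' + K" if "H \<in> SH \<sigma> e n" for H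
  proof -
    have "U * (P + H) * Y \<in> (+) P' ` SH \<sigma> e n" unfolding eq using that by blast
    then show ?thesis by blast
  qed
  have XY: "U * H * Y \<in> SH \<sigma> e n" if H: "H \<in> SH \<sigma> e n" for H
  proof -
    note Hc = SH_carrier[OF H]
    obtain K where K: "K \<in> SH \<sigma> e n" "U * (P + H) * Y = P' + K" using img[OF H] by blast
    obtain K0 where K0: "K0 \<in> SH \<sigma> e n" "U * (P + 0\<^sub>m n n) * Y = P' + K0" using img[OF H0] by blast
    have "U * (P + H) * Y = (U * P + U * H) * Y" using mult_add_distrib_mat[OF Xc P(1) Hc] by simp
    also have "\<dots> = U * P * Y + U * H * Y"
      by (rule add_mult_distrib_mat[OF mult_carrier_mat[OF Xc P(1)] mult_carrier_mat[OF Xc Hc] Yc])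
    finally have "P' + K = (P' + K0) + U * H * Y" using K(2) K0(2) P(1) by simp
    then have "(P' + K0) + U * H * Y - (P' + K0) = P' + K - (P' + K0)" by simp
    moreover have "(P' + K0) + U * H * Y - (P' + K0) = U * H * Y"
      using P(2) SH_carrier[OF K0(1)] Xc Hc Yc by (intro eq_matI) auto
    moreover have "P' + K - (P' + K0) = K - K0"
      using P(2) SH_carrier[OF K0(1)] SH_carrier[OF K(1)] by (intro eq_matI) auto
    ultimately show ?thesis using msub_diff[OF msub_SH K(1) K0(1)] by simp
  qed
  obtain \<alpha> where a: "\<alpha> \<in> F - {0}" "\<And>x. x \<in> sp n \<Longrightarrow> act n (star_mat \<sigma> U) x = (\<lambda>i. act n Y x i * \<alpha>)"
    using SH_conj_proportional[OF n U Y XY] by blast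
  have aF: "\<alpha> \<in> F" using a(1) by simp
  have "P' + 0\<^sub>m n n \<in> (\<lambda>M. U * M * Y) ` (+) P ` SH \<sigma> e n" unfolding eq[symmetric] using H0 by blast
  then obtain H where H: "H \<in> SH \<sigma> e n" "P' = U * (P + H) * Y" using P(2) by auto
  note Hc = SH_carrier[OF H(1)]
  have "e (hf n x (act n P' x)) = \<alpha> * e (hf n (act n Y x) (act n P (act n Y x)))" if x: "x \<in> sp n" for x
  proof -
    have PH: "P + H \<in> carrier_mat n n" using P(1) Hc by simp
    have "hf n x (act n P' x) = hf n (act n (star_mat \<sigma> U) x) (act n (P + H) (act n Y x))"
      unfolding H(2) act_mult[OF mult_carrier_mat[OF Xc PH] Yc] act_mult[OF Xc PH] hf_adjoint[OF Xc] ..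
    also have "\<dots> = \<alpha> * hf n (act n Y x) (act n P (act n Y x) + act n H (act n Y x))"
      unfolding a(2)[OF x] hf_sc_left s_F[OF aF] act_mat_add[OF P(1) Hc] ..
    finally have "e (hf n x (act n P' x)) = \<alpha> * e (hf n (act n Y x) (act n P (act n Y x) + act n H (act n Y x)))"
      using e_sm[OF aF] by simp
    then show ?thesis unfolding hf_add_right e_add SH_isotropic[OF H(1)] by simp
  qed
  then show ?thesis unfolding similar_def using Y a(1) by blast
qed

text \<open>Take for \<open>U\<close> the star of \<open>Q\<close> times \<open>\<alpha>\<close>.
  Then \<open>H \<mapsto> U * H * Q\<close> preserves isotropy and maps \<open>SH\<close> onto
  itself by dimension. The difference \<open>D\<close> between \<open>P'\<close> and
  \<open>U * P * Q\<close> is isotropic by the hypothesis, so it lies in \<open>SH\<close>.\<close>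

lemma equivalent_of_similar:
  assumes P: "P \<in> carrier_mat n n" "P' \<in> carrier_mat n n" and sim: "similar n P P'"
  shows "mat_equivalent n ((+) P ` SH \<sigma> e n) ((+) P' ` SH \<sigma> e n)"
proof -
  obtain Q \<alpha> where Q: "Q \<in> GL n" and a: "\<alpha> \<in> F - {0}"
    and q: "\<And>x. x \<in> sp n \<Longrightarrow> e (hf n x (act n P' x)) = \<alpha> * e (hf n (act n Q x) (act n P (act n Q x)))"
    using sim unfolding similar_def by blast
  have aF: "\<alpha> \<in> F" "\<alpha> \<noteq> 0" using a by auto
  note Qc = GL_carrier[OF Q]
  define U where "U = \<alpha> \<cdot>\<^sub>m star_mat \<sigma> Q"
  have Xc: "U \<in> carrier_mat n n" unfolding U_def using Qc by simp
  have Xact: "act n U z = (\<lambda>i. act n (star_mat \<sigma> Q) z i * \<alpha>)" for z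
  proof (rule ext)
    fix i
    have "(\<Sum>j<n. U $$ (i, j) * z j) = \<alpha> * (\<Sum>j<n. star_mat \<sigma> Q $$ (i, j) * z j)" if "i < n"
      unfolding sum_distrib_left using that star_carrier[OF Qc] by (intro sum.cong) (auto simp: U_def mult.assoc)
    then show "act n U z i = act n (star_mat \<sigma> Q) z i * \<alpha>" using F_comm[OF aF(1)] by (simp add: act_def)
  qed
  have U: "U \<in> GL n"
  proof (rule inj_GL[OF Xc])
    fix x assume x: "x \<in> sp n" "act n U x = 0"
    have "act n (star_mat \<sigma> Q) x i * \<alpha> = 0" for i using fun_cong[OF x(2)[unfolded Xact], of i] by simp
    then have "act n (star_mat \<sigma> Q) x = 0" using aF(2) by (intro ext) simp
    then show "x = 0" by (rule GL_inj[OF star_GL[OF Q] x(1)])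
  qed
  have form: "hf n x (act n (U * M * Q) x) = hf n (act n Q x) (act n M (act n Q x)) * \<alpha>" if M: "M \<in> carrier_mat n n" for x M
    unfolding act_mult[OF mult_carrier_mat[OF Xc M] Qc] act_mult[OF Xc M] Xact hf_sc_right
      hf_adjoint[OF star_carrier[OF Qc]] star_star[OF Qc] ..
  have sub: "(\<lambda>H. U * H * Q) ` SH \<sigma> e n \<subseteq> SH \<sigma> e n"
  proof (rule image_subsetI)
    fix H assume H: "H \<in> SH \<sigma> e n"
    show "U * H * Q \<in> SH \<sigma> e n"
    proof (rule SH_I)
      show "U * H * Q \<in> carrier_mat n n" using Xc SH_carrier[OF H] Qc by auto
      show "e (hf n x (act n (U * H * Q) x)) = 0" for x
        unfolding form[OF SH_carrier[OF H]] e_sm_right[OF aF(1)] SH_isotropic[OF H] by simp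
    qed
  qed
  note md = mdim_mult[OF U Q msub_SH]
  have surj: "(\<lambda>H. U * H * Q) ` SH \<sigma> e n = SH \<sigma> e n" by (rule mdim_mono(2)[OF md(1) msub_SH sub md(2)])
  define D where "D = P' + - (U * P * Q)"
  have XPQ: "U * P * Q \<in> carrier_mat n n" using Xc P(1) Qc by auto
  have D: "D \<in> SH \<sigma> e n"
  proof (rule SH_I)
    show "D \<in> carrier_mat n n" unfolding D_def using P(2) XPQ by simp
    fix x assume x: "x \<in> sp n"
    have "hf n x (act n D x) = hf n x (act n P' x) - hf n x (act n (U * P * Q) x)"
      unfolding D_def act_mat_add[OF P(2) uminus_carrier_mat[OF XPQ]] act_mat_uminus[OF XPQ]
      by (simp add: hf_def right_diff_distrib sum_subtractf)
    then show "e (hf n x (act n D x)) = 0" unfolding form[OF P(1)] using q[OF x] e_sm_right[OF aF(1)] by (simp add: e_diff)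
  qed
  note Dc = SH_carrier[OF D]
  have split: "U * (P + H) * Q = P' + (U * H * Q - D)" if H: "H \<in> SH \<sigma> e n" for H
  proof -
    note Hc = SH_carrier[OF H]
    have "U * (P + H) * Q = (U * P + U * H) * Q" using mult_add_distrib_mat[OF Xc P(1) Hc] by simp
    also have "\<dots> = U * P * Q + U * H * Q"
      by (rule add_mult_distrib_mat[OF mult_carrier_mat[OF Xc P(1)] mult_carrier_mat[OF Xc Hc] Qc])
    also have "\<dots> = P' + (U * H * Q - D)"
      unfolding D_def using P(2) XPQ mult_carrier_mat[OF mult_carrier_mat[OF Xc Hc] Qc] by (intro eq_matI) auto
    finally show ?thesis .
  qed
  have "(+) P' ` SH \<sigma> e n = (\<lambda>M. U * M * Q) ` (+) P ` SH \<sigma> e n"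
  proof (intro equalityI subsetI)
    fix M assume "M \<in> (+) P' ` SH \<sigma> e n"
    then obtain K where K: "K \<in> SH \<sigma> e n" "M = P' + K" by blast
    have "K + D \<in> (\<lambda>H. U * H * Q) ` SH \<sigma> e n" unfolding surj by (rule msubD(3)[OF msub_SH K(1) D])
    then obtain H where H: "H \<in> SH \<sigma> e n" "K + D = U * H * Q" by blast
    have "K + D - D = K" using SH_carrier[OF K(1)] Dc by (intro eq_matI) auto
    then have "M = U * (P + H) * Q" using split[OF H(1)] H(2) K(2) by simp
    then show "M \<in> (\<lambda>M. U * M * Q) ` (+) P ` SH \<sigma> e n" using H(1) by blast
  next
    fix M assume "M \<in> (\<lambda>M. U * M * Q) ` (+) P ` SH \<sigma> e n"
    then obtain H where H: "H \<in> SH \<sigma> e n" "M = U * (P + H) * Q" by blast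
    have "U * H * Q - D \<in> SH \<sigma> e n" by (rule msub_diff[OF msub_SH _ D]) (use sub H(1) in blast)
    then show "M \<in> (+) P' ` SH \<sigma> e n" unfolding H(2) split[OF H(1)] by (rule imageI)
  qed
  then show ?thesis unfolding mat_equivalent_def using U Q by blast
qed

lemma mat_equivalentE:
  assumes "mat_equivalent n S T"
  obtains U Y where "U \<in> GL n" "Y \<in> GL n" "T = (\<lambda>M. U * M * Y) ` S"
  using assms unfolding mat_equivalent_def by blast

text \<open>\<open>first_block_le\<close>, applied in both directions, equalises the sizes of the
  first blocks and makes \<open>U\<close> block triangular. Then \<open>Y\<close> is so too, because
  \<open>U * M\<close> and \<open>U * M * Y\<close> are and \<open>U * M\<close> is invertible. The
  equivalence therefore restricts to the diagonal blocks, and induction handles the lower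
  one.\<close>

lemma joint_equivalent_imp:
  assumes "nonisotropic_list \<sigma> e ns Ps" "nonisotropic_list \<sigma> e ms Ps'" "\<forall>m\<in>set ns. m > 0" "\<forall>m\<in>set ms. m > 0"
    "sum_list ns = sum_list ms" "mat_equivalent (sum_list ns) (SH_joint \<sigma> e ns Ps) (SH_joint \<sigma> e ms Ps')"
  shows "ns = ms \<and> (\<forall>k<length ns. similar (ns ! k) (Ps ! k) (Ps' ! k))"
  using assms
proof (induction arbitrary: ms Ps' rule: nlist_induct)
  case Nil
  then show ?case by (cases ms) auto
next
  case (Cons n P ns Ps)
  obtain m ms' where ms: "ms = m # ms'" using Cons(5,7) by (cases ms) auto
  have "length Ps' = length ms" using Cons(4) unfolding nonisotropic_list_def by simp
  then obtain P' Qs where Ps': "Ps' = P' # Qs" using ms by (cases Ps') auto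
  have l': "nonisotropic \<sigma> e m P'" "nonisotropic_list \<sigma> e ms' Qs" using Cons(4) nlist_Cons unfolding ms Ps' by auto
  define N where "N = sum_list (n # ns)"
  define k k' where "k = sum_list ns" and "k' = sum_list ms'"
  have N: "n + k = N" "m + k' = N" using Cons(7) unfolding N_def k_def k'_def ms by auto
  have pos: "n > 0" "m > 0" using Cons(5,6) ms by auto
  define S T where "S = SH_joint \<sigma> e ns Ps" and "T = SH_joint \<sigma> e ms' Qs"
  have S: "S \<subseteq> GL k" "S \<noteq> {}" unfolding S_def k_def
    by (rule conjunct1[OF SH_joint_optimal[OF Cons(2)]], rule affine_nonempty[OF conjunct2[OF SH_joint_optimal[OF Cons(2)]]])
  have T: "T \<subseteq> GL k'" "T \<noteq> {}" unfolding T_def k'_def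
    by (rule conjunct1[OF SH_joint_optimal[OF l'(2)]], rule affine_nonempty[OF conjunct2[OF SH_joint_optimal[OF l'(2)]]])
  note Sc = GL_sub[OF S(1)] and Tc = GL_sub[OF T(1)]
  let ?A = "(+) P ` SH \<sigma> e n" and ?A' = "(+) P' ` SH \<sigma> e m"
  note Ag = nonisotropic_unital[OF Cons(1)] and Ag' = nonisotropic_unital[OF l'(1)]
  note Ac = GL_sub[OF Ag] and Ac' = GL_sub[OF Ag']
  have eq: "mat_equivalent N (blk n k ?A S) (blk m k' ?A' T)"
    using Cons(8) unfolding ms Ps' SH_joint_Cons[OF Cons(1,2)] SH_joint_Cons[OF l'] S_def T_def k_def k'_def N_def .
  have cA: "blk n k ?A S \<subseteq> carrier_mat N N" using blk_carrier[of n k] N(1) by simp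
  obtain U Y where XY: "U \<in> GL N" "Y \<in> GL N" "blk m k' ?A' T = (\<lambda>M. U * M * Y) ` blk n k ?A S"
    by (rule mat_equivalentE[OF eq])
  obtain U' Y' where XY': "U' \<in> GL N" "Y' \<in> GL N" "blk n k ?A S = (\<lambda>M. U' * M * Y') ` blk m k' ?A' T"
    by (rule mat_equivalentE[OF equivalent_sym[OF cA eq]])
  have u1: "upper m k' (U * M * Y)" if "M \<in> blk n k ?A S" for M
  proof -
    have "U * M * Y \<in> blk m k' ?A' T" unfolding XY(3) using that by (rule imageI)
    then show ?thesis unfolding blk_def by blast
  qed
  have u2: "upper n k (U' * M * Y')" if "M \<in> blk m k' ?A' T" for M
  proof -
    have "U' * M * Y' \<in> blk n k ?A S" unfolding XY'(3) using that by (rule imageI)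
    then show ?thesis unfolding blk_def by blast
  qed
  have le1: "\<forall>i<k'. \<forall>j<n. U $$ (m + i, j) = 0" "n \<le> m"
    by (rule first_block_le[OF Cons(1) Sc S(2) pos(2) N XY(1,2)], erule u1)
      (rule first_block_le[OF Cons(1) Sc S(2) pos(2) N XY(1,2)], erule u1)
  have "m \<le> n" by (rule first_block_le(2)[OF l'(1) Tc T(2) pos(1) N(2,1) XY'(1,2)], erule u2)
  then have nm: "n = m" using le1(2) by simp
  then have kk: "k = k'" using N by simp
  have XN: "U \<in> GL (n + k)" "Y \<in> GL (n + k)" using XY(1,2) N(1) by simp_all
  have uX: "upper n k U" unfolding upper_def using le1(1) nm kk by simp
  obtain M where M: "M \<in> blk n k ?A S"
  proof -
    obtain s where "s \<in> S" using S(2) by blast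
    moreover have "P + 0\<^sub>m n n \<in> ?A" using msubD(2)[OF msub_SH] by (rule imageI)
    moreover from this have "P + 0\<^sub>m n n \<in> carrier_mat n n" using Ac by blast
    ultimately have "bd n k (P + 0\<^sub>m n n) s \<in> blk n k ?A S" unfolding blk_def using bd_parts[of "P + 0\<^sub>m n n" n s k] Sc by auto
    then show thesis by (rule that)
  qed
  have MG: "M \<in> GL (n + k)" using blk_unital[OF Ag S(1)] M by blast
  have Mu: "upper n k M" using M unfolding blk_def by blast
  note xc = GL_carrier[OF XN(1)] and yc = GL_carrier[OF XN(2)] and mc = GL_carrier[OF MG]
  have uY: "upper n k Y"
    by (rule upper_left_factor[OF mult_carrier_mat[OF xc mc] yc upper_mult[OF xc mc uX Mu] GL_mult[OF XN(1) MG]])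
      (use u1[OF M] nm kk in simp)
  have cb: "blk n k ?A' T = blk n k ((\<lambda>M. ul n U * M * ul n Y) ` ?A) ((\<lambda>M. lr n k U * M * lr n k Y) ` S)"
    using conj_blk[OF XN(1) uX XN(2) uY Ac Sc] XY(3) nm kk by simp
  have g: "ul n U \<in> GL n" "ul n Y \<in> GL n" "lr n k U \<in> GL k" "lr n k Y \<in> GL k"
    using blk_GL[OF xc uX] blk_GL[OF yc uY] XN by auto
  have c1: "(\<lambda>M. ul n U * M * ul n Y) ` ?A \<subseteq> carrier_mat n n"
    by (rule image_subsetI, rule mult_carrier_mat[OF mult_carrier_mat[OF ul_carrier subsetD[OF Ac]] ul_carrier])
  have c2: "(\<lambda>M. lr n k U * M * lr n k Y) ` S \<subseteq> carrier_mat k k"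
    by (rule image_subsetI, rule mult_carrier_mat[OF mult_carrier_mat[OF lr_carrier subsetD[OF Sc]] lr_carrier])
  have "SH \<sigma> e n \<noteq> {}" for n using msubD(2)[OF msub_SH, of n] by (metis empty_iff)
  then have ne: "?A \<noteq> {}" "?A' \<noteq> {}" by simp_all
  have Ac'': "?A' \<subseteq> carrier_mat n n" using Ac' unfolding nm .
  have Tc'': "T \<subseteq> carrier_mat k k" using Tc unfolding kk .
  have e1: "?A' = (\<lambda>M. ul n U * M * ul n Y) ` ?A"
    by (rule blk_eqD(1)[OF cb Ac'' c1 Tc'' c2 ne(2) T(2)]) (use ne(1) S(2) in simp_all)
  have e2: "T = (\<lambda>M. lr n k U * M * lr n k Y) ` S"
    by (rule blk_eqD(2)[OF cb Ac'' c1 Tc'' c2 ne(2) T(2)]) (use ne(1) S(2) in simp_all)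
  have P'c: "P' \<in> carrier_mat n n" using nonisotropic_carrier[OF l'(1)] nm by simp
  have e1': "(+) P' ` SH \<sigma> e n = (\<lambda>M. ul n U * M * ul n Y) ` ?A" using e1 unfolding nm .
  have s1: "similar n P P'" by (rule similar_of_equivalent[OF pos(1) nonisotropic_carrier[OF Cons(1)] P'c g(1,2) e1'])
  have "mat_equivalent k S T" unfolding mat_equivalent_def
    by (rule bexI[of _ "lr n k U"], rule bexI[of _ "lr n k Y"], rule e2, rule g(4), rule g(3))
  then have "mat_equivalent (sum_list ns) (SH_joint \<sigma> e ns Ps) (SH_joint \<sigma> e ms' Qs)" unfolding S_def T_def k_def .
  moreover have "sum_list ns = sum_list ms'" using kk unfolding k_def k'_def .
  ultimately have IH: "ns = ms' \<and> (\<forall>k<length ns. similar (ns ! k) (Ps ! k) (Qs ! k))"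
    by (intro Cons(3)[OF l'(2)]) (use Cons(5,6) ms in auto)
  have sim: "similar ((n # ns) ! i) ((P # Ps) ! i) ((P' # Qs) ! i)" if "i < length (n # ns)" for i
    using that s1 conjunct2[OF IH] by (cases i) simp_all
  have "n # ns = m # ms'" using IH nm by simp
  then show ?case unfolding ms Ps' by (intro conjI allI impI sim)
qed

lemma joint_equivalent_if:
  assumes "nonisotropic_list \<sigma> e ns Ps" "nonisotropic_list \<sigma> e ns Ps'" "\<forall>k<length ns. similar (ns ! k) (Ps ! k) (Ps' ! k)"
  shows "mat_equivalent (sum_list ns) (SH_joint \<sigma> e ns Ps) (SH_joint \<sigma> e ns Ps')"
  using assms
proof (induction arbitrary: Ps' rule: nlist_induct)
  case Nil
  have "Ps' = []" using Nil(1) unfolding nonisotropic_list_def by simp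
  then show ?case unfolding mat_equivalent_def
    by (intro bexI[of _ "1\<^sub>m 0"]) (auto simp: SH_joint_Nil dest!: carrier_0)
next
  case (Cons n P ns Ps)
  have "length Ps' = Suc (length ns)" using Cons(4) unfolding nonisotropic_list_def by simp
  then obtain P' Qs where Ps': "Ps' = P' # Qs" by (cases Ps') auto
  have l': "nonisotropic \<sigma> e n P'" "nonisotropic_list \<sigma> e ns Qs" using Cons(4) nlist_Cons unfolding Ps' by auto
  have s: "similar n P P'" using Cons(5) unfolding Ps' by force
  have "similar (ns ! k) (Ps ! k) (Qs ! k)" if "k < length ns" for k
    using Cons(5)[rule_format, of "Suc k"] that unfolding Ps' by simp
  then have IH: "mat_equivalent (sum_list ns) (SH_joint \<sigma> e ns Ps) (SH_joint \<sigma> e ns Qs)" using Cons(3)[OF l'(2)] by blast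
  show ?case unfolding Ps' SH_joint_Cons[OF Cons(1,2)] SH_joint_Cons[OF l']
    using equivalent_blk[OF GL_sub[OF nonisotropic_unital[OF Cons(1)]] SH_joint_carrier[OF Cons(2)]
      equivalent_of_similar[OF nonisotropic_carrier[OF Cons(1)] nonisotropic_carrier[OF l'(1)] s] IH] by simp
qed

lemma similar_iff:
  assumes "P \<in> carrier_mat n n" "P' \<in> carrier_mat n n"
  shows "similar n P P' \<longleftrightarrow> (\<exists>Q\<in>GL n. \<exists>\<alpha>\<in>F - {0}. \<forall>x\<in>carrier_vec n.
    e (star_form \<sigma> P' x) = \<alpha> * e (star_form \<sigma> P (Q *\<^sub>v x)))"
  unfolding similar_def all_vec
  by (intro bex_cong refl ball_cong) (simp add: star_form_hf[OF assms(1)] star_form_hf[OF assms(2)] act_vec)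

end

theorem theorem7p3:
  fixes F :: "'a::division_ring set" and n d :: nat and \<sigma> e :: "'a \<Rightarrow> 'a"
  assumes "central_subfield F"
    and "finite_degree F" and "degree_over F = d"
    and "n \<ge> 1"
    and "quadratic_type F"
    and "infinite F \<or> card F \<ge> n * d"
    and "associated_pair F \<sigma> e"
  shows "(\<forall>M. optimal F n M \<longrightarrow>
            (\<exists>ns Ps. ordered_partition n ns \<and> nonisotropic_list \<sigma> e ns Ps \<and>
                     mat_equivalent n M (SH_joint \<sigma> e ns Ps))) \<and>
         (\<forall>ns Ps. ordered_partition n ns \<and> nonisotropic_list \<sigma> e ns Ps \<longrightarrow>
            optimal F n (SH_joint \<sigma> e ns Ps)) \<and>
         (\<forall>ns Ps ms Ps'.
            ordered_partition n ns \<and> nonisotropic_list \<sigma> e ns Ps \<and>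
            ordered_partition n ms \<and> nonisotropic_list \<sigma> e ms Ps' \<longrightarrow>
            (mat_equivalent n (SH_joint \<sigma> e ns Ps) (SH_joint \<sigma> e ms Ps') \<longleftrightarrow>
             ns = ms \<and>
             (\<forall>k<length ns. \<exists>Q\<in>GL (ns ! k). \<exists>\<alpha>\<in>F - {0}. \<forall>x\<in>carrier_vec (ns ! k).
                e (star_form \<sigma> (Ps' ! k) x) = \<alpha> * e (star_form \<sigma> (Ps ! k) (Q *\<^sub>v x)))))"
proof -
  have cs: "central_sub F" using assms(1) by unfold_locales
  interpret quad_mat F \<sigma> e d
    unfolding quad_mat_def by (rule central_sub.quad_of_associated_pair[OF cs assms(2,3,7)])
  have big: "big F (n * d)" using assms(6) unfolding big_def by blast
  note opt = optimal_iff[OF big]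
  show ?thesis
  proof (intro conjI allI impI)
    fix M assume "optimal F n M"
    then show "\<exists>ns Ps. ordered_partition n ns \<and> nonisotropic_list \<sigma> e ns Ps \<and> mat_equivalent n M (SH_joint \<sigma> e ns Ps)"
      using optimal_classification[OF _ _ big] unfolding opt by blast
  next
    fix ns Ps assume "ordered_partition n ns \<and> nonisotropic_list \<sigma> e ns Ps"
    then show "optimal F n (SH_joint \<sigma> e ns Ps)"
      using SH_joint_optimal[of ns Ps] unfolding opt ordered_partition_def by blast
  next
    fix ns Ps ms Ps'
    assume h: "ordered_partition n ns \<and> nonisotropic_list \<sigma> e ns Ps \<and> ordered_partition n ms \<and> nonisotropic_list \<sigma> e ms Ps'"
    then have l: "nonisotropic_list \<sigma> e ns Ps" "nonisotropic_list \<sigma> e ms Ps'" and s: "sum_list ns = n" "sum_list ms = n"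
      and p: "\<forall>m\<in>set ns. m > 0" "\<forall>m\<in>set ms. m > 0" unfolding ordered_partition_def by auto
    have c: "k < length ns \<Longrightarrow> Ps ! k \<in> carrier_mat (ns ! k) (ns ! k)" "k < length ms \<Longrightarrow> Ps' ! k \<in> carrier_mat (ms ! k) (ms ! k)" for k
      using l unfolding nonisotropic_list_def by auto
    have 1: "mat_equivalent n (SH_joint \<sigma> e ns Ps) (SH_joint \<sigma> e ms Ps') \<longleftrightarrow>
        ns = ms \<and> (\<forall>k<length ns. similar (ns ! k) (Ps ! k) (Ps' ! k))"
    proof
      assume "mat_equivalent n (SH_joint \<sigma> e ns Ps) (SH_joint \<sigma> e ms Ps')"
      then show "ns = ms \<and> (\<forall>k<length ns. similar (ns ! k) (Ps ! k) (Ps' ! k))"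
        by (intro joint_equivalent_imp[OF l p]) (simp_all only: s)
    next
      assume r: "ns = ms \<and> (\<forall>k<length ns. similar (ns ! k) (Ps ! k) (Ps' ! k))"
      have "nonisotropic_list \<sigma> e ns Ps'" using l(2) r by (simp only:)
      from joint_equivalent_if[OF l(1) this conjunct2[OF r]]
      show "mat_equivalent n (SH_joint \<sigma> e ns Ps) (SH_joint \<sigma> e ms Ps')"
        unfolding s(2) conjunct1[OF r] .
    qed
    show "mat_equivalent n (SH_joint \<sigma> e ns Ps) (SH_joint \<sigma> e ms Ps') \<longleftrightarrow>
             ns = ms \<and>
             (\<forall>k<length ns. \<exists>Q\<in>GL (ns ! k). \<exists>\<alpha>\<in>F - {0}. \<forall>x\<in>carrier_vec (ns ! k).
                e (star_form \<sigma> (Ps' ! k) x) = \<alpha> * e (star_form \<sigma> (Ps ! k) (Q *\<^sub>v x)))"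
      unfolding 1
    proof (rule conj_cong[OF refl])
      assume eq: "ns = ms"
      have "similar (ns ! k) (Ps ! k) (Ps' ! k) \<longleftrightarrow> (\<exists>Q\<in>GL (ns ! k). \<exists>\<alpha>\<in>F - {0}. \<forall>x\<in>carrier_vec (ns ! k).
          e (star_form \<sigma> (Ps' ! k) x) = \<alpha> * e (star_form \<sigma> (Ps ! k) (Q *\<^sub>v x)))" if "k < length ns" for k
        by (rule similar_iff) (use c that eq in simp_all)
      then show "(\<forall>k<length ns. similar (ns ! k) (Ps ! k) (Ps' ! k)) \<longleftrightarrow>
          (\<forall>k<length ns. \<exists>Q\<in>GL (ns ! k). \<exists>\<alpha>\<in>F - {0}. \<forall>x\<in>carrier_vec (ns ! k).
            e (star_form \<sigma> (Ps' ! k) x) = \<alpha> * e (star_form \<sigma> (Ps ! k) (Q *\<^sub>v x)))" by simp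
    qed
  qed
qed

end
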